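(* Let $(M,g,J)$ be a compact Kähler manifold of complex dimension $m\ge 2$ with constant positive complex scalar curvature $R$ (equal to half of the Riemannian scalar curvature). Let $E$ be its traceless Ricci tensor and $B$ its Bochner tensor. If $$\sqrt{2}\,|E|+|B|<\frac{2\sqrt{m^2-1}\,R}{3(m^2-2)}$$ at every point of $M$, then $(M,g,J)$ is biholomorphically homothetic to $\mathbb{C}P^m$.
   Context: Manifolds are connected. Let $(M,g,J)$ be a Kähler manifold of complex dimension $m$. In local complex coordinates $(z_\alpha)$, $g_{\alpha\bar\beta}$, $R_{\alpha\bar\beta}$, $R_{\alpha\bar\beta\gamma\bar\delta}$ are the components of the metric, the Ricci tensor (usual sign, positive on complex projective space) and the curvature tensor, the curvature sign convention being such that $R_{\alpha\bar\beta}=-g^{\gamma\bar\delta}R_{\alpha\bar\beta\gamma\bar\delta}$ (summation convention). The complex scalar curvature is $R=g^{\alpha\bar\beta}R_{\alpha\bar\beta}$, so the Riemannian scalar curvature is $S_g=2R$. The traceless Ricci tensor is $E=E_{\alpha\bar\beta}\,dz^\alpha\otimes dz^{\bar\beta}+E_{\bar\alpha\beta}\,dz^{\bar\alpha}\otimes dz^\beta$ with $E_{\alpha\bar\beta}=R_{\alpha\bar\beta}-\frac{R}{m}g_{\alpha\bar\beta}$ and $E_{\bar\alpha\beta}=\overline{E_{\alpha\bar\beta}}$. The Bochner tensor $B$ has components $$B_{\alpha\bar\beta\gamma\bar\delta}=R_{\alpha\bar\beta\gamma\bar\delta}+\tfrac{1}{m+2}\left(R_{\alpha\bar\beta}g_{\gamma\bar\delta}+R_{\gamma\bar\beta}g_{\alpha\bar\delta}+g_{\alpha\bar\beta}R_{\gamma\bar\delta}+g_{\gamma\bar\beta}R_{\alpha\bar\delta}\right)-\tfrac{R}{(m+1)(m+2)}\left(g_{\alpha\bar\beta}g_{\gamma\bar\delta}+g_{\gamma\bar\beta}g_{\alpha\bar\delta}\right).$$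 Norms: at a point, in a frame with $g_{\alpha\bar\beta}=\delta_{\alpha\beta}$, $|E|^2=2\sum_{\alpha,\beta}|E_{\alpha\bar\beta}|^2$ and $|B|^2=4\sum_{\alpha,\beta,\gamma,\delta}|B_{\alpha\bar\beta\gamma\bar\delta}|^2$ (the norms of $E$, $B$ as real tensors). "Biholomorphically homothetic to $\mathbb{C}P^m$" means that there is a biholomorphism $M\to\mathbb{C}P^m$ under which the Fubini–Study metric pulls back to a positive constant multiple of $g$. *)

theory Defs
  imports "HOL-Analysis.Analysis"
begin

section \<open>Calculus on open subsets of complex coordinate space\<close>

fun Ck_on :: "nat \<Rightarrow> ('a::real_normed_vector \<Rightarrow> 'b::real_normed_vector) \<Rightarrow> 'a set \<Rightarrow> bool" where
  "Ck_on 0 f S \<longleftrightarrow> continuous_on S f"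
| "Ck_on (Suc k) f S \<longleftrightarrow>
     (\<forall>x\<in>S. f differentiable (at x)) \<and> (\<forall>v. Ck_on k (\<lambda>x. frechet_derivative f (at x) v) S)"

text \<open>Only meant for open sets \<open>S\<close>; derivatives are real Frechet derivatives.\<close>
definition smooth_on :: "('a::real_normed_vector \<Rightarrow> 'b::real_normed_vector) \<Rightarrow> 'a set \<Rightarrow> bool" where
  "smooth_on f S \<longleftrightarrow> (\<forall>k. Ck_on k f S)"

text \<open>Complex differentiability: the real derivative exists and is complex linear.\<close>
definition complex_differentiable_at :: "(complex^'m \<Rightarrow> complex^'n) \<Rightarrow> complex^'m \<Rightarrow> bool" where
  "complex_differentiable_at f z \<longleftrightarrow>
     (\<exists>D. (f has_derivative D) (at z) \<and> (\<forall>a v. D (a *s v) = a *s D v))"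

text \<open>Wirtinger derivatives \<open>\<partial>/\<partial>z\<^sub>\<alpha> = (\<partial>/\<partial>x\<^sub>\<alpha> - i \<partial>/\<partial>y\<^sub>\<alpha>)/2\<close> and
  \<open>\<partial>/\<partial>z\<^sub>\<alpha>bar = (\<partial>/\<partial>x\<^sub>\<alpha> + i \<partial>/\<partial>y\<^sub>\<alpha>)/2\<close>.\<close>
definition dz :: "'m \<Rightarrow> (complex^'m \<Rightarrow> complex) \<Rightarrow> complex^'m \<Rightarrow> complex" where
  "dz \<alpha> f z = (frechet_derivative f (at z) (axis \<alpha> 1)
               - \<i> * frechet_derivative f (at z) (axis \<alpha> \<i>)) / 2"

definition dzbar :: "'m \<Rightarrow> (complex^'m \<Rightarrow> complex) \<Rightarrow> complex^'m \<Rightarrow> complex" where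
  "dzbar \<alpha> f z = (frechet_derivative f (at z) (axis \<alpha> 1)
               + \<i> * frechet_derivative f (at z) (axis \<alpha> \<i>)) / 2"

text \<open>A Hermitian metric in local coordinates is a matrix-valued function \<open>G\<close>, where
  \<open>G z $ \<alpha> $ \<beta>\<close> is the component with first index \<open>\<alpha>\<close> unbarred and second index \<open>\<beta>\<close> barred.
  The following is its pullback under a holomorphic map \<open>F\<close>.\<close>
definition pullback_metric ::
  "(complex^'m \<Rightarrow> complex^'n) \<Rightarrow> (complex^'n \<Rightarrow> complex^'n^'n) \<Rightarrow> complex^'m \<Rightarrow> complex^'m^'m" where
  "pullback_metric F G z = (\<chi> \<alpha> \<beta>. \<Sum>\<mu>\<in>UNIV. \<Sum>\<nu>\<in>UNIV.
     dz \<alpha> (\<lambda>w. F w $ \<mu>) z * cnj (dz \<beta> (\<lambda>w. F w $ \<nu>) z) * G (F z) $ \<mu> $ \<nu>)"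


section \<open>Complex manifolds\<close>

text \<open>A chart is a domain together with a coordinate map (whose values outside the domain are
  irrelevant).\<close>
type_synonym ('a, 'm) chart = "'a set \<times> ('a \<Rightarrow> complex^'m)"

abbreviation chart_inv :: "('a, 'm) chart \<Rightarrow> complex^'m \<Rightarrow> 'a" where
  "chart_inv c \<equiv> inv_into (fst c) (snd c)"

text \<open>The complex structure \<open>J\<close> is encoded by the holomorphic atlas \<open>A\<close>, which need not be maximal:
  in every chart of \<open>A\<close>, \<open>J\<close> is multiplication by \<open>i\<close>. Manifolds are connected and nonempty; the
  complex dimension is \<open>CARD('m)\<close>.\<close>
locale complex_manifold =
  fixes X :: "'a topology" and A :: "('a, 'm::finite) chart set"
  assumes nonempty: "topspace X \<noteq> {}"
    and connected: "connected_space X"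
    and Hausdorff: "Hausdorff_space X"
    and second_countable: "\<exists>\<B>. countable \<B> \<and> (\<forall>V\<in>\<B>. openin X V) \<and>
          (\<forall>U x. openin X U \<and> x \<in> U \<longrightarrow> (\<exists>V\<in>\<B>. x \<in> V \<and> V \<subseteq> U))"
    and charts_cover: "(\<Union>c\<in>A. fst c) = topspace X"
    and chart_domain: "c \<in> A \<Longrightarrow> openin X (fst c)"
    and chart_range: "c \<in> A \<Longrightarrow> open (snd c ` fst c)"
    and chart_homeomorphic: "c \<in> A \<Longrightarrow>
          homeomorphic_map (subtopology X (fst c)) (top_of_set (snd c ` fst c)) (snd c)"
    and transition_holomorphic: "c \<in> A \<Longrightarrow> d \<in> A \<Longrightarrow> p \<in> fst c \<inter> fst d \<Longrightarrow>
          complex_differentiable_at (snd d \<circ> chart_inv c) (snd c p)"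

text \<open>Continuity guarantees that the coordinate expression of \<open>f\<close> is defined near \<open>snd c p\<close>.\<close>
definition holomorphic_map ::
  "'a topology \<Rightarrow> ('a, 'm::finite) chart set \<Rightarrow> 'b topology \<Rightarrow> ('b, 'n::finite) chart set \<Rightarrow> ('a \<Rightarrow> 'b) \<Rightarrow> bool"
  where "holomorphic_map X A Y B f \<longleftrightarrow> continuous_map X Y f \<and>
    (\<forall>c\<in>A. \<forall>d\<in>B. \<forall>p\<in>fst c. f p \<in> fst d \<longrightarrow>
       complex_differentiable_at (snd d \<circ> f \<circ> chart_inv c) (snd c p))"

definition biholomorphism ::
  "'a topology \<Rightarrow> ('a, 'm::finite) chart set \<Rightarrow> 'b topology \<Rightarrow> ('b, 'n::finite) chart set \<Rightarrow> ('a \<Rightarrow> 'b) \<Rightarrow> bool"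
  where "biholomorphism X A Y B f \<longleftrightarrow> bij_betw f (topspace X) (topspace Y) \<and>
    holomorphic_map X A Y B f \<and> holomorphic_map Y B X A (inv_into (topspace X) f)"


section \<open>Kaehler metrics and their curvature\<close>

text \<open>A metric assigns to every chart \<open>c\<close> its component functions on the coordinate range of \<open>c\<close>.\<close>
type_synonym ('a, 'm) chart_metric = "('a, 'm) chart \<Rightarrow> complex^'m \<Rightarrow> complex^'m^'m"

text \<open>The last axiom is closedness of the Kaehler form
  \<open>i \<Sum>\<^sub>\<alpha>\<^sub>\<beta> g\<^sub>\<alpha>\<^sub>\<beta> dz\<^sub>\<alpha> \<and> dz\<^sub>\<beta>bar\<close>.\<close>
locale kaehler_manifold = complex_manifold X A
  for X :: "'a topology" and A :: "('a, 'm::finite) chart set" +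
  fixes g :: "('a, 'm) chart_metric"
  assumes metric_smooth: "c \<in> A \<Longrightarrow> smooth_on (g c) (snd c ` fst c)"
    and metric_tensor: "c \<in> A \<Longrightarrow> d \<in> A \<Longrightarrow> p \<in> fst c \<inter> fst d \<Longrightarrow>
          g c (snd c p) = pullback_metric (snd d \<circ> chart_inv c) (g d) (snd c p)"
    and metric_hermitian: "c \<in> A \<Longrightarrow> z \<in> snd c ` fst c \<Longrightarrow>
          g c z $ \<beta> $ \<alpha> = cnj (g c z $ \<alpha> $ \<beta>)"
    and metric_positive: "c \<in> A \<Longrightarrow> z \<in> snd c ` fst c \<Longrightarrow> v \<noteq> 0 \<Longrightarrow>
          0 < Re (\<Sum>\<alpha>\<in>UNIV. \<Sum>\<beta>\<in>UNIV. g c z $ \<alpha> $ \<beta> * v $ \<alpha> * cnj (v $ \<beta>))"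
    and metric_closed: "c \<in> A \<Longrightarrow> z \<in> snd c ` fst c \<Longrightarrow>
          dz \<gamma> (\<lambda>w. g c w $ \<alpha> $ \<beta>) z = dz \<alpha> (\<lambda>w. g c w $ \<gamma> $ \<beta>) z"

text \<open>The inverse metric with first index \<open>\<alpha>\<close> unbarred and second index \<open>\<beta>\<close> barred, normalised by
  \<open>\<Sum>\<^sub>\<beta> g_up G \<alpha> \<beta> * G $ \<gamma> $ \<beta> = \<delta>\<^sub>\<alpha>\<^sub>\<gamma>\<close>; hence the transposition.\<close>
definition g_up :: "complex^'m^'m \<Rightarrow> 'm \<Rightarrow> 'm \<Rightarrow> complex" where
  "g_up G \<alpha> \<beta> = matrix_inv G $ \<beta> $ \<alpha>"

text \<open>In Kaehler coordinates the only nonzero Christoffel symbols of the Levi-Civita connection, up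
  to conjugation, are those in \<open>\<nabla>\<^sub>\<gamma> \<partial>\<^sub>\<alpha> = \<Sum>\<^sub>\<mu> christoffel G \<mu> \<gamma> \<alpha> \<partial>\<^sub>\<mu>\<close>.\<close>
definition christoffel ::
  "(complex^'m \<Rightarrow> complex^'m^'m) \<Rightarrow> 'm \<Rightarrow> 'm \<Rightarrow> 'm \<Rightarrow> complex^'m \<Rightarrow> complex" where
  "christoffel G \<mu> \<gamma> \<alpha> z = (\<Sum>\<nu>\<in>UNIV. g_up (G z) \<mu> \<nu> * dz \<gamma> (\<lambda>w. G w $ \<alpha> $ \<nu>) z)"

text \<open>The second and fourth index are barred. The curvature operator of the Levi-Civita connection
  maps \<open>\<partial>\<^sub>\<alpha>\<close> to \<open>R(\<partial>\<^sub>\<gamma>, \<partial>\<^sub>\<delta>bar) \<partial>\<^sub>\<alpha> = - \<Sum>\<^sub>\<mu> (\<partial>\<^sub>\<delta>bar \<Gamma>\<^sup>\<mu>\<^sub>\<gamma>\<^sub>\<alpha>) \<partial>\<^sub>\<mu>\<close>; the sign below is the one for which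
  the Ricci tensor, positive on complex projective space, is minus the trace. In terms of the
  metric, the components are
  \<open>\<partial>\<^sub>\<gamma> \<partial>\<^sub>\<delta>bar g\<^sub>\<alpha>\<^sub>\<beta> - \<Sum> g_up \<mu> \<nu> \<partial>\<^sub>\<gamma> g\<^sub>\<alpha>\<^sub>\<nu> \<partial>\<^sub>\<delta>bar g\<^sub>\<mu>\<^sub>\<beta>\<close>.\<close>
definition riemann ::
  "(complex^'m \<Rightarrow> complex^'m^'m) \<Rightarrow> complex^'m \<Rightarrow> 'm \<Rightarrow> 'm \<Rightarrow> 'm \<Rightarrow> 'm \<Rightarrow> complex" where
  "riemann G z \<alpha> \<beta> \<gamma> \<delta> = (\<Sum>\<mu>\<in>UNIV. G z $ \<mu> $ \<beta> * dzbar \<delta> (christoffel G \<mu> \<gamma> \<alpha>) z)"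

definition ricci :: "(complex^'m \<Rightarrow> complex^'m^'m) \<Rightarrow> complex^'m \<Rightarrow> 'm \<Rightarrow> 'm \<Rightarrow> complex" where
  "ricci G z \<alpha> \<beta> = - (\<Sum>\<gamma>\<in>UNIV. \<Sum>\<delta>\<in>UNIV. g_up (G z) \<gamma> \<delta> * riemann G z \<alpha> \<beta> \<gamma> \<delta>)"

text \<open>The complex scalar curvature, half of the Riemannian one. It is real for a Kaehler metric.\<close>
definition scalar_curv :: "(complex^'m \<Rightarrow> complex^'m^'m) \<Rightarrow> complex^'m \<Rightarrow> complex" where
  "scalar_curv G z = (\<Sum>\<alpha>\<in>UNIV. \<Sum>\<beta>\<in>UNIV. g_up (G z) \<alpha> \<beta> * ricci G z \<alpha> \<beta>)"

definition traceless_ricci ::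
  "(complex^'m \<Rightarrow> complex^'m^'m) \<Rightarrow> complex^'m \<Rightarrow> 'm \<Rightarrow> 'm \<Rightarrow> complex" where
  "traceless_ricci G z \<alpha> \<beta> = ricci G z \<alpha> \<beta> - scalar_curv G z / of_nat CARD('m) * G z $ \<alpha> $ \<beta>"

definition bochner ::
  "(complex^'m \<Rightarrow> complex^'m^'m) \<Rightarrow> complex^'m \<Rightarrow> 'm \<Rightarrow> 'm \<Rightarrow> 'm \<Rightarrow> 'm \<Rightarrow> complex" where
  "bochner G z \<alpha> \<beta> \<gamma> \<delta> = riemann G z \<alpha> \<beta> \<gamma> \<delta>
     + 1 / (of_nat CARD('m) + 2) *
         (ricci G z \<alpha> \<beta> * G z $ \<gamma> $ \<delta> + ricci G z \<gamma> \<beta> * G z $ \<alpha> $ \<delta>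
          + G z $ \<alpha> $ \<beta> * ricci G z \<gamma> \<delta> + G z $ \<gamma> $ \<beta> * ricci G z \<alpha> \<delta>)
     - scalar_curv G z / ((of_nat CARD('m) + 1) * (of_nat CARD('m) + 2)) *
         (G z $ \<alpha> $ \<beta> * G z $ \<gamma> $ \<delta> + G z $ \<gamma> $ \<beta> * G z $ \<alpha> $ \<delta>)"

text \<open>The columns of \<open>P\<close> are the coefficients of a frame \<open>e\<^sub>a = \<Sum>\<^sub>\<alpha> P $ \<alpha> $ a \<partial>\<^sub>\<alpha>\<close> of (1,0)-vectors in
  which the metric has components \<open>\<delta>\<^sub>a\<^sub>b\<close>.\<close>
definition unitary_frame :: "complex^'m^'m \<Rightarrow> complex^'m^'m \<Rightarrow> bool" where
  "unitary_frame G P \<longleftrightarrow> (\<forall>a b. (\<Sum>\<alpha>\<in>UNIV. \<Sum>\<beta>\<in>UNIV. P $ \<alpha> $ a * cnj (P $ \<beta> $ b) * G $ \<alpha> $ \<beta>)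
                                = (if a = b then 1 else 0))"

text \<open>The norms are computed from the components in some unitary frame; a different choice of unitary
  frame gives the same value.\<close>
definition norm2_tensor :: "complex^'m^'m \<Rightarrow> ('m \<Rightarrow> 'm \<Rightarrow> complex) \<Rightarrow> real" where
  "norm2_tensor G T = (let P = (SOME P. unitary_frame G P) in
     sqrt (2 * (\<Sum>a\<in>UNIV. \<Sum>b\<in>UNIV.
       (cmod (\<Sum>\<alpha>\<in>UNIV. \<Sum>\<beta>\<in>UNIV. P $ \<alpha> $ a * cnj (P $ \<beta> $ b) * T \<alpha> \<beta>))\<^sup>2)))"

definition norm4_tensor :: "complex^'m^'m \<Rightarrow> ('m \<Rightarrow> 'm \<Rightarrow> 'm \<Rightarrow> 'm \<Rightarrow> complex) \<Rightarrow> real" where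
  "norm4_tensor G T = (let P = (SOME P. unitary_frame G P) in
     sqrt (4 * (\<Sum>a\<in>UNIV. \<Sum>b\<in>UNIV. \<Sum>c\<in>UNIV. \<Sum>d\<in>UNIV.
       (cmod (\<Sum>\<alpha>\<in>UNIV. \<Sum>\<beta>\<in>UNIV. \<Sum>\<gamma>\<in>UNIV. \<Sum>\<delta>\<in>UNIV.
          P $ \<alpha> $ a * cnj (P $ \<beta> $ b) * P $ \<gamma> $ c * cnj (P $ \<delta> $ d) * T \<alpha> \<beta> \<gamma> \<delta>))\<^sup>2)))"

definition norm_E :: "(complex^'m \<Rightarrow> complex^'m^'m) \<Rightarrow> complex^'m \<Rightarrow> real" where
  "norm_E G z = norm2_tensor (G z) (traceless_ricci G z)"

definition norm_B :: "(complex^'m \<Rightarrow> complex^'m^'m) \<Rightarrow> complex^'m \<Rightarrow> real" where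
  "norm_B G z = norm4_tensor (G z) (bochner G z)"

text \<open>There is a biholomorphism pulling the metric \<open>h\<close> back to a positive multiple of \<open>g\<close>.\<close>
definition biholomorphically_homothetic ::
  "'a topology \<Rightarrow> ('a, 'm::finite) chart set \<Rightarrow> ('a, 'm) chart_metric \<Rightarrow>
   'b topology \<Rightarrow> ('b, 'n::finite) chart set \<Rightarrow> ('b, 'n) chart_metric \<Rightarrow> bool" where
  "biholomorphically_homothetic X A g Y B h \<longleftrightarrow>
     (\<exists>f. \<exists>k>0. biholomorphism X A Y B f \<and>
        (\<forall>c\<in>A. \<forall>d\<in>B. \<forall>p\<in>fst c. f p \<in> fst d \<longrightarrow>
           pullback_metric (snd d \<circ> f \<circ> chart_inv c) (h d) (snd c p) = k *\<^sub>R g c (snd c p)))"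


section \<open>Complex projective space with the Fubini-Study metric\<close>

text \<open>Points are the complex lines through \<open>0\<close> in the space \<open>complex^('m option)\<close> of dimension
  \<open>CARD('m) + 1\<close>.\<close>
definition cline :: "complex^('m::finite option) \<Rightarrow> (complex^('m option)) set" where
  "cline z = range (\<lambda>a. a *s z)"

definition cp_topology :: "(complex^('m::finite option)) set topology" where
  "cp_topology = topology (\<lambda>S. S \<subseteq> cline ` (- {0}) \<and> open {z. z \<noteq> 0 \<and> cline z \<in> S})"

lemma openin_cp_topology:
  "openin cp_topology S \<longleftrightarrow>
     S \<subseteq> cline ` (- {0}) \<and> open {z :: complex^('m::finite option). z \<noteq> 0 \<and> cline z \<in> S}"
proof -
  have "istopology (\<lambda>S. S \<subseteq> cline ` (- {0}) \<and> open {z :: complex^('m option). z \<noteq> 0 \<and> cline z \<in> S})"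
    unfolding istopology_def
  proof (rule conjI; clarify)
    fix S T :: "(complex^('m option)) set set"
    assume a: "S \<subseteq> cline ` (- {0})" "open {z. z \<noteq> 0 \<and> cline z \<in> S}"
      "T \<subseteq> cline ` (- {0})" "open {z. z \<noteq> 0 \<and> cline z \<in> T}"
    have "{z. z \<noteq> 0 \<and> cline z \<in> S \<inter> T} =
        {z. z \<noteq> 0 \<and> cline z \<in> S} \<inter> {z. z \<noteq> 0 \<and> cline z \<in> T}" by auto
    then show "S \<inter> T \<subseteq> cline ` (- {0}) \<and> open {z. z \<noteq> 0 \<and> cline z \<in> S \<inter> T}"
      using a by auto
  next
    fix K :: "(complex^('m option)) set set set"
    assume a: "\<forall>S\<in>K. S \<subseteq> cline ` (- {0}) \<and> open {z. z \<noteq> 0 \<and> cline z \<in> S}"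
    have "{z. z \<noteq> 0 \<and> cline z \<in> \<Union>K} = (\<Union>S\<in>K. {z. z \<noteq> 0 \<and> cline z \<in> S})" by auto
    then show "\<Union>K \<subseteq> cline ` (- {0}) \<and> open {z. z \<noteq> 0 \<and> cline z \<in> \<Union>K}"
      using a by auto
  qed
  then show ?thesis
    by (simp add: cp_topology_def topology_inverse')
qed

lemma topspace_cp_topology: "topspace cp_topology = cline ` (- {0 :: complex^('m::finite option)})"
proof -
  have "{z :: complex^('m option). z \<noteq> 0 \<and> cline z \<in> cline ` (- {0})} = - {0}" by auto
  then have "openin cp_topology (cline ` (- {0 :: complex^('m option)}))"
    by (simp add: openin_cp_topology open_Compl)
  then show ?thesis
    by (meson openin_cp_topology openin_subset openin_topspace subset_antisym)
qed

lemma quotient_map_cline: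
  "quotient_map (top_of_set (- {0 :: complex^('m::finite option)})) cp_topology cline"
proof -
  have "{z \<in> - {0}. cline z \<in> U} = {z :: complex^('m option). z \<noteq> 0 \<and> cline z \<in> U}" for U
    by auto
  then show ?thesis
    unfolding quotient_map_def
    by (auto simp: topspace_cp_topology openin_cp_topology openin_open_eq open_Compl)
qed

text \<open>The affine chart for an ordering \<open>\<sigma>\<close> of the homogeneous coordinates: where the coordinate with
  index \<open>\<sigma> None\<close> does not vanish, divide the others by it. The quotients do not depend on the
  chosen point \<open>z\<close> of the line.\<close>
definition cp_chart ::
  "('m option \<Rightarrow> 'm option) \<Rightarrow> ((complex^('m::finite option)) set, 'm) chart" where
  "cp_chart \<sigma> = (cline ` {z. z $ \<sigma> None \<noteq> 0},
     \<lambda>L. let z = (SOME z. z \<in> L \<and> z \<noteq> 0) in \<chi> j. z $ \<sigma> (Some j) / z $ \<sigma> None)"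

definition cp_atlas :: "((complex^('m::finite option)) set, 'm) chart set" where
  "cp_atlas = cp_chart ` {\<sigma>. bij \<sigma>}"

text \<open>The Fubini-Study metric has Kaehler potential \<open>ln (1 + |w|\<^sup>2)\<close> in every affine chart.\<close>
definition fubini_study :: "((complex^('m::finite option)) set, 'm) chart_metric" where
  "fubini_study c w =
     (\<chi> \<alpha> \<beta>. dz \<alpha> (dzbar \<beta> (\<lambda>v. complex_of_real (ln (1 + (norm v)\<^sup>2)))) w)"

end

theory Submission
  imports Defs "HOL-Complex_Analysis.Cauchy_Integral_Formula"
begin

text \<open>Constancy of the scalar curvature makes the traceless Ricci tensor \<open>E\<close>, and if \<open>E = 0\<close> also the Bochner tensor \<open>B\<close>, a
  Codazzi tensor, whose rough Laplacian is algebraic in the tensor and the curvature. At a maximum of \<open>|E|\<^sup>2\<close>, respectively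
  \<open>|B|\<^sup>2\<close>, the pinching condition contradicts \<open>\<Delta>|T|\<^sup>2 \<le> 0\<close> unless the tensor vanishes; hence the metric \<open>g\<close> has constant
  holomorphic sectional curvature \<open>k\<close>. A Hermitian metric on a bundle of rank \<open>m + 1\<close> is then flat, and a parallel frame yields local
  holomorphic homogeneous coordinates \<open>s\<close>, for which \<open>ln |s|\<^sup>2\<close> is a potential of \<open>k g\<close> and which are unique up to unitary maps.
  By compactness their local inverses exist on balls whose radius is uniform relative to the norm of the centre, so
  they continue to a map of the nonzero vectors onto \<open>M\<close>. Two vectors with the same image differ up to a factor by a unitary map
  preserving the fibres; this has an eigenvector, near which the fibres are lines, so it is a scalar. The fibres are therefore exactly
  the complex lines.\<close>

section \<open>Smooth functions and Wirtinger calculus\<close>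

lemma Ck_on_cong:
  assumes "open S" "\<And>x. x \<in> S \<Longrightarrow> f x = g x"
  shows "Ck_on k f S \<longleftrightarrow> Ck_on k g S"
  using assms(2)
proof (induction k arbitrary: f g)
  case 0
  then show ?case by (auto cong: continuous_on_cong)
next
  case (Suc k)
  have e: "(f has_derivative D) (at x) \<longleftrightarrow> (g has_derivative D) (at x)" if "x \<in> S" for x D
    using Suc.prems has_derivative_transform_within_open[OF _ assms(1) that] by metis
  then have "frechet_derivative f (at x) = frechet_derivative g (at x)" if "x \<in> S" for x
    using that by (auto simp: frechet_derivative_def)
  then have "Ck_on k (\<lambda>x. frechet_derivative f (at x) v) S \<longleftrightarrow> Ck_on k (\<lambda>x. frechet_derivative g (at x) v) S" for v
    by (intro Suc.IH) auto
  moreover have "f differentiable (at x) \<longleftrightarrow> g differentiable (at x)" if "x \<in> S" for x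
    using e that by (auto simp: differentiable_def)
  ultimately show ?case by auto
qed

lemma Ck_on_SucD: "Ck_on (Suc k) f S \<Longrightarrow> Ck_on k f S"
proof (induction k arbitrary: f)
  case 0
  then show ?case
    by (auto intro!: continuous_at_imp_continuous_on differentiable_imp_continuous_within)
qed auto

lemma smooth_on_iff:
  "smooth_on f S \<longleftrightarrow> (\<forall>x\<in>S. f differentiable (at x)) \<and> (\<forall>v. smooth_on (\<lambda>x. frechet_derivative f (at x) v) S)"
  (is "?L \<longleftrightarrow> ?R")
proof
  assume ?L
  then show ?R unfolding smooth_on_def using Ck_on.simps(2) by blast
next
  assume R: ?R
  have "Ck_on k f S" for k
  proof (cases k)
    case 0
    then show ?thesis using R by (auto intro!: continuous_at_imp_continuous_on differentiable_imp_continuous_within)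
  qed (use R in \<open>auto simp: smooth_on_def\<close>)
  then show ?L by (simp add: smooth_on_def)
qed

lemma smooth_on_differentiable: "smooth_on f S \<Longrightarrow> x \<in> S \<Longrightarrow> f differentiable (at x)"
  using smooth_on_iff by blast

lemma smooth_on_frechet: "smooth_on f S \<Longrightarrow> smooth_on (\<lambda>x. frechet_derivative f (at x) v) S"
  using smooth_on_iff by blast

lemma smooth_on_cong: "open S \<Longrightarrow> (\<And>x. x \<in> S \<Longrightarrow> f x = g x) \<Longrightarrow> smooth_on f S \<longleftrightarrow> smooth_on g S"
  using Ck_on_cong unfolding smooth_on_def by metis

lemma smooth_on_subset: "smooth_on f S \<Longrightarrow> T \<subseteq> S \<Longrightarrow> smooth_on f T"
proof -
  have "Ck_on k f S \<Longrightarrow> T \<subseteq> S \<Longrightarrow> Ck_on k f T" for k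
    by (induction k arbitrary: f) (auto intro: continuous_on_subset)
  then show "smooth_on f S \<Longrightarrow> T \<subseteq> S \<Longrightarrow> smooth_on f T" by (auto simp: smooth_on_def)
qed

lemma smooth_on_continuous: "smooth_on f S \<Longrightarrow> continuous_on S f"
  unfolding smooth_on_def using Ck_on.simps(1) by blast

lemma frechet_derivativeI: "(f has_derivative D) (at x) \<Longrightarrow> frechet_derivative f (at x) = D"
  using frechet_derivative_at by metis

lemma has_frechet: "f differentiable (at x) \<Longrightarrow> (f has_derivative frechet_derivative f (at x)) (at x)"
  by (simp add: frechet_derivative_works)

lemma Ck_on_const: "open S \<Longrightarrow> Ck_on k (\<lambda>x. c) S"
  by (induction k arbitrary: c) auto

lemma Ck_on_bounded_linear:
  assumes "bounded_linear L" "open S" "Ck_on k f S"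
  shows "Ck_on k (\<lambda>x. L (f x)) S"
  using assms(3)
proof (induction k arbitrary: f)
  case 0
  then show ?case using bounded_linear.continuous_on[OF assms(1)] by auto
next
  case (Suc k)
  have d: "((\<lambda>x. L (f x)) has_derivative (\<lambda>v. L (frechet_derivative f (at x) v))) (at x)" if "x \<in> S" for x
    using Suc.prems that by (intro bounded_linear.has_derivative[OF assms(1)] has_frechet) auto
  have "Ck_on k (\<lambda>x. frechet_derivative (\<lambda>x. L (f x)) (at x) v) S" for v
    using Suc d Ck_on_cong[OF assms(2), of "\<lambda>x. frechet_derivative (\<lambda>x. L (f x)) (at x) v" "\<lambda>x. L (frechet_derivative f (at x) v)" k]
    by (auto simp: frechet_derivativeI[OF d])
  then show ?case using d by (auto simp: differentiable_def)
qed

lemma Ck_on_add: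
  assumes "open S" "Ck_on k f S" "Ck_on k g S"
  shows "Ck_on k (\<lambda>x. f x + g x) S"
  using assms(2,3)
proof (induction k arbitrary: f g)
  case 0
  then show ?case by (auto intro: continuous_intros)
next
  case (Suc k)
  have d: "((\<lambda>x. f x + g x) has_derivative (\<lambda>v. frechet_derivative f (at x) v + frechet_derivative g (at x) v)) (at x)" if "x \<in> S" for x
    using Suc.prems that by (intro has_derivative_add has_frechet) auto
  have "Ck_on k (\<lambda>x. frechet_derivative (\<lambda>x. f x + g x) (at x) v) S" for v
    using Suc d Ck_on_cong[OF assms(1), of "\<lambda>x. frechet_derivative (\<lambda>x. f x + g x) (at x) v" "\<lambda>x. frechet_derivative f (at x) v + frechet_derivative g (at x) v" k]
    by (auto simp: frechet_derivativeI[OF d])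
  then show ?case using d by (auto simp: differentiable_def)
qed

lemma Ck_on_mult:
  fixes f g :: "'a::real_normed_vector \<Rightarrow> 'b::real_normed_algebra"
  assumes "open S" "Ck_on k f S" "Ck_on k g S"
  shows "Ck_on k (\<lambda>x. f x * g x) S"
  using assms(2,3)
proof (induction k arbitrary: f g)
  case 0
  then show ?case by (auto intro: continuous_intros)
next
  case (Suc k)
  have d: "((\<lambda>x. f x * g x) has_derivative (\<lambda>v. f x * frechet_derivative g (at x) v + frechet_derivative f (at x) v * g x)) (at x)" if "x \<in> S" for x
    using Suc.prems that by (intro has_derivative_mult has_frechet) auto
  have "Ck_on k (\<lambda>x. f x * frechet_derivative g (at x) v + frechet_derivative f (at x) v * g x) S" for v
    using Suc.prems Ck_on_SucD[OF Suc.prems(1)] Ck_on_SucD[OF Suc.prems(2)]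
    by (intro Ck_on_add assms(1) Suc.IH) auto
  then have "Ck_on k (\<lambda>x. frechet_derivative (\<lambda>x. f x * g x) (at x) v) S" for v
    using Ck_on_cong[OF assms(1), of "\<lambda>x. frechet_derivative (\<lambda>x. f x * g x) (at x) v" "\<lambda>x. f x * frechet_derivative g (at x) v + frechet_derivative f (at x) v * g x" k]
    by (auto simp: frechet_derivativeI[OF d])
  then show ?case using d by (auto simp: differentiable_def)
qed

lemma smooth_on_const: "open S \<Longrightarrow> smooth_on (\<lambda>x. c) S"
  by (simp add: smooth_on_def Ck_on_const)

lemma smooth_on_bounded_linear: "bounded_linear L \<Longrightarrow> open S \<Longrightarrow> smooth_on f S \<Longrightarrow> smooth_on (\<lambda>x. L (f x)) S"
  by (simp add: smooth_on_def Ck_on_bounded_linear)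

lemma smooth_on_add: "open S \<Longrightarrow> smooth_on f S \<Longrightarrow> smooth_on g S \<Longrightarrow> smooth_on (\<lambda>x. f x + g x) S"
  by (simp add: smooth_on_def Ck_on_add)

lemma smooth_on_mult:
  fixes f g :: "'a::real_normed_vector \<Rightarrow> 'b::real_normed_algebra"
  shows "open S \<Longrightarrow> smooth_on f S \<Longrightarrow> smooth_on g S \<Longrightarrow> smooth_on (\<lambda>x. f x * g x) S"
  by (simp add: smooth_on_def Ck_on_mult)

lemma smooth_on_minus: "open S \<Longrightarrow> smooth_on f S \<Longrightarrow> smooth_on (\<lambda>x. - f x) S"
  by (rule smooth_on_bounded_linear) (auto intro: bounded_linear_minus bounded_linear_ident)

lemma smooth_on_diff: "open S \<Longrightarrow> smooth_on f S \<Longrightarrow> smooth_on g S \<Longrightarrow> smooth_on (\<lambda>x. f x - g x) S"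
  using smooth_on_add[OF _ _ smooth_on_minus, of S f g] by simp

lemma smooth_on_cnj: "open S \<Longrightarrow> smooth_on f S \<Longrightarrow> smooth_on (\<lambda>x. cnj (f x)) S"
  by (rule smooth_on_bounded_linear) (auto intro: bounded_linear_cnj)

lemma smooth_on_sum:
  "open S \<Longrightarrow> (\<And>i. i \<in> I \<Longrightarrow> smooth_on (f i) S) \<Longrightarrow> smooth_on (\<lambda>x. \<Sum>i\<in>I. f i x) S"
  by (induction I rule: infinite_finite_induct) (auto intro: smooth_on_add smooth_on_const)

lemma smooth_on_prod:
  fixes f :: "'i \<Rightarrow> 'a::real_normed_vector \<Rightarrow> complex"
  shows "open S \<Longrightarrow> (\<And>i. i \<in> I \<Longrightarrow> smooth_on (f i) S) \<Longrightarrow> smooth_on (\<lambda>x. \<Prod>i\<in>I. f i x) S"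
  by (induction I rule: infinite_finite_induct) (auto intro: smooth_on_mult smooth_on_const)

lemma smooth_on_nth:
  fixes f :: "'a::real_normed_vector \<Rightarrow> 'b::real_normed_vector^'n::finite"
  shows "open S \<Longrightarrow> smooth_on f S \<Longrightarrow> smooth_on (\<lambda>x. f x $ i) S"
  by (rule smooth_on_bounded_linear) (auto intro: bounded_linear_vec_nth)

lemma smooth_on_derivI:
  fixes f :: "'a::real_normed_vector \<Rightarrow> complex"
  assumes "open S" "\<And>x. x \<in> S \<Longrightarrow> (f has_derivative D x) (at x)" "\<And>k v. Ck_on k f S \<Longrightarrow> Ck_on k (\<lambda>x. D x v) S"
  shows "smooth_on f S"
proof -
  have "Ck_on k f S" for k
  proof (induction k)
    case 0
    then show ?case using assms(2) by (auto intro!: continuous_at_imp_continuous_on has_derivative_continuous)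
  next
    case (Suc k)
    have "Ck_on k (\<lambda>x. frechet_derivative f (at x) v) S \<longleftrightarrow> Ck_on k (\<lambda>x. D x v) S" for v
      by (rule Ck_on_cong[OF assms(1)]) (simp add: frechet_derivativeI[OF assms(2)])
    then show ?case using assms(2,3) Suc by (auto simp: differentiable_def)
  qed
  then show ?thesis by (simp add: smooth_on_def)
qed

lemma smooth_on_inverse:
  fixes f :: "'a::real_normed_vector \<Rightarrow> complex"
  assumes "open S" "smooth_on f S" "\<And>x. x \<in> S \<Longrightarrow> f x \<noteq> 0"
  shows "smooth_on (\<lambda>x. inverse (f x)) S"
proof (rule smooth_on_derivI[OF assms(1)])
  show "((\<lambda>x. inverse (f x)) has_derivative (\<lambda>v. - (inverse (f x) * frechet_derivative f (at x) v * inverse (f x)))) (at x)" if "x \<in> S" for x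
    using that assms(2,3) by (intro Deriv.has_derivative_inverse has_frechet smooth_on_differentiable) auto
  show "Ck_on k (\<lambda>x. - (inverse (f x) * frechet_derivative f (at x) v * inverse (f x))) S" if "Ck_on k (\<lambda>x. inverse (f x)) S" for k v
  proof -
    have "Ck_on k (\<lambda>x. frechet_derivative f (at x) v) S" using smooth_on_frechet[OF assms(2)] by (simp add: smooth_on_def)
    then have "Ck_on k (\<lambda>x. (inverse (f x) * frechet_derivative f (at x) v * inverse (f x))) S"
      using that assms(1) Ck_on_mult by blast
    then show ?thesis using Ck_on_bounded_linear[OF bounded_linear_minus[OF bounded_linear_ident] assms(1)] by blast
  qed
qed

lemma smooth_on_divide:
  fixes f g :: "'a::real_normed_vector \<Rightarrow> complex"
  assumes "open S" "smooth_on f S" "smooth_on g S" "\<And>x. x \<in> S \<Longrightarrow> g x \<noteq> 0"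
  shows "smooth_on (\<lambda>x. f x / g x) S"
  using smooth_on_mult[OF assms(1,2) smooth_on_inverse[OF assms(1,3,4)]] by (simp add: divide_inverse)

lemma has_derivative_chain_field:
  assumes "(f has_derivative D) (at z)" "(h has_field_derivative c) (at (f z))"
  shows "((\<lambda>x. h (f x)) has_derivative (\<lambda>v. c * D v)) (at z)"
  using has_derivative_compose[OF assms(1) assms(2)[unfolded has_field_derivative_def]] .

lemma second_difference_mvt:
  fixes f :: "'a::real_normed_vector \<Rightarrow> real"
  assumes h: "0 < h" and d: "\<And>x. x \<in> S \<Longrightarrow> f differentiable (at x)"
    "\<And>x. x \<in> S \<Longrightarrow> (\<lambda>x. frechet_derivative f (at x) u) differentiable (at x)"
    and S: "\<And>s t. 0 \<le> s \<Longrightarrow> s \<le> h \<Longrightarrow> 0 \<le> t \<Longrightarrow> t \<le> h \<Longrightarrow> z + s *\<^sub>R u + t *\<^sub>R v \<in> S"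
  shows "\<exists>s t. 0 \<le> s \<and> s \<le> h \<and> 0 \<le> t \<and> t \<le> h \<and>
     f (z + h *\<^sub>R u + h *\<^sub>R v) - f (z + h *\<^sub>R u) - f (z + h *\<^sub>R v) + f z =
     h * h * frechet_derivative (\<lambda>x. frechet_derivative f (at x) u) (at (z + s *\<^sub>R u + t *\<^sub>R v)) v"
proof -
  let ?D = "\<lambda>x. frechet_derivative f (at x) u"
  have 1: "((\<lambda>s. f (z + s *\<^sub>R u + t *\<^sub>R v)) has_real_derivative ?D (z + s *\<^sub>R u + t *\<^sub>R v)) (at s)"
    if "0 \<le> s" "s \<le> h" "0 \<le> t" "t \<le> h" for s t
  proof -
    have l: "((\<lambda>s. z + s *\<^sub>R u + t *\<^sub>R v) has_derivative (\<lambda>s. s *\<^sub>R u)) (at s)"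
      by (auto intro!: derivative_eq_intros)
    from has_derivative_compose[OF this has_frechet[OF d(1)[OF S[OF that]]]]
    have "((\<lambda>s. f (z + s *\<^sub>R u + t *\<^sub>R v)) has_derivative (\<lambda>r. frechet_derivative f (at (z + s *\<^sub>R u + t *\<^sub>R v)) (r *\<^sub>R u))) (at s)" .
    moreover have "frechet_derivative f (at (z + s *\<^sub>R u + t *\<^sub>R v)) (r *\<^sub>R u) = ?D (z + s *\<^sub>R u + t *\<^sub>R v) * r" for r
      using linear_scale[OF linear_frechet_derivative[OF d(1)[OF S[OF that]]]] by simp
    ultimately show ?thesis by (simp add: has_field_derivative_def)
  qed
  have "\<exists>s. 0 < s \<and> s < h \<and> (f (z + h *\<^sub>R u + h *\<^sub>R v) - f (z + h *\<^sub>R u + 0 *\<^sub>R v)) - (f (z + 0 *\<^sub>R u + h *\<^sub>R v) - f (z + 0 *\<^sub>R u + 0 *\<^sub>R v))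
     = (h - 0) * (?D (z + s *\<^sub>R u + h *\<^sub>R v) - ?D (z + s *\<^sub>R u + 0 *\<^sub>R v))"
    by (rule MVT2[OF h]) (intro DERIV_diff 1; use h in simp)
  then obtain s where s: "0 < s" "s < h" and e1: "f (z + h *\<^sub>R u + h *\<^sub>R v) - f (z + h *\<^sub>R u) - f (z + h *\<^sub>R v) + f z
     = h * (?D (z + s *\<^sub>R u + h *\<^sub>R v) - ?D (z + s *\<^sub>R u))" by (auto simp: algebra_simps)
  have 2: "((\<lambda>t. ?D (z + s *\<^sub>R u + t *\<^sub>R v)) has_real_derivative frechet_derivative ?D (at (z + s *\<^sub>R u + t *\<^sub>R v)) v) (at t)"
    if "0 \<le> t" "t \<le> h" for t
  proof -
    have S': "z + s *\<^sub>R u + t *\<^sub>R v \<in> S" using s that by (intro S) auto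
    have l: "((\<lambda>t. z + s *\<^sub>R u + t *\<^sub>R v) has_derivative (\<lambda>t. t *\<^sub>R v)) (at t)"
      by (auto intro!: derivative_eq_intros)
    from has_derivative_compose[OF this has_frechet[OF d(2)[OF S']]]
    have "((\<lambda>t. ?D (z + s *\<^sub>R u + t *\<^sub>R v)) has_derivative (\<lambda>r. frechet_derivative ?D (at (z + s *\<^sub>R u + t *\<^sub>R v)) (r *\<^sub>R v))) (at t)" .
    moreover have "frechet_derivative ?D (at (z + s *\<^sub>R u + t *\<^sub>R v)) (r *\<^sub>R v) = frechet_derivative ?D (at (z + s *\<^sub>R u + t *\<^sub>R v)) v * r" for r
      using linear_scale[OF linear_frechet_derivative[OF d(2)[OF S']]] by simp
    ultimately show ?thesis by (simp add: has_field_derivative_def)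
  qed
  have "\<exists>t. 0 < t \<and> t < h \<and> ?D (z + s *\<^sub>R u + h *\<^sub>R v) - ?D (z + s *\<^sub>R u + 0 *\<^sub>R v)
     = (h - 0) * frechet_derivative ?D (at (z + s *\<^sub>R u + t *\<^sub>R v)) v"
    by (rule MVT2[OF h]) (intro 2; simp)
  then obtain t where t: "0 < t" "t < h" "?D (z + s *\<^sub>R u + h *\<^sub>R v) - ?D (z + s *\<^sub>R u)
     = h * frechet_derivative ?D (at (z + s *\<^sub>R u + t *\<^sub>R v)) v" by auto
  show ?thesis
    by (rule exI[of _ s], rule exI[of _ t]) (use s t e1 in \<open>simp add: mult.assoc\<close>)
qed

lemma second_derivative_commute_real:
  fixes f :: "'a::real_normed_vector \<Rightarrow> real"
  assumes "open S" "smooth_on f S" "z \<in> S"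
  shows "frechet_derivative (\<lambda>x. frechet_derivative f (at x) u) (at z) v =
         frechet_derivative (\<lambda>x. frechet_derivative f (at x) v) (at z) u"
proof -
  let ?A = "\<lambda>x. frechet_derivative (\<lambda>x. frechet_derivative f (at x) u) (at x) v"
  let ?B = "\<lambda>x. frechet_derivative (\<lambda>x. frechet_derivative f (at x) v) (at x) u"
  have cA: "continuous_on S ?A" and cB: "continuous_on S ?B"
    by (intro smooth_on_continuous smooth_on_frechet assms(2))+
  have "dist (?A z) (?B z) < e" if "e > 0" for e
  proof -
    have "isCont ?A z" "isCont ?B z" using cA cB assms by (auto simp: continuous_on_eq_continuous_at)
    moreover have "e / 2 > 0" using that by simp
    ultimately obtain d1 d2 where d: "d1 > 0" "d2 > 0" "\<And>x. dist x z < d1 \<Longrightarrow> dist (?A x) (?A z) < e / 2"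
      "\<And>x. dist x z < d2 \<Longrightarrow> dist (?B x) (?B z) < e / 2"
      unfolding continuous_at_eps_delta by metis
    obtain d3 where d3: "d3 > 0" "ball z d3 \<subseteq> S" using assms open_contains_ball by blast
    define d4 where "d4 = min d1 (min d2 d3)"
    define h where "h = d4 / (2 * (norm u + norm v + 1))"
    have n: "norm u + norm v + 1 > 0" by (smt (verit) norm_ge_zero)
    have h: "h > 0" using d(1,2) d3(1) n by (simp add: h_def d4_def)
    have near: "dist (z + s *\<^sub>R u + t *\<^sub>R v) z < d4" if "0 \<le> s" "s \<le> h" "0 \<le> t" "t \<le> h" for s t
    proof -
      have "dist (z + s *\<^sub>R u + t *\<^sub>R v) z = norm (s *\<^sub>R u + t *\<^sub>R v)" by (simp add: dist_norm)
      also have "\<dots> \<le> s * norm u + t * norm v" using that by (intro norm_triangle_le) auto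
      also have "\<dots> \<le> h * norm u + h * norm v" using that by (intro add_mono mult_right_mono) auto
      also have "\<dots> < h * (2 * (norm u + norm v + 1))" using h by (simp add: algebra_simps) (smt (verit) mult_nonneg_nonneg norm_ge_zero)
      also have "\<dots> = d4" using n by (simp add: h_def)
      finally show ?thesis .
    qed
    have inS: "z + s *\<^sub>R u + t *\<^sub>R v \<in> S" "z + s *\<^sub>R v + t *\<^sub>R u \<in> S" if "0 \<le> s" "s \<le> h" "0 \<le> t" "t \<le> h" for s t
      using near[OF that] near[OF that(3,4,1,2)] d3(2) by (auto simp: d4_def dist_commute subset_iff add_ac)
    obtain s t where st: "0 \<le> s" "s \<le> h" "0 \<le> t" "t \<le> h" and
      e1: "f (z + h *\<^sub>R u + h *\<^sub>R v) - f (z + h *\<^sub>R u) - f (z + h *\<^sub>R v) + f z = h * h * ?A (z + s *\<^sub>R u + t *\<^sub>R v)"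
      using second_difference_mvt[OF h smooth_on_differentiable[OF assms(2)]
          smooth_on_differentiable[OF smooth_on_frechet[OF assms(2)]] inS(1)] by blast
    obtain s' t' where st': "0 \<le> s'" "s' \<le> h" "0 \<le> t'" "t' \<le> h" and
      e2: "f (z + h *\<^sub>R v + h *\<^sub>R u) - f (z + h *\<^sub>R v) - f (z + h *\<^sub>R u) + f z = h * h * ?B (z + s' *\<^sub>R v + t' *\<^sub>R u)"
      using second_difference_mvt[OF h smooth_on_differentiable[OF assms(2)]
          smooth_on_differentiable[OF smooth_on_frechet[OF assms(2)]] inS(2)] by blast
    have eq: "z + h *\<^sub>R v + h *\<^sub>R u = z + h *\<^sub>R u + h *\<^sub>R v" by simp
    have "f (z + h *\<^sub>R u + h *\<^sub>R v) - f (z + h *\<^sub>R u) - f (z + h *\<^sub>R v) + f z = h * h * ?B (z + s' *\<^sub>R v + t' *\<^sub>R u)"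
      using e2 unfolding eq by linarith
    with e1 have "h * h * ?A (z + s *\<^sub>R u + t *\<^sub>R v) = h * h * ?B (z + s' *\<^sub>R v + t' *\<^sub>R u)"
      by metis
    then have "?A (z + s *\<^sub>R u + t *\<^sub>R v) = ?B (z + s' *\<^sub>R v + t' *\<^sub>R u)" using h by simp
    moreover have "dist (?A (z + s *\<^sub>R u + t *\<^sub>R v)) (?A z) < e / 2" using near[OF st] by (intro d) (simp add: d4_def)
    moreover have "dist (?B (z + s' *\<^sub>R v + t' *\<^sub>R u)) (?B z) < e / 2"
      using near[OF st'(3,4,1,2)] by (intro d) (simp add: d4_def add_ac)
    ultimately show ?thesis by (smt (verit) dist_commute dist_triangle field_sum_of_halves)
  qed
  then show ?thesis by (metis dist_eq_0_iff zero_less_dist_iff less_irrefl)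
qed

lemma second_derivative_commute:
  fixes f :: "'a::real_normed_vector \<Rightarrow> complex"
  assumes "open S" "smooth_on f S" "z \<in> S"
  shows "frechet_derivative (\<lambda>x. frechet_derivative f (at x) u) (at z) v =
         frechet_derivative (\<lambda>x. frechet_derivative f (at x) v) (at z) u"
proof -
  have L: "L (frechet_derivative (\<lambda>x. frechet_derivative f (at x) u) (at z) v) =
    L (frechet_derivative (\<lambda>x. frechet_derivative f (at x) v) (at z) u)" if L: "bounded_linear L" for L :: "complex \<Rightarrow> real"
  proof -
    have 1: "frechet_derivative (\<lambda>x. L (g x)) (at x) w = L (frechet_derivative g (at x) w)"
      if "smooth_on g S" "x \<in> S" for g :: "'a \<Rightarrow> complex" and x w
      using frechet_derivativeI[OF bounded_linear.has_derivative[OF L has_frechet[OF smooth_on_differentiable[OF that]]]] by simp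
    have 2: "frechet_derivative (\<lambda>x. frechet_derivative (\<lambda>x. L (f x)) (at x) u) (at z) v =
       L (frechet_derivative (\<lambda>x. frechet_derivative f (at x) u) (at z) v)" for u v
    proof -
      have "((\<lambda>x. frechet_derivative (\<lambda>x. L (f x)) (at x) u) has_derivative D) (at z)"
        if "((\<lambda>x. L (frechet_derivative f (at x) u)) has_derivative D) (at z)" for D
        by (rule has_derivative_transform_within_open[OF that assms(1,3)]) (simp add: 1 assms)
      then show ?thesis
        using bounded_linear.has_derivative[OF L has_frechet[OF smooth_on_differentiable[OF smooth_on_frechet[OF assms(2)] assms(3)]]]
        by (metis frechet_derivativeI)
    qed
    from second_derivative_commute_real[OF assms(1) smooth_on_bounded_linear[OF L assms(1,2)] assms(3)]
    show ?thesis by (simp add: 2)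
  qed
  show ?thesis
    using L[OF bounded_linear_Re] L[OF bounded_linear_Im] by (simp add: complex_eq_iff)
qed

text \<open>A uniform treatment of \<open>dz\<close> (\<open>k = - i\<close>) and \<open>dzbar\<close> (\<open>k = i\<close>).\<close>
definition wd :: "complex \<Rightarrow> 'm \<Rightarrow> (complex^'m::finite \<Rightarrow> complex) \<Rightarrow> complex^'m \<Rightarrow> complex" where
  "wd k al f z = (frechet_derivative f (at z) (axis al 1) + k * frechet_derivative f (at z) (axis al \<i>)) / 2"

lemma dz_wd: "dz al f z = wd (- \<i>) al f z" by (simp add: dz_def wd_def)
lemma dzbar_wd: "dzbar al f z = wd \<i> al f z" by (simp add: dzbar_def wd_def)

lemma wdI: "(f has_derivative D) (at z) \<Longrightarrow> wd k al f z = (D (axis al 1) + k * D (axis al \<i>)) / 2"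
  by (simp add: wd_def frechet_derivativeI)

lemma wd_cong:
  assumes "open S" "z \<in> S" "\<And>x. x \<in> S \<Longrightarrow> f x = g x"
  shows "wd k al f z = wd k al g z"
proof -
  have "(f has_derivative D) (at z) \<longleftrightarrow> (g has_derivative D) (at z)" for D
    using has_derivative_transform_within_open[OF _ assms(1,2)] assms(3) by metis
  then show ?thesis by (simp add: wd_def frechet_derivative_def)
qed

lemma wd_const [simp]: "wd k al (\<lambda>x. c) z = 0"
  by (simp add: wd_def)

lemma wd_add: "f differentiable (at z) \<Longrightarrow> g differentiable (at z) \<Longrightarrow>
    wd k al (\<lambda>x. f x + g x) z = wd k al f z + wd k al g z"
  by (subst wdI[OF has_derivative_add[OF has_frechet has_frechet]]) (auto simp: wd_def field_simps)

lemma wd_diff: "f differentiable (at z) \<Longrightarrow> g differentiable (at z) \<Longrightarrow>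
    wd k al (\<lambda>x. f x - g x) z = wd k al f z - wd k al g z"
  by (subst wdI[OF has_derivative_diff[OF has_frechet has_frechet]]) (auto simp: wd_def field_simps)

lemma wd_mult: "f differentiable (at z) \<Longrightarrow> g differentiable (at z) \<Longrightarrow>
    wd k al (\<lambda>x. f x * g x) z = wd k al f z * g z + f z * wd k al g z"
  by (subst wdI[OF has_derivative_mult[OF has_frechet has_frechet]]) (auto simp: wd_def field_simps)

lemma wd_sum: "(\<And>i. i \<in> I \<Longrightarrow> f i differentiable (at z)) \<Longrightarrow>
    wd k al (\<lambda>x. \<Sum>i\<in>I. f i x) z = (\<Sum>i\<in>I. wd k al (f i) z)"
proof (induction I rule: infinite_finite_induct)
  case (insert i I)
  then have "(\<lambda>x. \<Sum>i\<in>I. f i x) differentiable (at z)" by (cases "I = {}") auto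
  with insert show ?case by (simp add: wd_add)
qed auto

lemma differentiable_cnj: "f differentiable (at z) \<Longrightarrow> (\<lambda>x. cnj (f x)) differentiable (at z)"
  using bounded_linear.has_derivative[OF bounded_linear_cnj] unfolding differentiable_def by blast

lemma wd_cnj: "f differentiable (at z) \<Longrightarrow> wd k al (\<lambda>x. cnj (f x)) z = cnj (wd (cnj k) al f z)"
  by (subst wdI[OF bounded_linear.has_derivative[OF bounded_linear_cnj has_frechet]]) (auto simp: wd_def)

lemma wd_chain:
  assumes "f differentiable (at z)" "(h has_field_derivative c) (at (f z))"
  shows "wd k al (\<lambda>x. h (f x)) z = c * wd k al f z"
  by (subst wdI[OF has_derivative_chain_field[OF has_frechet[OF assms(1)] assms(2)]]) (simp add: wd_def field_simps)

lemma differentiable_chain_complex: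
  "f differentiable (at z) \<Longrightarrow> (h has_field_derivative c) (at (f z)) \<Longrightarrow> (\<lambda>x. h (f x)) differentiable (at z)"
  using has_derivative_chain_field has_frechet differentiable_def by blast

lemma wd_inverse: "f differentiable (at z) \<Longrightarrow> f z \<noteq> 0 \<Longrightarrow>
    wd k al (\<lambda>x. inverse (f x)) z = - (wd k al f z / (f z)\<^sup>2)"
  using wd_chain[OF _ DERIV_inverse, of f z k al] by (simp add: divide_inverse power2_eq_square)

lemma differentiable_divide_complex:
  fixes f :: "'a::real_normed_vector \<Rightarrow> complex"
  shows "f differentiable (at z) \<Longrightarrow> g differentiable (at z) \<Longrightarrow> g z \<noteq> 0 \<Longrightarrow> (\<lambda>x. f x / g x) differentiable (at z)"
  by simp

lemma smooth_on_wd: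
  assumes "open S" "smooth_on f S"
  shows "smooth_on (wd k al f) S"
proof -
  have "smooth_on (\<lambda>z. frechet_derivative f (at z) (axis al 1) * (1/2) + k / 2 * frechet_derivative f (at z) (axis al \<i>)) S"
    using assms by (intro smooth_on_add smooth_on_mult smooth_on_const smooth_on_frechet)
  then show ?thesis by (rule smooth_on_cong[THEN iffD1, rotated 2]) (auto simp: assms wd_def field_simps)
qed

lemma frechet_wd:
  assumes "open S" "smooth_on f S" "z \<in> S"
  shows "frechet_derivative (wd k al f) (at z) v =
     (frechet_derivative (\<lambda>x. frechet_derivative f (at x) v) (at z) (axis al 1)
       + k * frechet_derivative (\<lambda>x. frechet_derivative f (at x) v) (at z) (axis al \<i>)) / 2"
proof -
  have d: "(\<lambda>x. frechet_derivative f (at x) u) differentiable (at z)" for u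
    using smooth_on_differentiable[OF smooth_on_frechet[OF assms(2)] assms(3)] .
  have eq: "wd k al f = (\<lambda>x. frechet_derivative f (at x) (axis al 1) * (1/2) + (k / 2) * frechet_derivative f (at x) (axis al \<i>))"
    by (auto simp: wd_def field_simps)
  have "((\<lambda>x. frechet_derivative f (at x) (axis al 1) * (1/2) + (k / 2) * frechet_derivative f (at x) (axis al \<i>)) has_derivative
    (\<lambda>v. frechet_derivative (\<lambda>x. frechet_derivative f (at x) (axis al 1)) (at z) v * (1/2) +
       (k / 2) * frechet_derivative (\<lambda>x. frechet_derivative f (at x) (axis al \<i>)) (at z) v)) (at z)"
    by (intro has_derivative_add has_derivative_mult_left has_derivative_mult_right has_frechet d)
  then show ?thesis
    unfolding eq by (simp add: frechet_derivativeI second_derivative_commute[OF assms, of _ v] field_simps)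
qed

lemma wd_commute:
  assumes "open S" "smooth_on f S" "z \<in> S"
  shows "wd k al (wd l be f) z = wd l be (wd k al f) z"
proof -
  have "wd k al (wd l be f) z = (frechet_derivative (wd l be f) (at z) (axis al 1) + k * frechet_derivative (wd l be f) (at z) (axis al \<i>)) / 2"
    by (simp add: wd_def)
  also have "\<dots> = (wd l be (\<lambda>x. frechet_derivative f (at x) (axis al 1)) z + k * wd l be (\<lambda>x. frechet_derivative f (at x) (axis al \<i>)) z) / 2"
    unfolding frechet_wd[OF assms] by (simp add: wd_def)
  also have "\<dots> = wd l be (wd k al f) z"
  proof -
    have d: "(\<lambda>x. frechet_derivative f (at x) u) differentiable (at z)" for u
      using smooth_on_differentiable[OF smooth_on_frechet[OF assms(2)] assms(3)] .
    have eq: "wd k al f = (\<lambda>x. frechet_derivative f (at x) (axis al 1) * (1/2) + (k / 2) * frechet_derivative f (at x) (axis al \<i>))"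
      by (auto simp: wd_def field_simps)
    have m: "wd l be (\<lambda>x. g x * c) z = wd l be g z * c" "wd l be (\<lambda>x. c * g x) z = c * wd l be g z"
      if "g differentiable (at z)" for g c
      using wd_mult[OF that differentiable_const, of l be c] wd_mult[OF differentiable_const that, of l be c] by simp_all
    have "wd l be (wd k al f) z = wd l be (\<lambda>x. frechet_derivative f (at x) (axis al 1)) z * (1/2)
       + (k / 2) * wd l be (\<lambda>x. frechet_derivative f (at x) (axis al \<i>)) z"
      unfolding eq by (subst wd_add) (simp_all only: m d differentiable_mult differentiable_const)
    then show ?thesis by (simp add: field_simps)
  qed
  finally show ?thesis .
qed

lemma vec_axis_expansion: "(v::complex^'m::finite) = (\<Sum>al\<in>UNIV. Re (v $ al) *\<^sub>R axis al 1 + Im (v $ al) *\<^sub>R axis al \<i>)"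
proof -
  have "Re (v $ al) *\<^sub>R axis al 1 + Im (v $ al) *\<^sub>R axis al \<i> = axis al (v $ al)" for al
    by (simp add: vec_eq_iff axis_def complex_eq_iff)
  moreover have "v = (\<Sum>al\<in>UNIV. axis al (v $ al))"
    by (simp add: vec_eq_iff axis_def)
  ultimately show ?thesis by simp
qed

lemma frechet_dz:
  fixes f :: "complex^'m::finite \<Rightarrow> complex"
  assumes "f differentiable (at z)"
  shows "frechet_derivative f (at z) v = (\<Sum>al\<in>UNIV. v $ al * dz al f z + cnj (v $ al) * dzbar al f z)"
proof -
  let ?D = "frechet_derivative f (at z)"
  have l: "linear ?D" using linear_frechet_derivative[OF assms] .
  have "?D v = ?D (\<Sum>al\<in>UNIV. Re (v $ al) *\<^sub>R axis al 1 + Im (v $ al) *\<^sub>R axis al \<i>)"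
    by (rule arg_cong[OF vec_axis_expansion])
  also have "\<dots> = (\<Sum>al\<in>UNIV. Re (v $ al) *\<^sub>R ?D (axis al 1) + Im (v $ al) *\<^sub>R ?D (axis al \<i>))"
    by (simp add: linear_sum[OF l] linear_add[OF l] linear_scale[OF l])
  also have "\<dots> = (\<Sum>al\<in>UNIV. v $ al * dz al f z + cnj (v $ al) * dzbar al f z)"
    by (rule sum.cong) (auto simp: dz_def dzbar_def complex_eq_iff field_simps)
  finally show ?thesis .
qed

lemma has_derivative_dz:
  fixes f :: "complex^'m::finite \<Rightarrow> complex"
  assumes "f differentiable (at z)"
  shows "(f has_derivative (\<lambda>v. \<Sum>al\<in>UNIV. v $ al * dz al f z + cnj (v $ al) * dzbar al f z)) (at z)"
  using has_frechet[OF assms] by (simp add: frechet_dz[OF assms, abs_def])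

lemma differentiable_vec:
  fixes F :: "'a::real_normed_vector \<Rightarrow> complex^'m::finite"
  shows "(\<And>i. (\<lambda>w. F w $ i) differentiable (at z)) \<Longrightarrow>
   (F has_derivative (\<lambda>v. \<chi> i. frechet_derivative (\<lambda>w. F w $ i) (at z) v)) (at z)"
proof (subst has_derivative_componentwise_within, rule ballI)
  fix b :: "complex^'m" assume d: "\<And>i. (\<lambda>w. F w $ i) differentiable (at z)" and "b \<in> Basis"
  then obtain i c where b: "b = axis i c" by (auto simp: Basis_vec_def)
  show "((\<lambda>x. F x \<bullet> b) has_derivative (\<lambda>v. (\<chi> i. frechet_derivative (\<lambda>w. F w $ i) (at z) v) \<bullet> b)) (at z)"
    unfolding b inner_axis vec_lambda_beta by (rule has_derivative_inner_left[OF has_frechet[OF d]])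
qed

lemma wd_compose:
  fixes f :: "complex^'m::finite \<Rightarrow> complex" and T :: "complex^'n::finite \<Rightarrow> complex^'m"
  assumes T: "\<And>mu. (\<lambda>w. T w $ mu) differentiable (at z)" and f: "f differentiable (at (T z))"
  shows "(\<lambda>w. f (T w)) differentiable (at z)"
    "wd k al (\<lambda>w. f (T w)) z = (\<Sum>mu\<in>UNIV. wd k al (\<lambda>w. T w $ mu) z * dz mu f (T z) + wd k al (\<lambda>w. cnj (T w $ mu)) z * dzbar mu f (T z))"
proof -
  have d: "((\<lambda>w. f (T w)) has_derivative (\<lambda>v. \<Sum>mu\<in>UNIV. frechet_derivative (\<lambda>w. T w $ mu) (at z) v * dz mu f (T z)
     + cnj (frechet_derivative (\<lambda>w. T w $ mu) (at z) v) * dzbar mu f (T z))) (at z)"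
    using has_derivative_compose[OF differentiable_vec[OF T] has_derivative_dz[OF f]] by simp
  then show "(\<lambda>w. f (T w)) differentiable (at z)" by (auto simp: differentiable_def)
  have c: "frechet_derivative (\<lambda>w. cnj (T w $ mu)) (at z) = (\<lambda>v. cnj (frechet_derivative (\<lambda>w. T w $ mu) (at z) v))" for mu
    by (rule frechet_derivativeI[OF bounded_linear.has_derivative[OF bounded_linear_cnj has_frechet[OF T]]])
  show "wd k al (\<lambda>w. f (T w)) z = (\<Sum>mu\<in>UNIV. wd k al (\<lambda>w. T w $ mu) z * dz mu f (T z) + wd k al (\<lambda>w. cnj (T w $ mu)) z * dzbar mu f (T z))"
    unfolding wdI[OF d] sum_distrib_left sum.distrib[symmetric] sum_divide_distrib
    by (rule sum.cong) (simp_all add: wd_def c field_simps)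
qed

subsection \<open>Holomorphic functions of several variables\<close>

definition hol_on :: "(complex^'m::finite) set \<Rightarrow> (complex^'m \<Rightarrow> complex) \<Rightarrow> bool" where
  "hol_on S f \<longleftrightarrow> (\<forall>z\<in>S. f differentiable (at z) \<and> (\<forall>al. dzbar al f z = 0))"

lemma hol_on_differentiable: "hol_on S f \<Longrightarrow> z \<in> S \<Longrightarrow> f differentiable (at z)"
  by (simp add: hol_on_def)

lemma hol_on_dzbar: "hol_on S f \<Longrightarrow> z \<in> S \<Longrightarrow> dzbar al f z = 0"
  by (simp add: hol_on_def)

lemma hol_on_has_derivative:
  assumes "hol_on S f" "z \<in> S"
  shows "(f has_derivative (\<lambda>v. \<Sum>al\<in>UNIV. v $ al * dz al f z)) (at z)"
  using has_derivative_dz[of f z] assms by (simp add: hol_on_def)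

lemma hol_onI:
  fixes f :: "complex^'m::finite \<Rightarrow> complex"
  assumes "\<And>z. z \<in> S \<Longrightarrow> (f has_derivative D z) (at z)" "\<And>z v. z \<in> S \<Longrightarrow> D z (\<i> *s v) = \<i> * D z v"
  shows "hol_on S f"
  unfolding hol_on_def
proof (intro ballI conjI allI)
  fix z and al :: 'm assume z: "z \<in> S"
  show "f differentiable (at z)" using assms(1)[OF z] by (auto simp: differentiable_def)
  have "axis al \<i> = \<i> *s axis al (1::complex)" by (simp add: vec_eq_iff axis_def)
  then have "D z (axis al \<i>) = \<i> * D z (axis al 1)" using assms(2)[OF z] by metis
  then show "dzbar al f z = 0" by (simp add: dzbar_def frechet_derivativeI[OF assms(1)[OF z]])
qed

lemma hol_on_subset: "hol_on S f \<Longrightarrow> T \<subseteq> S \<Longrightarrow> hol_on T f"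
  by (auto simp: hol_on_def)

lemma hol_on_cong: "open S \<Longrightarrow> (\<And>z. z \<in> S \<Longrightarrow> f z = g z) \<Longrightarrow> hol_on S f \<longleftrightarrow> hol_on S g"
proof -
  have "hol_on S f \<Longrightarrow> hol_on S g" if "open S" "\<And>z. z \<in> S \<Longrightarrow> f z = g z" for f g
    using has_derivative_transform_within_open[OF hol_on_has_derivative[of S f] that(1)] that(2)
    by (intro hol_onI[of S g "\<lambda>z v. \<Sum>al\<in>UNIV. v $ al * dz al f z"]) (auto simp: sum_distrib_left mult.assoc)
  then show "open S \<Longrightarrow> (\<And>z. z \<in> S \<Longrightarrow> f z = g z) \<Longrightarrow> hol_on S f \<longleftrightarrow> hol_on S g"
    by metis
qed

lemma hol_on_const: "hol_on S (\<lambda>z. c)"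
  by (auto simp: hol_on_def dzbar_wd)

lemma hol_on_nth: "hol_on S (\<lambda>z. z $ i)"
proof (rule hol_onI)
  show "((\<lambda>z. z $ i) has_derivative (\<lambda>v. v $ i)) (at z)" for z :: "complex^'a"
    by (rule bounded_linear_imp_has_derivative[OF bounded_linear_vec_nth])
qed auto

lemma hol_on_add: "hol_on S f \<Longrightarrow> hol_on S g \<Longrightarrow> hol_on S (\<lambda>z. f z + g z)"
  by (auto simp: hol_on_def dzbar_wd wd_add)

lemma hol_on_diff: "hol_on S f \<Longrightarrow> hol_on S g \<Longrightarrow> hol_on S (\<lambda>z. f z - g z)"
  by (auto simp: hol_on_def dzbar_wd wd_diff)

lemma hol_on_mult: "hol_on S f \<Longrightarrow> hol_on S g \<Longrightarrow> hol_on S (\<lambda>z. f z * g z)"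
  by (auto simp: hol_on_def dzbar_wd wd_mult)

lemma hol_on_sum: "(\<And>i. i \<in> I \<Longrightarrow> hol_on S (f i)) \<Longrightarrow> hol_on S (\<lambda>z. \<Sum>i\<in>I. f i z)"
  by (induction I rule: infinite_finite_induct) (auto intro: hol_on_add hol_on_const)

lemma hol_on_prod: "(\<And>i. i \<in> I \<Longrightarrow> hol_on S (f i)) \<Longrightarrow> hol_on S (\<lambda>z. \<Prod>i\<in>I. f i z)"
  by (induction I rule: infinite_finite_induct) (auto intro: hol_on_mult hol_on_const)

lemma hol_on_inverse: "hol_on S f \<Longrightarrow> (\<And>z. z \<in> S \<Longrightarrow> f z \<noteq> 0) \<Longrightarrow> hol_on S (\<lambda>z. inverse (f z))"
  by (auto simp: hol_on_def dzbar_wd wd_inverse)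

lemma hol_on_divide: "hol_on S f \<Longrightarrow> hol_on S g \<Longrightarrow> (\<And>z. z \<in> S \<Longrightarrow> g z \<noteq> 0) \<Longrightarrow> hol_on S (\<lambda>z. f z / g z)"
  unfolding divide_inverse by (intro hol_on_mult hol_on_inverse)

lemma hol_compose:
  fixes f :: "complex^'m::finite \<Rightarrow> complex" and T :: "complex^'n::finite \<Rightarrow> complex^'m"
  assumes T: "\<And>mu. hol_on S (\<lambda>w. T w $ mu)" and z: "z \<in> S" and f: "f differentiable (at (T z))"
  shows "(\<lambda>w. f (T w)) differentiable (at z)"
    "dz al (\<lambda>w. f (T w)) z = (\<Sum>mu\<in>UNIV. dz al (\<lambda>w. T w $ mu) z * dz mu f (T z))"
    "dzbar al (\<lambda>w. f (T w)) z = (\<Sum>mu\<in>UNIV. cnj (dz al (\<lambda>w. T w $ mu) z) * dzbar mu f (T z))"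
proof -
  note d = hol_on_differentiable[OF T z]
  show "(\<lambda>w. f (T w)) differentiable (at z)" by (rule wd_compose[OF d f])
  have "wd \<i> al (\<lambda>w. T w $ mu) z = 0" for mu using hol_on_dzbar[OF T z] by (simp add: dzbar_wd)
  then show "dz al (\<lambda>w. f (T w)) z = (\<Sum>mu\<in>UNIV. dz al (\<lambda>w. T w $ mu) z * dz mu f (T z))"
    "dzbar al (\<lambda>w. f (T w)) z = (\<Sum>mu\<in>UNIV. cnj (dz al (\<lambda>w. T w $ mu) z) * dzbar mu f (T z))"
    unfolding dz_wd dzbar_wd wd_compose(2)[OF d f] by (simp_all add: wd_cnj[OF d] dz_wd dzbar_wd)
qed

lemma hol_on_compose:
  fixes f :: "complex^'m::finite \<Rightarrow> complex" and T :: "complex^'n::finite \<Rightarrow> complex^'m"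
  assumes T: "\<And>mu. hol_on S (\<lambda>w. T w $ mu)" and f: "hol_on S' f" and "\<And>z. z \<in> S \<Longrightarrow> T z \<in> S'"
  shows "hol_on S (\<lambda>w. f (T w))"
  unfolding hol_on_def
  using hol_compose[OF T _ hol_on_differentiable[OF f]] hol_on_dzbar[OF f] assms(3) by auto

lemma complex_differentiable_iff:
  "complex_differentiable_at F z \<longleftrightarrow> (\<forall>i. (\<lambda>w. F w $ i) differentiable (at z) \<and> (\<forall>al. dzbar al (\<lambda>w. F w $ i) z = 0))"
  (is "?L \<longleftrightarrow> ?R")
proof
  assume ?L
  then obtain D where D: "(F has_derivative D) (at z)" "\<And>a v. D (a *s v) = a *s D v"
    by (auto simp: complex_differentiable_at_def)
  have "hol_on {z} (\<lambda>w. F w $ i)" for i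
    by (rule hol_onI[where D="\<lambda>_ v. D v $ i"])
      (use bounded_linear.has_derivative[OF bounded_linear_vec_nth D(1)] D(2) in auto)
  then show ?R by (simp add: hol_on_def)
next
  assume R: ?R
  then have d: "\<And>i. (\<lambda>w. F w $ i) differentiable (at z)" by simp
  show ?L unfolding complex_differentiable_at_def
    by (rule exI, rule conjI[OF differentiable_vec[OF d]])
      (use R in \<open>auto simp: vec_eq_iff frechet_dz[OF d] sum_distrib_left mult.assoc\<close>)
qed

lemma complex_differentiable_hol_on: "(\<forall>z\<in>S. complex_differentiable_at F z) \<longleftrightarrow> (\<forall>i. hol_on S (\<lambda>w. F w $ i))"
  by (auto simp: complex_differentiable_iff hol_on_def)

lemma hol_on_line:
  assumes "hol_on S f" "z + t *s v \<in> S"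
  shows "((\<lambda>t. f (z + t *s v)) has_field_derivative (\<Sum>al\<in>UNIV. v $ al * dz al f (z + t *s v))) (at t)"
proof -
  have "bounded_linear (\<lambda>t. t *s v)"
    by (intro linear_conv_bounded_linear[THEN iffD1] linearI) (auto simp: vec_eq_iff algebra_simps)
  then have "((\<lambda>t. z + t *s v) has_derivative (\<lambda>t. t *s v)) (at t)"
    by (auto intro!: derivative_eq_intros bounded_linear_imp_has_derivative)
  from has_derivative_compose[OF this hol_on_has_derivative[OF assms]]
  moreover have "(\<lambda>x. \<Sum>al\<in>UNIV. (x *s v) $ al * dz al f (z + t *s v)) = (*) (\<Sum>al\<in>UNIV. v $ al * dz al f (z + t *s v))"
    by (auto simp: fun_eq_iff sum_distrib_left mult_ac)
  ultimately show ?thesis by (simp only: has_field_derivative_def)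
qed

lemma norm_vec_smult: "norm (c *s (v::complex^'n::finite)) = cmod c * norm v"
  by (simp add: norm_vec_def norm_mult L2_set_right_distrib)

lemma norm_axis_one: "norm (axis al 1 :: complex^'n::finite) = 1"
  by (simp add: norm_vec_def L2_set_def axis_def if_distrib[of norm] if_distrib[of "\<lambda>x. x\<^sup>2"] cong: if_cong)

lemma ball_line_subset:
  assumes "ball z r \<subseteq> S" "cmod t * norm v < r"
  shows "z + t *s (v :: complex^'n::finite) \<in> S"
proof -
  have "z + t *s v \<in> ball z r" using assms(2) by (simp add: dist_norm norm_vec_smult)
  then show ?thesis using assms(1) by blast
qed

lemma hol_line_holomorphic:
  assumes "hol_on S f" "ball z r \<subseteq> S" "norm v = 1"
  shows "(\<lambda>t. f (z + t *s v)) holomorphic_on ball 0 r"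
proof (rule holomorphic_onI)
  fix t :: complex assume "t \<in> ball 0 r"
  then have "z + t *s v \<in> S" using ball_line_subset[OF assms(2)] assms(3) by simp
  from hol_on_line[OF assms(1) this] show "(\<lambda>t. f (z + t *s v)) field_differentiable at t within ball 0 r"
    using field_differentiable_at_within field_differentiable_def by blast
qed

lemma hol_Cauchy_dz:
  assumes f: "hol_on S f" and b: "ball z r \<subseteq> S" "0 < r" and B: "\<And>w. w \<in> ball z r \<Longrightarrow> cmod (f w) \<le> B"
  shows "cmod (dz al f z) \<le> 2 * B / r"
proof -
  let ?v = "axis al 1" and ?ph = "\<lambda>t. f (z + t *s axis al 1)"
  have h: "?ph holomorphic_on ball 0 r" by (rule hol_line_holomorphic[OF f b(1) norm_axis_one])
  have "cmod ((deriv ^^ 1) ?ph 0) \<le> fact 1 * B / (r/2)^1"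
  proof (rule Cauchy_inequality)
    show "?ph holomorphic_on ball 0 (r/2)" using h b(2) by (rule_tac holomorphic_on_subset) auto
    show "continuous_on (cball 0 (r/2)) ?ph"
      using holomorphic_on_imp_continuous_on[OF h] b(2) by (rule_tac continuous_on_subset) auto
    show "cmod (?ph x) \<le> B" if "cmod (0 - x) = r/2" for x
      using that b(2) by (intro B) (simp add: dist_norm norm_vec_smult norm_axis_one)
  qed (use b in simp)
  moreover have "deriv ?ph 0 = dz al f z"
  proof -
    have "z \<in> S" using b by auto
    then have "(?ph has_field_derivative (\<Sum>be\<in>UNIV. ?v $ be * dz be f (z + 0 *s ?v))) (at 0)"
      by (intro hol_on_line[OF f]) simp
    from DERIV_imp_deriv[OF this] show ?thesis by (simp add: axis_def if_distrib[of "\<lambda>x. x * _"] cong: if_cong)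
  qed
  ultimately show ?thesis by (simp add: field_simps)
qed

lemma hol_on_uniform_limit:
  fixes f :: "nat \<Rightarrow> complex^'m::finite \<Rightarrow> complex"
  assumes S: "open S" and f: "\<And>n. hol_on S (f n)" and lim: "uniform_limit S f g sequentially"
  shows "hol_on S g"
proof -
  have "\<exists>D. (g has_derivative D) (at z0) \<and> (\<forall>v. D (\<i> *s v) = \<i> * D v)" if z0: "z0 \<in> S" for z0
  proof -
    obtain e0 where e0: "e0 > 0" "ball z0 e0 \<subseteq> S" using S z0 open_contains_ball by blast
    define r where "r = e0 / 2"
    have r: "r > 0" using e0 by (simp add: r_def)
    define B where "B = ball z0 r"
    have sub: "ball x r \<subseteq> S" if "x \<in> B" for x
    proof -
      have "ball x r \<subseteq> ball z0 e0"
      proof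
        fix w assume "w \<in> ball x r"
        then show "w \<in> ball z0 e0" using that dist_triangle[of z0 w x] by (simp add: B_def r_def)
      qed
      then show ?thesis using e0 by blast
    qed
    have BS: "B \<subseteq> S" using sub r by force
    have "uniformly_Cauchy_on B (\<lambda>n x. dz al (f n) x)" for al
    proof (rule uniformly_Cauchy_onI)
      fix e :: real assume e: "e > 0"
      have "e * r / 8 > 0" using e r by simp
      with lim obtain N where N: "\<And>n x. n \<ge> N \<Longrightarrow> x \<in> S \<Longrightarrow> dist (f n x) (g x) < e * r / 8"
        unfolding uniform_limit_iff eventually_sequentially by metis
      have "dist (dz al (f m) x) (dz al (f n) x) < e" if "x \<in> B" "m \<ge> N" "n \<ge> N" for x m n
      proof -
        have "cmod (dz al (\<lambda>w. f m w - f n w) x) \<le> 2 * (e * r / 4) / r"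
        proof (rule hol_Cauchy_dz[OF hol_on_diff[OF f f] sub[OF that(1)] r])
          fix w assume "w \<in> ball x r"
          then have "w \<in> S" using sub[OF that(1)] by blast
          then have "dist (f m w) (f n w) < e * r / 4"
            using dist_triangle_half_l[of "f m w" "g w" "e * r / 4" "f n w"] N[OF that(2)] N[OF that(3)] by (simp add: dist_commute)
          then show "cmod (f m w - f n w) \<le> e * r / 4" by (simp add: dist_norm)
        qed
        moreover have "dz al (\<lambda>w. f m w - f n w) x = dz al (f m) x - dz al (f n) x"
          using that BS hol_on_differentiable[OF f] by (auto simp: dz_wd wd_diff)
        ultimately have "cmod (dz al (f m) x - dz al (f n) x) \<le> e / 2" using r by (simp add: field_simps)
        then show ?thesis using e by (simp add: dist_norm)
      qed
      then show "\<exists>M. \<forall>x\<in>B. \<forall>m\<ge>M. \<forall>n\<ge>M. dist (dz al (f m) x) (dz al (f n) x) < e" by blast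
    qed
    then have "\<exists>a. uniform_limit B (\<lambda>n x. dz al (f n) x) a sequentially" for al
      using Cauchy_uniformly_convergent uniformly_convergent_on_def by metis
    then obtain a where a: "\<And>al. uniform_limit B (\<lambda>n x. dz al (f n) x) (a al) sequentially" by metis
    have z0B: "z0 \<in> B" using r by (simp add: B_def)
    have "\<exists>h. \<forall>x\<in>B. (\<lambda>n. f n x) \<longlonglongrightarrow> h x \<and> (h has_derivative (\<lambda>v. \<Sum>al\<in>UNIV. v $ al * a al x)) (at x within B)"
    proof (rule has_derivative_sequence)
      show "convex B" by (simp add: B_def)
      show "(f n has_derivative (\<lambda>v. \<Sum>al\<in>UNIV. v $ al * dz al (f n) x)) (at x within B)" if "x \<in> B" for n x
        using hol_on_has_derivative[OF f] that BS has_derivative_at_withinI by blast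
      show "z0 \<in> B" by fact
      show "(\<lambda>n. f n z0) \<longlonglongrightarrow> g z0" using lim z0 by (rule tendsto_uniform_limitI)
      fix e :: real assume e: "e > 0"
      define e' where "e' = e / real CARD('m)"
      have e': "e' > 0" using e by (simp add: e'_def)
      have "\<forall>\<^sub>F n in sequentially. \<forall>al. \<forall>x\<in>B. dist (dz al (f n) x) (a al x) < e'"
        using a e' by (auto simp: uniform_limit_iff intro!: eventually_all_finite)
      then show "\<forall>\<^sub>F n in sequentially. \<forall>x\<in>B. \<forall>h. norm ((\<Sum>al\<in>UNIV. h $ al * dz al (f n) x) - (\<Sum>al\<in>UNIV. h $ al * a al x)) \<le> e * norm h"
      proof (eventually_elim, intro ballI allI)
        fix n x and h :: "complex^'m" assume H: "\<forall>al. \<forall>x\<in>B. dist (dz al (f n) x) (a al x) < e'" and x: "x \<in> B"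
        have "norm ((\<Sum>al\<in>UNIV. h $ al * dz al (f n) x) - (\<Sum>al\<in>UNIV. h $ al * a al x)) = norm (\<Sum>al\<in>UNIV. h $ al * (dz al (f n) x - a al x))"
          by (simp add: sum_subtractf right_diff_distrib)
        also have "\<dots> \<le> (\<Sum>al\<in>(UNIV::'m set). norm h * e')"
        proof (rule sum_norm_le)
          fix al :: 'm
          have "cmod (h $ al) \<le> norm h" "cmod (dz al (f n) x - a al x) \<le> e'"
            using H x by (auto simp: dist_norm less_imp_le Finite_Cartesian_Product.norm_nth_le)
          then show "cmod (h $ al * (dz al (f n) x - a al x)) \<le> norm h * e'" by (simp add: norm_mult mult_mono)
        qed
        also have "\<dots> = e * norm h" by (simp add: e'_def)
        finally show "norm ((\<Sum>al\<in>UNIV. h $ al * dz al (f n) x) - (\<Sum>al\<in>UNIV. h $ al * a al x)) \<le> e * norm h" .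
      qed
    qed
    then obtain h where h: "\<And>x. x \<in> B \<Longrightarrow> (\<lambda>n. f n x) \<longlonglongrightarrow> h x"
      "\<And>x. x \<in> B \<Longrightarrow> (h has_derivative (\<lambda>v. \<Sum>al\<in>UNIV. v $ al * a al x)) (at x within B)" by blast
    have "h x = g x" if "x \<in> B" for x
      using h(1)[OF that] tendsto_uniform_limitI[OF lim] that BS LIMSEQ_unique by blast
    moreover have "(h has_derivative (\<lambda>v. \<Sum>al\<in>UNIV. v $ al * a al z0)) (at z0)"
      using h(2)[OF z0B] at_within_open[OF z0B] by (simp add: B_def)
    ultimately have "(g has_derivative (\<lambda>v. \<Sum>al\<in>UNIV. v $ al * a al z0)) (at z0)"
      using has_derivative_transform_within_open[of h _ z0 UNIV B g] z0B by (auto simp: B_def)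
    then show ?thesis by (intro exI conjI) (auto simp: sum_distrib_left mult.assoc)
  qed
  then obtain D where "\<And>z. z \<in> S \<Longrightarrow> (g has_derivative D z) (at z)" "\<And>z v. z \<in> S \<Longrightarrow> D z (\<i> *s v) = \<i> * D z v" by metis
  then show ?thesis by (rule hol_onI)
qed

lemma hol_on_continuous: "hol_on S f \<Longrightarrow> continuous_on S f"
  by (auto intro!: continuous_at_imp_continuous_on differentiable_imp_continuous_within dest: hol_on_differentiable)

lemma hol_difference_quotient:
  assumes f: "hol_on S f" and b: "ball z (3*r) \<subseteq> S" "0 < r" and B: "\<And>w. w \<in> ball z (3*r) \<Longrightarrow> cmod (f w) \<le> B"
    and t: "cmod t \<le> r"
  shows "cmod (f (z + t *s axis al 1) - f z - dz al f z * t) \<le> 2 * B / r^2 * (cmod t)\<^sup>2"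
proof -
  let ?v = "axis al 1" and ?ph = "\<lambda>t. f (z + t *s axis al 1)"
  have h: "?ph holomorphic_on ball 0 (3*r)" by (rule hol_line_holomorphic[OF f b(1) norm_axis_one])
  have d: "((deriv ^^ i) ?ph has_field_derivative (deriv ^^ Suc i) ?ph x) (at x within cball 0 r)" if "x \<in> cball 0 r" for i x
  proof -
    have "(deriv ^^ i) ?ph holomorphic_on ball 0 (3*r)" by (rule holomorphic_higher_deriv[OF h]) simp
    then have "((deriv ^^ i) ?ph has_field_derivative (deriv ^^ Suc i) ?ph x) (at x)"
      using holomorphic_derivI[of _ "ball 0 (3*r)" x] that b(2) by auto
    then show ?thesis by (rule has_field_derivative_at_within)
  qed
  have d2: "cmod ((deriv ^^ Suc 1) ?ph x) \<le> 2 * B / r^2" if "x \<in> cball 0 r" for x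
  proof -
    have "cmod ((deriv ^^ 2) ?ph x) \<le> fact 2 * B / r^2"
    proof (rule Cauchy_inequality[OF _ _ b(2)])
      have s: "cball x r \<subseteq> ball 0 (3*r)"
      proof
        fix y assume "y \<in> cball x r"
        then show "y \<in> ball 0 (3*r)" using that b(2) norm_triangle_sub[of y x] by (simp add: dist_norm norm_minus_commute)
      qed
      show "?ph holomorphic_on ball x r" using s by (intro holomorphic_on_subset[OF h]) auto
      show "continuous_on (cball x r) ?ph" using holomorphic_on_imp_continuous_on[OF h] s by (rule continuous_on_subset)
      show "cmod (?ph y) \<le> B" if "cmod (x - y) = r" for y
      proof -
        have "y \<in> ball 0 (3*r)" using s that by (auto simp: dist_norm)
        then show ?thesis by (intro B) (simp add: dist_norm norm_vec_smult norm_axis_one)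
      qed
    qed
    then show ?thesis by (simp add: numeral_2_eq_2)
  qed
  have "cmod ((deriv ^^ 0) ?ph t - (\<Sum>i\<le>1. (deriv ^^ i) ?ph 0 * (t - 0) ^ i / fact i)) \<le> (2 * B / r^2) * cmod (t - 0) ^ Suc 1 / fact 1"
    by (rule complex_Taylor[OF convex_cball[of 0 r]]) (use d d2 t b in \<open>auto\<close>)
  moreover have "deriv ?ph 0 = dz al f z"
  proof -
    have "z \<in> S" using b by auto
    then have "(?ph has_field_derivative (\<Sum>be\<in>UNIV. ?v $ be * dz be f (z + 0 *s ?v))) (at 0)"
      by (intro hol_on_line[OF f]) simp
    from DERIV_imp_deriv[OF this] show ?thesis by (simp add: axis_def if_distrib[of "\<lambda>x. x * _"] cong: if_cong)
  qed
  ultimately show ?thesis by (simp add: power2_eq_square algebra_simps)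
qed

lemma hol_on_dz:
  fixes f :: "complex^'m::finite \<Rightarrow> complex"
  assumes S: "open S" and f: "hol_on S f"
  shows "hol_on S (dz al f)"
proof -
  have "hol_on {z0} (dz al f)" if z0: "z0 \<in> S" for z0
  proof -
    obtain e0 where e0: "e0 > 0" "cball z0 e0 \<subseteq> S" using S z0 open_contains_cball by blast
    define r where "r = e0 / 4"
    have r: "r > 0" using e0 by (simp add: r_def)
    have "compact (f ` cball z0 e0)"
      using e0 by (intro compact_continuous_image continuous_on_subset[OF hol_on_continuous[OF f]]) auto
    then obtain B where B: "\<And>w. w \<in> cball z0 e0 \<Longrightarrow> cmod (f w) \<le> B"
      by (meson bounded_iff compact_imp_bounded image_eqI)
    have B0: "0 \<le> B" using B[of z0] e0 order_trans[OF norm_ge_zero[of "f z0"]] by auto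
    have near: "ball z (3*r) \<subseteq> cball z0 e0" if "z \<in> ball z0 r" for z
    proof
      fix w assume "w \<in> ball z (3*r)"
      then show "w \<in> cball z0 e0" using that dist_triangle[of z0 w z] by (simp add: r_def)
    qed
    define t where "t n = complex_of_real (r / real (Suc n))" for n
    have ct: "cmod (t n) = r / real (Suc n)" for n using r unfolding t_def norm_of_real by simp
    have t: "cmod (t n) \<le> r" "t n \<noteq> 0" for n
      using r ct[of n] by (auto simp: field_simps)
    define q where "q n z = (f (z + t n *s axis al 1) - f z) / t n" for n z
    have "hol_on (ball z0 r) (dz al f)"
    proof (rule hol_on_uniform_limit)
      show "hol_on (ball z0 r) (q n)" for n
      proof -
        have "hol_on (ball z0 r) (\<lambda>z. f (z + t n *s axis al 1))"
        proof (rule hol_on_compose[OF _ f])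
          show "hol_on (ball z0 r) (\<lambda>w. (w + t n *s axis al 1) $ mu)" for mu
            by (simp del: vector_smult_component) (intro hol_on_add hol_on_nth hol_on_const)
          show "z + t n *s axis al 1 \<in> S" if "z \<in> ball z0 r" for z
            using ball_line_subset[OF near[OF that], of "t n" "axis al 1"] t[of n] r e0 by (auto simp: norm_axis_one)
        qed
        moreover have "hol_on (ball z0 r) f" using near e0 r by (intro hol_on_subset[OF f]) force
        ultimately show ?thesis
          unfolding q_def using t by (intro hol_on_divide hol_on_diff hol_on_const) auto
      qed
      show "uniform_limit (ball z0 r) q (dz al f) sequentially"
      proof (rule uniform_limitI)
        fix e :: real assume e: "e > 0"
        have bd: "dist (q n z) (dz al f z) \<le> 2 * B / r\<^sup>2 * (r / real (Suc n))" if "z \<in> ball z0 r" for n z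
        proof -
          have "cmod (f (z + t n *s axis al 1) - f z - dz al f z * t n) \<le> 2 * B / r^2 * (cmod (t n))\<^sup>2"
            using near[OF that] e0 r t B by (intro hol_difference_quotient[OF f]) auto
          moreover have "q n z - dz al f z = (f (z + t n *s axis al 1) - f z - dz al f z * t n) / t n"
            using t[of n] by (simp add: q_def field_simps)
          ultimately have "cmod (q n z - dz al f z) \<le> 2 * B / r^2 * (cmod (t n))\<^sup>2 / cmod (t n)"
            by (simp only: norm_divide) (rule divide_right_mono, simp_all)
          also have "\<dots> = 2 * B / r\<^sup>2 * (r / real (Suc n))"
            using t[of n] ct[of n] by (simp add: power2_eq_square)
          finally show ?thesis by (simp add: dist_norm)
        qed
        have "(\<lambda>n. 2 * B / r\<^sup>2 * (r / real (Suc n))) \<longlonglongrightarrow> 2 * B / r\<^sup>2 * 0"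
          by (intro tendsto_intros LIMSEQ_Suc[OF lim_const_over_n])
        then have "\<forall>\<^sub>F n in sequentially. 2 * B / r\<^sup>2 * (r / real (Suc n)) < e"
          using e by (intro order_tendstoD) auto
        then show "\<forall>\<^sub>F n in sequentially. \<forall>z\<in>ball z0 r. dist (q n z) (dz al f z) < e"
          by eventually_elim (blast intro: le_less_trans[OF bd])
      qed
    qed auto
    then show ?thesis using r by (auto intro: hol_on_subset)
  qed
  then show ?thesis by (auto simp: hol_on_def)
qed

lemma hol_on_radial_integral:
  fixes h :: "complex^'m::finite \<Rightarrow> complex"
  assumes h: "hol_on (ball 0 r) h"
  shows "hol_on (ball 0 r) (\<lambda>z. integral {0..1} (\<lambda>t. h (t *\<^sub>R z)))"
proof -
  let ?U = "ball (0::complex^'m) r"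
  have inU: "t *\<^sub>R z \<in> ?U" if "z \<in> ?U" "t \<in> {0..1}" for t z
  proof -
    have "\<bar>t\<bar> * norm z \<le> 1 * norm z" using that by (intro mult_right_mono) auto
    then show ?thesis using that by simp
  qed
  define b :: "'m \<Rightarrow> (complex^'m) \<Rightarrow>\<^sub>L complex" where "b al = Blinfun (\<lambda>v. v $ al)" for al
  have b: "blinfun_apply (b al) v = v $ al" for al v
    unfolding b_def by (subst bounded_linear_Blinfun_apply) (auto intro: bounded_linear_vec_nth)
  define fx where "fx z t = (\<Sum>al\<in>UNIV. blinfun_mult_right (complex_of_real t * dz al h (t *\<^sub>R z)) o\<^sub>L b al)" for z t
  have fx: "blinfun_apply (fx z t) v = (\<Sum>al\<in>UNIV. complex_of_real t * dz al h (t *\<^sub>R z) * v $ al)" for z t v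
    by (simp add: fx_def blinfun.sum_left b)
  have cd: "continuous_on ?U (dz al h)" for al by (rule hol_on_continuous[OF hol_on_dz[OF open_ball h]])
  have cfx: "continuous_on (?U \<times> cbox 0 1) (\<lambda>(z, t). fx z t)"
    unfolding fx_def split_beta
    by (intro continuous_on_sum bounded_bilinear.continuous_on[OF bounded_bilinear_blinfun_compose]
        bounded_linear.continuous_on[OF bounded_linear_blinfun_mult_right] continuous_on_mult continuous_on_const
        continuous_on_compose2[OF cd] continuous_intros) (use inU in auto)
  have d: "((\<lambda>z. integral {0..1} (\<lambda>t. h (t *\<^sub>R z))) has_derivative blinfun_apply (integral {0..1} (fx z0))) (at z0)" if z0: "z0 \<in> ?U" for z0
  proof -
    have "((\<lambda>z. integral (cbox 0 1) (\<lambda>t. h (t *\<^sub>R z))) has_derivative blinfun_apply (integral (cbox 0 1) (fx z0))) (at z0 within ?U)"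
    proof (rule leibniz_rule[OF _ _ cfx z0 convex_ball])
      fix z and t :: real assume zt: "z \<in> ?U" "t \<in> cbox 0 1"
      then have t: "t \<in> {0..1}" by simp
      have l: "((\<lambda>z :: complex^'m. t *\<^sub>R z) has_derivative (\<lambda>v. t *\<^sub>R v)) (at z)"
        by (rule has_derivative_scaleR_right[OF has_derivative_ident])
      have "((\<lambda>z. h (t *\<^sub>R z)) has_derivative (\<lambda>v. \<Sum>al\<in>UNIV. (t *\<^sub>R v) $ al * dz al h (t *\<^sub>R z))) (at z)"
        by (rule has_derivative_compose[OF l hol_on_has_derivative[OF h inU[OF zt(1) t]]])
      moreover have "(\<lambda>v. \<Sum>al\<in>UNIV. (t *\<^sub>R v) $ al * dz al h (t *\<^sub>R z)) = blinfun_apply (fx z t)"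
        by (rule ext) (simp add: fx mult_ac scaleR_conv_of_real[where 'a=complex])
      ultimately show "((\<lambda>z. h (t *\<^sub>R z)) has_derivative blinfun_apply (fx z t)) (at z within ?U)"
        by (simp only: has_derivative_at_withinI)
    next
      fix z assume "z \<in> ?U"
      then show "(\<lambda>t. h (t *\<^sub>R z)) integrable_on cbox 0 1"
        using inU by (intro integrable_continuous continuous_on_compose2[OF hol_on_continuous[OF h]] continuous_intros) auto
    qed
    then show ?thesis using at_within_open[OF z0] by simp
  qed
  show ?thesis
  proof (rule hol_onI[OF d])
    fix z v assume z: "z \<in> ?U"
    have "continuous_on (cbox 0 1) (\<lambda>t. case (z, t) of (z, t) \<Rightarrow> fx z t)"
      by (rule continuous_on_compose2[OF cfx continuous_on_Pair[OF continuous_on_const continuous_on_id]]) (use z in auto)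
    then have int: "fx z integrable_on {0..1}"
      using integrable_continuous[of 0 1 "fx z"] by simp
    have "blinfun_apply (integral {0..1} (fx z)) w = integral {0..1} (\<lambda>t. blinfun_apply (fx z t) w)" for w
      using blinfun_apply_integral[OF int] by simp
    then show "blinfun_apply (integral {0..1} (fx z)) (\<i> *s v) = \<i> * blinfun_apply (integral {0..1} (fx z)) v"
      by (simp add: fx integral_mult_right[symmetric] sum_distrib_left mult_ac del: integral_mult_right)
  qed
qed

section \<open>Flat Hermitian matrix functions\<close>

lemma matrix_inv_right_left:
  fixes A :: "complex^'n::finite^'n"
  assumes "det A \<noteq> 0"
  shows "A ** matrix_inv A = mat 1" "matrix_inv A ** A = mat 1"
proof -
  have "\<exists>B. A ** B = mat 1 \<and> B ** A = mat 1" using assms invertible_det_nz[of A] by (auto simp: invertible_def)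
  then have "A ** matrix_inv A = mat 1 \<and> matrix_inv A ** A = mat 1" unfolding matrix_inv_def by (rule someI_ex)
  then show "A ** matrix_inv A = mat 1" "matrix_inv A ** A = mat 1" by auto
qed

lemma matrix_inv_unique:
  fixes A B :: "complex^'n::finite^'n"
  assumes "A ** B = mat 1"
  shows "matrix_inv A = B" "det A \<noteq> 0"
proof -
  show d: "det A \<noteq> 0" using arg_cong[OF assms, of det] by (auto simp: det_mul)
  have "matrix_inv A = matrix_inv A ** (A ** B)" by (simp add: assms)
  also have "\<dots> = B" by (simp only: matrix_mul_assoc matrix_inv_right_left[OF d] matrix_mul_lid)
  finally show "matrix_inv A = B" .
qed

lemma matrix_inv_cramer:
  fixes A :: "complex^'n::finite^'n"
  assumes "det A \<noteq> 0"
  shows "matrix_inv A $ i $ j = det (\<chi> k l. if l = i then (if k = j then 1 else 0) else A $ k $ l) / det A"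
proof -
  have "A *v (matrix_inv A *v axis j 1) = axis j 1"
    by (simp add: matrix_vector_mul_assoc matrix_inv_right_left[OF assms])
  then have "matrix_inv A *v axis j 1 = (\<chi> k. det (\<chi> i' l. if l = k then axis j 1 $ i' else A $ i' $ l) / det A)"
    by (rule cramer[OF assms, THEN iffD1])
  then have "(matrix_inv A *v axis j 1) $ i = det (\<chi> i' l. if l = i then axis j 1 $ i' else A $ i' $ l) / det A"
    by simp
  moreover have "(matrix_inv A *v axis j 1) $ i = matrix_inv A $ i $ j"
    by (simp add: matrix_vector_mult_def axis_def if_distrib[of "\<lambda>x. _ * x"] cong: if_cong)
  moreover have "(\<chi> i' l. if l = i then axis j 1 $ i' else A $ i' $ l) = (\<chi> k l. if l = i then (if k = j then 1 else 0) else A $ k $ l)"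
    by (simp add: vec_eq_iff axis_def)
  ultimately show ?thesis by simp
qed

lemma hol_on_det:
  "(\<And>i j. hol_on S (\<lambda>z. A z $ i $ j)) \<Longrightarrow> hol_on S (\<lambda>z. det (A z))"
  unfolding det_def by (intro hol_on_sum hol_on_mult hol_on_prod hol_on_const)

lemma hol_on_matrix_inv:
  assumes "\<And>i j. hol_on S (\<lambda>z. A z $ i $ j)" "\<And>z. z \<in> S \<Longrightarrow> det (A z) \<noteq> 0" "open S"
  shows "hol_on S (\<lambda>z. matrix_inv (A z) $ i $ j)"
proof -
  have "hol_on S (\<lambda>z. (\<chi> k l. if l = i then (if k = j then 1 else 0) else A z $ k $ l) $ k $ l)" for k l
    using assms(1) by (cases "l = i"; cases "k = j") (simp_all add: hol_on_const)
  then have "hol_on S (\<lambda>z. det (\<chi> k l. if l = i then (if k = j then 1 else 0) else A z $ k $ l) / det (A z))"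
    using assms by (intro hol_on_divide hol_on_det) auto
  then show ?thesis
    by (rule hol_on_cong[OF assms(3), THEN iffD1, rotated]) (simp add: matrix_inv_cramer[OF assms(2)])
qed

lemma smooth_on_det:
  "open S \<Longrightarrow> (\<And>i j. smooth_on (\<lambda>z. A z $ i $ j) S) \<Longrightarrow> smooth_on (\<lambda>z. det (A z :: complex^'n::finite^'n)) S"
  unfolding det_def by (intro smooth_on_sum smooth_on_mult smooth_on_prod smooth_on_const)

lemma smooth_on_matrix_inv:
  fixes A :: "'a::real_normed_vector \<Rightarrow> complex^'n::finite^'n"
  assumes "open S" "\<And>i j. smooth_on (\<lambda>z. A z $ i $ j) S" "\<And>z. z \<in> S \<Longrightarrow> det (A z) \<noteq> 0"
  shows "smooth_on (\<lambda>z. matrix_inv (A z) $ i $ j) S"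
proof -
  have "smooth_on (\<lambda>z. (\<chi> k l. if l = i then (if k = j then 1 else 0) else A z $ k $ l) $ k $ l) S" for k l
    using assms(1,2) by (cases "l = i"; cases "k = j") (simp_all add: smooth_on_const)
  then have "smooth_on (\<lambda>z. det (\<chi> k l. if l = i then (if k = j then 1 else 0) else A z $ k $ l) / det (A z)) S"
    using assms by (intro smooth_on_divide smooth_on_det) auto
  then show ?thesis
    by (rule smooth_on_cong[OF assms(1), THEN iffD1, rotated]) (simp add: matrix_inv_cramer[OF assms(3)])
qed

lemma radial_vector_derivative:
  fixes f :: "complex^'m::finite \<Rightarrow> complex"
  assumes "f differentiable (at (s *\<^sub>R z))"
  shows "((\<lambda>s. f (s *\<^sub>R z)) has_vector_derivative (\<Sum>al\<in>UNIV. z $ al * dz al f (s *\<^sub>R z) + cnj (z $ al) * dzbar al f (s *\<^sub>R z))) (at s within T)"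
proof -
  have l: "((\<lambda>s. s *\<^sub>R z) has_derivative (\<lambda>t. t *\<^sub>R z)) (at s within T)"
    by (rule has_derivative_scaleR_left[OF has_derivative_ident])
  have "((\<lambda>s. f (s *\<^sub>R z)) has_derivative (\<lambda>t. \<Sum>al\<in>UNIV. (t *\<^sub>R z) $ al * dz al f (s *\<^sub>R z) + cnj ((t *\<^sub>R z) $ al) * dzbar al f (s *\<^sub>R z))) (at s within T)"
    by (rule has_derivative_compose[OF l has_derivative_dz[OF assms]])
  moreover have "(\<lambda>t. \<Sum>al\<in>UNIV. (t *\<^sub>R z) $ al * dz al f (s *\<^sub>R z) + cnj ((t *\<^sub>R z) $ al) * dzbar al f (s *\<^sub>R z)) =
    (\<lambda>t. t *\<^sub>R (\<Sum>al\<in>UNIV. z $ al * dz al f (s *\<^sub>R z) + cnj (z $ al) * dzbar al f (s *\<^sub>R z)))"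
    by (rule ext) (simp add: scaleR_sum_right scaleR_add_right)
  ultimately show ?thesis by (simp only: has_vector_derivative_def)
qed

lemma radial_in_ball:
  fixes z :: "'a::real_normed_vector"
  assumes "z \<in> ball 0 r" "t \<in> {0..1}"
  shows "t *\<^sub>R z \<in> ball 0 r"
proof -
  have "\<bar>t\<bar> * norm z \<le> 1 * norm z" using assms by (intro mult_right_mono) auto
  then show ?thesis using assms by simp
qed

text \<open>The linear equation \<open>y' = - y om\<close> along the rays from \<open>0\<close> is solved by Picard iteration; the iterates,
  and hence the solution, depend holomorphically on the point.\<close>
lemma radial_row_solution:
  fixes om :: "'m::finite \<Rightarrow> 'n::finite \<Rightarrow> 'n \<Rightarrow> complex^'m \<Rightarrow> complex"
  assumes r0: "r0 > 0" and om: "\<And>ga i j. hol_on (ball 0 r0) (om ga i j)"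
  obtains r where "0 < r" "r \<le> r0"
    "\<And>c. \<exists>y. (\<forall>j. hol_on (ball 0 r) (y j)) \<and> (\<forall>j. y j 0 = c j) \<and>
       (\<forall>z\<in>ball 0 r. \<forall>s\<in>{0..1}. \<forall>j. ((\<lambda>s. y j (s *\<^sub>R z)) has_vector_derivative
          - (\<Sum>i\<in>UNIV. y i (s *\<^sub>R z) * (\<Sum>ga\<in>UNIV. z $ ga * om ga i j (s *\<^sub>R z)))) (at s within {0..1}))"
proof -
  have "\<exists>L. \<forall>w\<in>cball 0 (r0/2). cmod (om ga i j w) \<le> L" for ga i j
  proof -
    have "compact (om ga i j ` cball 0 (r0/2))"
      using r0 by (intro compact_continuous_image continuous_on_subset[OF hol_on_continuous[OF om]]) auto
    then show ?thesis by (meson bounded_iff compact_imp_bounded image_eqI)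
  qed
  then obtain L0 where L0: "\<And>ga i j w. w \<in> cball 0 (r0/2) \<Longrightarrow> cmod (om ga i j w) \<le> L0 ga i j" by metis
  define L where "L = 1 + (\<Sum>ga\<in>UNIV. \<Sum>i\<in>UNIV. \<Sum>j\<in>UNIV. \<bar>L0 ga i j\<bar>)"
  have L1: "L > 0" unfolding L_def by (intro add_pos_nonneg sum_nonneg) auto
  have L: "cmod (om ga i j w) \<le> L" if "w \<in> cball 0 (r0/2)" for ga i j w
  proof -
    have "cmod (om ga i j w) \<le> \<bar>L0 ga i j\<bar>" using L0[OF that, of ga i j] by linarith
    also have "\<dots> \<le> (\<Sum>j\<in>UNIV. \<bar>L0 ga i j\<bar>)" by (intro member_le_sum) auto
    also have "\<dots> \<le> (\<Sum>i\<in>UNIV. \<Sum>j\<in>UNIV. \<bar>L0 ga i j\<bar>)"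
      by (rule member_le_sum[of i UNIV "\<lambda>i. \<Sum>j\<in>UNIV. \<bar>L0 ga i j\<bar>"]) (auto intro: sum_nonneg)
    also have "\<dots> \<le> (\<Sum>ga\<in>UNIV. \<Sum>i\<in>UNIV. \<Sum>j\<in>UNIV. \<bar>L0 ga i j\<bar>)"
      by (rule member_le_sum[of ga UNIV "\<lambda>ga. \<Sum>i\<in>UNIV. \<Sum>j\<in>UNIV. \<bar>L0 ga i j\<bar>"]) (auto intro: sum_nonneg)
    finally show ?thesis by (simp add: L_def)
  qed
  define m where "m = real CARD('m)" define n where "n = real CARD('n)"
  have mn: "m > 0" "n > 0" by (simp_all add: m_def n_def)
  define r where "r = min (r0/2) (1 / (2 * n * m * L))"
  have r: "r > 0" "r \<le> r0 / 2" "m * r * n * L \<le> 1/2"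
  proof -
    show "r > 0" "r \<le> r0 / 2" using r0 mn L1 by (auto simp: r_def)
    have "r \<le> 1 / (2 * n * m * L)" by (simp add: r_def)
    then show "m * r * n * L \<le> 1/2" using mn L1 by (simp add: field_simps)
  qed
  let ?U = "ball (0 :: complex^'m) r"
  have U: "?U \<subseteq> cball 0 (r0/2)" "?U \<subseteq> ball 0 r0" using r r0 by auto
  have omU: "hol_on ?U (om ga i j)" for ga i j using hol_on_subset[OF om U(2)] .
  have "\<exists>y. (\<forall>j. hol_on ?U (y j)) \<and> (\<forall>j. y j 0 = c j) \<and>
       (\<forall>z\<in>?U. \<forall>s\<in>{0..1}. \<forall>j. ((\<lambda>s. y j (s *\<^sub>R z)) has_vector_derivative
          - (\<Sum>i\<in>UNIV. y i (s *\<^sub>R z) * (\<Sum>ga\<in>UNIV. z $ ga * om ga i j (s *\<^sub>R z)))) (at s within {0..1}))" for c :: "'n \<Rightarrow> complex"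
  proof -
    define T where "T y j z = c j - (\<Sum>ga\<in>UNIV. z $ ga * integral {0..1} (\<lambda>t. \<Sum>i\<in>UNIV. y i (t *\<^sub>R z) * om ga i j (t *\<^sub>R z)))"
      for y :: "'n \<Rightarrow> complex^'m \<Rightarrow> complex" and j and z :: "complex^'m"
    have Thol: "hol_on ?U (T y j)" if "\<And>i. hol_on ?U (y i)" for y j
      unfolding T_def
      by (intro hol_on_diff hol_on_const hol_on_sum hol_on_mult hol_on_nth hol_on_radial_integral omU that)
    have cont: "continuous_on {0..1} (\<lambda>t. f (t *\<^sub>R z))" if "hol_on ?U f" "z \<in> ?U" for f z
      by (rule continuous_on_compose2[OF hol_on_continuous[OF that(1)]])
        (use radial_in_ball[OF that(2)] in \<open>auto intro!: continuous_intros\<close>)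
    have Tdiff: "cmod (T y j z - T y' j z) \<le> D / 2"
      if y: "\<And>i. hol_on ?U (y i)" "\<And>i. hol_on ?U (y' i)" and D: "\<And>i w. w \<in> ?U \<Longrightarrow> cmod (y i w - y' i w) \<le> D" and z: "z \<in> ?U"
      for y y' j z D
    proof -
      have D0: "0 \<le> D" using order_trans[OF norm_ge_zero D[OF z]] by blast
      let ?I = "\<lambda>y ga. integral {0..1} (\<lambda>t. \<Sum>i\<in>UNIV. y i (t *\<^sub>R z) * om ga i j (t *\<^sub>R z))"
      have I: "cmod (?I y ga - ?I y' ga) \<le> n * D * L" for ga
      proof -
        have c: "continuous_on {0..1} (\<lambda>t. \<Sum>i\<in>UNIV. y i (t *\<^sub>R z) * om ga i j (t *\<^sub>R z))" if "\<And>i. hol_on ?U (y i)" for y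
          by (rule cont[OF _ z]) (intro hol_on_sum hol_on_mult that omU)
        have "?I y ga - ?I y' ga = integral {0..1} (\<lambda>t. (\<Sum>i\<in>UNIV. y i (t *\<^sub>R z) * om ga i j (t *\<^sub>R z)) - (\<Sum>i\<in>UNIV. y' i (t *\<^sub>R z) * om ga i j (t *\<^sub>R z)))"
          by (rule integral_diff[symmetric]) (intro integrable_continuous_interval c y)+
        moreover have "cmod (integral {0..1} (\<lambda>t. (\<Sum>i\<in>UNIV. y i (t *\<^sub>R z) * om ga i j (t *\<^sub>R z)) - (\<Sum>i\<in>UNIV. y' i (t *\<^sub>R z) * om ga i j (t *\<^sub>R z)))) \<le> (n * D * L) * (1 - 0)"
        proof (rule integral_bound)
          show "continuous_on {0..1} (\<lambda>t. (\<Sum>i\<in>UNIV. y i (t *\<^sub>R z) * om ga i j (t *\<^sub>R z)) - (\<Sum>i\<in>UNIV. y' i (t *\<^sub>R z) * om ga i j (t *\<^sub>R z)))"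
            by (intro continuous_on_diff c y)
          fix t :: real assume "t \<in> {0..1}"
          then have w: "t *\<^sub>R z \<in> ?U" using radial_in_ball[OF z] by blast
          have "cmod (\<Sum>i\<in>UNIV. (y i (t *\<^sub>R z) - y' i (t *\<^sub>R z)) * om ga i j (t *\<^sub>R z)) \<le> (\<Sum>i\<in>(UNIV::'n set). D * L)"
            using D[OF w] L[OF subsetD[OF U(1) w]] D0 by (intro sum_norm_le) (auto simp: norm_mult intro!: mult_mono)
          then show "cmod ((\<Sum>i\<in>UNIV. y i (t *\<^sub>R z) * om ga i j (t *\<^sub>R z)) - (\<Sum>i\<in>UNIV. y' i (t *\<^sub>R z) * om ga i j (t *\<^sub>R z))) \<le> n * D * L"
            by (simp add: sum_subtractf left_diff_distrib n_def mult.assoc)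
        qed simp
        ultimately show ?thesis by simp
      qed
      have "T y j z - T y' j z = - (\<Sum>ga\<in>UNIV. z $ ga * (?I y ga - ?I y' ga))"
        by (simp add: T_def right_diff_distrib sum_subtractf)
      then have "cmod (T y j z - T y' j z) = cmod (\<Sum>ga\<in>UNIV. z $ ga * (?I y ga - ?I y' ga))" by simp
      also have "\<dots> \<le> (\<Sum>ga\<in>(UNIV::'m set). r * (n * D * L))"
      proof (rule sum_norm_le)
        fix ga
        have "cmod (z $ ga) \<le> r" using z Finite_Cartesian_Product.norm_nth_le[of z ga] by simp
        then show "cmod (z $ ga * (?I y ga - ?I y' ga)) \<le> r * (n * D * L)"
          using I[of ga] r by (auto simp: norm_mult intro!: mult_mono)
      qed
      also have "\<dots> = (m * r * n * L) * D" by (simp add: m_def)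
      also have "\<dots> \<le> 1/2 * D" using r D0 by (intro mult_right_mono) auto
      finally show ?thesis by simp
    qed
    define Y where "Y k = (T ^^ k) (\<lambda>j z. c j)" for k
    have YS: "Y (Suc k) = T (Y k)" for k by (simp add: Y_def)
    have Yhol: "hol_on ?U (Y k j)" for k j
    proof (induction k arbitrary: j)
      case 0
      then show ?case by (simp add: Y_def hol_on_const)
    qed (simp add: YS Thol)
    define C where "C = (\<Sum>j\<in>UNIV. cmod (c j))"
    have C: "cmod (c j) \<le> C" for j unfolding C_def by (rule member_le_sum) auto
    have T0: "T (\<lambda>_ _. 0) j z = c j" for j z by (simp add: T_def)
    have step: "cmod (Y (Suc k) j z - Y k j z) \<le> C / 2 ^ Suc k" if "z \<in> ?U" for k j z
      using that
    proof (induction k arbitrary: j z)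
      case 0
      have "cmod (T (\<lambda>j z. c j) j z - T (\<lambda>_ _. 0) j z) \<le> C / 2"
        by (rule Tdiff[OF _ _ _ 0]) (auto simp: hol_on_const C)
      then show ?case by (simp add: T0 YS) (simp add: Y_def)
    next
      case (Suc k)
      have "cmod (T (Y (Suc k)) j z - T (Y k) j z) \<le> (C / 2 ^ Suc k) / 2"
        by (rule Tdiff[OF Yhol Yhol Suc.IH Suc.prems])
      then show ?case by (simp add: YS)
    qed
    have "\<exists>l. uniform_limit ?U (\<lambda>k. Y k j) l sequentially" for j
    proof -
      have "uniform_limit ?U (\<lambda>N z. \<Sum>k<N. (Y (Suc k) j z - Y k j z)) (\<lambda>z. suminf (\<lambda>k. Y (Suc k) j z - Y k j z)) sequentially"
      proof (rule Weierstrass_m_test)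
        show "cmod (Y (Suc k) j z - Y k j z) \<le> C / 2 * (1/2) ^ k" if "z \<in> ?U" for k z
          using step[OF that, of k j] by (simp add: power_divide)
        show "summable (\<lambda>k. C / 2 * (1/2) ^ k)" by (intro summable_mult summable_geometric) simp
      qed
      note W = this
      have "uniform_limit ?U (\<lambda>N z. c j + (\<Sum>k<N. (Y (Suc k) j z - Y k j z))) (\<lambda>z. c j + suminf (\<lambda>k. Y (Suc k) j z - Y k j z)) sequentially"
        by (rule uniform_limit_add[OF uniform_limit_const W])
      moreover have "c j + (\<Sum>k<N. (Y (Suc k) j z - Y k j z)) = Y N j z" for N z
        using sum_lessThan_telescope[of "\<lambda>k. Y k j z" N] by (simp add: Y_def)
      ultimately have "uniform_limit ?U (\<lambda>N. Y N j) (\<lambda>z. c j + suminf (\<lambda>k. Y (Suc k) j z - Y k j z)) sequentially" by simp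
      then show ?thesis by blast
    qed
    then obtain y where lim: "\<And>j. uniform_limit ?U (\<lambda>k. Y k j) (y j) sequentially" by metis
    have yhol: "hol_on ?U (y j)" for j by (rule hol_on_uniform_limit[OF open_ball Yhol lim])
    have fixp: "T y j z = y j z" if z: "z \<in> ?U" for j z
    proof -
      have "dist (T y j z) (y j z) < e" if "e > 0" for e
      proof -
        have e: "e / 2 > 0" using that by simp
        have "\<forall>\<^sub>F k in sequentially. \<forall>i. \<forall>w\<in>?U. dist (Y k i w) (y i w) < e / 2"
          using lim e unfolding uniform_limit_iff by (intro eventually_all_finite) blast
        then obtain k where k: "\<And>k' i w. k' \<ge> k \<Longrightarrow> w \<in> ?U \<Longrightarrow> dist (Y k' i w) (y i w) < e / 2"
          unfolding eventually_sequentially by metis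
        have "cmod (T y j z - T (Y k) j z) \<le> (e/2) / 2"
          using k[of k] by (intro Tdiff[OF yhol Yhol _ z]) (auto simp: dist_norm norm_minus_commute less_imp_le)
        moreover have "dist (Y (Suc k) j z) (y j z) < e / 2" using k[of "Suc k"] z by simp
        ultimately show ?thesis
          using dist_triangle[of "T y j z" "y j z" "T (Y k) j z"] that by (simp add: YS dist_norm)
      qed
      then show ?thesis by (metis dist_eq_0_iff zero_less_dist_iff less_irrefl)
    qed
    have y0: "y j 0 = c j" for j using fixp[of 0 j] r by (simp add: T_def)
    have "((\<lambda>s. y j (s *\<^sub>R z)) has_vector_derivative
          - (\<Sum>i\<in>UNIV. y i (s *\<^sub>R z) * (\<Sum>ga\<in>UNIV. z $ ga * om ga i j (s *\<^sub>R z)))) (at s within {0..1})"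
      if z: "z \<in> ?U" and s: "s \<in> {0..1}" for z s j
    proof -
      define p where "p s = (\<Sum>ga\<in>UNIV. z $ ga * (\<Sum>i\<in>UNIV. y i (s *\<^sub>R z) * om ga i j (s *\<^sub>R z)))" for s
      have cp: "continuous_on {0..1} p"
        unfolding p_def by (rule cont[OF _ z]) (intro hol_on_sum hol_on_mult hol_on_const yhol omU)
      define G where "G s = integral {0..s} p" for s
      have G: "(G has_vector_derivative p s) (at s within {0..1})" if "s \<in> {0..1}" for s
        unfolding G_def by (rule integral_has_vector_derivative[OF cp that])
      have yG: "y j (s *\<^sub>R z) = c j - G s" if s: "s \<in> {0..1}" for s
      proof -
        have sz: "s *\<^sub>R z \<in> ?U" by (rule radial_in_ball[OF z s])
        have "((\<lambda>t. G (s * t)) has_vector_derivative s *\<^sub>R p (s * t)) (at t within {0..1})" if t: "t \<in> {0..1}" for t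
        proof -
          have st: "s * t \<in> {0..1}" "\<And>t. t \<in> {0..1} \<Longrightarrow> s * t \<in> {0..1}" using s t by (auto simp: mult_le_one)
          have "((\<lambda>t. s * t) has_vector_derivative s) (at t within {0..1})"
            by (auto intro!: derivative_eq_intros simp: has_vector_derivative_def)
          moreover have "(G has_vector_derivative p (s * t)) (at (s * t) within (\<lambda>t. s * t) ` {0..1})"
            using has_vector_derivative_within_subset[OF G[OF st(1)]] st(2) by blast
          ultimately show ?thesis using vector_diff_chain_within[of "\<lambda>t. s * t" s t "{0..1}" G "p (s * t)"] by (simp add: o_def)
        qed
        then have "((\<lambda>t. s *\<^sub>R p (s * t)) has_integral (G (s * 1) - G (s * 0))) {0..1}"
          by (intro fundamental_theorem_of_calculus) auto
        then have I: "integral {0..1} (\<lambda>t. s *\<^sub>R p (s * t)) = G (s * 1) - G (s * 0)" by (rule integral_unique)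
        have GG: "G (s * 1) - G (s * 0) = G s" by (simp add: G_def)
        define h where "h ga t = (\<Sum>i\<in>UNIV. y i (t *\<^sub>R (s *\<^sub>R z)) * om ga i j (t *\<^sub>R (s *\<^sub>R z)))" for ga t
        have cc: "continuous_on {0..1} (h ga)" for ga
          unfolding h_def by (rule cont[OF _ sz]) (intro hol_on_sum hol_on_mult yhol omU)
        have "(\<Sum>ga\<in>UNIV. (s *\<^sub>R z) $ ga * integral {0..1} (h ga)) = (\<Sum>ga\<in>UNIV. integral {0..1} (\<lambda>t. (s *\<^sub>R z) $ ga * h ga t))"
          by simp
        also have "\<dots> = integral {0..1} (\<lambda>t. \<Sum>ga\<in>UNIV. (s *\<^sub>R z) $ ga * h ga t)"
          by (rule integral_sum[symmetric], simp) (intro integrable_continuous_interval continuous_on_mult cc continuous_on_const)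
        also have "\<dots> = integral {0..1} (\<lambda>t. s *\<^sub>R p (s * t))"
          by (simp add: p_def h_def scaleR_sum_right mult.commute)
        finally show ?thesis using fixp[OF sz, of j] unfolding I GG T_def h_def[symmetric] by simp
      qed
      have "((\<lambda>s. c j - G s) has_vector_derivative - p s) (at s within {0..1})"
        using has_vector_derivative_diff[OF has_vector_derivative_const G[OF s]] by simp
      then have "((\<lambda>s. y j (s *\<^sub>R z)) has_vector_derivative - p s) (at s within {0..1})"
        by (rule has_vector_derivative_transform[OF s, rotated]) (simp add: yG)
      moreover have "p s = (\<Sum>i\<in>UNIV. y i (s *\<^sub>R z) * (\<Sum>ga\<in>UNIV. z $ ga * om ga i j (s *\<^sub>R z)))"
        unfolding p_def sum_distrib_left by (subst sum.swap) (simp add: mult_ac)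
      ultimately show ?thesis by simp
    qed
    then show ?thesis using yhol y0 by blast
  qed
  then show ?thesis using that[of r] r r0 by auto
qed

lemma matrix_mult_nth: "(A ** B) $ i $ j = (\<Sum>k\<in>UNIV. A $ i $ k * B $ k $ j)"
  by (simp add: matrix_matrix_mult_def)

lemma flat_hermitian_factor:
  fixes M :: "'n::finite \<Rightarrow> 'n \<Rightarrow> complex^'m::finite \<Rightarrow> complex" and P :: "'n \<Rightarrow> 'n \<Rightarrow> complex"
  assumes r0: "r0 > 0" and om: "\<And>ga i j. hol_on (ball 0 r0) (om ga i j)"
    and M: "\<And>i j z. z \<in> ball 0 r0 \<Longrightarrow> M i j differentiable (at z)"
    and herm: "\<And>i j z. z \<in> ball 0 r0 \<Longrightarrow> M j i z = cnj (M i j z)"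
    and flat: "\<And>ga i j z. z \<in> ball 0 r0 \<Longrightarrow> dz ga (M i j) z = (\<Sum>k\<in>UNIV. om ga i k z * M k j z)"
    and P: "\<And>a b. (\<Sum>i\<in>UNIV. \<Sum>j\<in>UNIV. P i a * M i j 0 * cnj (P j b)) = (if a = b then 1 else 0)"
  obtains r and S :: "'n \<Rightarrow> 'n \<Rightarrow> complex^'m \<Rightarrow> complex" where "0 < r" "r \<le> r0" "\<And>i j. hol_on (ball 0 r) (S i j)"
    "\<And>i k z. z \<in> ball 0 r \<Longrightarrow> M i k z = (\<Sum>j\<in>UNIV. S i j z * cnj (S k j z))"
proof -
  obtain r where r: "0 < r" "r \<le> r0" and sol:
    "\<And>c. \<exists>y. (\<forall>j. hol_on (ball 0 r) (y j)) \<and> (\<forall>j. y j 0 = c j) \<and>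
       (\<forall>z\<in>ball 0 r. \<forall>s\<in>{0..1}. \<forall>j. ((\<lambda>s. y j (s *\<^sub>R z)) has_vector_derivative
          - (\<Sum>i\<in>UNIV. y i (s *\<^sub>R z) * (\<Sum>ga\<in>UNIV. z $ ga * om ga i j (s *\<^sub>R z)))) (at s within {0..1}))"
    by (rule radial_row_solution[of r0 om, OF r0 om]) (rule that)
  have "\<exists>y. \<forall>a. (\<forall>j. hol_on (ball 0 r) (y a j)) \<and> (\<forall>j. y a j 0 = P j a) \<and>
       (\<forall>z\<in>ball 0 r. \<forall>s\<in>{0..1}. \<forall>j. ((\<lambda>s. y a j (s *\<^sub>R z)) has_vector_derivative
          - (\<Sum>i\<in>UNIV. y a i (s *\<^sub>R z) * (\<Sum>ga\<in>UNIV. z $ ga * om ga i j (s *\<^sub>R z)))) (at s within {0..1}))"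
    by (rule choice, rule allI, rule sol)
  then obtain y where yhol: "\<And>a j. hol_on (ball 0 r) (y a j)" and y0: "\<And>a j. y a j 0 = P j a"
    and yd: "\<And>a j z s. z \<in> ball 0 r \<Longrightarrow> s \<in> {0..1} \<Longrightarrow> ((\<lambda>s. y a j (s *\<^sub>R z)) has_vector_derivative
          - (\<Sum>i\<in>UNIV. y a i (s *\<^sub>R z) * (\<Sum>ga\<in>UNIV. z $ ga * om ga i j (s *\<^sub>R z)))) (at s within {0..1})"
    by blast
  have YMY: "(\<Sum>i\<in>UNIV. \<Sum>j\<in>UNIV. y a i z * M i j z * cnj (y b j z)) = (if a = b then 1 else 0)" if z: "z \<in> ball 0 r" for a b z
  proof -
    define q where "q s = (\<Sum>i\<in>UNIV. \<Sum>j\<in>UNIV. y a i (s *\<^sub>R z) * M i j (s *\<^sub>R z) * cnj (y b j (s *\<^sub>R z)))" for s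
    have "(q has_vector_derivative 0) (at s within {0..1})" if s: "s \<in> {0..1}" for s
    proof -
      define w where "w = s *\<^sub>R z"
      have w: "w \<in> ball 0 r" "w \<in> ball 0 r0" using radial_in_ball[OF z s] r by (auto simp: w_def)
      define \<Omega> where "\<Omega> i j = (\<Sum>ga\<in>UNIV. z $ ga * om ga i j w)" for i j
      have d1: "((\<lambda>s. y a i (s *\<^sub>R z)) has_vector_derivative - (\<Sum>k\<in>UNIV. y a k w * \<Omega> k i)) (at s within {0..1})" for a i
        using yd[OF z s] by (simp add: w_def \<Omega>_def)
      have d2: "((\<lambda>s. cnj (y b i (s *\<^sub>R z))) has_vector_derivative - (\<Sum>k\<in>UNIV. cnj (y b k w * \<Omega> k i))) (at s within {0..1})" for i
        using has_vector_derivative_cnj[OF d1[of b i]] by simp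
      have d3: "((\<lambda>s. M i j (s *\<^sub>R z)) has_vector_derivative (\<Sum>k\<in>UNIV. \<Omega> i k * M k j w) + (\<Sum>k\<in>UNIV. cnj (\<Omega> j k) * M i k w)) (at s within {0..1})" for i j
      proof -
        have db: "dzbar ga (M i j) w = (\<Sum>k\<in>UNIV. cnj (om ga j k w) * M i k w)" for ga
        proof -
          have "wd \<i> ga (M i j) w = wd \<i> ga (\<lambda>x. cnj (M j i x)) w"
            by (rule wd_cong[OF open_ball w(2)]) (rule herm)
          also have "\<dots> = cnj (dz ga (M j i) w)" by (simp add: wd_cnj[OF M[OF w(2)]] dz_wd)
          also have "\<dots> = (\<Sum>k\<in>UNIV. cnj (om ga j k w) * M i k w)"
          proof -
            have "cnj (M k i w) = M i k w" for k using herm[OF w(2), of k i] by simp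
            then show ?thesis by (simp add: flat[OF w(2)])
          qed
          finally show ?thesis by (simp add: dzbar_wd)
        qed
        have "(\<Sum>ga\<in>UNIV. z $ ga * dz ga (M i j) w + cnj (z $ ga) * dzbar ga (M i j) w)
          = (\<Sum>k\<in>UNIV. \<Omega> i k * M k j w) + (\<Sum>k\<in>UNIV. cnj (\<Omega> j k) * M i k w)"
          unfolding \<Omega>_def sum.distrib cnj_sum sum_distrib_right complex_cnj_mult
          by (rule arg_cong2[where f="(+)"]; subst sum.swap) (simp_all add: flat[OF w(2)] db sum_distrib_left mult.assoc)
        then show ?thesis
          using radial_vector_derivative[of "M i j" s z "{0..1}"] M[OF w(2)] by (simp add: w_def)
      qed
      define u where "u i = y a i w" for i
      define v where "v i = cnj (y b i w)" for i
      have "(q has_vector_derivative (\<Sum>i\<in>UNIV. \<Sum>j\<in>UNIV.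
         (u i * M i j w) * - (\<Sum>k\<in>UNIV. v k * cnj (\<Omega> k j)) +
         (u i * ((\<Sum>k\<in>UNIV. \<Omega> i k * M k j w) + (\<Sum>k\<in>UNIV. cnj (\<Omega> j k) * M i k w)) + - (\<Sum>k\<in>UNIV. u k * \<Omega> k i) * M i j w) * v j)) (at s within {0..1})"
        unfolding q_def u_def v_def
        by (intro has_vector_derivative_sum)
          (rule has_vector_derivative_mult[OF has_vector_derivative_mult[OF d1 d3] d2, folded w_def, simplified complex_cnj_mult])
      moreover have "(\<Sum>i\<in>UNIV. \<Sum>j\<in>UNIV.
         (u i * M i j w) * - (\<Sum>k\<in>UNIV. v k * cnj (\<Omega> k j)) +
         (u i * ((\<Sum>k\<in>UNIV. \<Omega> i k * M k j w) + (\<Sum>k\<in>UNIV. cnj (\<Omega> j k) * M i k w)) + - (\<Sum>k\<in>UNIV. u k * \<Omega> k i) * M i j w) * v j) = 0"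
      proof -
        have A: "(\<Sum>i\<in>UNIV. \<Sum>j\<in>UNIV. u i * (\<Sum>k\<in>UNIV. \<Omega> i k * M k j w) * v j) = (\<Sum>i\<in>UNIV. \<Sum>j\<in>UNIV. (\<Sum>k\<in>UNIV. u k * \<Omega> k i) * M i j w * v j)"
        proof -
          have "(\<Sum>i\<in>UNIV. \<Sum>j\<in>UNIV. u i * (\<Sum>k\<in>UNIV. \<Omega> i k * M k j w) * v j) = (\<Sum>j\<in>UNIV. \<Sum>i\<in>UNIV. \<Sum>k\<in>UNIV. u i * (\<Omega> i k * M k j w) * v j)"
            by (subst sum.swap) (simp add: sum_distrib_left sum_distrib_right)
          also have "\<dots> = (\<Sum>j\<in>UNIV. \<Sum>k\<in>UNIV. \<Sum>i\<in>UNIV. u i * (\<Omega> i k * M k j w) * v j)"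
            by (intro sum.cong refl sum.swap)
          also have "\<dots> = (\<Sum>i\<in>UNIV. \<Sum>j\<in>UNIV. (\<Sum>k\<in>UNIV. u k * \<Omega> k i) * M i j w * v j)"
            by (subst sum.swap) (simp add: sum_distrib_left sum_distrib_right mult.assoc)
          finally show ?thesis .
        qed
        have B: "(\<Sum>i\<in>UNIV. \<Sum>j\<in>UNIV. u i * (\<Sum>k\<in>UNIV. cnj (\<Omega> j k) * M i k w) * v j) = (\<Sum>i\<in>UNIV. \<Sum>j\<in>UNIV. u i * M i j w * (\<Sum>k\<in>UNIV. v k * cnj (\<Omega> k j)))"
        proof (rule sum.cong[OF refl])
          fix i
          have "(\<Sum>j\<in>UNIV. u i * (\<Sum>k\<in>UNIV. cnj (\<Omega> j k) * M i k w) * v j) = (\<Sum>j\<in>UNIV. \<Sum>k\<in>UNIV. u i * (cnj (\<Omega> j k) * M i k w) * v j)"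
            by (simp add: sum_distrib_left sum_distrib_right)
          also have "\<dots> = (\<Sum>k\<in>UNIV. \<Sum>j\<in>UNIV. u i * (cnj (\<Omega> j k) * M i k w) * v j)" by (rule sum.swap)
          also have "\<dots> = (\<Sum>j\<in>UNIV. u i * M i j w * (\<Sum>k\<in>UNIV. v k * cnj (\<Omega> k j)))"
            by (simp add: sum_distrib_left mult_ac)
          finally show "(\<Sum>j\<in>UNIV. u i * (\<Sum>k\<in>UNIV. cnj (\<Omega> j k) * M i k w) * v j) = (\<Sum>j\<in>UNIV. u i * M i j w * (\<Sum>k\<in>UNIV. v k * cnj (\<Omega> k j)))" .
        qed
        have "x * - V + (u' * (A' + B') + - U' * m) * v' = (u' * A' * v' - U' * m * v') + (u' * B' * v' - x * V)" for x V u' A' B' U' m v' :: complex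
          by (simp add: algebra_simps)
        then show ?thesis by (simp only: sum.distrib sum_subtractf A B) simp
      qed
      ultimately show ?thesis by simp
    qed
    then have "\<exists>k. \<forall>s\<in>{0..1}. q s = k"
      using has_derivative_zero_constant[of "{0..1}" q] by (auto simp: has_vector_derivative_def)
    then have "q 1 = q 0" by auto
    then show ?thesis using P[of a b] by (simp add: q_def y0)
  qed
  define Y where "Y z = (\<chi> a i. y a i z)" for z
  have Y: "Y z ** ((\<chi> i j. M i j z) ** (\<chi> j b. cnj (y b j z))) = mat 1" if "z \<in> ball 0 r" for z
    using YMY[OF that] by (simp add: vec_eq_iff matrix_mult_nth Y_def mat_def sum_distrib_left mult.assoc)
  have "M i k z = (\<Sum>j\<in>UNIV. matrix_inv (Y z) $ i $ j * cnj (matrix_inv (Y z) $ k $ j))" if z: "z \<in> ball 0 r" for i k z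
  proof -
    let ?M = "(\<chi> i j. M i j z) :: complex^'n^'n" and ?H = "(\<chi> j b. cnj (y b j z)) :: complex^'n^'n" and ?S = "matrix_inv (Y z)"
    let ?SH = "(\<chi> j k. cnj (?S $ k $ j)) :: complex^'n^'n"
    have S: "?S = ?M ** ?H" "Y z ** ?S = mat 1"
      using matrix_inv_unique[OF Y[OF z]] Y[OF z] by auto
    have HS: "?H ** ?SH = mat 1"
    proof -
      have "(?H ** ?SH) $ i $ j = cnj ((?S ** Y z) $ j $ i)" for i j
        by (simp add: matrix_mult_nth Y_def mult.commute)
      moreover have "?S ** Y z = mat 1" using matrix_inv_right_left matrix_inv_unique(2)[OF Y[OF z]] by blast
      ultimately show ?thesis by (auto simp: vec_eq_iff mat_def)
    qed
    have "?S ** ?SH = ?M ** (?H ** ?SH)" by (simp only: S(1) matrix_mul_assoc)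
    then have "?S ** ?SH = ?M" by (simp add: HS)
    from arg_cong[OF this, of "\<lambda>A. A $ i $ k"] show ?thesis by (simp add: matrix_mult_nth)
  qed
  moreover have "hol_on (ball 0 r) (\<lambda>z. matrix_inv (Y z) $ i $ j)" for i j
  proof (rule hol_on_matrix_inv)
    show "hol_on (ball 0 r) (\<lambda>z. Y z $ i $ j)" for i j using yhol by (simp add: Y_def)
    show "det (Y z) \<noteq> 0" if "z \<in> ball 0 r" for z using matrix_inv_unique(2)[OF Y[OF that]] .
  qed simp
  ultimately show ?thesis using that[of r "\<lambda>i j z. matrix_inv (Y z) $ i $ j"] r by blast
qed

section \<open>Matrix-valued functions and Hermitian bundles\<close>

definition hadj :: "complex^'n^'m \<Rightarrow> complex^'m^'n" where
  "hadj A = (\<chi> i j. cnj (A $ j $ i))"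

lemma hadj_nth [simp]: "hadj A $ i $ j = cnj (A $ j $ i)" by (simp add: hadj_def)

lemma hadj_hadj [simp]: "hadj (hadj A) = A" by (simp add: vec_eq_iff)

lemma hadj_mult: "hadj (A ** B) = hadj B ** hadj (A :: complex^'n::finite^'m)"
  by (simp add: vec_eq_iff matrix_mult_nth mult.commute)

lemma hadj_mat1 [simp]: "hadj (mat 1) = mat 1" by (simp add: vec_eq_iff mat_def)

lemma mm_diff_left: "(A - B) ** C = A ** C - B ** (C :: complex^'k^'n::finite)"
  by (simp add: vec_eq_iff matrix_mult_nth left_diff_distrib sum_subtractf)

lemma mm_diff_right: "A ** (B - C) = A ** B - A ** (C :: complex^'k^'n::finite)"
  by (simp add: vec_eq_iff matrix_mult_nth right_diff_distrib sum_subtractf)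

lemma mm_add_left: "(A + B) ** C = A ** C + B ** (C :: complex^'k^'n::finite)"
  by (simp add: vec_eq_iff matrix_mult_nth distrib_right sum.distrib)

lemma mm_add_right: "A ** (B + C) = A ** B + A ** (C :: complex^'k^'n::finite)"
  by (simp add: vec_eq_iff matrix_mult_nth distrib_left sum.distrib)

lemma mm_minus_left: "(- A) ** B = - (A ** (B :: complex^'k^'n::finite))"
  by (simp add: vec_eq_iff matrix_mult_nth sum_negf)

lemma mm_minus_right: "A ** (- B) = - (A ** (B :: complex^'k^'n::finite))"
  by (simp add: vec_eq_iff matrix_mult_nth sum_negf)

lemma mm_zero_left [simp]: "0 ** (B :: complex^'k^'n::finite) = 0"
  by (simp add: vec_eq_iff matrix_mult_nth)

lemma mm_zero_right [simp]: "A ** (0 :: complex^'k^'n::finite) = 0"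
  by (simp add: vec_eq_iff matrix_mult_nth)

lemmas mm_simps = mm_diff_left mm_diff_right mm_add_left mm_add_right mm_minus_left mm_minus_right

lemma trace_mult_commute: "trace (A ** B) = trace (B ** (A :: complex^'n::finite^'n))"
  by (rule trace_mul_sym)

lemma trace_add': "trace (A + B) = trace A + trace (B :: complex^'n::finite^'n)"
  by (simp add: trace_def sum.distrib)

lemma trace_diff': "trace (A - B) = trace A - trace (B :: complex^'n::finite^'n)"
  by (simp add: trace_def sum_subtractf)

lemma matrix_inv_hadj:
  fixes A :: "complex^'n::finite^'n"
  assumes "det A \<noteq> 0"
  shows "matrix_inv (hadj A) = hadj (matrix_inv A)" "det (hadj A) \<noteq> 0"
proof -
  have "hadj A ** hadj (matrix_inv A) = mat 1"
    by (simp add: hadj_mult[symmetric] matrix_inv_right_left[OF assms])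
  from matrix_inv_unique[OF this] show "matrix_inv (hadj A) = hadj (matrix_inv A)" "det (hadj A) \<noteq> 0" by auto
qed

definition msmooth :: "('a::real_normed_vector) set \<Rightarrow> ('a \<Rightarrow> complex^'k^'l) \<Rightarrow> bool" where
  "msmooth S A \<longleftrightarrow> (\<forall>i j. smooth_on (\<lambda>z. A z $ i $ j) S)"

definition md :: "complex \<Rightarrow> 'm \<Rightarrow> (complex^'m::finite \<Rightarrow> complex^'k^'l) \<Rightarrow> complex^'m \<Rightarrow> complex^'k^'l" where
  "md k ga A z = (\<chi> i j. wd k ga (\<lambda>w. A w $ i $ j) z)"

lemma md_nth [simp]: "md k ga A z $ i $ j = wd k ga (\<lambda>w. A w $ i $ j) z"
  by (simp add: md_def)

lemma msmoothD: "msmooth S A \<Longrightarrow> smooth_on (\<lambda>z. A z $ i $ j) S"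
  by (simp add: msmooth_def)

lemma msmooth_diff_at: "msmooth S A \<Longrightarrow> z \<in> S \<Longrightarrow> (\<lambda>z. A z $ i $ j) differentiable (at z)"
  by (rule smooth_on_differentiable[OF msmoothD])

lemma msmooth_mult: "open S \<Longrightarrow> msmooth S A \<Longrightarrow> msmooth S B \<Longrightarrow> msmooth S (\<lambda>z. A z ** (B z :: complex^'k^'n::finite))"
  unfolding msmooth_def matrix_mult_nth by (auto intro!: smooth_on_sum smooth_on_mult)

lemma msmooth_add: "open S \<Longrightarrow> msmooth S A \<Longrightarrow> msmooth S B \<Longrightarrow> msmooth S (\<lambda>z. A z + B z)"
  unfolding msmooth_def by (auto intro!: smooth_on_add)

lemma msmooth_diff: "open S \<Longrightarrow> msmooth S A \<Longrightarrow> msmooth S B \<Longrightarrow> msmooth S (\<lambda>z. A z - B z)"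
  unfolding msmooth_def by (auto intro!: smooth_on_diff)

lemma msmooth_const: "open S \<Longrightarrow> msmooth S (\<lambda>z. A)"
  unfolding msmooth_def by (auto intro!: smooth_on_const)

lemma msmooth_md: "open S \<Longrightarrow> msmooth S A \<Longrightarrow> msmooth S (md k ga A)"
  unfolding msmooth_def using smooth_on_wd by (simp add: smooth_on_wd)

lemma msmooth_inv:
  "open S \<Longrightarrow> msmooth S A \<Longrightarrow> (\<And>z. z \<in> S \<Longrightarrow> det (A z) \<noteq> 0) \<Longrightarrow> msmooth S (\<lambda>z. matrix_inv (A z :: complex^'n::finite^'n))"
  unfolding msmooth_def by (intro allI smooth_on_matrix_inv) auto

lemma md_cong: "open S \<Longrightarrow> z \<in> S \<Longrightarrow> (\<And>w. w \<in> S \<Longrightarrow> A w = B w) \<Longrightarrow> md k ga A z = md k ga B z"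
  by (simp add: vec_eq_iff) (intro allI wd_cong[of S]; simp)

lemma md_const [simp]: "md k ga (\<lambda>w. A) z = 0"
  by (simp add: vec_eq_iff)

lemma md_mult:
  "msmooth S A \<Longrightarrow> msmooth S B \<Longrightarrow> z \<in> S \<Longrightarrow>
    md k ga (\<lambda>w. A w ** (B w :: complex^'k^'n::finite)) z = md k ga A z ** B z + A z ** md k ga B z"
  by (simp add: vec_eq_iff matrix_mult_nth wd_sum wd_mult msmooth_diff_at sum.distrib)

lemma md_add: "msmooth S A \<Longrightarrow> msmooth S B \<Longrightarrow> z \<in> S \<Longrightarrow> md k ga (\<lambda>w. A w + B w) z = md k ga A z + md k ga B z"
  by (simp add: vec_eq_iff wd_add msmooth_diff_at)

lemma md_diff: "msmooth S A \<Longrightarrow> msmooth S B \<Longrightarrow> z \<in> S \<Longrightarrow> md k ga (\<lambda>w. A w - B w) z = md k ga A z - md k ga B z"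
  by (simp add: vec_eq_iff wd_diff msmooth_diff_at)

lemma md_hadj: "msmooth S A \<Longrightarrow> z \<in> S \<Longrightarrow> md k ga (\<lambda>w. hadj (A w)) z = hadj (md (cnj k) ga A z)"
  by (simp add: vec_eq_iff wd_cnj msmooth_diff_at)

lemma md_commute: "open S \<Longrightarrow> msmooth S A \<Longrightarrow> z \<in> S \<Longrightarrow> md k ga (md l de A) z = md l de (md k ga A) z"
proof -
  assume a: "open S" "msmooth S A" "z \<in> S"
  have "wd k ga (wd l de (\<lambda>w. A w $ i $ j)) z = wd l de (wd k ga (\<lambda>w. A w $ i $ j)) z" for i j
    by (rule wd_commute[OF a(1) msmoothD[OF a(2)] a(3)])
  then show ?thesis by (simp add: vec_eq_iff)
qed

lemma md_inv:
  fixes A :: "complex^'m::finite \<Rightarrow> complex^'n::finite^'n"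
  assumes "open S" "msmooth S A" "\<And>z. z \<in> S \<Longrightarrow> det (A z) \<noteq> 0" "z \<in> S"
  shows "md k ga (\<lambda>w. matrix_inv (A w)) z = - (matrix_inv (A z) ** md k ga A z ** matrix_inv (A z))"
proof -
  note i = matrix_inv_right_left[OF assms(3)]
  have s: "msmooth S (\<lambda>w. matrix_inv (A w))" by (rule msmooth_inv[OF assms(1-3)])
  have "md k ga (\<lambda>w. A w ** matrix_inv (A w)) z = md k ga (\<lambda>w. mat 1) z"
    by (rule md_cong[OF assms(1,4)]) (simp add: i)
  then have "md k ga A z ** matrix_inv (A z) + A z ** md k ga (\<lambda>w. matrix_inv (A w)) z = 0"
    by (simp add: md_mult[OF assms(2) s assms(4)])
  then have "matrix_inv (A z) ** (A z ** md k ga (\<lambda>w. matrix_inv (A w)) z) = matrix_inv (A z) ** - (md k ga A z ** matrix_inv (A z))"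
    by (simp add: add_eq_0_iff)
  then show ?thesis by (simp add: matrix_mul_assoc i[OF assms(4)] mm_simps)
qed

lemma smooth_on_trace: "open S \<Longrightarrow> msmooth S A \<Longrightarrow> smooth_on (\<lambda>z. trace (A z :: complex^'n::finite^'n)) S"
  unfolding trace_def by (intro smooth_on_sum) (auto intro: msmoothD)

lemma wd_trace: "msmooth S A \<Longrightarrow> z \<in> S \<Longrightarrow> wd k ga (\<lambda>w. trace (A w :: complex^'n::finite^'n)) z = trace (md k ga A z)"
  by (simp add: trace_def wd_sum msmooth_diff_at)

lemma trace_hadj_nonneg: "0 \<le> Re (trace (A ** hadj (A :: complex^'n::finite^'n)))"
  by (auto simp: trace_def matrix_mult_nth intro!: sum_nonneg)

locale herm_bundle =
  fixes U :: "(complex^'m::finite) set" and H :: "complex^'m \<Rightarrow> complex^'n::finite^'n"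
  assumes openU: "open U" and Hsmooth: "msmooth U H" and Hherm: "z \<in> U \<Longrightarrow> hadj (H z) = H z"
    and Hdet: "z \<in> U \<Longrightarrow> det (H z) \<noteq> 0"
begin

abbreviation Hi :: "complex^'m \<Rightarrow> complex^'n^'n" where "Hi z \<equiv> matrix_inv (H z)"

definition conn :: "'m \<Rightarrow> complex^'m \<Rightarrow> complex^'n^'n" where
  "conn ga z = md (- \<i>) ga H z ** Hi z"

definition curv :: "'m \<Rightarrow> 'm \<Rightarrow> complex^'m \<Rightarrow> complex^'n^'n" where
  "curv ga de = md \<i> de (conn ga)"

definition D :: "'m \<Rightarrow> (complex^'m \<Rightarrow> complex^'n^'n) \<Rightarrow> complex^'m \<Rightarrow> complex^'n^'n" where
  "D ga T z = md (- \<i>) ga T z - conn ga z ** T z + T z ** conn ga z"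

lemma Hi_simps: assumes "z \<in> U"
  shows "H z ** Hi z = mat 1" "Hi z ** H z = mat 1" "A ** H z ** Hi z = A" "A ** Hi z ** H z = A"
  using matrix_inv_right_left[OF Hdet[OF assms]] by (simp_all add: matrix_mul_assoc[symmetric])

lemma Hi_smooth: "msmooth U Hi" by (rule msmooth_inv[OF openU Hsmooth Hdet])

lemma Hi_herm: "z \<in> U \<Longrightarrow> hadj (Hi z) = Hi z"
  using matrix_inv_hadj(1)[OF Hdet] Hherm by metis

lemma conn_smooth: "msmooth U (conn ga)"
  unfolding conn_def[abs_def] by (intro msmooth_mult openU msmooth_md Hsmooth Hi_smooth)

lemma curv_smooth: "msmooth U (curv ga de)"
  unfolding curv_def by (intro msmooth_md openU conn_smooth)

lemma D_smooth: "msmooth U T \<Longrightarrow> msmooth U (D ga T)"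
  unfolding D_def[abs_def] by (intro msmooth_add msmooth_diff msmooth_mult openU msmooth_md conn_smooth)

lemma md_H: "z \<in> U \<Longrightarrow> md (- \<i>) ga H z = conn ga z ** H z"
  by (simp add: conn_def Hi_simps)

lemma md_Hi: "z \<in> U \<Longrightarrow> md (- \<i>) ga Hi z = - (Hi z ** conn ga z)"
  by (simp add: md_inv[OF openU Hsmooth Hdet] conn_def matrix_mul_assoc)

text \<open>The curvature of the Chern connection has no \<open>(2,0)\<close>-part.\<close>
lemma conn_flat:
  assumes z: "z \<in> U"
  shows "md (- \<i>) ep (conn ga) z + conn ga z ** conn ep z = md (- \<i>) ga (conn ep) z + conn ep z ** conn ga z"
proof -
  have "md (- \<i>) ep (conn ga) z + conn ga z ** conn ep z = md (- \<i>) ep (md (- \<i>) ga H) z ** Hi z" for ep ga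
    unfolding conn_def[abs_def]
    by (subst md_mult[OF msmooth_md[OF openU Hsmooth] Hi_smooth z])
      (simp add: md_Hi[OF z] mm_simps matrix_mul_assoc conn_def)
  then show ?thesis by (simp add: md_commute[OF openU Hsmooth z, of _ ep])
qed

text \<open>The second Bianchi identity.\<close>
lemma D_curv_sym:
  assumes z: "z \<in> U"
  shows "D ep (curv ga de) z = D ga (curv ep de) z"
proof -
  have "md \<i> de (\<lambda>w. md (- \<i>) ep (conn ga) w + conn ga w ** conn ep w) z = md \<i> de (\<lambda>w. md (- \<i>) ga (conn ep) w + conn ep w ** conn ga w) z"
    by (rule md_cong[OF openU z]) (rule conn_flat)
  moreover have "md \<i> de (\<lambda>w. md (- \<i>) ep (conn ga) w + conn ga w ** conn ep w) z =
      md (- \<i>) ep (curv ga de) z + curv ga de z ** conn ep z + conn ga z ** curv ep de z" for ep ga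
    by (simp add: md_add[OF msmooth_md[OF openU conn_smooth] msmooth_mult[OF openU conn_smooth conn_smooth] z]
        md_mult[OF conn_smooth conn_smooth z] md_commute[OF openU conn_smooth z, of \<i>] curv_def)
  ultimately show ?thesis by (simp add: D_def algebra_simps)
qed

lemma dbar_D:
  assumes T: "msmooth U T" and z: "z \<in> U"
  shows "md \<i> de (D ga T) z = md (- \<i>) ga (md \<i> de T) z - conn ga z ** md \<i> de T z + md \<i> de T z ** conn ga z
     - curv ga de z ** T z + T z ** curv ga de z"
  unfolding D_def[abs_def]
  by (subst md_add[OF _ _ z], (intro msmooth_diff msmooth_mult msmooth_md openU conn_smooth T)+,
     subst md_diff[OF _ _ z], (intro msmooth_mult msmooth_md openU conn_smooth T)+)
   (simp add: md_mult[OF _ _ z] conn_smooth T md_commute[OF openU T z, of \<i>] curv_def)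

lemma D_selfadjoint:
  assumes T: "msmooth U T" and sa: "\<And>w. w \<in> U \<Longrightarrow> hadj (T w ** H w) = T w ** H w" and z: "z \<in> U"
  shows "D ga T z = H z ** hadj (md \<i> ga T z) ** Hi z"
proof -
  have sa': "T w ** H w = H w ** hadj (T w)" if "w \<in> U" for w
    using sa[OF that] Hherm[OF that] by (simp add: hadj_mult)
  have Ta: "msmooth U (\<lambda>w. hadj (T w))" using T by (auto simp: msmooth_def intro!: smooth_on_cnj openU)
  have "md (- \<i>) ga (\<lambda>w. T w ** H w) z = md (- \<i>) ga (\<lambda>w. H w ** hadj (T w)) z"
    by (rule md_cong[OF openU z]) (rule sa')
  then have "md (- \<i>) ga T z ** H z + T z ** (conn ga z ** H z) = conn ga z ** (H z ** hadj (T z)) + H z ** hadj (md \<i> ga T z)"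
    by (simp add: md_mult[OF T Hsmooth z] md_mult[OF Hsmooth Ta z] md_H[OF z] md_hadj[OF T z] matrix_mul_assoc)
  then have "(md (- \<i>) ga T z ** H z + T z ** (conn ga z ** H z)) ** Hi z = (conn ga z ** (T z ** H z) + H z ** hadj (md \<i> ga T z)) ** Hi z"
    by (simp add: sa'[OF z])
  then have "md (- \<i>) ga T z + T z ** conn ga z = conn ga z ** T z + H z ** hadj (md \<i> ga T z) ** Hi z"
    by (simp add: mm_simps matrix_mul_assoc Hi_simps[OF z])
  then show ?thesis by (simp add: D_def algebra_simps)
qed

lemma laplace_trace:
  assumes T: "msmooth U T" and z: "z \<in> U"
  shows "wd \<i> de (wd (- \<i>) ga (\<lambda>w. trace (T w ** T w))) z =
     2 * trace (md \<i> de T z ** D ga T z) + 2 * trace (T z ** md \<i> de (D ga T) z)"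
proof -
  have 1: "wd (- \<i>) ga (\<lambda>w. trace (T w ** T w)) w = 2 * trace (T w ** D ga T w)" if "w \<in> U" for w
  proof -
    have "trace (T w ** (conn ga w ** T w)) = trace (T w ** (T w ** conn ga w))"
      by (subst trace_mult_commute) (simp add: matrix_mul_assoc)
    moreover have "trace (md (- \<i>) ga T w ** T w) = trace (T w ** md (- \<i>) ga T w)" by (rule trace_mult_commute)
    ultimately show ?thesis
      by (simp add: wd_trace[OF msmooth_mult[OF openU T T] that] md_mult[OF T T that] D_def mm_simps trace_add' trace_diff')
  qed
  have "wd \<i> de (wd (- \<i>) ga (\<lambda>w. trace (T w ** T w))) z = wd \<i> de (\<lambda>w. 2 * trace (T w ** D ga T w)) z"
    by (rule wd_cong[OF openU z]) (rule 1)
  also have "\<dots> = 2 * trace (md \<i> de (\<lambda>w. T w ** D ga T w) z)"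
  proof -
    have "(\<lambda>w. trace (T w ** D ga T w)) differentiable (at z)"
      by (intro smooth_on_differentiable[OF smooth_on_trace z] openU msmooth_mult T D_smooth)
    then show ?thesis
      by (simp add: wd_mult wd_trace[OF msmooth_mult[OF openU T D_smooth[OF T]] z])
  qed
  finally show ?thesis
    by (simp add: md_mult[OF T D_smooth[OF T] z] trace_add' distrib_left)
qed

end

lemma second_derivative_at_max:
  fixes f f' :: "real \<Rightarrow> real"
  assumes e: "e > 0" and f: "\<And>t. \<bar>t\<bar> < e \<Longrightarrow> (f has_real_derivative f' t) (at t)"
    and f': "(f' has_real_derivative c) (at 0)" and max: "\<And>t. \<bar>t\<bar> < e \<Longrightarrow> f t \<le> f 0"
  shows "c \<le> 0"
proof (rule ccontr)
  assume "\<not> c \<le> 0"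
  then have "c > 0" by simp
  have "f' 0 = 0"
    by (rule DERIV_local_max[OF f[of 0] e]) (use e max in auto)
  from DERIV_pos_inc_right[OF f' \<open>c > 0\<close>] obtain d where d: "d > 0" "\<And>h. 0 < h \<Longrightarrow> h < d \<Longrightarrow> f' 0 < f' (0 + h)" by blast
  define h where "h = min d e / 2"
  have h: "h > 0" "h < d" "h < e" using d e by (auto simp: h_def)
  have "\<exists>x>0. x < h \<and> f h - f 0 = (h - 0) * f' x"
    by (rule MVT2) (use h f in auto)
  then obtain x where x: "0 < x" "x < h" "f h - f 0 = h * f' x" by auto
  have "f' x > 0" using d(2)[of x] x h \<open>f' 0 = 0\<close> by simp
  then have "f h > f 0" using x h mult_pos_pos[of h "f' x"] by linarith
  then show False using max[of h] h by simp
qed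

lemma laplace_at_max:
  fixes f :: "complex^'m::finite \<Rightarrow> complex"
  assumes "open U" "smooth_on f U" "p \<in> U" "\<And>w. w \<in> U \<Longrightarrow> Re (f w) \<le> Re (f p)"
  shows "Re (wd \<i> ga (wd (- \<i>) ga f) p) \<le> 0"
proof -
  let ?D = "\<lambda>v x. frechet_derivative f (at x) v"
  have D2: "Re (frechet_derivative (?D v) (at p) v) \<le> 0" for v
  proof -
    obtain e where e: "e > 0" "ball p e \<subseteq> U" using assms open_contains_ball by blast
    define e' where "e' = e / (norm v + 1)"
    have n: "norm v + 1 > 0" by (smt (verit) norm_ge_zero)
    have e': "e' > 0" using e n by (simp add: e'_def)
    have inU: "p + t *\<^sub>R v \<in> U" if "\<bar>t\<bar> < e'" for t
    proof -
      have "\<bar>t\<bar> * norm v \<le> e' * norm v" using that by (intro mult_right_mono) auto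
      also have "\<dots> < e' * (norm v + 1)" using e' by simp
      also have "\<dots> = e" using n by (simp add: e'_def)
      finally have "p + t *\<^sub>R v \<in> ball p e" by (simp add: dist_norm)
      then show ?thesis using e by blast
    qed
    have der: "((\<lambda>t. Re (g (p + t *\<^sub>R v))) has_real_derivative Re (frechet_derivative g (at (p + t *\<^sub>R v)) v)) (at t)"
      if "smooth_on g U" "\<bar>t\<bar> < e'" for g :: "complex^'m \<Rightarrow> complex" and t
    proof -
      have l: "((\<lambda>t. p + t *\<^sub>R v) has_derivative (\<lambda>t. t *\<^sub>R v)) (at t)" by (auto intro!: derivative_eq_intros)
      have d: "g differentiable (at (p + t *\<^sub>R v))" using smooth_on_differentiable[OF that(1) inU[OF that(2)]] .
      have "((\<lambda>t. Re (g (p + t *\<^sub>R v))) has_derivative (\<lambda>s. Re (frechet_derivative g (at (p + t *\<^sub>R v)) (s *\<^sub>R v)))) (at t)"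
        by (intro bounded_linear.has_derivative[OF bounded_linear_Re] has_derivative_compose[OF l has_frechet[OF d]])
      moreover have "(\<lambda>s. Re (frechet_derivative g (at (p + t *\<^sub>R v)) (s *\<^sub>R v))) = (*) (Re (frechet_derivative g (at (p + t *\<^sub>R v)) v))"
        by (simp add: fun_eq_iff linear_scale[OF linear_frechet_derivative[OF d]])
      ultimately show ?thesis by (simp only: has_field_derivative_def)
    qed
    show ?thesis
    proof (rule second_derivative_at_max[OF e'])
      show "((\<lambda>t. Re (f (p + t *\<^sub>R v))) has_real_derivative Re (?D v (p + t *\<^sub>R v))) (at t)" if "\<bar>t\<bar> < e'" for t
        by (rule der[OF assms(2) that])
      show "((\<lambda>t. Re (?D v (p + t *\<^sub>R v))) has_real_derivative Re (frechet_derivative (?D v) (at p) v)) (at 0)"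
        using der[OF smooth_on_frechet[OF assms(2)], of 0 v] e' by simp
      show "Re (f (p + t *\<^sub>R v)) \<le> Re (f (p + 0 *\<^sub>R v))" if "\<bar>t\<bar> < e'" for t
        using assms(4)[OF inU[OF that]] by simp
    qed
  qed
  have E: "wd \<i> ga (wd (- \<i>) ga f) p = (frechet_derivative (?D (axis ga 1)) (at p) (axis ga 1) + frechet_derivative (?D (axis ga \<i>)) (at p) (axis ga \<i>)) / 4"
    unfolding wd_def[of \<i>] frechet_wd[OF assms(1-3)]
    by (simp add: second_derivative_commute[OF assms(1-3), of "axis ga \<i>" "axis ga 1"] field_simps)
  show ?thesis unfolding E using D2[of "axis ga 1"] D2[of "axis ga \<i>"] by simp
qed

context herm_bundle begin

lemma maximum_principle:
  assumes T: "msmooth U T" and sa: "\<And>w. w \<in> U \<Longrightarrow> hadj (T w ** H w) = T w ** H w"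
    and p: "p \<in> U" "H p = mat 1" and max: "\<And>w. w \<in> U \<Longrightarrow> Re (trace (T w ** T w)) \<le> Re (trace (T p ** T p))"
  shows "Re (trace (T p ** md \<i> ga (D ga T) p)) \<le> 0"
proof -
  have "Hi p = mat 1" using matrix_inv_unique(1)[of "mat 1" "mat 1"] p by simp
  then have "D ga T p = hadj (md \<i> ga T p)" using D_selfadjoint[OF T sa p(1)] p(2) by simp
  then have "0 \<le> Re (trace (md \<i> ga T p ** D ga T p))" using trace_hadj_nonneg by metis
  moreover have "Re (wd \<i> ga (wd (- \<i>) ga (\<lambda>w. trace (T w ** T w))) p) \<le> 0"
    by (rule laplace_at_max[OF openU smooth_on_trace[OF openU msmooth_mult[OF openU T T]] p(1) max])
  ultimately show ?thesis by (simp add: laplace_trace[OF T p(1)])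
qed

end

section \<open>Local Kaehler geometry\<close>

definition kron :: "complex^'m^'m \<Rightarrow> complex^'m^'m \<Rightarrow> complex^('m \<times> 'm)^('m \<times> 'm)" where
  "kron A B = (\<chi> p q. A $ fst p $ fst q * B $ snd p $ snd q)"

lemma kron_nth [simp]: "kron A B $ p $ q = A $ fst p $ fst q * B $ snd p $ snd q"
  by (simp add: kron_def)

lemma sum_pair: "(\<Sum>p\<in>UNIV. f p) = (\<Sum>a\<in>UNIV. \<Sum>b\<in>UNIV. f (a, b))"
  by (simp add: sum.cartesian_product UNIV_Times_UNIV[symmetric] del: UNIV_Times_UNIV)

lemma if_mult_zero: "(if P then a else 0) * b = (if P then a * b else 0)" "b * (if P then a else 0) = (if P then b * a else (0::complex))"
  by auto

lemma kron_mult: "kron A B ** kron C D = kron (A ** C) (B ** (D :: complex^'m::finite^'m))"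
  by (simp add: vec_eq_iff matrix_mult_nth sum_pair sum_product mult_ac)

lemma kron_mat1: "kron (mat 1) (mat 1) = mat 1"
  by (auto simp: vec_eq_iff mat_def)

lemma hadj_kron: "hadj (kron A B) = kron (hadj A) (hadj B)"
  by (simp add: vec_eq_iff)

lemma kron_diff_left: "kron (A - B) C = kron A C - kron B C" by (simp add: vec_eq_iff algebra_simps)
lemma kron_add_left: "kron (A + B) C = kron A C + kron B C" by (simp add: vec_eq_iff algebra_simps)

lemma kron_inv:
  fixes A B :: "complex^'m::finite^'m"
  assumes "det A \<noteq> 0" "det B \<noteq> 0"
  shows "det (kron A B) \<noteq> 0" "matrix_inv (kron A B) = kron (matrix_inv A) (matrix_inv B)"
proof -
  have "kron A B ** kron (matrix_inv A) (matrix_inv B) = mat 1"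
    by (simp add: kron_mult matrix_inv_right_left[OF assms(1)] matrix_inv_right_left[OF assms(2)] kron_mat1)
  from matrix_inv_unique[OF this] show "det (kron A B) \<noteq> 0" "matrix_inv (kron A B) = kron (matrix_inv A) (matrix_inv B)" by auto
qed

lemma msmooth_kron: "open S \<Longrightarrow> msmooth S A \<Longrightarrow> msmooth S B \<Longrightarrow> msmooth S (\<lambda>z. kron (A z) (B z))"
  unfolding msmooth_def by (auto intro!: smooth_on_mult)

lemma md_kron: "msmooth S A \<Longrightarrow> msmooth S B \<Longrightarrow> z \<in> S \<Longrightarrow>
    md k ga (\<lambda>z. kron (A z) (B z)) z = kron (md k ga A z) (B z) + kron (A z) (md k ga B z)"
  by (simp add: vec_eq_iff wd_mult msmooth_diff_at)

definition kder :: "complex^'m^'m \<Rightarrow> complex^('m \<times> 'm)^('m \<times> 'm)" where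
  "kder A = kron A (mat 1) + kron (mat 1) A"

lemma kder_mult_nth:
  fixes A :: "complex^'m::finite^'m"
  shows "(kder A ** T) $ (a, n) $ b = (\<Sum>s\<in>UNIV. A $ a $ s * T $ (s, n) $ b) + (\<Sum>s\<in>UNIV. A $ n $ s * T $ (a, s) $ b)"
    "(T ** kder A) $ b $ (a, n) = (\<Sum>s\<in>UNIV. T $ b $ (s, n) * A $ s $ a) + (\<Sum>s\<in>UNIV. T $ b $ (a, s) * A $ s $ n)"
proof -
  have *: "(\<Sum>p\<in>UNIV. \<Sum>q\<in>UNIV. if n = q then f p q else 0) = (\<Sum>p\<in>UNIV. f p n)"
    "(\<Sum>p\<in>UNIV. \<Sum>q\<in>UNIV. if q = n then f p q else 0) = (\<Sum>p\<in>UNIV. f p n)"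
    "(\<Sum>p\<in>UNIV. \<Sum>q\<in>UNIV. if a = p then f p q else 0) = (\<Sum>q\<in>UNIV. f a q)"
    "(\<Sum>p\<in>UNIV. \<Sum>q\<in>UNIV. if p = a then f p q else 0) = (\<Sum>q\<in>UNIV. f a q)" for f :: "'m \<Rightarrow> 'm \<Rightarrow> complex"
  proof -
    show "(\<Sum>p\<in>UNIV. \<Sum>q\<in>UNIV. if a = p then f p q else 0) = (\<Sum>q\<in>UNIV. f a q)"
      "(\<Sum>p\<in>UNIV. \<Sum>q\<in>UNIV. if p = a then f p q else 0) = (\<Sum>q\<in>UNIV. f a q)"
      by (subst sum.swap, simp)+
  qed simp_all
  show "(kder A ** T) $ (a, n) $ b = (\<Sum>s\<in>UNIV. A $ a $ s * T $ (s, n) $ b) + (\<Sum>s\<in>UNIV. A $ n $ s * T $ (a, s) $ b)"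
    "(T ** kder A) $ b $ (a, n) = (\<Sum>s\<in>UNIV. T $ b $ (s, n) * A $ s $ a) + (\<Sum>s\<in>UNIV. T $ b $ (a, s) * A $ s $ n)"
    by (simp_all add: kder_def matrix_mult_nth mat_def sum_pair distrib_left distrib_right sum.distrib if_mult_zero * cong: if_cong)
qed

definition ptr :: "complex^('m \<times> 'm)^('m \<times> 'm) \<Rightarrow> complex^'m^'m" where
  "ptr T = (\<chi> mu ro. \<Sum>de\<in>UNIV. T $ (de, mu) $ (de, ro))"

lemma ptr_nth [simp]: "ptr T $ mu $ ro = (\<Sum>de\<in>UNIV. T $ (de, mu) $ (de, ro))" by (simp add: ptr_def)

locale local_kaehler =
  fixes U :: "(complex^'m::finite) set" and G :: "complex^'m \<Rightarrow> complex^'m^'m"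
  assumes open_U: "open U" and G_smooth: "msmooth U G" and G_herm: "z \<in> U \<Longrightarrow> G z $ be $ al = cnj (G z $ al $ be)"
    and G_pos: "z \<in> U \<Longrightarrow> v \<noteq> 0 \<Longrightarrow> 0 < Re (\<Sum>al\<in>UNIV. \<Sum>be\<in>UNIV. G z $ al $ be * v $ al * cnj (v $ be))"
    and G_closed: "z \<in> U \<Longrightarrow> dz ga (\<lambda>w. G w $ al $ be) z = dz al (\<lambda>w. G w $ ga $ be) z"
begin

lemma G_hadj: "z \<in> U \<Longrightarrow> hadj (G z) = G z"
  by (simp add: vec_eq_iff G_herm[symmetric])

lemma G_det: assumes "z \<in> U" shows "det (G z) \<noteq> 0"
proof
  assume "det (G z) = 0"
  then have "\<not> invertible (G z)" by (simp add: invertible_det_nz)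
  then obtain x where x: "x \<noteq> 0" "G z *v x = 0"
    using matrix_left_invertible_ker[of "G z"] invertible_left_inverse[of "G z"] by blast
  define v where "v = (\<chi> be. cnj (x $ be))"
  have "v \<noteq> 0" using x by (simp add: v_def vec_eq_iff)
  have "(\<Sum>al\<in>UNIV. \<Sum>be\<in>UNIV. G z $ al $ be * v $ al * cnj (v $ be)) = (\<Sum>al\<in>UNIV. v $ al * (G z *v x) $ al)"
    by (simp add: matrix_vector_mult_def v_def sum_distrib_left mult_ac)
  also have "\<dots> = 0" by (simp add: x)
  finally show False using G_pos[OF assms \<open>v \<noteq> 0\<close>] by simp
qed

sublocale base: herm_bundle U G
  by unfold_locales (auto intro: open_U G_smooth G_hadj dest: G_det)

sublocale V: herm_bundle U "\<lambda>z. kron (G z) (G z)"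
  by unfold_locales (auto intro: open_U msmooth_kron G_smooth simp: hadj_kron G_hadj kron_inv(1) dest: G_det)

abbreviation Gi :: "complex^'m \<Rightarrow> complex^'m^'m" where "Gi z \<equiv> matrix_inv (G z)"

lemma V_conn: "z \<in> U \<Longrightarrow> V.conn ga z = kder (base.conn ga z)"
  by (simp add: V.conn_def base.conn_def md_kron[OF G_smooth G_smooth] kron_inv(2) G_det mm_add_left kron_mult base.Hi_simps kder_def)

lemma V_curv: assumes "z \<in> U" shows "V.curv ga de z = kder (base.curv ga de z)"
proof -
  have "V.curv ga de z = md \<i> de (\<lambda>w. kron (base.conn ga w) (mat 1) + kron (mat 1) (base.conn ga w)) z"
    unfolding V.curv_def by (rule md_cong[OF open_U assms]) (simp add: V_conn kder_def)
  also have "\<dots> = kder (base.curv ga de z)"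
    using base.conn_smooth[of ga] msmooth_const[OF open_U, of "mat 1 :: complex^'m^'m"]
    by (subst md_add[OF _ _ assms])
      (auto intro!: msmooth_kron open_U simp: md_kron[OF _ _ assms] kder_def base.curv_def vec_eq_iff)
  finally show ?thesis .
qed

lemma torsion_free: assumes "z \<in> U" shows "base.conn ga z $ al $ mu = base.conn al z $ ga $ mu"
  using G_closed[OF assms] by (simp add: base.conn_def matrix_mult_nth dz_wd)

lemma curv_torsion: assumes "z \<in> U" shows "base.curv ga de z $ al $ mu = base.curv al de z $ ga $ mu"
  unfolding base.curv_def md_nth by (rule wd_cong[OF open_U assms]) (rule torsion_free)

definition Rh :: "complex^'m \<Rightarrow> complex^('m \<times> 'm)^('m \<times> 'm)" where
  "Rh z = (\<chi> p q. \<Sum>de\<in>UNIV. Gi z $ de $ fst q * base.curv (fst p) de z $ snd p $ snd q)"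

lemma Rh_nth: "Rh z $ (al, nu) $ (ga, mu) = (\<Sum>de\<in>UNIV. Gi z $ de $ ga * base.curv al de z $ nu $ mu)"
  by (simp add: Rh_def)

lemma Rh_smooth: "msmooth U Rh"
  unfolding msmooth_def Rh_def
  using msmoothD[OF base.Hi_smooth] msmoothD[OF base.curv_smooth]
  by (auto intro!: smooth_on_sum smooth_on_mult open_U)

lemma Rh_sym: assumes "z \<in> U" shows "Rh z $ (al, nu) $ b = Rh z $ (nu, al) $ b"
  by (cases b) (simp add: Rh_nth curv_torsion[OF assms, of al])

lemma V_D_nth: assumes "z \<in> U"
  shows "V.D ep T z $ (al, nu) $ (ga, mu) = wd (- \<i>) ep (\<lambda>w. T w $ (al, nu) $ (ga, mu)) z
     - ((\<Sum>s\<in>UNIV. base.conn ep z $ al $ s * T z $ (s, nu) $ (ga, mu)) + (\<Sum>s\<in>UNIV. base.conn ep z $ nu $ s * T z $ (al, s) $ (ga, mu)))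
     + ((\<Sum>s\<in>UNIV. T z $ (al, nu) $ (s, mu) * base.conn ep z $ s $ ga) + (\<Sum>s\<in>UNIV. T z $ (al, nu) $ (ga, s) * base.conn ep z $ s $ mu))"
  by (simp add: V.D_def V_conn[OF assms] kder_mult_nth)

lemma V_D_Rh: assumes z: "z \<in> U"
  shows "V.D ep Rh z $ (al, nu) $ (ga, mu) =
    (\<Sum>de\<in>UNIV. Gi z $ de $ ga * (base.D ep (base.curv al de) z $ nu $ mu - (\<Sum>s\<in>UNIV. base.conn ep z $ al $ s * base.curv s de z $ nu $ mu)))"
proof -
  let ?C = "base.conn ep z" and ?R = "\<lambda>al de. base.curv al de z"
  have 1: "wd (- \<i>) ep (\<lambda>w. Rh w $ (al, nu) $ (ga, mu)) z =
     (\<Sum>de\<in>UNIV. Gi z $ de $ ga * wd (- \<i>) ep (\<lambda>w. base.curv al de w $ nu $ mu) z) - (\<Sum>s\<in>UNIV. Rh z $ (al, nu) $ (s, mu) * ?C $ s $ ga)"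
  proof -
    have d: "(\<lambda>w. Gi w $ de $ ga) differentiable (at z)" "(\<lambda>w. base.curv al de w $ nu $ mu) differentiable (at z)" for de
      using msmooth_diff_at[OF base.Hi_smooth z] msmooth_diff_at[OF base.curv_smooth z] by auto
    have g: "wd (- \<i>) ep (\<lambda>w. Gi w $ de $ ga) z = - (\<Sum>s\<in>UNIV. Gi z $ de $ s * ?C $ s $ ga)" for de
      using arg_cong[OF base.md_Hi[OF z, of ep], of "\<lambda>A. A $ de $ ga"] by (simp add: matrix_mult_nth)
    have "wd (- \<i>) ep (\<lambda>w. Rh w $ (al, nu) $ (ga, mu)) z = (\<Sum>de\<in>UNIV. Gi z $ de $ ga * wd (- \<i>) ep (\<lambda>w. base.curv al de w $ nu $ mu) z)
       - (\<Sum>de\<in>UNIV. \<Sum>s\<in>UNIV. Gi z $ de $ s * ?C $ s $ ga * ?R al de $ nu $ mu)"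
      unfolding Rh_nth by (simp add: wd_sum wd_mult d g sum.distrib sum_negf sum_subtractf sum_distrib_right)
    also have "(\<Sum>de\<in>UNIV. \<Sum>s\<in>UNIV. Gi z $ de $ s * ?C $ s $ ga * ?R al de $ nu $ mu) = (\<Sum>s\<in>UNIV. Rh z $ (al, nu) $ (s, mu) * ?C $ s $ ga)"
      by (subst sum.swap) (simp add: Rh_nth sum_distrib_left mult_ac)
    finally show ?thesis .
  qed
  have 2: "(\<Sum>s\<in>UNIV. c s * Rh z $ (p s, q s) $ (ga, mu)) = (\<Sum>de\<in>UNIV. Gi z $ de $ ga * (\<Sum>s\<in>UNIV. c s * ?R (p s) de $ q s $ mu))" for c p q
    unfolding Rh_nth sum_distrib_left by (subst sum.swap) (simp add: mult_ac)
  have 3: "(\<Sum>s\<in>UNIV. Rh z $ (al, nu) $ (ga, s) * ?C $ s $ mu) = (\<Sum>de\<in>UNIV. Gi z $ de $ ga * (\<Sum>s\<in>UNIV. ?R al de $ nu $ s * ?C $ s $ mu))"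
    unfolding Rh_nth sum_distrib_left sum_distrib_right by (subst sum.swap) (simp add: mult_ac)
  show ?thesis
    unfolding V_D_nth[OF z] 1 2[of _ "\<lambda>s. s" "\<lambda>_. nu"] 2[of _ "\<lambda>_. al" "\<lambda>s. s"] 3
    by (simp add: base.D_def matrix_mult_nth right_diff_distrib distrib_left sum.distrib sum_subtractf)
qed

definition codazzi :: "(complex^'m \<Rightarrow> complex^('m \<times> 'm)^('m \<times> 'm)) \<Rightarrow> bool" where
  "codazzi T \<longleftrightarrow> (\<forall>z\<in>U. \<forall>ep al nu b. V.D ep T z $ (al, nu) $ b = V.D al T z $ (ep, nu) $ b)"

lemma codazziD: "codazzi T \<Longrightarrow> z \<in> U \<Longrightarrow> V.D ep T z $ (al, nu) $ b = V.D al T z $ (ep, nu) $ b"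
  by (simp only: codazzi_def)

lemma codazzi_Rh: "codazzi Rh"
  unfolding codazzi_def
proof (intro ballI allI)
  fix z ep al nu and b :: "'m \<times> 'm" assume z: "z \<in> U"
  show "V.D ep Rh z $ (al, nu) $ b = V.D al Rh z $ (ep, nu) $ b"
    by (cases b) (simp add: V_D_Rh[OF z] base.D_curv_sym[OF z, of ep al] torsion_free[OF z, of ep al])
qed

lemma V_D_Rh_sym: assumes z: "z \<in> U"
  shows "V.D ep Rh z $ (al, nu) $ b = V.D ep Rh z $ (nu, al) $ b"
proof -
  obtain ga mu where b: "b = (ga, mu)" by (cases b)
  have "wd (- \<i>) ep (\<lambda>w. Rh w $ (al, nu) $ (ga, mu)) z = wd (- \<i>) ep (\<lambda>w. Rh w $ (nu, al) $ (ga, mu)) z"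
    by (rule wd_cong[OF open_U z]) (rule Rh_sym)
  moreover have "(\<Sum>s\<in>UNIV. c s * Rh z $ (al, s) $ (ga, mu)) = (\<Sum>s\<in>UNIV. c s * Rh z $ (s, al) $ (ga, mu))" for c al
    by (simp add: Rh_sym[OF z, of al])
  ultimately show ?thesis unfolding b V_D_nth[OF z] by (simp add: Rh_sym[OF z, of al nu])
qed

lemma D_ptr: assumes T: "msmooth U T" and z: "z \<in> U"
  shows "base.D ga (\<lambda>w. ptr (T w)) z = ptr (V.D ga T z)"
proof -
  have "base.D ga (\<lambda>w. ptr (T w)) z $ mu $ ro = ptr (V.D ga T z) $ mu $ ro" for mu ro
  proof -
    have a: "(\<Sum>d\<in>UNIV. \<Sum>s\<in>UNIV. base.conn ga z $ d $ s * T z $ (s, mu) $ (d, ro)) = (\<Sum>d\<in>UNIV. \<Sum>s\<in>UNIV. T z $ (d, mu) $ (s, ro) * base.conn ga z $ s $ d)"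
      by (subst sum.swap) (simp add: mult.commute)
    have b: "(\<Sum>s\<in>UNIV. base.conn ga z $ mu $ s * (\<Sum>d\<in>UNIV. T z $ (d, s) $ (d, ro))) = (\<Sum>d\<in>UNIV. \<Sum>s\<in>UNIV. base.conn ga z $ mu $ s * T z $ (d, s) $ (d, ro))"
      unfolding sum_distrib_left by (rule sum.swap)
    have c: "(\<Sum>s\<in>UNIV. (\<Sum>d\<in>UNIV. T z $ (d, mu) $ (d, s)) * base.conn ga z $ s $ ro) = (\<Sum>d\<in>UNIV. \<Sum>s\<in>UNIV. T z $ (d, mu) $ (d, s) * base.conn ga z $ s $ ro)"
      unfolding sum_distrib_right by (rule sum.swap)
    show ?thesis
      by (simp add: V_D_nth[OF z] base.D_def matrix_mult_nth b c wd_sum msmooth_diff_at[OF T z] sum.distrib sum_subtractf a)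
  qed
  then show ?thesis by (simp add: vec_eq_iff)
qed

lemma divergence_free:
  assumes T: "msmooth U T" and sa: "\<And>w. w \<in> U \<Longrightarrow> hadj (T w ** kron (G w) (G w)) = T w ** kron (G w) (G w)"
    and cod: "codazzi T" and tr: "\<And>w. w \<in> U \<Longrightarrow> ptr (T w) = 0" and z: "z \<in> U"
  shows "(\<Sum>ga\<in>UNIV. \<Sum>de\<in>UNIV. Gi z $ de $ ga * md \<i> de T z $ (ga, nu) $ b) = 0"
proof -
  let ?H = "kron (G z) (G z)"
  have C: "md \<i> de T z = ?H ** hadj (V.D de T z) ** V.Hi z" for de
  proof -
    have "V.Hi z ** V.D de T z ** ?H = V.Hi z ** (?H ** hadj (md \<i> de T z) ** V.Hi z) ** ?H"
      by (simp only: V.D_selfadjoint[OF T sa z])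
    also have "\<dots> = hadj (md \<i> de T z)"
      using V.Hi_simps[OF z] by (simp add: matrix_mul_assoc)
    finally have "hadj (V.Hi z ** V.D de T z ** ?H) = md \<i> de T z" by simp
    then show ?thesis using V.Hherm[OF z] V.Hi_herm[OF z] by (simp add: hadj_mult matrix_mul_assoc)
  qed
  have zero: "(\<Sum>de\<in>UNIV. V.D de T z $ c $ (de, ro)) = 0" for c ro
  proof -
    obtain be mu where c: "c = (be, mu)" by (cases c)
    have "(\<Sum>de\<in>UNIV. V.D de T z $ c $ (de, ro)) = ptr (V.D be T z) $ mu $ ro"
      unfolding c ptr_nth by (rule sum.cong[OF refl]) (rule codazziD[OF cod z])
    also have "\<dots> = base.D be (\<lambda>w. ptr (T w)) z $ mu $ ro" by (simp only: D_ptr[OF T z])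
    also have "base.D be (\<lambda>w. ptr (T w)) z = base.D be (\<lambda>w. 0) z"
      using md_cong[OF open_U z tr, where k="- \<i>" and ga=be] tr[OF z] unfolding base.D_def by simp
    also have "\<dots> $ mu $ ro = 0" by (simp add: base.D_def)
    finally show ?thesis .
  qed
  have row: "(\<Sum>ga\<in>UNIV. \<Sum>de\<in>UNIV. Gi z $ de $ ga * (?H ** hadj (V.D de T z)) $ (ga, nu) $ c) = 0" for c
  proof -
    have "(\<Sum>ga\<in>UNIV. Gi z $ de $ ga * (?H ** hadj (V.D de T z)) $ (ga, nu) $ c) = (\<Sum>ro\<in>UNIV. G z $ nu $ ro * cnj (V.D de T z $ c $ (de, ro)))" for de
    proof -
      have "(\<Sum>ga\<in>UNIV. Gi z $ de $ ga * (?H ** hadj (V.D de T z)) $ (ga, nu) $ c) =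
        (\<Sum>ga\<in>UNIV. \<Sum>si\<in>UNIV. (Gi z $ de $ ga * G z $ ga $ si) * (\<Sum>ro\<in>UNIV. G z $ nu $ ro * cnj (V.D de T z $ c $ (si, ro))))"
        by (simp add: matrix_mult_nth sum_pair sum_distrib_left mult.assoc)
      also have "\<dots> = (\<Sum>si\<in>UNIV. (Gi z ** G z) $ de $ si * (\<Sum>ro\<in>UNIV. G z $ nu $ ro * cnj (V.D de T z $ c $ (si, ro))))"
        by (subst sum.swap) (simp add: matrix_mult_nth sum_distrib_right)
      also have "\<dots> = (\<Sum>ro\<in>UNIV. G z $ nu $ ro * cnj (V.D de T z $ c $ (de, ro)))"
        by (simp add: base.Hi_simps[OF z] mat_def if_mult_zero cong: if_cong)
      finally show ?thesis .
    qed
    then have "(\<Sum>ga\<in>UNIV. \<Sum>de\<in>UNIV. Gi z $ de $ ga * (?H ** hadj (V.D de T z)) $ (ga, nu) $ c) =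
       (\<Sum>de\<in>UNIV. \<Sum>ro\<in>UNIV. G z $ nu $ ro * cnj (V.D de T z $ c $ (de, ro)))"
      by (subst sum.swap) simp
    also have "\<dots> = (\<Sum>ro\<in>UNIV. G z $ nu $ ro * cnj (\<Sum>de\<in>UNIV. V.D de T z $ c $ (de, ro)))"
      by (subst sum.swap) (simp add: sum_distrib_left)
    finally show ?thesis by (simp add: zero)
  qed
  have "(\<Sum>ga\<in>UNIV. \<Sum>de\<in>UNIV. Gi z $ de $ ga * md \<i> de T z $ (ga, nu) $ b) =
    (\<Sum>ga\<in>UNIV. \<Sum>de\<in>UNIV. \<Sum>c\<in>UNIV. Gi z $ de $ ga * (?H ** hadj (V.D de T z)) $ (ga, nu) $ c * V.Hi z $ c $ b)"
    unfolding C by (subst matrix_mult_nth) (simp only: sum_distrib_left mult.assoc)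
  also have "\<dots> = (\<Sum>c\<in>UNIV. (\<Sum>ga\<in>UNIV. \<Sum>de\<in>UNIV. Gi z $ de $ ga * (?H ** hadj (V.D de T z)) $ (ga, nu) $ c) * V.Hi z $ c $ b)"
    unfolding sum_distrib_right by (subst sum.swap[of _ UNIV "UNIV :: ('m \<times> 'm) set"], rule sum.cong[OF refl]) (rule sum.swap)
  finally show ?thesis by (simp only: row) simp
qed

lemma codazzi_laplacian:
  assumes T: "msmooth U T" and sa: "\<And>w. w \<in> U \<Longrightarrow> hadj (T w ** kron (G w) (G w)) = T w ** kron (G w) (G w)"
    and cod: "codazzi T" and tr: "\<And>w. w \<in> U \<Longrightarrow> ptr (T w) = 0" and p: "p \<in> U" "G p = mat 1"
  shows "(\<Sum>ga\<in>UNIV. md \<i> ga (V.D ga T) p $ (al, nu) $ b) =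
     (\<Sum>ga\<in>UNIV. (T p ** kder (base.curv al ga p) - kder (base.curv al ga p) ** T p) $ (ga, nu) $ b)"
proof -
  let ?C = "base.conn al p" and ?W = "\<lambda>de. md \<i> de T p"
  have Gi: "Gi p = mat 1" using matrix_inv_unique(1)[of "mat 1" "mat 1"] p by simp
  have dv: "(\<Sum>ga\<in>UNIV. ?W ga $ (ga, nu) $ b) = 0" for nu b
    using divergence_free[OF T sa cod tr p(1), of nu b] by (simp add: Gi mat_def if_mult_zero cong: if_cong)
  have A: "(\<Sum>ga\<in>UNIV. md (- \<i>) al (md \<i> ga T) p $ (ga, nu) $ b) = (\<Sum>ga\<in>UNIV. \<Sum>de\<in>UNIV. ?C $ de $ ga * ?W de $ (ga, nu) $ b)"
  proof -
    have d: "(\<lambda>w. Gi w $ de $ ga) differentiable (at p)" "(\<lambda>w. md \<i> de T w $ (ga, nu) $ b) differentiable (at p)" for de ga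
      using msmooth_diff_at[OF base.Hi_smooth p(1)] msmooth_diff_at[OF msmooth_md[OF open_U T] p(1)] by blast+
    have g: "wd (- \<i>) al (\<lambda>w. Gi w $ de $ ga) p = - ?C $ de $ ga" for de ga
      using arg_cong[OF base.md_Hi[OF p(1), of al], of "\<lambda>A. A $ de $ ga"] by (simp add: Gi)
    have "wd (- \<i>) al (\<lambda>w. \<Sum>ga\<in>UNIV. \<Sum>de\<in>UNIV. Gi w $ de $ ga * md \<i> de T w $ (ga, nu) $ b) p = wd (- \<i>) al (\<lambda>w. 0) p"
      by (rule wd_cong[OF open_U p(1)]) (rule divergence_free[OF T sa cod tr])
    moreover have "wd (- \<i>) al (\<lambda>w. \<Sum>ga\<in>UNIV. \<Sum>de\<in>UNIV. Gi w $ de $ ga * md \<i> de T w $ (ga, nu) $ b) p =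
      (\<Sum>ga\<in>UNIV. \<Sum>de\<in>UNIV. Gi p $ de $ ga * wd (- \<i>) al (\<lambda>w. md \<i> de T w $ (ga, nu) $ b) p) - (\<Sum>ga\<in>UNIV. \<Sum>de\<in>UNIV. ?C $ de $ ga * ?W de $ (ga, nu) $ b)"
    proof -
      have s1: "(\<lambda>w. Gi w $ de $ ga * md \<i> de T w $ (ga, nu) $ b) differentiable (at p)" for ga de using d by (rule differentiable_mult)
      have s2: "(\<lambda>w. \<Sum>de\<in>UNIV. Gi w $ de $ ga * md \<i> de T w $ (ga, nu) $ b) differentiable (at p)" for ga using s1 by (intro differentiable_sum) auto
      show ?thesis
        by (simp only: wd_sum[OF s2] wd_sum[OF s1] wd_mult[OF d] g) (simp add: sum.distrib sum_negf sum_subtractf)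
    qed
    ultimately show ?thesis by (simp add: Gi mat_def if_mult_zero cong: if_cong)
  qed
  have B: "(\<Sum>ga\<in>UNIV. (kder ?C ** ?W ga) $ (ga, nu) $ b) = (\<Sum>ga\<in>UNIV. \<Sum>de\<in>UNIV. ?C $ de $ ga * ?W de $ (ga, nu) $ b)"
  proof -
    have "(\<Sum>ga\<in>UNIV. \<Sum>s\<in>UNIV. ?C $ nu $ s * ?W ga $ (ga, s) $ b) = (\<Sum>s\<in>UNIV. ?C $ nu $ s * (\<Sum>ga\<in>UNIV. ?W ga $ (ga, s) $ b))"
      unfolding sum_distrib_left by (rule sum.swap)
    also have "\<dots> = 0" by (simp only: dv) simp
    finally have "(\<Sum>ga\<in>UNIV. (kder ?C ** ?W ga) $ (ga, nu) $ b) = (\<Sum>ga\<in>UNIV. \<Sum>s\<in>UNIV. ?C $ ga $ s * ?W ga $ (s, nu) $ b)"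
      by (simp only: kder_mult_nth sum.distrib) simp
    then show ?thesis by (subst (asm) sum.swap) simp
  qed
  have C: "(\<Sum>ga\<in>UNIV. (?W ga ** kder ?C) $ (ga, nu) $ b) = 0"
  proof -
    have "(\<Sum>ga\<in>UNIV. (?W ga ** kder ?C) $ (ga, nu) $ b) = (\<Sum>c\<in>UNIV. (\<Sum>ga\<in>UNIV. ?W ga $ (ga, nu) $ c) * kder ?C $ c $ b)"
      unfolding matrix_mult_nth sum_distrib_right by (rule sum.swap)
    then show ?thesis by (simp only: dv) simp
  qed
  have "(\<Sum>ga\<in>UNIV. md \<i> ga (V.D ga T) p $ (al, nu) $ b) = (\<Sum>ga\<in>UNIV. md \<i> ga (V.D al T) p $ (ga, nu) $ b)"
    unfolding md_nth by (intro sum.cong refl wd_cong[OF open_U p(1)]) (rule codazziD[OF cod])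
  also have "\<dots> = (\<Sum>ga\<in>UNIV. md (- \<i>) al (md \<i> ga T) p $ (ga, nu) $ b - (kder ?C ** ?W ga) $ (ga, nu) $ b + (?W ga ** kder ?C) $ (ga, nu) $ b
     + (T p ** kder (base.curv al ga p) - kder (base.curv al ga p) ** T p) $ (ga, nu) $ b)"
    unfolding V.dbar_D[OF T p(1)] V_conn[OF p(1)] V_curv[OF p(1)] by (simp del: md_nth add: algebra_simps)
  also have "\<dots> = (\<Sum>ga\<in>UNIV. (T p ** kder (base.curv al ga p) - kder (base.curv al ga p) ** T p) $ (ga, nu) $ b)"
    by (simp only: sum.distrib sum_subtractf A B C) simp
  finally show ?thesis .
qed

end

section \<open>Hermitian matrices\<close>

lemma norm_matrix: "(norm (A :: complex^'n::finite^'m::finite))\<^sup>2 = (\<Sum>i\<in>UNIV. \<Sum>j\<in>UNIV. (cmod (A $ i $ j))\<^sup>2)"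
  by (simp add: norm_vec_def L2_set_def sum_nonneg)

lemma inner_matrix: "(A :: complex^'n::finite^'m::finite) \<bullet> B = (\<Sum>i\<in>UNIV. \<Sum>j\<in>UNIV. Re (A $ i $ j * cnj (B $ i $ j)))"
  by (simp add: inner_vec_def inner_complex_def)

lemma trace_mult: "trace (A ** B) = (\<Sum>i\<in>UNIV. \<Sum>j\<in>UNIV. A $ i $ j * B $ j $ (i :: 'n::finite))"
  by (simp add: trace_def matrix_mult_nth)

lemma trace_sq_hermitian:
  assumes "hadj A = (A :: complex^'n::finite^'n)"
  shows "trace (A ** A) = complex_of_real ((norm A)\<^sup>2)"
proof -
  have "A $ i $ j * A $ j $ i = complex_of_real ((cmod (A $ i $ j))\<^sup>2)" for i j
    using arg_cong[OF assms, of "\<lambda>B. B $ j $ i"] complex_norm_square[of "A $ i $ j"] by simp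
  then show ?thesis by (simp add: trace_mult norm_matrix)
qed

text \<open>Test the traceless \<open>A\<close> against \<open>v v\<^sup>* - |v|\<^sup>2/N\<close>.\<close>
lemma traceless_hermitian_form_le:
  fixes A :: "complex^'n::finite^'n" and v :: "'n \<Rightarrow> complex"
  assumes tr: "trace A = 0"
  shows "Re (\<Sum>k\<in>UNIV. \<Sum>l\<in>UNIV. cnj (v k) * A $ k $ l * v l) \<le> norm A * sqrt (1 - 1 / real CARD('n)) * (\<Sum>k\<in>UNIV. (cmod (v k))\<^sup>2)"
proof -
  let ?N = "real CARD('n)"
  define n where "n = (\<Sum>k\<in>UNIV. (cmod (v k))\<^sup>2)"
  have n0: "n \<ge> 0" by (simp add: n_def sum_nonneg)
  define M :: "complex^'n^'n" where "M = (\<chi> k l. v k * cnj (v l) - (if k = l then complex_of_real (n / ?N) else 0))"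
  have 1: "A \<bullet> M = Re (\<Sum>k\<in>UNIV. \<Sum>l\<in>UNIV. cnj (v k) * A $ k $ l * v l)"
  proof -
    have "A $ k $ l * cnj (M $ k $ l) = cnj (v k) * A $ k $ l * v l - (if k = l then A $ k $ l * complex_of_real (n / ?N) else 0)" for k l
      by (simp add: M_def algebra_simps)
    then have "A \<bullet> M = Re ((\<Sum>k\<in>UNIV. \<Sum>l\<in>UNIV. cnj (v k) * A $ k $ l * v l) - trace A * complex_of_real (n / ?N))"
      unfolding inner_matrix Re_sum[symmetric] by (simp add: sum_subtractf trace_def sum_distrib_right sum_divide_distrib)
    then show ?thesis by (simp add: tr)
  qed
  have 2: "(norm M)\<^sup>2 = n\<^sup>2 * (1 - 1 / ?N)"
  proof -
    have "complex_of_real ((norm M)\<^sup>2) = (\<Sum>k\<in>UNIV. \<Sum>l\<in>UNIV. M $ k $ l * cnj (M $ k $ l))"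
      unfolding norm_matrix of_real_sum complex_norm_square ..
    also have "\<dots> = (\<Sum>k\<in>UNIV. \<Sum>l\<in>UNIV. (v k * cnj (v k)) * (v l * cnj (v l)) - (if k = l then 2 * (v k * cnj (v k)) * complex_of_real (n / ?N) else 0)
        + (if k = l then complex_of_real (n / ?N) ^ 2 else 0))"
      by (intro sum.cong refl) (auto simp: M_def algebra_simps power2_eq_square)
    also have "\<dots> = (\<Sum>k\<in>UNIV. v k * cnj (v k)) * (\<Sum>k\<in>UNIV. v k * cnj (v k)) - 2 * (\<Sum>k\<in>UNIV. v k * cnj (v k)) * complex_of_real (n / ?N) + ?N * complex_of_real (n / ?N) ^ 2"
      by (simp add: sum.distrib sum_subtractf sum_product sum_distrib_left sum_distrib_right sum_divide_distrib) (rule sum.swap)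
    also have "(\<Sum>k\<in>UNIV. v k * cnj (v k)) = complex_of_real n"
      unfolding n_def of_real_sum complex_norm_square ..
    also have "complex_of_real n * complex_of_real n - 2 * complex_of_real n * complex_of_real (n / ?N) + complex_of_real ?N * complex_of_real (n / ?N) ^ 2
       = complex_of_real (n\<^sup>2 * (1 - 1 / ?N))"
      by (simp add: field_simps power2_eq_square)
    finally show ?thesis using of_real_eq_iff by blast
  qed
  have "norm M = sqrt (n\<^sup>2 * (1 - 1 / ?N))" unfolding 2[symmetric] by simp
  also have "\<dots> = n * sqrt (1 - 1 / ?N)" using n0 by (simp add: real_sqrt_mult)
  finally have "norm M = n * sqrt (1 - 1 / ?N)" .
  then show ?thesis using norm_cauchy_schwarz[of A M] 1 by (simp add: n_def mult_ac)
qed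

lemma traceless_hermitian_cubic:
  fixes A :: "complex^'n::finite^'n"
  assumes herm: "hadj A = A" and tr: "trace A = 0" and N2: "CARD('n) \<ge> 2"
  shows "\<bar>Re (trace (A ** A ** A))\<bar> \<le> (real CARD('n) - 2) / sqrt (real CARD('n) * (real CARD('n) - 1)) * norm A ^ 3"
proof -
  have main: "Re (trace (A ** A ** A)) \<le> (real CARD('n) - 2) / sqrt (real CARD('n) * (real CARD('n) - 1)) * norm A ^ 3"
    if herm: "hadj A = A" and tr: "trace A = 0" for A :: "complex^'n^'n"
  proof -
    define N where "N = real CARD('n)"
    have N: "N \<ge> 2" using N2 by (simp add: N_def)
    define r where "r = sqrt (N * (N - 1))"
    have r: "r > 0" "r * r = N * (N - 1)" using N by (auto simp: r_def)
    define a where "a = norm A"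
    define s where "s = a * (N - 1) / r"
    define t where "t = a / r"
    have sa: "a * sqrt (1 - 1 / N) = s"
    proof -
      have "sqrt (1 - 1 / N) = (N - 1) / r"
      proof (rule real_sqrt_unique)
        have "((N - 1) / r)\<^sup>2 = (N - 1) * (N - 1) / (r * r)" by (simp add: power2_eq_square)
        also have "\<dots> = (N - 1) * (N - 1) / (N * (N - 1))" by (simp only: r(2))
        also have "\<dots> = 1 - 1 / N" using N by (simp add: field_simps)
        finally show "((N - 1) / r)\<^sup>2 = 1 - 1 / N" .
        show "0 \<le> (N - 1) / r" using N r by simp
      qed
      then show ?thesis by (simp add: s_def)
    qed
    define C where "C = A + mat (complex_of_real t)"
    have C: "C $ j $ k = cnj (C $ k $ j)" for j k
      using arg_cong[OF herm, of "\<lambda>B. B $ j $ k"] by (simp add: C_def mat_def)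
    have "Re (\<Sum>j\<in>UNIV. \<Sum>k\<in>UNIV. \<Sum>l\<in>UNIV. cnj (C $ k $ j) * A $ k $ l * C $ l $ j) \<le> (\<Sum>j\<in>UNIV. s * (\<Sum>k\<in>UNIV. (cmod (C $ k $ j))\<^sup>2))"
    proof -
      have "Re (\<Sum>k\<in>UNIV. \<Sum>l\<in>UNIV. cnj (C $ k $ j) * A $ k $ l * C $ l $ j) \<le> s * (\<Sum>k\<in>UNIV. (cmod (C $ k $ j))\<^sup>2)" for j
        using traceless_hermitian_form_le[OF tr, of "\<lambda>k. C $ k $ j"] unfolding sa[symmetric] a_def N_def .
      then show ?thesis by (subst Re_sum) (rule sum_mono)
    qed
    also have "\<dots> = s * Re (trace (C ** C))"
    proof -
      have "hadj C = C" unfolding vec_eq_iff hadj_nth by (intro allI) (rule C[symmetric])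
      from trace_sq_hermitian[OF this] have "Re (trace (C ** C)) = (norm C)\<^sup>2" by simp
      also have "\<dots> = (\<Sum>j\<in>UNIV. \<Sum>k\<in>UNIV. (cmod (C $ k $ j))\<^sup>2)" unfolding norm_matrix by (rule sum.swap)
      finally show ?thesis by (simp only: sum_distrib_left)
    qed
    also have "(\<Sum>j\<in>UNIV. \<Sum>k\<in>UNIV. \<Sum>l\<in>UNIV. cnj (C $ k $ j) * A $ k $ l * C $ l $ j) = trace (C ** A ** C)"
      unfolding trace_def matrix_mult_nth
      by (simp add: sum_distrib_right C[symmetric]) (intro sum.cong refl sum.swap)
    finally have le: "Re (trace (C ** A ** C)) \<le> s * Re (trace (C ** C))" .
    have sq: "trace (A ** A) = complex_of_real (a\<^sup>2)" using trace_sq_hermitian[OF herm] by (simp add: a_def)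
    have mt: "mat (complex_of_real c) ** B = c *\<^sub>R B" "B ** mat (complex_of_real c) = c *\<^sub>R B" for c and B :: "complex^'n^'n"
      by (simp_all add: vec_eq_iff matrix_mult_nth mat_def if_mult_zero scaleR_conv_of_real[where 'a=complex] cong: if_cong)
    have ts: "trace (c *\<^sub>R B) = complex_of_real c * trace B" for c and B :: "complex^'n^'n"
      by (simp add: trace_def sum_distrib_left scaleR_conv_of_real[where 'a=complex])
    have sA: "(c *\<^sub>R A) ** B = c *\<^sub>R (A ** B)" "A ** (c *\<^sub>R B) = c *\<^sub>R (A ** B)" for c and A B :: "complex^'n^'n"
      by (simp_all add: vec_eq_iff matrix_mult_nth scaleR_sum_right)
    have tm: "trace (mat c :: complex^'n^'n) = N * c" for c by (simp add: trace_def mat_def N_def)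
    have CC: "trace (C ** C) = a\<^sup>2 + N * t\<^sup>2"
      by (simp add: C_def mm_simps trace_add' mt ts tm sq tr power2_eq_square)
    have CAC: "trace (C ** A ** C) = trace (A ** A ** A) + 2 * t * a\<^sup>2"
      by (simp add: C_def mm_simps trace_add' mt ts sA tm sq tr)
    have "Re (trace (A ** A ** A)) \<le> s * (a\<^sup>2 + N * t\<^sup>2) - 2 * t * a\<^sup>2"
      using le unfolding CC CAC by simp
    also have "\<dots> = (N - 2) / r * a ^ 3"
    proof -
      have "s * (a\<^sup>2 + N * t\<^sup>2) - 2 * t * a\<^sup>2 = a ^ 3 / r * ((N - 1) * (1 + N / (r * r)) - 2)"
        using r(1) by (simp add: s_def t_def field_simps power2_eq_square power3_eq_cube)
      also have "N / (r * r) = 1 / (N - 1)" using N by (simp add: r(2))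
      also have "(N - 1) * (1 + 1 / (N - 1)) - 2 = N - 2" using N by (simp add: field_simps)
      finally show ?thesis by simp
    qed
    finally show ?thesis by (simp add: a_def r_def N_def)
  qed
  have "hadj (- A) = - A" "trace (- A) = 0" using herm tr by (simp_all add: vec_eq_iff trace_def sum_negf)
  from main[OF this] main[OF herm tr] show ?thesis
    by (simp add: mm_simps trace_def sum_negf abs_le_iff)
qed

lemma unitary_frame_exists:
  fixes G :: "complex^'m::finite^'m"
  assumes herm: "\<And>al be. G $ be $ al = cnj (G $ al $ be)"
    and pos: "\<And>v. v \<noteq> 0 \<Longrightarrow> 0 < Re (\<Sum>al\<in>UNIV. \<Sum>be\<in>UNIV. G $ al $ be * v $ al * cnj (v $ be))"
  shows "\<exists>P. unitary_frame G P"
proof -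
  define h where "h u v = (\<Sum>al\<in>UNIV. \<Sum>be\<in>UNIV. u $ al * cnj (v $ be) * G $ al $ be)" for u v :: "complex^'m"
  have hc: "h v u = cnj (h u v)" for u v
    unfolding h_def cnj_sum complex_cnj_mult complex_cnj_cnj herm[symmetric]
    by (subst sum.swap) (simp add: mult_ac)
  have hpos: "0 < Re (h v v)" if "v \<noteq> 0" for v
    using pos[OF that] by (simp add: h_def mult_ac)
  have hs: "h (c *s u) v = c * h u v" "h u (c *s v) = cnj c * h u v" for c u v
    by (simp_all add: h_def sum_distrib_left mult_ac)
  have "\<exists>e :: 'm \<Rightarrow> complex^'m. \<forall>a\<in>S. \<forall>b\<in>S. h (e a) (e b) = (if a = b then 1 else 0)" if "finite S" for S
    using that
  proof (induction S)
    case (insert a S)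
    then obtain e where e: "\<And>x y. x \<in> S \<Longrightarrow> y \<in> S \<Longrightarrow> h (e x) (e y) = (if x = y then 1 else 0)" by blast
    define A :: "complex^'m^'m" where "A = (\<chi> b al. if b \<in> S then (\<Sum>be\<in>UNIV. cnj (e b $ be) * G $ al $ be) else 0)"
    have "row a A = 0" using insert.hyps by (simp add: row_def A_def vec_eq_iff)
    then have "det A = 0" by (rule det_zero_row(2))
    then have "\<not> invertible A" by (simp add: invertible_det_nz)
    then obtain v where v: "v \<noteq> 0" "A *v v = 0"
      using matrix_left_invertible_ker[of A] invertible_left_inverse[of A] by blast
    have hv: "h v (e b) = 0" if "b \<in> S" for b
    proof -
      have "h v (e b) = (A *v v) $ b"
        using that by (simp add: h_def A_def matrix_vector_mult_def sum_distrib_left sum_distrib_right mult_ac)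
      then show ?thesis by (simp add: v)
    qed
    define c where "c = 1 / sqrt (Re (h v v))"
    define w where "w = complex_of_real c *s v"
    have hvr: "h v v = complex_of_real (Re (h v v))" using hc[of v v] by (simp add: complex_eq_iff)
    have "h w w = complex_of_real c * complex_of_real c * h v v" by (simp add: w_def hs)
    also have "\<dots> = complex_of_real (c * c * Re (h v v))" by (simp only: of_real_mult hvr[symmetric])
    also have "c * c * Re (h v v) = 1" using hpos[OF v(1)] by (simp add: c_def)
    also have "complex_of_real 1 = 1" by simp
    finally have ww: "h w w = 1" .
    have we: "h w (e b) = 0" "h (e b) w = 0" if "b \<in> S" for b
      using hv[OF that] hc[of w "e b"] by (simp_all add: w_def hs)
    have "\<forall>x\<in>insert a S. \<forall>y\<in>insert a S. h ((e(a := w)) x) ((e(a := w)) y) = (if x = y then 1 else 0)"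
    proof (intro ballI)
      fix x y assume xy: "x \<in> insert a S" "y \<in> insert a S"
      consider "x = a" "y = a" | "x = a" "y \<in> S" | "x \<in> S" "y = a" | "x \<in> S" "y \<in> S" using xy by blast
      then show "h ((e(a := w)) x) ((e(a := w)) y) = (if x = y then 1 else 0)"
      proof cases
        case 1
        then show ?thesis using ww by simp
      next
        case 2
        then have "y \<noteq> a" using insert.hyps by blast
        then show ?thesis using 2 we(1) by simp
      next
        case 3
        then have "x \<noteq> a" using insert.hyps by blast
        then show ?thesis using 3 we(2) by simp
      next
        case 4
        then have "x \<noteq> a" "y \<noteq> a" using insert.hyps by blast+
        then show ?thesis using e[OF 4] by simp
      qed
    qed
    then show ?case by (rule exI[of _ "e(a := w)"])
  qed auto
  from this[OF finite_class.finite_UNIV]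
  obtain e :: "'m \<Rightarrow> complex^'m" where "\<forall>a\<in>UNIV. \<forall>b\<in>UNIV. h (e a) (e b) = (if a = b then 1 else 0)" by (rule exE)
  then have e: "h (e a) (e b) = (if a = b then 1 else 0)" for a b by simp
  have "unitary_frame G (\<chi> al a. e a $ al)"
    using e by (simp add: unitary_frame_def h_def)
  then show ?thesis by blast
qed

lemma unitary_frame_matrix:
  "unitary_frame G P \<longleftrightarrow> transpose P ** G ** hadj (transpose P) = mat (1::complex)"
proof -
  have "(transpose P ** G ** hadj (transpose P)) $ a $ b = (\<Sum>al\<in>UNIV. \<Sum>be\<in>UNIV. P $ al $ a * cnj (P $ be $ b) * G $ al $ be)" for a b
    unfolding matrix_mult_nth by (simp add: transpose_def sum_distrib_right) (subst sum.swap, simp add: mult_ac)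
  then show ?thesis by (auto simp: unitary_frame_def vec_eq_iff mat_def)
qed

text \<open>\<open>T ** matrix_inv G\<close> is the endomorphism obtained by raising the barred index of \<open>T\<close>.\<close>
lemma congruence_endomorphism:
  fixes G T J :: "complex^'n::finite^'n"
  assumes "det G \<noteq> 0" "det J \<noteq> 0"
  shows "(J ** T ** hadj J) ** matrix_inv (J ** G ** hadj J) = J ** (T ** matrix_inv G) ** matrix_inv J"
    "det (J ** G ** hadj J) \<noteq> 0"
proof -
  note J = matrix_inv_right_left[OF assms(2)] and G = matrix_inv_right_left[OF assms(1)]
    and Jh = matrix_inv_right_left[OF matrix_inv_hadj(2)[OF assms(2)]]
  have "(J ** G ** hadj J) ** (matrix_inv (hadj J) ** matrix_inv G ** matrix_inv J) = J ** G ** (hadj J ** matrix_inv (hadj J)) ** matrix_inv G ** matrix_inv J"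
    by (simp add: matrix_mul_assoc)
  also have "\<dots> = J ** (G ** matrix_inv G) ** matrix_inv J" by (simp add: Jh matrix_mul_assoc)
  also have "\<dots> = mat 1" by (simp add: G J)
  finally have i: "(J ** G ** hadj J) ** (matrix_inv (hadj J) ** matrix_inv G ** matrix_inv J) = mat 1" .
  show "det (J ** G ** hadj J) \<noteq> 0" by (rule matrix_inv_unique(2)[OF i])
  have "(J ** T ** hadj J) ** matrix_inv (J ** G ** hadj J) = J ** T ** (hadj J ** matrix_inv (hadj J)) ** matrix_inv G ** matrix_inv J"
    by (simp add: matrix_inv_unique(1)[OF i] matrix_mul_assoc)
  also have "\<dots> = J ** (T ** matrix_inv G) ** matrix_inv J" by (simp add: Jh matrix_mul_assoc)
  finally show "(J ** T ** hadj J) ** matrix_inv (J ** G ** hadj J) = J ** (T ** matrix_inv G) ** matrix_inv J" .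
qed

lemma trace_conjugate_sq:
  fixes A J :: "complex^'n::finite^'n"
  assumes "det J \<noteq> 0"
  shows "trace ((J ** A ** matrix_inv J) ** (J ** A ** matrix_inv J)) = trace (A ** A)"
proof -
  note J = matrix_inv_right_left[OF assms]
  have "trace ((J ** A ** matrix_inv J) ** (J ** A ** matrix_inv J)) = trace (J ** (A ** (matrix_inv J ** J) ** A ** matrix_inv J))"
    by (simp add: matrix_mul_assoc)
  also have "\<dots> = trace ((A ** A ** matrix_inv J) ** J)" by (subst trace_mult_commute) (simp add: J matrix_mul_assoc)
  also have "\<dots> = trace (A ** A ** (matrix_inv J ** J))" by (simp add: matrix_mul_assoc)
  finally show ?thesis by (simp add: J)
qed

lemma norm2_tensor_trace:
  fixes G :: "complex^'m::finite^'m"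
  assumes G: "\<exists>P. unitary_frame G P" "det G \<noteq> 0" and T: "\<And>al be. T al be = A $ al $ be" and herm: "hadj A = A"
  shows "norm2_tensor G T = sqrt 2 * sqrt (Re (trace ((A ** matrix_inv G) ** (A ** matrix_inv G))))"
    "0 \<le> Re (trace ((A ** matrix_inv G) ** (A ** matrix_inv G)))"
proof -
  define P where "P = (SOME P. unitary_frame G P)"
  have P: "unitary_frame G P" using G(1) unfolding P_def by (rule someI_ex)
  let ?J = "transpose P"
  have JG: "?J ** G ** hadj ?J = mat 1" using P by (simp add: unitary_frame_matrix)
  have "det ?J * det G * det (hadj ?J) = 1" using arg_cong[OF JG, of det] by (simp add: det_mul)
  then have J: "det ?J \<noteq> 0" by auto
  let ?A = "?J ** A ** hadj ?J"
  have hA: "hadj ?A = ?A" by (simp add: hadj_mult herm matrix_mul_assoc)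
  have I1: "matrix_inv (mat 1 :: complex^'m^'m) = mat 1" by (rule matrix_inv_unique) simp
  have "trace (?A ** ?A) = trace ((A ** matrix_inv G) ** (A ** matrix_inv G))"
    using congruence_endomorphism(1)[OF G(2) J, of A] trace_conjugate_sq[OF J, of "A ** matrix_inv G"]
    unfolding JG I1 by simp
  then have n: "Re (trace ((A ** matrix_inv G) ** (A ** matrix_inv G))) = (norm ?A)\<^sup>2"
    using trace_sq_hermitian[OF hA] by (metis Re_complex_of_real)
  have e: "(\<Sum>al\<in>UNIV. \<Sum>be\<in>UNIV. P $ al $ a * cnj (P $ be $ b) * T al be) = ?A $ a $ b" for a b
    unfolding matrix_mult_nth T by (simp add: transpose_def sum_distrib_right) (subst sum.swap, simp add: mult_ac)
  show "norm2_tensor G T = sqrt 2 * sqrt (Re (trace ((A ** matrix_inv G) ** (A ** matrix_inv G))))"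
    unfolding norm2_tensor_def Let_def P_def[symmetric] e n norm_matrix[symmetric] by (simp add: real_sqrt_mult)
  show "0 \<le> Re (trace ((A ** matrix_inv G) ** (A ** matrix_inv G)))" by (simp add: n)
qed

lemma norm4_tensor_trace:
  fixes G :: "complex^'m::finite^'m"
  assumes G: "\<exists>P. unitary_frame G P" "det G \<noteq> 0" and T: "\<And>al be ga de. T al be ga de = A $ (ga, al) $ (de, be)" and herm: "hadj A = A"
  shows "norm4_tensor G T = 2 * sqrt (Re (trace ((A ** matrix_inv (kron G G)) ** (A ** matrix_inv (kron G G)))))"
    "0 \<le> Re (trace ((A ** matrix_inv (kron G G)) ** (A ** matrix_inv (kron G G))))"
proof -
  define P where "P = (SOME P. unitary_frame G P)"
  have P: "unitary_frame G P" using G(1) unfolding P_def by (rule someI_ex)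
  let ?J = "transpose P"
  let ?K = "kron ?J ?J" and ?H = "kron G G"
  have JG: "?J ** G ** hadj ?J = mat 1" using P by (simp add: unitary_frame_matrix)
  then have KH: "?K ** ?H ** hadj ?K = mat 1" by (simp add: hadj_kron kron_mult kron_mat1)
  have "det ?J * det G * det (hadj ?J) = 1" using arg_cong[OF JG, of det] by (simp add: det_mul)
  then have "det ?J \<noteq> 0" by auto
  then have K: "det ?K \<noteq> 0" by (simp add: kron_inv)
  have H: "det ?H \<noteq> 0" using G(2) by (simp add: kron_inv)
  let ?A = "?K ** A ** hadj ?K"
  have hA: "hadj ?A = ?A" by (simp add: hadj_mult herm matrix_mul_assoc)
  have I1: "matrix_inv (mat 1 :: complex^('m \<times> 'm)^('m \<times> 'm)) = mat 1" by (rule matrix_inv_unique) simp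
  have "trace (?A ** ?A) = trace ((A ** matrix_inv ?H) ** (A ** matrix_inv ?H))"
    using congruence_endomorphism(1)[OF H K, of A] trace_conjugate_sq[OF K, of "A ** matrix_inv ?H"]
    unfolding KH I1 by simp
  then have n: "Re (trace ((A ** matrix_inv ?H) ** (A ** matrix_inv ?H))) = (norm ?A)\<^sup>2"
    using trace_sq_hermitian[OF hA] by (metis Re_complex_of_real)
  have e: "(\<Sum>al\<in>UNIV. \<Sum>be\<in>UNIV. \<Sum>ga\<in>UNIV. \<Sum>de\<in>UNIV. P $ al $ a * cnj (P $ be $ b) * P $ ga $ c * cnj (P $ de $ d) * T al be ga de) = ?A $ (c, a) $ (d, b)" for a b c d
  proof -
    have "?A $ (c, a) $ (d, b) = (\<Sum>q\<in>UNIV. \<Sum>p\<in>UNIV. (P $ fst p $ c * P $ snd p $ a) * A $ p $ q * cnj (P $ fst q $ d * P $ snd q $ b))"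
      by (simp add: matrix_mult_nth transpose_def sum_distrib_right)
    also have "\<dots> = (\<Sum>p\<in>UNIV. \<Sum>q\<in>UNIV. (P $ fst p $ c * P $ snd p $ a) * A $ p $ q * cnj (P $ fst q $ d * P $ snd q $ b))" by (rule sum.swap)
    also have "\<dots> = (\<Sum>ga\<in>UNIV. \<Sum>al\<in>UNIV. \<Sum>de\<in>UNIV. \<Sum>be\<in>UNIV. P $ al $ a * cnj (P $ be $ b) * P $ ga $ c * cnj (P $ de $ d) * T al be ga de)"
      by (simp add: sum_pair T mult_ac)
    also have "\<dots> = (\<Sum>al\<in>UNIV. \<Sum>ga\<in>UNIV. \<Sum>be\<in>UNIV. \<Sum>de\<in>UNIV. P $ al $ a * cnj (P $ be $ b) * P $ ga $ c * cnj (P $ de $ d) * T al be ga de)"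
      by (subst sum.swap) (intro sum.cong refl sum.swap)
    also have "\<dots> = (\<Sum>al\<in>UNIV. \<Sum>be\<in>UNIV. \<Sum>ga\<in>UNIV. \<Sum>de\<in>UNIV. P $ al $ a * cnj (P $ be $ b) * P $ ga $ c * cnj (P $ de $ d) * T al be ga de)"
      by (intro sum.cong refl sum.swap)
    finally show ?thesis ..
  qed
  have "(\<Sum>a\<in>UNIV. \<Sum>b\<in>UNIV. \<Sum>c\<in>UNIV. \<Sum>d\<in>UNIV. (cmod (?A $ (c, a) $ (d, b)))\<^sup>2) = (norm ?A)\<^sup>2"
  proof -
    have "(norm ?A)\<^sup>2 = (\<Sum>c\<in>UNIV. \<Sum>a\<in>UNIV. \<Sum>d\<in>UNIV. \<Sum>b\<in>UNIV. (cmod (?A $ (c, a) $ (d, b)))\<^sup>2)"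
      by (simp only: norm_matrix sum_pair)
    also have "\<dots> = (\<Sum>a\<in>UNIV. \<Sum>c\<in>UNIV. \<Sum>b\<in>UNIV. \<Sum>d\<in>UNIV. (cmod (?A $ (c, a) $ (d, b)))\<^sup>2)"
      by (subst sum.swap) (intro sum.cong refl sum.swap)
    also have "\<dots> = (\<Sum>a\<in>UNIV. \<Sum>b\<in>UNIV. \<Sum>c\<in>UNIV. \<Sum>d\<in>UNIV. (cmod (?A $ (c, a) $ (d, b)))\<^sup>2)"
      by (intro sum.cong refl sum.swap)
    finally show ?thesis ..
  qed
  then show "norm4_tensor G T = 2 * sqrt (Re (trace ((A ** matrix_inv ?H) ** (A ** matrix_inv ?H))))"
    unfolding norm4_tensor_def Let_def P_def[symmetric] e n by (simp add: real_sqrt_mult)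
  show "0 \<le> Re (trace ((A ** matrix_inv ?H) ** (A ** matrix_inv ?H)))" by (simp add: n)
qed

section \<open>Vanishing of the traceless Ricci and Bochner tensors\<close>

definition ric_mat :: "(complex^'m \<Rightarrow> complex^'m^'m) \<Rightarrow> complex^'m::finite \<Rightarrow> complex^'m^'m" where
  "ric_mat G z = (\<chi> al be. ricci G z al be)"

definition e_mat :: "(complex^'m \<Rightarrow> complex^'m^'m) \<Rightarrow> complex^'m::finite \<Rightarrow> complex^'m^'m" where
  "e_mat G z = (\<chi> al be. traceless_ricci G z al be)"

definition e_end :: "(complex^'m \<Rightarrow> complex^'m^'m) \<Rightarrow> complex^'m::finite \<Rightarrow> complex^'m^'m" where
  "e_end G z = e_mat G z ** matrix_inv (G z)"

text \<open>A tensor with components \<open>T al be ga de\<close>, barred in \<open>be\<close> and \<open>de\<close>, is viewed as a matrix with row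
  index \<open>(ga, al)\<close> and column index \<open>(de, be)\<close>.\<close>
definition r_mat :: "(complex^'m \<Rightarrow> complex^'m^'m) \<Rightarrow> complex^'m::finite \<Rightarrow> complex^('m \<times> 'm)^('m \<times> 'm)" where
  "r_mat G z = (\<chi> p q. riemann G z (snd p) (snd q) (fst p) (fst q))"

definition b_mat :: "(complex^'m \<Rightarrow> complex^'m^'m) \<Rightarrow> complex^'m::finite \<Rightarrow> complex^('m \<times> 'm)^('m \<times> 'm)" where
  "b_mat G z = (\<chi> p q. bochner G z (snd p) (snd q) (fst p) (fst q))"

definition b_end :: "(complex^'m \<Rightarrow> complex^'m^'m) \<Rightarrow> complex^'m::finite \<Rightarrow> complex^('m \<times> 'm)^('m \<times> 'm)" where
  "b_end G z = b_mat G z ** matrix_inv (kron (G z) (G z))"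

definition swapm :: "complex^('m \<times> 'm)^('m::finite \<times> 'm)" where
  "swapm = (\<chi> p q. if fst p = snd q \<and> snd p = fst q then 1 else 0)"

lemma sum_if_const: "(\<Sum>s\<in>A. if P then f s else 0) = (if P then (\<Sum>s\<in>A. f s) else 0)"
  by auto

lemma swapm_mult:
  fixes T :: "complex^('m \<times> 'm)^('m::finite \<times> 'm)"
  shows "(swapm ** T) $ (a, n) $ b = T $ (n, a) $ b" "(T ** swapm) $ b $ (a, n) = T $ b $ (n, a)"
proof -
  have i: "(if P \<and> Q then (1::complex) else 0) = (if P then (if Q then 1 else 0) else 0)" for P Q by simp
  show "(swapm ** T) $ (a, n) $ b = T $ (n, a) $ b" "(T ** swapm) $ b $ (a, n) = T $ b $ (n, a)"
    by (simp_all add: matrix_mult_nth swapm_def sum_pair i if_mult_zero sum_if_const cong: if_cong)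
qed

lemma kder_swapm: "kder A ** swapm = swapm ** kder (A :: complex^'m::finite^'m)"
proof -
  have "(kder A ** swapm) $ (a, n) $ (c, d) = (swapm ** kder A) $ (a, n) $ (c, d)" for a n c d
    by (simp add: swapm_mult) (simp add: kder_def mat_def)
  then show ?thesis by (auto simp: vec_eq_iff)
qed

lemma kron_swapm: "kron A A ** swapm = swapm ** kron A (A :: complex^'m::finite^'m)"
proof -
  have "(kron A A ** swapm) $ (a, n) $ (c, d) = (swapm ** kron A A) $ (a, n) $ (c, d)" for a n c d
    by (simp add: swapm_mult mult.commute)
  then show ?thesis by (auto simp: vec_eq_iff)
qed

context herm_bundle begin

lemma D_diff: "msmooth U S \<Longrightarrow> msmooth U T \<Longrightarrow> z \<in> U \<Longrightarrow> D ga (\<lambda>w. S w - T w) z = D ga S z - D ga T z"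
  by (simp add: D_def md_diff mm_simps algebra_simps)

lemma D_add: "msmooth U S \<Longrightarrow> msmooth U T \<Longrightarrow> z \<in> U \<Longrightarrow> D ga (\<lambda>w. S w + T w) z = D ga S z + D ga T z"
  by (simp add: D_def md_add mm_simps algebra_simps)

end

context local_kaehler begin

lemma christoffel_conn: "christoffel G mu ga al z = base.conn ga z $ al $ mu"
  by (simp add: christoffel_def base.conn_def matrix_mult_nth g_up_def dz_wd mult.commute)

lemma riemann_curv: "riemann G z al be ga de = (base.curv ga de z ** G z) $ al $ be"
proof -
  have "christoffel G mu ga al = (\<lambda>z. base.conn ga z $ al $ mu)" for mu by (rule ext) (rule christoffel_conn)
  then show ?thesis by (simp add: riemann_def base.curv_def matrix_mult_nth dzbar_wd mult.commute)
qed

lemma md_dbar_G: assumes "z \<in> U" shows "md \<i> de G z = G z ** hadj (base.conn de z)"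
proof -
  have "md \<i> de G z = md \<i> de (\<lambda>w. hadj (G w)) z"
    by (rule md_cong[OF open_U assms]) (simp add: G_hadj)
  also have "\<dots> = hadj (md (- \<i>) de G z)" by (simp add: md_hadj[OF G_smooth assms])
  finally show ?thesis by (simp add: base.md_H[OF assms] hadj_mult G_hadj[OF assms])
qed

lemma curv_mult_G: assumes z: "z \<in> U"
  shows "base.curv ga de z ** G z = md \<i> de (md (- \<i>) ga G) z - base.conn ga z ** G z ** hadj (base.conn de z)"
proof -
  have "md \<i> de (md (- \<i>) ga G) z = md \<i> de (\<lambda>w. base.conn ga w ** G w) z"
    by (rule md_cong[OF open_U z]) (rule base.md_H)
  then show ?thesis
    by (simp add: md_mult[OF base.conn_smooth G_smooth z] base.curv_def md_dbar_G[OF z] matrix_mul_assoc)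
qed

lemma curv_herm: assumes z: "z \<in> U"
  shows "hadj (base.curv ga de z ** G z) = base.curv de ga z ** G z"
proof -
  have "hadj (md \<i> de (md (- \<i>) ga G) z) = md (- \<i>) de (\<lambda>w. hadj (md (- \<i>) ga G w)) z"
    by (simp add: md_hadj[OF msmooth_md[OF open_U G_smooth] z])
  also have "\<dots> = md (- \<i>) de (md \<i> ga G) z"
  proof (rule md_cong[OF open_U z])
    fix w assume w: "w \<in> U"
    have "hadj (md (- \<i>) ga G w) = md \<i> ga (\<lambda>w. hadj (G w)) w" by (simp add: md_hadj[OF G_smooth w])
    also have "\<dots> = md \<i> ga G w" by (rule md_cong[OF open_U w]) (simp add: G_hadj)
    finally show "hadj (md (- \<i>) ga G w) = md \<i> ga G w" .
  qed
  also have "\<dots> = md \<i> ga (md (- \<i>) de G) z" by (rule md_commute[OF open_U G_smooth z])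
  finally have "hadj (md \<i> de (md (- \<i>) ga G) z) = md \<i> ga (md (- \<i>) de G) z" .
  moreover have "hadj (A - B) = hadj A - hadj B" for A B :: "complex^'m^'m" by (simp add: vec_eq_iff)
  ultimately show ?thesis by (simp add: curv_mult_G[OF z] hadj_mult G_hadj[OF z] matrix_mul_assoc)
qed

lemma riemann_herm: "z \<in> U \<Longrightarrow> cnj (riemann G z al be ga de) = riemann G z be al de ga"
  using arg_cong[OF curv_herm, of z "\<lambda>A. A $ be $ al"] by (simp add: riemann_curv)

lemma Rh_r_mat: assumes z: "z \<in> U" shows "Rh z ** kron (G z) (G z) = r_mat G z"
proof -
  have "(Rh z ** kron (G z) (G z)) $ (al, nu) $ (de, ro) = r_mat G z $ (al, nu) $ (de, ro)" for al nu de ro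
  proof -
    have "(Rh z ** kron (G z) (G z)) $ (al, nu) $ (de, ro) = (\<Sum>ga\<in>UNIV. \<Sum>mu\<in>UNIV. \<Sum>d\<in>UNIV. (Gi z $ d $ ga * G z $ ga $ de) * (base.curv al d z $ nu $ mu * G z $ mu $ ro))"
      by (simp add: matrix_mult_nth sum_pair Rh_nth sum_distrib_left mult_ac)
    also have "\<dots> = (\<Sum>ga\<in>UNIV. \<Sum>d\<in>UNIV. \<Sum>mu\<in>UNIV. (Gi z $ d $ ga * G z $ ga $ de) * (base.curv al d z $ nu $ mu * G z $ mu $ ro))"
      by (intro sum.cong refl sum.swap)
    also have "\<dots> = (\<Sum>d\<in>UNIV. (Gi z ** G z) $ d $ de * (base.curv al d z ** G z) $ nu $ ro)"
      by (subst sum.swap) (simp add: matrix_mult_nth sum_product)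
    also have "\<dots> = (base.curv al de z ** G z) $ nu $ ro"
      by (simp add: base.Hi_simps[OF z] mat_def if_mult_zero cong: if_cong)
    finally show ?thesis by (simp add: r_mat_def riemann_curv)
  qed
  then show ?thesis by (auto simp: vec_eq_iff)
qed

definition Ric :: "complex^'m \<Rightarrow> complex^'m^'m" where "Ric z = - ptr (Rh z)"

lemma ricci_Ric: "ric_mat G z = Ric z ** G z"
proof -
  have "ricci G z al be = (Ric z ** G z) $ al $ be" for al be
  proof -
    have "(\<Sum>ga\<in>UNIV. \<Sum>de\<in>UNIV. g_up (G z) ga de * riemann G z al be ga de) = (\<Sum>ga\<in>UNIV. \<Sum>de\<in>UNIV. \<Sum>mu\<in>UNIV. Gi z $ de $ ga * base.curv ga de z $ al $ mu * G z $ mu $ be)"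
      by (simp add: riemann_curv matrix_mult_nth g_up_def sum_distrib_left mult.assoc)
    also have "\<dots> = (\<Sum>ga\<in>UNIV. \<Sum>mu\<in>UNIV. \<Sum>de\<in>UNIV. Gi z $ de $ ga * base.curv ga de z $ al $ mu * G z $ mu $ be)"
      by (intro sum.cong refl sum.swap)
    also have "\<dots> = (\<Sum>mu\<in>UNIV. ptr (Rh z) $ al $ mu * G z $ mu $ be)"
      by (subst sum.swap) (simp add: Rh_nth sum_distrib_right)
    finally show ?thesis by (simp add: ricci_def Ric_def mm_simps matrix_mult_nth)
  qed
  then show ?thesis by (simp add: vec_eq_iff ric_mat_def)
qed

lemma Ric_smooth: "msmooth U Ric"
  unfolding msmooth_def Ric_def
  using msmoothD[OF Rh_smooth] by (auto intro!: smooth_on_minus smooth_on_sum open_U)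

lemma scalar_Ric: assumes "z \<in> U" shows "scalar_curv G z = trace (Ric z)"
proof -
  have "scalar_curv G z = trace (ric_mat G z ** Gi z)"
    by (simp add: scalar_curv_def trace_mult ric_mat_def g_up_def mult.commute)
  then show ?thesis by (simp add: ricci_Ric base.Hi_simps[OF assms] matrix_mul_assoc)
qed

lemma ric_mat_herm: assumes z: "z \<in> U" shows "hadj (ric_mat G z) = ric_mat G z"
proof -
  have "cnj (ricci G z be al) = ricci G z al be" for al be
  proof -
    have g: "cnj (g_up (G z) ga de) = g_up (G z) de ga" for ga de
      using arg_cong[OF base.Hi_herm[OF z], of "\<lambda>A. A $ ga $ de"] by (simp add: g_up_def)
    show ?thesis unfolding ricci_def by (subst sum.swap) (simp add: g riemann_herm[OF z])
  qed
  then show ?thesis by (simp add: vec_eq_iff ric_mat_def)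
qed

lemma e_mat_eq: "e_mat G z = ric_mat G z - mat (scalar_curv G z / of_nat CARD('m)) ** G z"
  by (simp add: vec_eq_iff e_mat_def ric_mat_def traceless_ricci_def matrix_mult_nth mat_def if_mult_zero cong: if_cong)

lemma e_end_eq: "z \<in> U \<Longrightarrow> e_end G z = Ric z - mat (scalar_curv G z / of_nat CARD('m))"
  by (simp add: e_end_def e_mat_eq ricci_Ric mm_simps base.Hi_simps)

lemma G_frame: "z \<in> U \<Longrightarrow> \<exists>P. unitary_frame (G z) P"
  by (rule unitary_frame_exists, rule G_herm, assumption, rule G_pos)

end

locale csc_kaehler = local_kaehler U G for U :: "(complex^'m::finite) set" and G :: "complex^'m \<Rightarrow> complex^'m^'m" +
  fixes R :: real
  assumes scal: "z \<in> U \<Longrightarrow> scalar_curv G z = complex_of_real R"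
begin

lemma e_end_R: "z \<in> U \<Longrightarrow> e_end G z = Ric z - mat (complex_of_real (R / real CARD('m)))"
  by (simp add: e_end_eq scal)

lemma cnj_ricci: assumes "z \<in> U" shows "cnj (ricci G z be al) = ricci G z al be"
  using arg_cong[OF ric_mat_herm[OF assms], of "\<lambda>A. A $ al $ be"] by (simp add: ric_mat_def)

lemma e_mat_herm: assumes "z \<in> U" shows "hadj (e_mat G z) = e_mat G z"
  by (simp add: vec_eq_iff e_mat_def traceless_ricci_def scal[OF assms] cnj_ricci[OF assms] G_herm[OF assms, symmetric])

lemma b_mat_herm: assumes "z \<in> U" shows "hadj (b_mat G z) = b_mat G z"
proof -
  have "cnj (bochner G z be al de ga) = bochner G z al be ga de" for al be ga de
    by (simp add: bochner_def cnj_ricci[OF assms] riemann_herm[OF assms] scal[OF assms] G_herm[OF assms, symmetric] add_ac mult_ac)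
  then show ?thesis by (simp add: vec_eq_iff b_mat_def)
qed

lemma norm_E_trace: assumes "z \<in> U"
  shows "norm_E G z = sqrt 2 * sqrt (Re (trace (e_end G z ** e_end G z)))" "0 \<le> Re (trace (e_end G z ** e_end G z))"
  using norm2_tensor_trace[OF G_frame[OF assms] G_det[OF assms] _ e_mat_herm[OF assms], of "traceless_ricci G z"]
  by (simp_all add: norm_E_def e_end_def e_mat_def)

lemma norm_B_trace: assumes "z \<in> U"
  shows "norm_B G z = 2 * sqrt (Re (trace (b_end G z ** b_end G z)))" "0 \<le> Re (trace (b_end G z ** b_end G z))"
  using norm4_tensor_trace[OF G_frame[OF assms] G_det[OF assms] _ b_mat_herm[OF assms], of "bochner G z"]
  by (simp_all add: norm_B_def b_end_def b_mat_def)

end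

context local_kaehler begin

lemma codazzi_max_inequality:
  assumes T: "msmooth U T" and sa: "\<And>w. w \<in> U \<Longrightarrow> hadj (T w ** kron (G w) (G w)) = T w ** kron (G w) (G w)"
    and cod: "codazzi T" and tr: "\<And>w. w \<in> U \<Longrightarrow> ptr (T w) = 0" and p: "p \<in> U" "G p = mat 1"
    and max: "\<And>w. w \<in> U \<Longrightarrow> Re (trace (T w ** T w)) \<le> Re (trace (T p ** T p))"
  defines "t \<equiv> T p" and "r \<equiv> Rh p"
  shows "Re (\<Sum>be\<in>UNIV. \<Sum>mu\<in>UNIV. \<Sum>al\<in>UNIV. \<Sum>nu\<in>UNIV. t $ (be, mu) $ (al, nu) *
     (\<Sum>ga\<in>UNIV. \<Sum>s\<in>UNIV. t $ (ga, nu) $ (s, mu) * r $ (al, s) $ (ga, be) + t $ (ga, nu) $ (be, s) * r $ (al, s) $ (ga, mu)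
        - r $ (al, ga) $ (ga, s) * t $ (s, nu) $ (be, mu) - r $ (al, nu) $ (ga, s) * t $ (ga, s) $ (be, mu))) \<le> 0"
proof -
  have Gi: "Gi p = mat 1" using matrix_inv_unique(1)[of "mat 1" "mat 1"] p by simp
  have c: "base.curv al ga p $ nu $ mu = r $ (al, nu) $ (ga, mu)" for al ga nu mu
    by (simp add: r_def Rh_nth Gi mat_def if_mult_zero cong: if_cong)
  let ?M = "\<lambda>ga. md \<i> ga (V.D ga T) p"
  have L: "(\<Sum>ga\<in>UNIV. ?M ga $ (al, nu) $ (be, mu)) =
     (\<Sum>ga\<in>UNIV. \<Sum>s\<in>UNIV. t $ (ga, nu) $ (s, mu) * r $ (al, s) $ (ga, be) + t $ (ga, nu) $ (be, s) * r $ (al, s) $ (ga, mu)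
        - r $ (al, ga) $ (ga, s) * t $ (s, nu) $ (be, mu) - r $ (al, nu) $ (ga, s) * t $ (ga, s) $ (be, mu))"
    for al nu be mu
    using codazzi_laplacian[OF T sa cod tr p, of al nu "(be, mu)"] unfolding t_def[symmetric]
    by (simp only: vector_minus_component kder_mult_nth c sum.distrib sum_subtractf diff_diff_eq)
  have "Re (\<Sum>ga\<in>UNIV. trace (t ** ?M ga)) \<le> 0"
    unfolding Re_sum t_def
    by (intro sum_nonpos V.maximum_principle[OF T sa p(1) _ max]) (auto simp: p kron_mat1)
  also have "(\<Sum>ga\<in>UNIV. trace (t ** ?M ga)) = (\<Sum>b\<in>UNIV. \<Sum>a\<in>UNIV. t $ b $ a * (\<Sum>ga\<in>UNIV. ?M ga $ a $ b))"
    unfolding trace_mult sum_distrib_left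
    by (subst sum.swap) (intro sum.cong refl sum.swap)
  also have "\<dots> = (\<Sum>be\<in>UNIV. \<Sum>mu\<in>UNIV. \<Sum>al\<in>UNIV. \<Sum>nu\<in>UNIV. t $ (be, mu) $ (al, nu) *
     (\<Sum>ga\<in>UNIV. \<Sum>s\<in>UNIV. t $ (ga, nu) $ (s, mu) * r $ (al, s) $ (ga, be) + t $ (ga, nu) $ (be, s) * r $ (al, s) $ (ga, mu)
        - r $ (al, ga) $ (ga, s) * t $ (s, nu) $ (be, mu) - r $ (al, nu) $ (ga, s) * t $ (ga, s) $ (be, mu)))"
    unfolding sum_pair L ..
  finally show ?thesis .
qed

end

lemma kron_zero [simp]: "kron A 0 = 0" "kron 0 A = 0"
  by (simp_all add: vec_eq_iff)

lemma mat_commute: "mat c ** A = A ** mat (c :: complex)" for A :: "complex^'n::finite^'n"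
  by (simp add: vec_eq_iff matrix_mult_nth mat_def if_mult_zero mult.commute cong: if_cong)

lemma trace_mat: "trace (mat c :: complex^'n::finite^'n) = of_nat CARD('n) * c"
  by (simp add: trace_def mat_def)

lemma ptr_kron: "ptr (kron A (mat 1)) = mat (trace (A :: complex^'m::finite^'m))"
  by (simp add: vec_eq_iff trace_def mat_def)

lemma cubic_coefficient_le_1:
  fixes N :: real assumes "N \<ge> 2"
  shows "(N - 2) / sqrt (N * (N - 1)) \<le> 1"
proof -
  have "N - 2 \<le> sqrt (N * (N - 1))"
  proof (rule real_le_rsqrt)
    show "(N - 2)\<^sup>2 \<le> N * (N - 1)" using assms by (simp add: power2_eq_square algebra_simps)
  qed
  moreover have "sqrt (N * (N - 1)) > 0" using assms by simp
  ultimately show ?thesis by (simp add: divide_le_eq)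
qed

lemma pinching_constant_le:
  fixes m :: real assumes "m \<ge> 2"
  shows "sqrt (m\<^sup>2 - 1) / (3 * (m\<^sup>2 - 2)) \<le> 1 / (m + 1)"
proof -
  have m2: "m * m \<ge> 2 * m" using assms by simp
  have "sqrt (m\<^sup>2 - 1) \<le> m - 1 / (2 * m)"
  proof (rule real_le_lsqrt)
    have "1 \<le> 2 * (m * m)" using assms m2 by linarith
    then have "1 / (2 * m) \<le> m" using assms by (simp add: divide_le_eq mult_ac)
    then show "0 \<le> m - 1 / (2 * m)" by simp
    show "m\<^sup>2 - 1 \<le> (m - 1 / (2 * m))\<^sup>2" using assms by (simp add: power2_eq_square field_simps)
  qed
  moreover have "(m - 1 / (2 * m)) * (m + 1) \<le> 3 * (m\<^sup>2 - 2)"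
  proof -
    have "(m - 1 / (2 * m)) * (m + 1) = m * m + m - 1/2 - 1 / (2 * m)" using assms by (simp add: field_simps)
    moreover have "2 * (m * m) - m - 6 + 1/2 + 1 / (2 * m) \<ge> 0"
    proof -
      have "2 * (m * m) - m - 6 + 1/2 + 1 / (2 * m) = (m - 2) * (2 * m + 3) + 1/2 + 1 / (2 * m)" by (simp add: algebra_simps)
      moreover have "(m - 2) * (2 * m + 3) \<ge> 0" using assms by simp
      moreover have "1 / (2 * m) \<ge> 0" using assms by simp
      ultimately show ?thesis by linarith
    qed
    ultimately show ?thesis by (simp add: power2_eq_square)
  qed
  ultimately have "sqrt (m\<^sup>2 - 1) * (m + 1) \<le> 3 * (m\<^sup>2 - 2)"
    using assms mult_right_mono[of "sqrt (m\<^sup>2 - 1)" "m - 1 / (2 * m)" "m + 1"] by linarith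
  moreover have "m * m > 2" using m2 assms by linarith
  then have "3 * (m\<^sup>2 - 2) > 0" by (simp add: power2_eq_square)
  ultimately show ?thesis using assms by (simp add: field_simps)
qed

context csc_kaehler begin

definition E :: "complex^'m \<Rightarrow> complex^'m^'m" where "E z = Ric z - mat (complex_of_real (R / real CARD('m)))"

lemma E_smooth: "msmooth U E"
  unfolding E_def[abs_def] by (intro msmooth_diff open_U Ric_smooth msmooth_const)

lemma E_e_end: "z \<in> U \<Longrightarrow> e_end G z = E z"
  by (simp add: e_end_R E_def)

lemma E_e_mat: assumes "z \<in> U" shows "E z ** G z = e_mat G z"
  using E_e_end[OF assms] base.Hi_simps(4)[OF assms] by (metis e_end_def)

lemma trace_E: assumes "z \<in> U" shows "trace (E z) = 0"
  using scalar_Ric[OF assms] scal[OF assms] by (simp add: E_def trace_diff' trace_mat)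

lemma D_E: assumes z: "z \<in> U" shows "base.D ga E z = - ptr (V.D ga Rh z)"
proof -
  have s: "msmooth U (\<lambda>w. ptr (Rh w))"
    using msmoothD[OF Rh_smooth] by (auto simp: msmooth_def intro!: smooth_on_sum open_U)
  have c: "base.D ga (\<lambda>w. mat c) z = 0" for c by (simp add: base.D_def mat_commute)
  have r: "Ric = (\<lambda>w. mat 0 - ptr (Rh w))" by (simp add: fun_eq_iff Ric_def mat_def vec_eq_iff)
  have "base.D ga E z = base.D ga Ric z"
    unfolding E_def[abs_def] by (simp add: base.D_diff[OF Ric_smooth msmooth_const[OF open_U] z] c)
  also have "\<dots> = - base.D ga (\<lambda>w. ptr (Rh w)) z"
    unfolding r by (simp only: base.D_diff[OF msmooth_const[OF open_U] s z] c) simp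
  finally show ?thesis by (simp add: D_ptr[OF Rh_smooth z])
qed

lemma D_E_sym: assumes z: "z \<in> U" shows "base.D ga E z $ al $ be = base.D al E z $ ga $ be"
proof -
  have "V.D ga Rh z $ (de, al) $ b = V.D al Rh z $ (de, ga) $ b" for de b
  proof -
    have "V.D ga Rh z $ (de, al) $ b = V.D ga Rh z $ (al, de) $ b" by (rule V_D_Rh_sym[OF z])
    also have "\<dots> = V.D al Rh z $ (ga, de) $ b" by (rule codazziD[OF codazzi_Rh z])
    also have "\<dots> = V.D al Rh z $ (de, ga) $ b" by (rule V_D_Rh_sym[OF z])
    finally show ?thesis .
  qed
  then show ?thesis by (simp add: D_E[OF z])
qed

lemma V_D_kron: assumes z: "z \<in> U" and A: "msmooth U A"
  shows "V.D ga (\<lambda>w. kron (A w) (mat 1)) z = kron (base.D ga A z) (mat 1)"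
  by (simp add: V.D_def base.D_def V_conn[OF z] md_kron[OF A msmooth_const[OF open_U] z] kder_def mm_simps kron_mult
      kron_diff_left kron_add_left)

lemma einstein_at_max:
  assumes p: "p \<in> U" "G p = mat 1" and m2: "CARD('m) \<ge> 2" and R: "R > 0"
    and max: "\<And>w. w \<in> U \<Longrightarrow> Re (trace (e_end G w ** e_end G w)) \<le> Re (trace (e_end G p ** e_end G p))"
    and pinch: "sqrt 2 * norm_E G p + norm_B G p < 2 * sqrt ((real CARD('m))\<^sup>2 - 1) * R / (3 * ((real CARD('m))\<^sup>2 - 2))"
  shows "e_end G p = 0"
proof (rule ccontr)
  assume ne: "e_end G p \<noteq> 0"
  define m where "m = real CARD('m)"
  have m: "m \<ge> 2" using m2 by (simp add: m_def)
  define T where "T z = kron (E z) (mat 1)" for z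
  have Ts: "msmooth U T" unfolding T_def[abs_def] by (intro msmooth_kron open_U E_smooth msmooth_const)
  have sa: "hadj (T w ** kron (G w) (G w)) = T w ** kron (G w) (G w)" if "w \<in> U" for w
    by (simp add: T_def kron_mult E_e_mat[OF that] hadj_kron e_mat_herm[OF that] G_hadj[OF that])
  have cod: "codazzi T"
    unfolding codazzi_def
  proof (intro ballI allI)
    fix z ep al nu and b :: "'m \<times> 'm" assume z: "z \<in> U"
    show "V.D ep T z $ (al, nu) $ b = V.D al T z $ (ep, nu) $ b"
      unfolding T_def[abs_def] V_D_kron[OF z E_smooth] kron_nth fst_conv snd_conv by (simp only: D_E_sym[OF z, of ep al])
  qed
  have tr: "ptr (T w) = 0" if "w \<in> U" for w
    by (simp add: T_def ptr_kron trace_E[OF that])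
  have TT: "trace (T w ** T w) = complex_of_real m * trace (e_end G w ** e_end G w)" if "w \<in> U" for w
  proof -
    have "T w ** T w = kron (E w ** E w) (mat 1)" by (simp add: T_def kron_mult)
    then show ?thesis
      by (simp add: E_e_end[OF that] m_def trace_def sum_pair mat_def sum_distrib_left mult.commute)
  qed
  have max': "Re (trace (T w ** T w)) \<le> Re (trace (T p ** T p))" if "w \<in> U" for w
    using max[OF that] m by (simp add: TT[OF that] TT[OF p(1)])
  define e where "e = E p"
  define r where "r = Rh p"
  define ro where "ro = Ric p"
  define b where "b = b_mat G p"
  have I1: "matrix_inv (mat 1 :: complex^'n::finite^'n) = mat 1" by (rule matrix_inv_unique) simp
  have ee: "e_end G p = e" "e_mat G p = e" using E_e_end[OF p(1)] E_e_mat[OF p(1)] by (simp_all add: e_def p(2))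
  have be: "b_end G p = b" by (simp add: b_end_def b_def p(2) kron_mat1 I1)
  have he: "hadj e = e" using e_mat_herm[OF p(1)] ee by simp
  have hb: "hadj b = b" using b_mat_herm[OF p(1)] by (simp add: b_def)
  have te: "trace e = 0" using trace_E[OF p(1)] by (simp add: e_def)
  let ?k = "complex_of_real (R / m)"
  have ro: "ro = e + mat ?k" by (simp add: ro_def e_def E_def m_def)
  let ?I = "\<lambda>x y :: 'm. if x = y then 1 else (0::complex)"
  have rb: "r $ (al, s) $ (ga, be) = b $ (al, s) $ (ga, be)
     - complex_of_real (1 / (m + 2)) * (ro $ s $ be * ?I al ga + ro $ al $ be * ?I s ga + ?I s be * ro $ al $ ga + ?I al be * ro $ s $ ga)
     + complex_of_real (R / ((m + 1) * (m + 2))) * (?I s be * ?I al ga + ?I al be * ?I s ga)" for al s ga be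
  proof -
    have "r = r_mat G p" using Rh_r_mat[OF p(1)] by (simp add: r_def p(2) kron_mat1)
    then have "r $ (al, s) $ (ga, be) = riemann G p s be al ga" by (simp add: r_mat_def)
    moreover have "ricci G p al be = ro $ al $ be" for al be
      using arg_cong[OF ricci_Ric[of p], of "\<lambda>A. A $ al $ be"] by (simp add: ric_mat_def ro_def p(2))
    moreover have "G p $ al $ be = ?I al be" for al be by (simp add: p(2) mat_def)
    ultimately show ?thesis
      by (simp only: b_def b_mat_def vec_lambda_beta fst_conv snd_conv bochner_def scal[OF p(1)]) (simp add: m_def)
  qed
  have rr: "(\<Sum>ga\<in>UNIV. r $ (al, ga) $ (ga, s)) = - ro $ al $ s" for al s
    unfolding r_def by (subst Rh_sym[OF p(1)]) (simp add: ro_def Ric_def)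
  define A1 where "A1 = (\<Sum>be\<in>UNIV. \<Sum>al\<in>UNIV. \<Sum>ga\<in>UNIV. \<Sum>s\<in>UNIV. e $ be $ al * e $ ga $ s * r $ (al, s) $ (ga, be))"
  define Bt where "Bt = (\<Sum>be\<in>UNIV. \<Sum>al\<in>UNIV. \<Sum>ga\<in>UNIV. \<Sum>s\<in>UNIV. e $ be $ al * e $ ga $ s * b $ (al, s) $ (ga, be))"
  have SS: "Re (complex_of_real m * (A1 + trace (e ** ro ** e))) \<le> 0"
  proof -
    have inner: "(\<Sum>ga\<in>UNIV. \<Sum>s\<in>UNIV. T p $ (ga, mu) $ (s, mu) * r $ (al, s) $ (ga, be) + T p $ (ga, mu) $ (be, s) * r $ (al, s) $ (ga, mu)
        - r $ (al, ga) $ (ga, s) * T p $ (s, mu) $ (be, mu) - r $ (al, mu) $ (ga, s) * T p $ (ga, s) $ (be, mu))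
      = (\<Sum>ga\<in>UNIV. \<Sum>s\<in>UNIV. e $ ga $ s * r $ (al, s) $ (ga, be)) + (ro ** e) $ al $ be" for al be mu
    proof -
      have 1: "(\<Sum>ga\<in>UNIV. \<Sum>s\<in>UNIV. T p $ (ga, mu) $ (be, s) * r $ (al, s) $ (ga, mu)) = (\<Sum>ga\<in>UNIV. e $ ga $ be * r $ (al, mu) $ (ga, mu))"
        by (simp add: T_def e_def[symmetric] mat_def if_mult_zero cong: if_cong)
      have 2: "(\<Sum>ga\<in>UNIV. \<Sum>s\<in>UNIV. r $ (al, mu) $ (ga, s) * T p $ (ga, s) $ (be, mu)) = (\<Sum>ga\<in>UNIV. e $ ga $ be * r $ (al, mu) $ (ga, mu))"
        by (simp add: T_def e_def[symmetric] mat_def if_mult_zero mult.commute cong: if_cong)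
      have 3: "(\<Sum>ga\<in>UNIV. \<Sum>s\<in>UNIV. r $ (al, ga) $ (ga, s) * T p $ (s, mu) $ (be, mu)) = - (ro ** e) $ al $ be"
      proof -
        have "(\<Sum>ga\<in>UNIV. \<Sum>s\<in>UNIV. r $ (al, ga) $ (ga, s) * T p $ (s, mu) $ (be, mu)) = (\<Sum>s\<in>UNIV. (\<Sum>ga\<in>UNIV. r $ (al, ga) $ (ga, s)) * e $ s $ be)"
          by (subst sum.swap) (simp add: T_def e_def[symmetric] mat_def sum_distrib_right)
        then show ?thesis by (simp add: rr matrix_mult_nth sum_negf)
      qed
      have 4: "(\<Sum>ga\<in>UNIV. \<Sum>s\<in>UNIV. T p $ (ga, mu) $ (s, mu) * r $ (al, s) $ (ga, be)) = (\<Sum>ga\<in>UNIV. \<Sum>s\<in>UNIV. e $ ga $ s * r $ (al, s) $ (ga, be))"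
        by (simp add: T_def e_def[symmetric] mat_def)
      show ?thesis unfolding sum_subtractf sum.distrib 1 2 3 4 by simp
    qed
    have "(\<Sum>be\<in>UNIV. \<Sum>mu\<in>UNIV. \<Sum>al\<in>UNIV. \<Sum>nu\<in>UNIV. T p $ (be, mu) $ (al, nu) *
     (\<Sum>ga\<in>UNIV. \<Sum>s\<in>UNIV. T p $ (ga, nu) $ (s, mu) * r $ (al, s) $ (ga, be) + T p $ (ga, nu) $ (be, s) * r $ (al, s) $ (ga, mu)
        - r $ (al, ga) $ (ga, s) * T p $ (s, nu) $ (be, mu) - r $ (al, nu) $ (ga, s) * T p $ (ga, s) $ (be, mu)))
      = (\<Sum>be\<in>UNIV. \<Sum>mu\<in>(UNIV :: 'm set). \<Sum>al\<in>UNIV. e $ be $ al * ((\<Sum>ga\<in>UNIV. \<Sum>s\<in>UNIV. e $ ga $ s * r $ (al, s) $ (ga, be)) + (ro ** e) $ al $ be))"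
      (is "(\<Sum>be\<in>UNIV. \<Sum>mu\<in>UNIV. \<Sum>al\<in>UNIV. \<Sum>nu\<in>UNIV. _ * ?f al be mu nu) = _")
    proof (intro sum.cong refl)
      fix be mu al
      have "(\<Sum>nu\<in>UNIV. T p $ (be, mu) $ (al, nu) * f nu) = e $ be $ al * f mu" for f
        by (simp add: T_def e_def[symmetric] mat_def if_mult_zero cong: if_cong)
      then show "(\<Sum>nu\<in>UNIV. T p $ (be, mu) $ (al, nu) * ?f al be mu nu) = e $ be $ al * ((\<Sum>ga\<in>UNIV. \<Sum>s\<in>UNIV. e $ ga $ s * r $ (al, s) $ (ga, be)) + (ro ** e) $ al $ be)"
        by (simp only: inner)
    qed
    also have "\<dots> = complex_of_real m * (A1 + trace (e ** ro ** e))"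
      by (simp add: A1_def trace_mult matrix_mul_assoc[symmetric] m_def distrib_left sum.distrib sum_distrib_left mult_ac)
    finally show ?thesis
      using codazzi_max_inequality[OF Ts sa cod tr p max'] unfolding r_def by simp
  qed
  have A1: "A1 = Bt - complex_of_real (1 / (m + 2)) * (trace (e ** e ** ro) + trace (e ** ro ** e)) + complex_of_real (R / ((m + 1) * (m + 2))) * trace (e ** e)"
  proof -
    let ?S = "\<lambda>f :: 'm \<Rightarrow> 'm \<Rightarrow> 'm \<Rightarrow> 'm \<Rightarrow> complex. \<Sum>be\<in>UNIV. \<Sum>al\<in>UNIV. \<Sum>ga\<in>UNIV. \<Sum>s\<in>UNIV. e $ be $ al * e $ ga $ s * f be al ga s"
    have lin: "?S (\<lambda>be al ga s. f0 be al ga s - c1 * (f1 be al ga s + f2 be al ga s + f3 be al ga s + f4 be al ga s) + c2 * (f5 be al ga s + f6 be al ga s))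
       = ?S f0 - c1 * (?S f1 + ?S f2 + ?S f3 + ?S f4) + c2 * (?S f5 + ?S f6)" for f0 f1 f2 f3 f4 f5 f6 c1 c2
      by (simp add: sum_distrib_left sum.distrib sum_subtractf algebra_simps)
    have 1: "?S (\<lambda>be al ga s. ro $ s $ be * ?I al ga) = trace (e ** e ** ro)"
      by (simp add: if_mult_zero sum_if_const trace_mult matrix_mul_assoc[symmetric] matrix_mult_nth sum_distrib_left mult.assoc cong: if_cong)
    have 2: "?S (\<lambda>be al ga s. ro $ al $ be * ?I s ga) = 0"
    proof -
      have "?S (\<lambda>be al ga s. ro $ al $ be * ?I s ga) = trace (e ** ro) * trace e"
        by (simp add: if_mult_zero sum_if_const trace_mult) (simp add: trace_def sum_distrib_left sum_distrib_right mult_ac)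
      then show ?thesis by (simp add: te)
    qed
    have 3: "?S (\<lambda>be al ga s. ?I s be * ro $ al $ ga) = trace (e ** ro ** e)"
      by (simp add: if_mult_zero sum_if_const trace_mult matrix_mul_assoc[symmetric] matrix_mult_nth sum_distrib_left mult_ac cong: if_cong)
    have 4: "?S (\<lambda>be al ga s. ?I al be * ro $ s $ ga) = 0"
    proof -
      have "?S (\<lambda>be al ga s. ?I al be * ro $ s $ ga) = (\<Sum>be\<in>UNIV. e $ be $ be * (\<Sum>ga\<in>UNIV. \<Sum>s\<in>UNIV. e $ ga $ s * ro $ s $ ga))"
        by (simp add: if_mult_zero sum_if_const sum_distrib_left mult_ac cong: if_cong)
      also have "\<dots> = trace e * trace (e ** ro)"
        by (simp only: trace_mult trace_def[of e] sum_distrib_right)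
      finally have "?S (\<lambda>be al ga s. ?I al be * ro $ s $ ga) = trace e * trace (e ** ro)" .
      then show ?thesis by (simp add: te)
    qed
    have 5: "?S (\<lambda>be al ga s. ?I s be * ?I al ga) = trace (e ** e)"
      by (simp add: if_mult_zero sum_if_const trace_mult cong: if_cong)
    have 6: "?S (\<lambda>be al ga s. ?I al be * ?I s ga) = 0"
    proof -
      have "?S (\<lambda>be al ga s. ?I al be * ?I s ga) = trace e * trace e"
        by (simp add: if_mult_zero sum_if_const cong: if_cong) (simp add: trace_def sum_distrib_left sum_distrib_right mult_ac)
      then show ?thesis by (simp add: te)
    qed
    have "A1 = ?S (\<lambda>be al ga s. b $ (al, s) $ (ga, be)
     - complex_of_real (1 / (m + 2)) * (ro $ s $ be * ?I al ga + ro $ al $ be * ?I s ga + ?I s be * ro $ al $ ga + ?I al be * ro $ s $ ga)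
     + complex_of_real (R / ((m + 1) * (m + 2))) * (?I s be * ?I al ga + ?I al be * ?I s ga))"
      unfolding A1_def rb ..
    also have "\<dots> = Bt - complex_of_real (1 / (m + 2)) * (trace (e ** e ** ro) + 0 + trace (e ** ro ** e) + 0) + complex_of_real (R / ((m + 1) * (m + 2))) * (trace (e ** e) + 0)"
      unfolding lin 1 2 3 4 5 6 Bt_def ..
    finally show ?thesis by simp
  qed
  define N where "N = norm e"
  define t3 where "t3 = Re (trace (e ** e ** e))"
  have N: "N > 0" using ne ee by (simp add: N_def)
  have t2: "trace (e ** e) = complex_of_real (N\<^sup>2)" using trace_sq_hermitian[OF he] by (simp add: N_def)
  have ts: "trace (mat c ** B) = c * trace B" for c and B :: "complex^'m^'m"
    by (simp add: trace_def matrix_mult_nth mat_def if_mult_zero sum_distrib_left cong: if_cong)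
  have tro: "Re (trace (e ** e ** ro)) = t3 + R / m * N\<^sup>2" "Re (trace (e ** ro ** e)) = t3 + R / m * N\<^sup>2"
    by (simp_all add: ro mm_simps trace_add' t3_def mat_commute[symmetric] ts t2 matrix_mul_assoc[symmetric])
  have "\<bar>t3\<bar> \<le> (m - 2) / sqrt (m * (m - 1)) * N ^ 3"
    using traceless_hermitian_cubic[OF he te m2] by (simp add: t3_def m_def N_def)
  also have "\<dots> \<le> 1 * N ^ 3" using cubic_coefficient_le_1[OF m] N by (intro mult_right_mono) auto
  finally have t3: "\<bar>t3\<bar> \<le> N ^ 3" by simp
  have Bt: "- (N\<^sup>2 * norm b) \<le> Re Bt"
  proof -
    define X :: "complex^('m \<times> 'm)^('m \<times> 'm)" where "X = (\<chi> p q. cnj (e $ snd q $ fst p * e $ fst q $ snd p))"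
    have "b \<bullet> X = Re (\<Sum>al\<in>UNIV. \<Sum>s\<in>UNIV. \<Sum>ga\<in>UNIV. \<Sum>be\<in>UNIV. e $ be $ al * e $ ga $ s * b $ (al, s) $ (ga, be))"
      unfolding inner_matrix sum_pair Re_sum by (simp add: X_def algebra_simps)
    also have "(\<Sum>al\<in>UNIV. \<Sum>s\<in>UNIV. \<Sum>ga\<in>UNIV. \<Sum>be\<in>UNIV. e $ be $ al * e $ ga $ s * b $ (al, s) $ (ga, be))
       = (\<Sum>al\<in>UNIV. \<Sum>s\<in>UNIV. \<Sum>be\<in>UNIV. \<Sum>ga\<in>UNIV. e $ be $ al * e $ ga $ s * b $ (al, s) $ (ga, be))"
      by (intro sum.cong refl sum.swap)
    also have "\<dots> = (\<Sum>al\<in>UNIV. \<Sum>be\<in>UNIV. \<Sum>s\<in>UNIV. \<Sum>ga\<in>UNIV. e $ be $ al * e $ ga $ s * b $ (al, s) $ (ga, be))"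
      by (intro sum.cong refl sum.swap)
    also have "\<dots> = Bt"
      unfolding Bt_def by (subst sum.swap) (intro sum.cong refl sum.swap)
    finally have bX: "b \<bullet> X = Re Bt" .
    have "(norm X)\<^sup>2 = (\<Sum>al\<in>UNIV. \<Sum>s\<in>UNIV. \<Sum>ga\<in>UNIV. \<Sum>be\<in>UNIV. (cmod (e $ be $ al))\<^sup>2 * (cmod (e $ ga $ s))\<^sup>2)"
      by (simp add: norm_matrix sum_pair X_def norm_mult power_mult_distrib)
    also have "\<dots> = (\<Sum>al\<in>UNIV. \<Sum>be\<in>UNIV. (cmod (e $ be $ al))\<^sup>2) * (\<Sum>s\<in>UNIV. \<Sum>ga\<in>UNIV. (cmod (e $ ga $ s))\<^sup>2)"
    proof -
      have "(\<Sum>ga\<in>UNIV. \<Sum>be\<in>UNIV. (cmod (e $ be $ al))\<^sup>2 * (cmod (e $ ga $ s))\<^sup>2) = (\<Sum>be\<in>UNIV. (cmod (e $ be $ al))\<^sup>2) * (\<Sum>ga\<in>UNIV. (cmod (e $ ga $ s))\<^sup>2)" for al s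
        by (subst sum.swap) (simp add: sum_product)
      then show ?thesis by (simp add: sum_product)
    qed
    also have "(\<Sum>al\<in>UNIV. \<Sum>be\<in>UNIV. (cmod (e $ be $ al))\<^sup>2) = N\<^sup>2"
      unfolding N_def norm_matrix by (rule sum.swap)
    finally have "(norm X)\<^sup>2 = (N\<^sup>2)\<^sup>2" by (simp add: power2_eq_square)
    then have "norm X = N\<^sup>2" by (rule power2_eq_imp_eq) auto
    then show ?thesis using Cauchy_Schwarz_ineq2[of b X] bX by (simp add: abs_le_iff mult.commute)
  qed
  have "m * (Re Bt - 1 / (m + 2) * (2 * (t3 + R / m * N\<^sup>2)) + R / ((m + 1) * (m + 2)) * N\<^sup>2 + (t3 + R / m * N\<^sup>2)) \<le> 0"
    using SS unfolding A1 by (simp add: tro t2)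
  then have "Re Bt - 1 / (m + 2) * (2 * (t3 + R / m * N\<^sup>2)) + R / ((m + 1) * (m + 2)) * N\<^sup>2 + (t3 + R / m * N\<^sup>2) \<le> 0"
    using m by (simp add: mult_le_0_iff)
  also have "Re Bt - 1 / (m + 2) * (2 * (t3 + R / m * N\<^sup>2)) + R / ((m + 1) * (m + 2)) * N\<^sup>2 + (t3 + R / m * N\<^sup>2)
     = Re Bt + m / (m + 2) * t3 + R / (m + 1) * N\<^sup>2"
    using m by (simp add: divide_simps) (simp add: algebra_simps)
  finally have "Re Bt + m / (m + 2) * t3 + R / (m + 1) * N\<^sup>2 \<le> 0" .
  moreover have "m / (m + 2) * t3 \<ge> - (N ^ 3)"
  proof -
    have "\<bar>m / (m + 2) * t3\<bar> \<le> 1 * N ^ 3"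
      unfolding abs_mult using m t3 N by (intro mult_mono) auto
    then show ?thesis by linarith
  qed
  ultimately have "N\<^sup>2 * (R / (m + 1)) \<le> N\<^sup>2 * (N + norm b)"
    using Bt by (simp add: algebra_simps power2_eq_square power3_eq_cube)
  then have 1: "R / (m + 1) \<le> N + norm b" by (rule mult_left_le_imp_le) (use N in simp)
  have "norm_E G p = sqrt 2 * N" using norm_E_trace[OF p(1)] N by (simp add: ee t2)
  moreover have "norm_B G p = 2 * norm b" using norm_B_trace[OF p(1)] trace_sq_hermitian[OF hb] by (simp add: be)
  ultimately have "2 * (N + norm b) < 2 * sqrt (m\<^sup>2 - 1) * R / (3 * (m\<^sup>2 - 2))"
    using pinch real_sqrt_mult_self[of 2] by (simp add: m_def mult.assoc[symmetric])
  also have "\<dots> = 2 * R * (sqrt (m\<^sup>2 - 1) / (3 * (m\<^sup>2 - 2)))" by simp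
  also have "\<dots> \<le> 2 * R * (1 / (m + 1))" using pinching_constant_le[OF m] R by (intro mult_left_mono) auto
  finally show False using 1 by simp
qed

end

lemma swapm_nth: "swapm $ (a, n) $ (c, d) = (if a = d \<and> n = c then 1 else 0)"
  by (simp add: swapm_def)

lemma ptr_add: "ptr (A + B) = ptr A + ptr B" by (simp add: vec_eq_iff sum.distrib)
lemma ptr_scaleR: "ptr (c *\<^sub>R A) = c *\<^sub>R ptr A" by (simp add: vec_eq_iff scaleR_sum_right)

lemma scaleR_mm: "(c *\<^sub>R A) ** B = c *\<^sub>R (A ** (B :: complex^'k^'n::finite))" "A ** (c *\<^sub>R B) = c *\<^sub>R (A ** B)"
  by (simp_all add: vec_eq_iff matrix_mult_nth scaleR_sum_right)

context csc_kaehler begin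

definition ka :: real where "ka = R / (real CARD('m) * (real CARD('m) + 1))"

definition BT :: "complex^'m \<Rightarrow> complex^('m \<times> 'm)^('m \<times> 'm)" where
  "BT z = Rh z + ka *\<^sub>R (mat 1 + swapm)"

lemma BT_smooth: "msmooth U BT"
  unfolding BT_def[abs_def] by (intro msmooth_add open_U Rh_smooth msmooth_const)

lemma D_BT: assumes z: "z \<in> U" shows "V.D ga BT z = V.D ga Rh z"
proof -
  have "V.D ga (\<lambda>w. ka *\<^sub>R (mat 1 + swapm)) z = 0"
    by (simp add: V.D_def V_conn[OF z] scaleR_mm mm_simps kder_swapm)
  then show ?thesis unfolding BT_def[abs_def] by (simp add: V.D_add[OF Rh_smooth msmooth_const[OF open_U] z])
qed

lemma codazzi_BT: "codazzi BT"
  using codazzi_Rh by (simp add: codazzi_def D_BT)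

lemma einstein_b_mat:
  assumes z: "z \<in> U" and ein: "e_end G z = 0"
  shows "b_mat G z = BT z ** kron (G z) (G z)" "b_end G z = BT z" "Ric z = mat (complex_of_real (R / real CARD('m)))"
proof -
  show Ric: "Ric z = mat (complex_of_real (R / real CARD('m)))" using e_end_R[OF z] ein by simp
  have ric: "ricci G z al be = complex_of_real (R / real CARD('m)) * G z $ al $ be" for al be
    using arg_cong[OF ricci_Ric[of z], of "\<lambda>A. A $ al $ be"] unfolding Ric
    by (simp add: ric_mat_def matrix_mult_nth mat_def if_mult_zero cong: if_cong)
  define m where "m = complex_of_nat CARD('m)"
  have m: "m \<noteq> 0" "m + 1 \<noteq> 0" "m + 2 \<noteq> 0"
    unfolding m_def using of_nat_neq_0[of "CARD('m)", where 'a=complex] of_nat_neq_0[of "CARD('m) + 1", where 'a=complex] by (simp_all add: add_ac)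
  have "b_mat G z $ (al, nu) $ (de, ro) = (BT z ** kron (G z) (G z)) $ (al, nu) $ (de, ro)" for al nu de ro
  proof -
    have "(BT z ** kron (G z) (G z)) $ (al, nu) $ (de, ro) = riemann G z nu ro al de + ka *\<^sub>R (G z $ al $ de * G z $ nu $ ro + G z $ nu $ de * G z $ al $ ro)"
      by (simp add: BT_def mm_simps scaleR_mm Rh_r_mat[OF z] swapm_mult) (simp add: r_mat_def)
    moreover have "b_mat G z $ (al, nu) $ (de, ro) = riemann G z nu ro al de
      + (1 / (m + 2) * (2 * (R / m)) - R / ((m + 1) * (m + 2))) * (G z $ al $ de * G z $ nu $ ro + G z $ nu $ de * G z $ al $ ro)"
      unfolding b_mat_def vec_lambda_beta fst_conv snd_conv bochner_def ric scal[OF z] m_def[symmetric]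
      by (simp add: algebra_simps m_def)
    moreover have "1 / (m + 2) * (2 * (R / m)) - R / ((m + 1) * (m + 2)) = complex_of_real ka"
      using m by (simp add: ka_def m_def[symmetric] divide_simps) (simp add: algebra_simps)
    ultimately show ?thesis by (simp add: scaleR_conv_of_real[where 'a=complex])
  qed
  then show b: "b_mat G z = BT z ** kron (G z) (G z)" by (auto simp: vec_eq_iff)
  show "b_end G z = BT z" by (simp add: b_end_def b V.Hi_simps[OF z])
qed

lemma bochner_flat_at_max:
  assumes p: "p \<in> U" "G p = mat 1" and m2: "CARD('m) \<ge> 2" and R: "R > 0"
    and ein: "\<And>w. w \<in> U \<Longrightarrow> e_end G w = 0"
    and max: "\<And>w. w \<in> U \<Longrightarrow> Re (trace (b_end G w ** b_end G w)) \<le> Re (trace (b_end G p ** b_end G p))"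
    and pinch: "sqrt 2 * norm_E G p + norm_B G p < 2 * sqrt ((real CARD('m))\<^sup>2 - 1) * R / (3 * ((real CARD('m))\<^sup>2 - 2))"
  shows "b_end G p = 0"
proof (rule ccontr)
  assume ne: "b_end G p \<noteq> 0"
  define m where "m = real CARD('m)"
  have m: "m \<ge> 2" using m2 by (simp add: m_def)
  note be = einstein_b_mat[OF _ ein]
  have sa: "hadj (BT w ** kron (G w) (G w)) = BT w ** kron (G w) (G w)" if "w \<in> U" for w
    using b_mat_herm[OF that] be(1)[OF that that] by simp
  have tr: "ptr (BT w) = 0" if "w \<in> U" for w
  proof -
    have "ptr (mat 1 :: complex^('m \<times> 'm)^('m \<times> 'm)) = m *\<^sub>R mat 1"
      by (simp add: vec_eq_iff mat_def m_def scaleR_conv_of_real[where 'a=complex])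
    moreover have "ptr (swapm :: complex^('m \<times> 'm)^('m \<times> 'm)) = mat 1"
    proof -
      have "(if de = ro \<and> mu = de then 1 else 0) = (if de = ro then (if mu = ro then 1 else 0) else (0::complex))" for de ro mu :: 'm by auto
      then show ?thesis by (simp add: vec_eq_iff swapm_nth mat_def)
    qed
    moreover have "ptr (Rh w) = - mat (complex_of_real (R / m))" using be(3)[OF that that] unfolding Ric_def m_def by (rule minus_equation_iff[THEN iffD1, OF _, symmetric])
    ultimately have "ptr (BT w) = - mat (complex_of_real (R / m)) + ka *\<^sub>R (m *\<^sub>R mat 1 + mat 1)"
      by (simp add: BT_def ptr_add ptr_scaleR)
    also have "R / m = ka * (m + 1)" using m by (simp add: ka_def m_def[symmetric])
    also have "- mat (complex_of_real (ka * (m + 1))) + ka *\<^sub>R (m *\<^sub>R mat 1 + mat 1) = (0 :: complex^'m^'m)"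
      by (simp add: vec_eq_iff mat_def scaleR_conv_of_real[where 'a=complex] distrib_left)
    finally show ?thesis .
  qed
  define b where "b = BT p"
  define r where "r = Rh p"
  have ee: "e_end G p = 0" by (rule ein[OF p(1)])
  have bp: "b_end G p = b" "b_mat G p = b" using be(1,2)[OF p(1) p(1)] by (simp_all add: b_def p(2) kron_mat1)
  have hb: "hadj b = b" using b_mat_herm[OF p(1)] bp by simp
  have lo: "b $ (a, n) $ c = b $ (n, a) $ c" for a n c
  proof -
    obtain x y where "c = (x, y)" by (cases c)
    then show ?thesis by (simp add: b_def BT_def Rh_sym[OF p(1), of a] mat_def swapm_nth conj_commute add.commute)
  qed
  have herm: "cnj (b $ x $ y) = b $ y $ x" for x y using arg_cong[OF hb, of "\<lambda>A. A $ y $ x"] by simp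
  have up: "b $ c $ (a, n) = b $ c $ (n, a)" for a n c
    using arg_cong[OF lo[of a n c], of cnj] by (simp add: herm)
  have t0: "(\<Sum>s\<in>UNIV. b $ (s, x) $ (s, y)) = 0" for x y
    using arg_cong[OF tr[OF p(1)], of "\<lambda>A. A $ x $ y"] by (simp add: b_def)
  have rb: "r $ (al, s) $ (ga, be) = b $ (al, s) $ (ga, be) - (if al = ga then (if s = be then complex_of_real ka else 0) else 0) - (if al = be then (if s = ga then complex_of_real ka else 0) else 0)" for al s ga be
  proof -
    have "r $ (al, s) $ (ga, be) = b $ (al, s) $ (ga, be) - ka *\<^sub>R (mat 1 $ (al, s) $ (ga, be) + swapm $ (al, s) $ (ga, be))"
      by (simp only: b_def BT_def r_def vector_add_component vector_scaleR_component add_diff_cancel_right')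
    then show ?thesis by (auto simp: mat_def swapm_nth scaleR_conv_of_real[where 'a=complex])
  qed
  let ?k = "complex_of_real ka"
  define C1 where "C1 = (\<Sum>be\<in>UNIV. \<Sum>mu\<in>UNIV. \<Sum>al\<in>UNIV. \<Sum>nu\<in>UNIV. b $ (be, mu) $ (al, nu) * (\<Sum>ga\<in>UNIV. \<Sum>s\<in>UNIV. b $ (ga, nu) $ (s, mu) * b $ (al, s) $ (ga, be)))"
  define C2 where "C2 = (\<Sum>be\<in>UNIV. \<Sum>mu\<in>UNIV. \<Sum>al\<in>UNIV. \<Sum>nu\<in>UNIV. b $ (be, mu) $ (al, nu) * (\<Sum>ga\<in>UNIV. \<Sum>s\<in>UNIV. b $ (ga, nu) $ (be, s) * b $ (al, s) $ (ga, mu)))"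
  have inner: "(\<Sum>ga\<in>UNIV. \<Sum>s\<in>UNIV. b $ (ga, nu) $ (s, mu) * r $ (al, s) $ (ga, be) + b $ (ga, nu) $ (be, s) * r $ (al, s) $ (ga, mu)
        - r $ (al, ga) $ (ga, s) * b $ (s, nu) $ (be, mu) - r $ (al, nu) $ (ga, s) * b $ (ga, s) $ (be, mu))
     = (\<Sum>ga\<in>UNIV. \<Sum>s\<in>UNIV. b $ (ga, nu) $ (s, mu) * b $ (al, s) $ (ga, be)) + (\<Sum>ga\<in>UNIV. \<Sum>s\<in>UNIV. b $ (ga, nu) $ (be, s) * b $ (al, s) $ (ga, mu))
       - (b ** b) $ (al, nu) $ (be, mu) + (m + 1) * ?k * b $ (al, nu) $ (be, mu)" for al be mu nu
  proof -
    have 1: "(\<Sum>ga\<in>UNIV. \<Sum>s\<in>UNIV. b $ (ga, nu) $ (s, mu) * r $ (al, s) $ (ga, be)) = (\<Sum>ga\<in>UNIV. \<Sum>s\<in>UNIV. b $ (ga, nu) $ (s, mu) * b $ (al, s) $ (ga, be)) - ?k * b $ (al, nu) $ (be, mu)"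
    proof -
      have "(\<Sum>ga\<in>UNIV. b $ (ga, nu) $ (ga, mu) * ?k) = 0" by (simp only: sum_distrib_right[symmetric] t0) simp
      then show ?thesis by (simp add: rb right_diff_distrib sum_subtractf if_mult_zero sum_if_const mult.commute cong: if_cong)
    qed
    have 2: "(\<Sum>ga\<in>UNIV. \<Sum>s\<in>UNIV. b $ (ga, nu) $ (be, s) * r $ (al, s) $ (ga, mu)) = (\<Sum>ga\<in>UNIV. \<Sum>s\<in>UNIV. b $ (ga, nu) $ (be, s) * b $ (al, s) $ (ga, mu)) - ?k * b $ (al, nu) $ (be, mu)"
    proof -
      have "(\<Sum>ga\<in>UNIV. b $ (ga, nu) $ (be, ga) * ?k) = 0" by (subst up) (simp only: sum_distrib_right[symmetric] t0, simp)
      then show ?thesis by (simp add: rb right_diff_distrib sum_subtractf if_mult_zero sum_if_const mult.commute cong: if_cong)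
    qed
    have 3: "(\<Sum>ga\<in>UNIV. \<Sum>s\<in>UNIV. r $ (al, ga) $ (ga, s) * b $ (s, nu) $ (be, mu)) = - ((m + 1) * ?k * b $ (al, nu) $ (be, mu))"
    proof -
      have "(\<Sum>ga\<in>UNIV. r $ (al, ga) $ (ga, s)) = (if al = s then - ((m + 1) * ?k) else 0)" for s
      proof -
        have "(\<Sum>ga\<in>UNIV. b $ (al, ga) $ (ga, s)) = 0" by (subst lo) (rule t0)
        then show ?thesis by (simp add: rb sum_subtractf sum_if_const m_def sum.distrib algebra_simps cong: if_cong)
      qed
      then have "(\<Sum>s\<in>UNIV. (\<Sum>ga\<in>UNIV. r $ (al, ga) $ (ga, s)) * b $ (s, nu) $ (be, mu)) = - ((m + 1) * ?k * b $ (al, nu) $ (be, mu))"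
        by (simp add: if_mult_zero cong: if_cong)
      then show ?thesis by (subst sum.swap) (simp only: sum_distrib_right)
    qed
    have 4: "(\<Sum>ga\<in>UNIV. \<Sum>s\<in>UNIV. r $ (al, nu) $ (ga, s) * b $ (ga, s) $ (be, mu)) = (b ** b) $ (al, nu) $ (be, mu) - 2 * ?k * b $ (al, nu) $ (be, mu)"
      by (simp add: rb left_diff_distrib sum_subtractf if_mult_zero sum_if_const matrix_mult_nth sum_pair lo[of nu al] cong: if_cong)
    show ?thesis unfolding sum_subtractf sum.distrib 1 2 3 4 by (simp add: algebra_simps)
  qed
  have SS: "Re (C1 + C2 - trace (b ** b ** b) + (m + 1) * ?k * trace (b ** b)) \<le> 0"
  proof -
    have "(\<Sum>be\<in>UNIV. \<Sum>mu\<in>UNIV. \<Sum>al\<in>UNIV. \<Sum>nu\<in>UNIV. b $ (be, mu) $ (al, nu) *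
     ((\<Sum>ga\<in>UNIV. \<Sum>s\<in>UNIV. b $ (ga, nu) $ (s, mu) * b $ (al, s) $ (ga, be)) + (\<Sum>ga\<in>UNIV. \<Sum>s\<in>UNIV. b $ (ga, nu) $ (be, s) * b $ (al, s) $ (ga, mu))
       - (b ** b) $ (al, nu) $ (be, mu) + (m + 1) * ?k * b $ (al, nu) $ (be, mu)))
      = C1 + C2 - trace (b ** (b ** b)) + (m + 1) * ?k * trace (b ** b)"
      unfolding C1_def C2_def trace_mult[of b] sum_pair
      by (simp only: distrib_left right_diff_distrib sum.distrib sum_subtractf) (simp add: sum_distrib_left mult_ac distrib_left distrib_right sum.distrib)
    then show ?thesis
      using codazzi_max_inequality[OF BT_smooth sa codazzi_BT tr p] max be(2) p(1)
      unfolding b_def[symmetric] r_def[symmetric] inner by (simp add: matrix_mul_assoc b_def)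
  qed
  define M :: "complex^('m \<times> 'm)^('m \<times> 'm)" where "M = (\<chi> p q. b $ (fst p, snd q) $ (snd p, fst q))"
  have hM: "hadj M = M" unfolding vec_eq_iff by (simp add: M_def herm) (metis lo up)
  have tM: "trace M = 0"
  proof -
    have "trace M = (\<Sum>x\<in>UNIV. \<Sum>y\<in>UNIV. b $ (x, y) $ (y, x))" by (simp add: trace_def sum_pair M_def)
    also have "\<dots> = (\<Sum>y\<in>UNIV. \<Sum>x\<in>UNIV. b $ (x, y) $ (x, y))" by (subst up) (rule sum.swap)
    finally show ?thesis by (simp add: t0)
  qed
  have tb: "trace b = 0"
  proof -
    have "trace b = (\<Sum>y\<in>UNIV. \<Sum>x\<in>UNIV. b $ (x, y) $ (x, y))" unfolding trace_def sum_pair by (rule sum.swap)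
    then show ?thesis by (simp add: t0)
  qed
  have nM: "norm M = norm b"
  proof -
    have "(norm M)\<^sup>2 = (\<Sum>x\<in>UNIV. \<Sum>y\<in>UNIV. \<Sum>z\<in>UNIV. \<Sum>w\<in>UNIV. (cmod (b $ (x, w) $ (y, z)))\<^sup>2)"
      by (simp add: norm_matrix sum_pair M_def)
    also have "\<dots> = (\<Sum>x\<in>UNIV. \<Sum>y\<in>UNIV. \<Sum>w\<in>UNIV. \<Sum>z\<in>UNIV. (cmod (b $ (x, w) $ (y, z)))\<^sup>2)"
      by (intro sum.cong refl sum.swap)
    also have "\<dots> = (\<Sum>x\<in>UNIV. \<Sum>w\<in>UNIV. \<Sum>y\<in>UNIV. \<Sum>z\<in>UNIV. (cmod (b $ (x, w) $ (y, z)))\<^sup>2)"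
      by (intro sum.cong refl sum.swap)
    also have "\<dots> = (norm b)\<^sup>2" by (simp add: norm_matrix sum_pair)
    finally show ?thesis by (rule power2_eq_imp_eq) auto
  qed
  have M3: "trace (M ** M ** M) = (\<Sum>al\<in>UNIV. \<Sum>be\<in>UNIV. \<Sum>mu\<in>UNIV. \<Sum>nu\<in>UNIV. \<Sum>ro\<in>UNIV. \<Sum>si\<in>UNIV. b $ (al, nu) $ (be, mu) * (b $ (mu, si) $ (nu, ro) * b $ (ro, be) $ (si, al)))"
    unfolding matrix_mul_assoc[symmetric] trace_mult[of M] matrix_mult_nth sum_pair by (simp add: M_def sum_distrib_left)
  have C1: "C1 = trace (M ** M ** M)"
  proof -
    have "C1 = (\<Sum>be\<in>UNIV. \<Sum>mu\<in>UNIV. \<Sum>al\<in>UNIV. \<Sum>nu\<in>UNIV. \<Sum>ga\<in>UNIV. \<Sum>s\<in>UNIV. b $ (be, mu) $ (al, nu) * (b $ (nu, ga) $ (mu, s) * b $ (s, al) $ (ga, be)))"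
      unfolding C1_def sum_distrib_left by (intro sum.cong refl) (metis lo up)
    also have "\<dots> = (\<Sum>be\<in>UNIV. \<Sum>mu\<in>UNIV. \<Sum>al\<in>UNIV. \<Sum>nu\<in>UNIV. \<Sum>s\<in>UNIV. \<Sum>ga\<in>UNIV. b $ (be, mu) $ (al, nu) * (b $ (nu, ga) $ (mu, s) * b $ (s, al) $ (ga, be)))"
      by (intro sum.cong refl sum.swap)
    also have "\<dots> = (\<Sum>be\<in>UNIV. \<Sum>al\<in>UNIV. \<Sum>mu\<in>UNIV. \<Sum>nu\<in>UNIV. \<Sum>s\<in>UNIV. \<Sum>ga\<in>UNIV. b $ (be, mu) $ (al, nu) * (b $ (nu, ga) $ (mu, s) * b $ (s, al) $ (ga, be)))"
      by (intro sum.cong refl sum.swap)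
    also have "\<dots> = (\<Sum>be\<in>UNIV. \<Sum>al\<in>UNIV. \<Sum>nu\<in>UNIV. \<Sum>mu\<in>UNIV. \<Sum>s\<in>UNIV. \<Sum>ga\<in>UNIV. b $ (be, mu) $ (al, nu) * (b $ (nu, ga) $ (mu, s) * b $ (s, al) $ (ga, be)))"
      by (intro sum.cong refl sum.swap)
    finally show ?thesis unfolding M3 .
  qed
  have C2: "C2 = trace (M ** M ** M)"
  proof -
    have "C2 = (\<Sum>be\<in>UNIV. \<Sum>mu\<in>UNIV. \<Sum>al\<in>UNIV. \<Sum>nu\<in>UNIV. \<Sum>ga\<in>UNIV. \<Sum>s\<in>UNIV. b $ (mu, be) $ (al, nu) * (b $ (nu, ga) $ (be, s) * b $ (s, al) $ (ga, mu)))"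
      unfolding C2_def sum_distrib_left by (intro sum.cong refl) (metis lo)
    also have "\<dots> = (\<Sum>be\<in>UNIV. \<Sum>mu\<in>UNIV. \<Sum>al\<in>UNIV. \<Sum>nu\<in>UNIV. \<Sum>s\<in>UNIV. \<Sum>ga\<in>UNIV. b $ (mu, be) $ (al, nu) * (b $ (nu, ga) $ (be, s) * b $ (s, al) $ (ga, mu)))"
      by (intro sum.cong refl sum.swap)
    also have "\<dots> = (\<Sum>mu\<in>UNIV. \<Sum>be\<in>UNIV. \<Sum>al\<in>UNIV. \<Sum>nu\<in>UNIV. \<Sum>s\<in>UNIV. \<Sum>ga\<in>UNIV. b $ (mu, be) $ (al, nu) * (b $ (nu, ga) $ (be, s) * b $ (s, al) $ (ga, mu)))"
      by (rule sum.swap)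
    also have "\<dots> = (\<Sum>mu\<in>UNIV. \<Sum>al\<in>UNIV. \<Sum>be\<in>UNIV. \<Sum>nu\<in>UNIV. \<Sum>s\<in>UNIV. \<Sum>ga\<in>UNIV. b $ (mu, be) $ (al, nu) * (b $ (nu, ga) $ (be, s) * b $ (s, al) $ (ga, mu)))"
      by (intro sum.cong refl sum.swap)
    also have "\<dots> = (\<Sum>mu\<in>UNIV. \<Sum>al\<in>UNIV. \<Sum>nu\<in>UNIV. \<Sum>be\<in>UNIV. \<Sum>s\<in>UNIV. \<Sum>ga\<in>UNIV. b $ (mu, be) $ (al, nu) * (b $ (nu, ga) $ (be, s) * b $ (s, al) $ (ga, mu)))"
      by (intro sum.cong refl sum.swap)
    finally show ?thesis unfolding M3 .
  qed
  define N where "N = norm b"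
  define c where "c = (m\<^sup>2 - 2) / (m * sqrt (m\<^sup>2 - 1))"
  have N: "N > 0" using ne bp by (simp add: N_def)
  have m4: "m\<^sup>2 \<ge> 4" using m power_mono[of 2 m 2] by simp
  have card: "real CARD('m \<times> 'm) = m\<^sup>2" by (simp add: m_def power2_eq_square)
  have card2: "CARD('m \<times> 'm) \<ge> 2" using mult_le_mono[OF m2 m2] by simp
  have c: "(m\<^sup>2 - 2) / sqrt (m\<^sup>2 * (m\<^sup>2 - 1)) = c" using m by (simp add: c_def real_sqrt_mult)
  have tb3: "\<bar>Re (trace (b ** b ** b))\<bar> \<le> c * N ^ 3"
    using traceless_hermitian_cubic[OF hb tb card2] unfolding card c by (simp add: N_def)
  have tM3: "\<bar>Re (trace (M ** M ** M))\<bar> \<le> c * N ^ 3"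
    using traceless_hermitian_cubic[OF hM tM card2] unfolding card c nM by (simp add: N_def)
  have t2: "trace (b ** b) = complex_of_real (N\<^sup>2)" using trace_sq_hermitian[OF hb] by (simp add: N_def)
  have "(m + 1) * ka * N\<^sup>2 \<le> 3 * (c * N ^ 3)"
    using SS tb3 tM3 by (simp add: C1 C2 t2)
  then have "N\<^sup>2 * ((m + 1) * ka) \<le> N\<^sup>2 * (3 * c * N)" by (simp add: power2_eq_square power3_eq_cube mult_ac)
  then have 1: "(m + 1) * ka \<le> 3 * c * N" by (rule mult_left_le_imp_le) (use N in simp)
  have "norm_E G p = 0" using norm_E_trace[OF p(1)] ee by (simp add: trace_def)
  moreover have "norm_B G p = 2 * N" using norm_B_trace[OF p(1)] N by (simp add: bp t2)
  ultimately have 2: "N < sqrt (m\<^sup>2 - 1) * R / (3 * (m\<^sup>2 - 2))" using pinch by (simp add: m_def)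
  have c0: "3 * c > 0" using m4 m by (simp add: c_def)
  have sq: "sqrt (m\<^sup>2 - 1) > 0" using m4 by simp
  have "3 * c * N < 3 * c * (sqrt (m\<^sup>2 - 1) * R / (3 * (m\<^sup>2 - 2)))" using 2 c0 by (rule mult_strict_left_mono)
  also have "\<dots> = R / m" using m4 m sq by (simp add: c_def)
  also have "\<dots> = (m + 1) * ka" using m by (simp add: ka_def m_def[symmetric])
  finally show False using 1 by simp
qed

end

section \<open>Holomorphic coordinate changes\<close>

definition mdiff :: "(complex^'m::finite \<Rightarrow> complex^'k^'l) \<Rightarrow> complex^'m \<Rightarrow> bool" where
  "mdiff A z \<longleftrightarrow> (\<forall>i j. (\<lambda>w. A w $ i $ j) differentiable (at z))"

lemma mdiff_mult: "mdiff A z \<Longrightarrow> mdiff B z \<Longrightarrow> mdiff (\<lambda>w. A w ** (B w :: complex^'k^'n::finite)) z"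
  unfolding mdiff_def matrix_mult_nth by (intro allI differentiable_sum differentiable_mult ballI) auto

lemma mdiff_hadj: "mdiff A z \<Longrightarrow> mdiff (\<lambda>w. hadj (A w)) z"
  unfolding mdiff_def by (auto intro!: differentiable_cnj)

lemma md_mult_at:
  "mdiff A z \<Longrightarrow> mdiff B z \<Longrightarrow>
    md k ga (\<lambda>w. A w ** (B w :: complex^'k^'n::finite)) z = md k ga A z ** B z + A z ** md k ga B z"
  by (simp add: vec_eq_iff matrix_mult_nth wd_sum wd_mult mdiff_def sum.distrib)

lemma md_add_at: "mdiff A z \<Longrightarrow> mdiff B z \<Longrightarrow> md k ga (\<lambda>w. A w + B w) z = md k ga A z + md k ga B z"
  by (simp add: vec_eq_iff wd_add mdiff_def)

lemma md_hadj_at: "mdiff A z \<Longrightarrow> md k ga (\<lambda>w. hadj (A w)) z = hadj (md (cnj k) ga A z)"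
  by (simp add: vec_eq_iff wd_cnj mdiff_def)

definition jac :: "(complex^'m::finite \<Rightarrow> complex^'n::finite) \<Rightarrow> complex^'m \<Rightarrow> complex^'n^'m" where
  "jac F z = (\<chi> al mu. dz al (\<lambda>w. F w $ mu) z)"

lemma pullback_metric_jac: "pullback_metric F G z = jac F z ** G (F z) ** hadj (jac F z)"
proof -
  have "pullback_metric F G z $ al $ be = (jac F z ** G (F z) ** hadj (jac F z)) $ al $ be" for al be
    by (simp add: pullback_metric_def jac_def matrix_mult_nth sum_distrib_right) (subst sum.swap, simp add: mult_ac)
  then show ?thesis by (simp add: vec_eq_iff)
qed

lemma kron1_nth:
  fixes A :: "complex^'m::finite^'m"
  shows "(kron A (mat 1) ** T) $ (a, n) $ b = (\<Sum>s\<in>UNIV. A $ a $ s * T $ (s, n) $ b)"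
    "(kron (mat 1) A ** T) $ (a, n) $ b = (\<Sum>s\<in>UNIV. A $ n $ s * T $ (a, s) $ b)"
    "(T ** kron A (mat 1)) $ b $ (a, n) = (\<Sum>s\<in>UNIV. T $ b $ (s, n) * A $ s $ a)"
    "(T ** kron (mat 1) A) $ b $ (a, n) = (\<Sum>s\<in>UNIV. T $ b $ (a, s) * A $ s $ n)"
  by (simp_all add: matrix_mult_nth sum_pair mat_def if_mult_zero sum_if_const cong: if_cong)

lemma ptr_conj:
  fixes J Ji :: "complex^'m::finite^'m"
  assumes "Ji ** J = mat 1"
  shows "ptr (kron J J ** T ** kron Ji Ji) = J ** ptr T ** Ji"
proof -
  have l: "ptr (kron (mat 1) A ** S) = A ** ptr S" for A :: "complex^'m^'m" and S
    unfolding vec_eq_iff ptr_nth matrix_mult_nth[of A] kron1_nth sum_distrib_left by (intro allI) (rule sum.swap)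
  have r: "ptr (S ** kron (mat 1) A) = ptr S ** A" for A :: "complex^'m^'m" and S
    unfolding vec_eq_iff ptr_nth matrix_mult_nth[of _ A] kron1_nth sum_distrib_right by (intro allI) (rule sum.swap)
  have c: "ptr (kron A (mat 1) ** S) = ptr (S ** kron A (mat 1))" for A :: "complex^'m^'m" and S
    unfolding vec_eq_iff ptr_nth kron1_nth by (intro allI, subst sum.swap) (simp add: mult.commute)
  have "ptr (kron J J ** T ** kron Ji Ji) = ptr (kron J (mat 1) ** (kron (mat 1) J ** T ** kron (mat 1) Ji ** kron Ji (mat 1)))"
  proof -
    have k: "kron J J = kron J (mat 1) ** kron (mat 1) J" "kron Ji Ji = kron (mat 1) Ji ** kron Ji (mat 1)"
      by (simp_all add: kron_mult)
    show ?thesis by (simp only: k matrix_mul_assoc)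
  qed
  also have "\<dots> = ptr (kron (mat 1) J ** T ** kron (mat 1) Ji ** (kron Ji (mat 1) ** kron J (mat 1)))"
    unfolding c by (simp add: matrix_mul_assoc)
  also have "\<dots> = J ** ptr T ** Ji"
    by (simp add: kron_mult assms kron_mat1 matrix_mul_assoc[symmetric] l) (simp add: matrix_mul_assoc r)
  finally show ?thesis .
qed

lemma sum_matrix_nth: "(\<Sum>i\<in>I. f i) $ a $ b = (\<Sum>i\<in>I. f i $ a $ (b :: 'n::finite))"
  by (simp add: sum_component)

context local_kaehler begin

lemma b_mat_eq:
  "b_mat G z = r_mat G z + mat (1 / (of_nat CARD('m) + 2)) ** ((kron (G z) (ric_mat G z) + kron (ric_mat G z) (G z)) ** (mat 1 + swapm))
    - mat (scalar_curv G z / ((of_nat CARD('m) + 1) * (of_nat CARD('m) + 2))) ** (kron (G z) (G z) ** (mat 1 + swapm))"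
proof -
  have m: "(mat c ** T) $ i $ j = c * T $ i $ j" for c :: complex and T :: "complex^('m \<times> 'm)^('m \<times> 'm)" and i j
    by (simp add: matrix_mult_nth mat_def if_mult_zero cong: if_cong)
  have "b_mat G z $ (al, nu) $ (de, ro) = (r_mat G z + mat (1 / (of_nat CARD('m) + 2)) ** ((kron (G z) (ric_mat G z) + kron (ric_mat G z) (G z)) ** (mat 1 + swapm))
    - mat (scalar_curv G z / ((of_nat CARD('m) + 1) * (of_nat CARD('m) + 2))) ** (kron (G z) (G z) ** (mat 1 + swapm))) $ (al, nu) $ (de, ro)" for al nu de ro
    unfolding vector_minus_component vector_add_component m mm_add_right mm_add_left matrix_mul_rid swapm_mult
    by (simp add: b_mat_def r_mat_def bochner_def ric_mat_def algebra_simps)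
  then show ?thesis by (auto simp: vec_eq_iff)
qed

end

locale kaehler_pullback = L: local_kaehler U G + L': local_kaehler U' G'
  for U :: "(complex^'m::finite) set" and G and U' :: "(complex^'m) set" and G' +
  fixes F :: "complex^'m \<Rightarrow> complex^'m"
  assumes F_hol: "hol_on U' (\<lambda>w. F w $ mu)" and F_in: "z \<in> U' \<Longrightarrow> F z \<in> U"
    and F_pull: "z \<in> U' \<Longrightarrow> G' z = pullback_metric F G z"
begin

lemma jac_hol: "hol_on U' (\<lambda>z. jac F z $ al $ mu)"
  unfolding jac_def by (simp add: hol_on_dz[OF L'.open_U F_hol])

lemma jac_det: assumes "z \<in> U'" shows "det (jac F z) \<noteq> 0"
  using L'.G_det[OF assms] unfolding F_pull[OF assms] pullback_metric_jac det_mul by auto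

lemma jac_inv_hol: "hol_on U' (\<lambda>z. matrix_inv (jac F z) $ i $ j)"
  by (rule hol_on_matrix_inv[OF jac_hol jac_det L'.open_U])

lemma md_hol:
  assumes "\<And>i j. hol_on U' (\<lambda>z. A z $ i $ j)" "z \<in> U'"
  shows "mdiff A z" "md \<i> ga A z = 0"
  using hol_on_differentiable[OF assms(1)] hol_on_dzbar[OF assms(1)] assms(2) by (auto simp: mdiff_def vec_eq_iff dzbar_wd)

lemma md_compose:
  assumes "msmooth U A" "z \<in> U'"
  shows "mdiff (\<lambda>w. A (F w)) z"
    "md (- \<i>) ga (\<lambda>w. A (F w)) z = (\<Sum>ro\<in>UNIV. mat (jac F z $ ga $ ro) ** md (- \<i>) ro A (F z))"
    "md \<i> ga (\<lambda>w. A (F w)) z = (\<Sum>ro\<in>UNIV. mat (cnj (jac F z $ ga $ ro)) ** md \<i> ro A (F z))"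
proof -
  note h = hol_compose[OF F_hol assms(2) msmooth_diff_at[OF assms(1) F_in[OF assms(2)]]]
  show "mdiff (\<lambda>w. A (F w)) z" using h(1) by (simp add: mdiff_def)
  have m: "(mat c ** T) $ i $ j = c * T $ i $ j" for c :: complex and T :: "complex^'c::finite^'b::finite" and i j
    by (simp add: matrix_mult_nth mat_def if_mult_zero cong: if_cong)
  show "md (- \<i>) ga (\<lambda>w. A (F w)) z = (\<Sum>ro\<in>UNIV. mat (jac F z $ ga $ ro) ** md (- \<i>) ro A (F z))"
    "md \<i> ga (\<lambda>w. A (F w)) z = (\<Sum>ro\<in>UNIV. mat (cnj (jac F z $ ga $ ro)) ** md \<i> ro A (F z))"
    using h(2,3) by (simp_all add: vec_eq_iff sum_matrix_nth m jac_def dz_wd dzbar_wd)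
qed

lemma conn_pull: assumes z: "z \<in> U'"
  shows "L'.base.conn ga z = md (- \<i>) ga (jac F) z ** matrix_inv (jac F z)
     + jac F z ** (\<Sum>ro\<in>UNIV. mat (jac F z $ ga $ ro) ** L.base.conn ro (F z)) ** matrix_inv (jac F z)"
proof -
  let ?J = "jac F z" and ?g = "G (F z)"
  note Jd = md_hol(1)[of "jac F", OF jac_hol z]
  note Ji = matrix_inv_right_left[OF jac_det[OF z]] and Jhi = matrix_inv_right_left[OF matrix_inv_hadj(2)[OF jac_det[OF z]]]
  have 1: "md (- \<i>) ga G' z = md (- \<i>) ga (\<lambda>w. jac F w ** G (F w) ** hadj (jac F w)) z"
    by (rule md_cong[OF L'.open_U z]) (simp add: F_pull pullback_metric_jac)
  have h0: "md (- \<i>) ga (\<lambda>w. hadj (jac F w)) z = 0"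
    using md_hadj_at[OF Jd, of "- \<i>" ga] md_hol(2)[of "jac F", OF jac_hol z, of ga] by (simp add: vec_eq_iff)
  note Gd = md_compose[OF L.G_smooth z]
  have 2: "md (- \<i>) ga G' z = md (- \<i>) ga (jac F) z ** ?g ** hadj ?J + ?J ** md (- \<i>) ga (\<lambda>w. G (F w)) z ** hadj ?J"
    unfolding 1 by (simp only: md_mult_at[OF mdiff_mult[OF Jd Gd(1)] mdiff_hadj[OF Jd]] md_mult_at[OF Jd Gd(1)] h0) (simp add: mm_simps)
  have 3: "md (- \<i>) ga (\<lambda>w. G (F w)) z = (\<Sum>ro\<in>UNIV. mat (?J $ ga $ ro) ** L.base.conn ro (F z)) ** ?g"
  proof -
    have sm: "(\<Sum>ro\<in>UNIV. A ro) ** B = (\<Sum>ro\<in>UNIV. A ro ** B)" for A :: "'m \<Rightarrow> complex^'m^'m" and B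
      by (simp add: vec_eq_iff matrix_mult_nth sum_matrix_nth sum_distrib_right) (intro allI sum.swap)
    show ?thesis unfolding Gd(2) sm by (simp add: L.base.md_H[OF F_in[OF z]] matrix_mul_assoc)
  qed
  have i1: "matrix_inv (G' z) = matrix_inv (hadj ?J) ** matrix_inv ?g ** matrix_inv ?J"
  proof (rule matrix_inv_unique)
    have "G' z ** (matrix_inv (hadj ?J) ** matrix_inv ?g ** matrix_inv ?J) = ?J ** (?g ** (hadj ?J ** matrix_inv (hadj ?J)) ** matrix_inv ?g) ** matrix_inv ?J"
      by (simp add: F_pull[OF z] pullback_metric_jac matrix_mul_assoc)
    then show "G' z ** (matrix_inv (hadj ?J) ** matrix_inv ?g ** matrix_inv ?J) = mat 1"
      by (simp add: Jhi L.base.Hi_simps[OF F_in[OF z]] Ji)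
  qed
  have c: "A ** hadj ?J ** matrix_inv (hadj ?J) = A" for A :: "complex^'m^'m"
    by (simp add: matrix_mul_assoc[symmetric] Jhi)
  show ?thesis
    unfolding L'.base.conn_def 2 i1 3
    by (simp add: mm_simps c matrix_mul_assoc L.base.Hi_simps[OF F_in[OF z]])
qed

lemma curv_pull: assumes z: "z \<in> U'"
  shows "L'.base.curv ga de z = jac F z ** (\<Sum>ro\<in>UNIV. \<Sum>si\<in>UNIV. mat (jac F z $ ga $ ro * cnj (jac F z $ de $ si)) ** L.base.curv ro si (F z)) ** matrix_inv (jac F z)"
proof -
  let ?S = "\<lambda>w. \<Sum>ro\<in>UNIV. mat (jac F w $ ga $ ro) ** L.base.conn ro (F w)"
  note J = md_hol[of "jac F", OF jac_hol z] and Ji = md_hol[of "\<lambda>z. matrix_inv (jac F z)", OF jac_inv_hol z]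
  have hdJ: "hol_on U' (\<lambda>z. md (- \<i>) ga (jac F) z $ i $ j)" for i j
    using hol_on_dz[OF L'.open_U jac_hol] by (simp add: dz_wd[abs_def])
  note dJ = md_hol[of "md (- \<i>) ga (jac F)", OF hdJ z]
  have hm: "hol_on U' (\<lambda>z. (mat (jac F z $ ga $ ro) :: complex^'m^'m) $ i $ j)" for ro i j
    using jac_hol hol_on_const by (cases "i = j") (simp_all add: mat_def)
  note mJ = md_hol[of "\<lambda>z. mat (jac F z $ ga $ ro) :: complex^'m^'m" for ro, OF hm z]
  note C = md_compose[OF L.base.conn_smooth z]
  have sd: "mdiff (\<lambda>w. \<Sum>ro\<in>I. T ro w) z" "md k de (\<lambda>w. \<Sum>ro\<in>I. T ro w) z = (\<Sum>ro\<in>I. md k de (T ro) z)" if "\<And>ro. mdiff (T ro) z" and "finite I"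
    for T :: "'m \<Rightarrow> complex^'m \<Rightarrow> complex^'m^'m" and I k
    using that(1) unfolding mdiff_def sum_matrix_nth vec_eq_iff md_nth
    by (auto intro!: differentiable_sum[OF that(2)] wd_sum)
  have tm: "mdiff (\<lambda>w. mat (jac F w $ ga $ ro) ** L.base.conn ro (F w)) z"
    "md \<i> de (\<lambda>w. mat (jac F w $ ga $ ro) ** L.base.conn ro (F w)) z = (\<Sum>si\<in>UNIV. mat (jac F z $ ga $ ro * cnj (jac F z $ de $ si)) ** L.base.curv ro si (F z))" for ro
  proof -
    show "mdiff (\<lambda>w. mat (jac F w $ ga $ ro) ** L.base.conn ro (F w)) z" by (rule mdiff_mult[OF mJ(1) C(1)])
    have m: "(mat c ** T) $ i $ j = c * T $ i $ j" for c :: complex and T :: "complex^'m^'m" and i j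
      by (simp add: matrix_mult_nth mat_def if_mult_zero cong: if_cong)
    show "md \<i> de (\<lambda>w. mat (jac F w $ ga $ ro) ** L.base.conn ro (F w)) z = (\<Sum>si\<in>UNIV. mat (jac F z $ ga $ ro * cnj (jac F z $ de $ si)) ** L.base.curv ro si (F z))"
      unfolding md_mult_at[OF mJ(1) C(1)] mJ(2) C(3)
      by (simp add: vec_eq_iff m sum_matrix_nth sum_distrib_left mult.assoc L.base.curv_def)
  qed
  have S: "mdiff ?S z" "md \<i> de ?S z = (\<Sum>ro\<in>UNIV. \<Sum>si\<in>UNIV. mat (jac F z $ ga $ ro * cnj (jac F z $ de $ si)) ** L.base.curv ro si (F z))"
    using sd[OF tm(1), of UNIV] tm(2) by simp_all
  have "L'.base.curv ga de z = md \<i> de (\<lambda>w. md (- \<i>) ga (jac F) w ** matrix_inv (jac F w) + jac F w ** ?S w ** matrix_inv (jac F w)) z"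
    unfolding L'.base.curv_def by (rule md_cong[OF L'.open_U z]) (rule conn_pull)
  also have "\<dots> = jac F z ** md \<i> de ?S z ** matrix_inv (jac F z)"
    by (simp only: md_add_at[OF mdiff_mult[OF dJ(1) Ji(1)] mdiff_mult[OF mdiff_mult[OF J(1) S(1)] Ji(1)]]
        md_mult_at[OF dJ(1) Ji(1)] md_mult_at[OF mdiff_mult[OF J(1) S(1)] Ji(1)] md_mult_at[OF J(1) S(1)] J(2) Ji(2) dJ(2)) simp
  finally show ?thesis unfolding S(2) .
qed

lemma r_mat_pull: assumes z: "z \<in> U'"
  shows "r_mat G' z = kron (jac F z) (jac F z) ** r_mat G (F z) ** hadj (kron (jac F z) (jac F z))"
proof -
  let ?J = "jac F z"
  have "r_mat G' z $ (al, nu) $ (de, ro) = (kron ?J ?J ** r_mat G (F z) ** hadj (kron ?J ?J)) $ (al, nu) $ (de, ro)" for al nu de ro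
  proof -
    let ?S = "\<Sum>a\<in>UNIV. \<Sum>d\<in>UNIV. mat (?J $ al $ a * cnj (?J $ de $ d)) ** L.base.curv a d (F z)"
    have m: "(mat c ** T) $ i $ j = c * T $ i $ j" for c :: complex and T :: "complex^'m^'m" and i j
      by (simp add: matrix_mult_nth mat_def if_mult_zero cong: if_cong)
    have SG: "(?S ** G (F z)) $ n $ q = (\<Sum>a\<in>UNIV. \<Sum>d\<in>UNIV. ?J $ al $ a * cnj (?J $ de $ d) * riemann G (F z) n q a d)" for n q
    proof -
      have "(?S ** G (F z)) $ n $ q = (\<Sum>s\<in>UNIV. \<Sum>a\<in>UNIV. \<Sum>d\<in>UNIV. ?J $ al $ a * cnj (?J $ de $ d) * L.base.curv a d (F z) $ n $ s * G (F z) $ s $ q)"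
        by (simp add: matrix_mult_nth[of ?S] sum_matrix_nth m sum_distrib_right)
      also have "\<dots> = (\<Sum>a\<in>UNIV. \<Sum>s\<in>UNIV. \<Sum>d\<in>UNIV. ?J $ al $ a * cnj (?J $ de $ d) * L.base.curv a d (F z) $ n $ s * G (F z) $ s $ q)"
        by (rule sum.swap)
      also have "\<dots> = (\<Sum>a\<in>UNIV. \<Sum>d\<in>UNIV. \<Sum>s\<in>UNIV. ?J $ al $ a * cnj (?J $ de $ d) * L.base.curv a d (F z) $ n $ s * G (F z) $ s $ q)"
        by (intro sum.cong refl sum.swap)
      finally show ?thesis by (simp add: L.riemann_curv matrix_mult_nth sum_distrib_left mult.assoc)
    qed
    have "L'.base.curv al de z ** G' z = ?J ** (?S ** (matrix_inv ?J ** ?J) ** G (F z)) ** hadj ?J"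
      unfolding curv_pull[OF z] F_pull[OF z] pullback_metric_jac by (simp only: matrix_mul_assoc)
    then have "r_mat G' z $ (al, nu) $ (de, ro) = (?J ** (?S ** G (F z)) ** hadj ?J) $ nu $ ro"
      by (simp add: r_mat_def L'.riemann_curv matrix_inv_right_left[OF jac_det[OF z]])
    also have "\<dots> = (\<Sum>q\<in>UNIV. \<Sum>n\<in>UNIV. \<Sum>a\<in>UNIV. \<Sum>d\<in>UNIV. ?J $ al $ a * ?J $ nu $ n * riemann G (F z) n q a d * cnj (?J $ de $ d * ?J $ ro $ q))"
      unfolding matrix_mult_nth[of _ "hadj ?J"] matrix_mult_nth[of ?J] SG by (simp add: sum_distrib_left sum_distrib_right mult_ac)
    also have "\<dots> = (\<Sum>q\<in>UNIV. \<Sum>d\<in>UNIV. \<Sum>a\<in>UNIV. \<Sum>n\<in>UNIV. ?J $ al $ a * ?J $ nu $ n * riemann G (F z) n q a d * cnj (?J $ de $ d * ?J $ ro $ q))"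
    proof (rule sum.cong[OF refl])
      fix q
      show "(\<Sum>n\<in>UNIV. \<Sum>a\<in>UNIV. \<Sum>d\<in>UNIV. ?J $ al $ a * ?J $ nu $ n * riemann G (F z) n q a d * cnj (?J $ de $ d * ?J $ ro $ q)) =
        (\<Sum>d\<in>UNIV. \<Sum>a\<in>UNIV. \<Sum>n\<in>UNIV. ?J $ al $ a * ?J $ nu $ n * riemann G (F z) n q a d * cnj (?J $ de $ d * ?J $ ro $ q))" (is "?A = ?B")
      proof -
        have "?A = (\<Sum>a\<in>UNIV. \<Sum>n\<in>UNIV. \<Sum>d\<in>UNIV. ?J $ al $ a * ?J $ nu $ n * riemann G (F z) n q a d * cnj (?J $ de $ d * ?J $ ro $ q))"
          by (rule sum.swap)
        also have "\<dots> = (\<Sum>a\<in>UNIV. \<Sum>d\<in>UNIV. \<Sum>n\<in>UNIV. ?J $ al $ a * ?J $ nu $ n * riemann G (F z) n q a d * cnj (?J $ de $ d * ?J $ ro $ q))"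
          by (intro sum.cong refl sum.swap)
        also have "\<dots> = ?B" by (rule sum.swap)
        finally show ?thesis .
      qed
    qed
    also have "\<dots> = (\<Sum>d\<in>UNIV. \<Sum>q\<in>UNIV. \<Sum>a\<in>UNIV. \<Sum>n\<in>UNIV. ?J $ al $ a * ?J $ nu $ n * riemann G (F z) n q a d * cnj (?J $ de $ d * ?J $ ro $ q))"
      by (rule sum.swap)
    also have "\<dots> = (kron ?J ?J ** r_mat G (F z) ** hadj (kron ?J ?J)) $ (al, nu) $ (de, ro)"
      by (simp add: matrix_mult_nth sum_pair r_mat_def sum_distrib_right)
    finally show ?thesis .
  qed
  then show ?thesis by (auto simp: vec_eq_iff)
qed

lemma tensor_pull: assumes z: "z \<in> U'"
  shows "ric_mat G' z = jac F z ** ric_mat G (F z) ** hadj (jac F z)" "scalar_curv G' z = scalar_curv G (F z)"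
    "e_end G' z = jac F z ** e_end G (F z) ** matrix_inv (jac F z)"
    "b_end G' z = kron (jac F z) (jac F z) ** b_end G (F z) ** matrix_inv (kron (jac F z) (jac F z))"
proof -
  let ?J = "jac F z" and ?z = "F z"
  let ?K = "kron ?J ?J"
  note zU = F_in[OF z] and J = jac_det[OF z]
  note Ji = matrix_inv_right_left[OF J]
  have K: "det ?K \<noteq> 0" "matrix_inv ?K = kron (matrix_inv ?J) (matrix_inv ?J)" using kron_inv[OF J J] by auto
  have G': "G' z = ?J ** G ?z ** hadj ?J" using F_pull[OF z] by (simp add: pullback_metric_jac)
  have H': "kron (G' z) (G' z) = ?K ** kron (G ?z) (G ?z) ** hadj ?K" by (simp add: G' kron_mult hadj_kron)
  have H: "det (kron (G ?z) (G ?z)) \<noteq> 0" using L.V.Hdet[OF zU] .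
  have "L'.Rh z = r_mat G' z ** matrix_inv (kron (G' z) (G' z))"
    by (simp add: L'.Rh_r_mat[OF z, symmetric] L'.V.Hi_simps[OF z])
  also have "\<dots> = ?K ** (r_mat G ?z ** matrix_inv (kron (G ?z) (G ?z))) ** matrix_inv ?K"
    unfolding r_mat_pull[OF z] H' by (rule congruence_endomorphism(1)[OF H K(1)])
  also have "r_mat G ?z ** matrix_inv (kron (G ?z) (G ?z)) = L.Rh ?z"
    by (simp add: L.Rh_r_mat[OF zU, symmetric] L.V.Hi_simps[OF zU])
  finally have Rh: "L'.Rh z = ?K ** L.Rh ?z ** kron (matrix_inv ?J) (matrix_inv ?J)" by (simp add: K)
  have Ric: "L'.Ric z = ?J ** L.Ric ?z ** matrix_inv ?J"
    by (simp add: L'.Ric_def L.Ric_def Rh ptr_conj[OF Ji(2)] mm_simps)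
  have "ric_mat G' z = ?J ** (L.Ric ?z ** (matrix_inv ?J ** ?J) ** G ?z) ** hadj ?J"
    unfolding L'.ricci_Ric Ric G' by (simp only: matrix_mul_assoc)
  then show ric: "ric_mat G' z = ?J ** ric_mat G ?z ** hadj ?J" by (simp add: Ji L.ricci_Ric)
  have "trace (L'.Ric z) = trace (L.Ric ?z)"
    unfolding Ric by (subst trace_mult_commute) (simp add: matrix_mul_assoc Ji)
  then show sc: "scalar_curv G' z = scalar_curv G ?z" by (simp add: L'.scalar_Ric[OF z] L.scalar_Ric[OF zU])
  show "e_end G' z = ?J ** e_end G ?z ** matrix_inv ?J"
    unfolding L'.e_end_eq[OF z] L.e_end_eq[OF zU] Ric sc
    by (simp add: mm_simps mat_commute[symmetric]) (simp add: matrix_mul_assoc[symmetric] Ji)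
  have sw: "kron (?J ** A ** hadj ?J) (?J ** B ** hadj ?J) = ?K ** kron A B ** hadj ?K" for A B
    by (simp add: kron_mult hadj_kron)
  have hs: "hadj ?K ** swapm = swapm ** hadj ?K" by (simp add: hadj_kron kron_swapm)
  have "b_mat G' z = ?K ** b_mat G ?z ** hadj ?K"
    unfolding L'.b_mat_eq L.b_mat_eq r_mat_pull[OF z] ric sc G' sw
    by (simp add: mm_simps matrix_mul_assoc mat_commute[symmetric]) (simp add: matrix_mul_assoc[symmetric] hs)
  then show "b_end G' z = ?K ** b_end G ?z ** matrix_inv ?K"
    unfolding b_end_def H' using congruence_endomorphism(1)[OF H K(1)] by simp
qed

lemma trace_pull: assumes z: "z \<in> U'"
  shows "trace (e_end G' z ** e_end G' z) = trace (e_end G (F z) ** e_end G (F z))"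
    "trace (b_end G' z ** b_end G' z) = trace (b_end G (F z) ** b_end G (F z))"
  using trace_conjugate_sq[OF jac_det[OF z]] trace_conjugate_sq[OF kron_inv(1)[OF jac_det[OF z] jac_det[OF z]]]
  by (simp_all add: tensor_pull[OF z])

end

section \<open>The maximum principle on the manifold\<close>

lemma smooth_on_affine:
  fixes L :: "'a::real_normed_vector \<Rightarrow> 'b::real_normed_vector" and f :: "'b \<Rightarrow> 'c::real_normed_vector"
  assumes L: "bounded_linear L" and f: "smooth_on f S" and T: "open T" "\<And>w. w \<in> T \<Longrightarrow> a + L w \<in> S"
  shows "smooth_on (\<lambda>w. f (a + L w)) T"
proof -
  have "Ck_on k (\<lambda>w. f (a + L w)) T" if "Ck_on k f S" for k and f :: "'b \<Rightarrow> 'c"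
    using that
  proof (induction k arbitrary: f)
    case 0
    have "continuous_on T (\<lambda>w. a + L w)"
      by (intro continuous_intros linear_continuous_on L)
    then show ?case using continuous_on_compose2[of S f T "\<lambda>w. a + L w"] 0 T(2) by auto
  next
    case (Suc k)
    have d: "((\<lambda>w. f (a + L w)) has_derivative (\<lambda>v. frechet_derivative f (at (a + L w)) (L v))) (at w)" if "w \<in> T" for w
    proof -
      have l: "((\<lambda>w. a + L w) has_derivative L) (at w)"
        by (auto intro!: derivative_eq_intros bounded_linear_imp_has_derivative L)
      have "f differentiable (at (a + L w))" using Suc.prems T(2)[OF that] by simp
      from has_derivative_compose[OF l has_frechet[OF this]] show ?thesis .
    qed
    have "Ck_on k (\<lambda>w. frechet_derivative f (at (a + L w)) (L v)) T" for v
      using Suc.prems by (intro Suc.IH) auto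
    then have "Ck_on k (\<lambda>w. frechet_derivative (\<lambda>w. f (a + L w)) (at w) v) T" for v
      by (rule Ck_on_cong[OF T(1), THEN iffD1, rotated]) (simp add: frechet_derivativeI[OF d])
    then show ?case using d by (auto simp: differentiable_def)
  qed
  then show ?thesis using f by (simp add: smooth_on_def)
qed

lemma local_kaehler_subset:
  assumes "local_kaehler U G" "open V" "V \<subseteq> U"
  shows "local_kaehler V G"
proof -
  interpret local_kaehler U G by fact
  show ?thesis
    by unfold_locales (use assms G_smooth G_pos G_closed in \<open>auto simp: msmooth_def subset_iff intro: smooth_on_subset G_herm\<close>)
qed

context local_kaehler begin

lemma normal_coordinates:
  assumes p: "p \<in> U"
  obtains V K F where "kaehler_pullback U G V K F" "0 \<in> V" "F 0 = p" "K 0 = mat 1"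
proof -
  obtain P where "unitary_frame (G p) P" using G_frame[OF p] by blast
  then have P1: "transpose P ** G p ** hadj (transpose P) = mat 1" by (simp add: unitary_frame_matrix)
  let ?J = "transpose P"
  define L where "L w = (\<chi> a. \<Sum>b\<in>UNIV. w $ b * P $ a $ b)" for w
  have L: "bounded_linear L"
    unfolding L_def by (intro linear_conv_bounded_linear[THEN iffD1] linearI)
      (auto simp: vec_eq_iff algebra_simps sum.distrib scaleR_sum_right)
  define F where "F w = p + L w" for w
  define V where "V = F -` U"
  have Fc: "continuous_on UNIV F" unfolding F_def by (intro continuous_intros linear_continuous_on L)
  have V: "open V" unfolding V_def by (rule open_vimage[OF open_U Fc])
  have FV: "F w \<in> U" if "w \<in> V" for w using that by (simp add: V_def)
  have Fhol: "hol_on S (\<lambda>w. F w $ a)" for S a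
    unfolding F_def L_def by simp (intro hol_on_add hol_on_sum hol_on_mult hol_on_nth hol_on_const)
  have J: "jac F w = ?J" for w
  proof -
    have "dz a (\<lambda>w. F w $ b) w = P $ b $ a" for a b
    proof -
      have "((\<lambda>w. F w $ b) has_derivative (\<lambda>v. \<Sum>c\<in>UNIV. v $ c * P $ b $ c)) (at w)"
        unfolding F_def L_def by simp (auto intro!: derivative_eq_intros bounded_linear_imp_has_derivative bounded_linear_vec_nth)
      note d = this
      show ?thesis
        unfolding dz_wd wdI[OF d] by (simp add: axis_def if_mult_zero cong: if_cong)
    qed
    then show ?thesis by (simp add: vec_eq_iff jac_def transpose_def)
  qed
  define K where "K w = ?J ** G (F w) ** hadj ?J" for w
  have GF: "msmooth V (\<lambda>w. G (F w))"
    unfolding msmooth_def F_def using smooth_on_affine[OF L msmoothD[OF G_smooth] V, where a=p] FV by (simp add: F_def)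
  have Jd: "det ?J \<noteq> 0" using arg_cong[OF P1, of det] by (auto simp: det_mul)
  have Ks: "msmooth V K" unfolding K_def by (intro msmooth_mult V msmooth_const GF)
  have "local_kaehler V K"
  proof
    show "open V" "msmooth V K" by fact+
    fix z assume z: "z \<in> V"
    have "hadj (K z) = K z" by (simp add: K_def hadj_mult G_hadj[OF FV[OF z]] matrix_mul_assoc)
    then show "K z $ b $ a = cnj (K z $ a $ b)" for a b by (metis hadj_nth)
    show "0 < Re (\<Sum>a\<in>UNIV. \<Sum>b\<in>UNIV. K z $ a $ b * v $ a * cnj (v $ b))" if v: "v \<noteq> 0" for v
    proof -
      define u where "u = transpose ?J *v v"
      have "u \<noteq> 0"
      proof
        assume "u = 0"
        then have "matrix_inv (transpose ?J) *v (transpose ?J *v v) = 0" by (simp add: u_def)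
        moreover have "det (transpose ?J) \<noteq> 0" using Jd by (simp add: det_transpose)
        ultimately show False using v by (simp add: matrix_vector_mul_assoc matrix_inv_right_left)
      qed
      have "(\<Sum>a\<in>UNIV. \<Sum>b\<in>UNIV. K z $ a $ b * v $ a * cnj (v $ b)) = (\<Sum>a\<in>UNIV. \<Sum>b\<in>UNIV. \<Sum>d\<in>UNIV. \<Sum>c\<in>UNIV. v $ a * ?J $ a $ c * G (F z) $ c $ d * cnj (?J $ b $ d * v $ b))"
        by (simp add: K_def matrix_mult_nth sum_distrib_left sum_distrib_right mult_ac)
      also have "\<dots> = (\<Sum>a\<in>UNIV. \<Sum>d\<in>UNIV. \<Sum>b\<in>UNIV. \<Sum>c\<in>UNIV. v $ a * ?J $ a $ c * G (F z) $ c $ d * cnj (?J $ b $ d * v $ b))"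
        by (intro sum.cong refl sum.swap)
      also have "\<dots> = (\<Sum>a\<in>UNIV. \<Sum>d\<in>UNIV. \<Sum>c\<in>UNIV. \<Sum>b\<in>UNIV. v $ a * ?J $ a $ c * G (F z) $ c $ d * cnj (?J $ b $ d * v $ b))"
        by (intro sum.cong refl sum.swap)
      also have "\<dots> = (\<Sum>a\<in>UNIV. \<Sum>c\<in>UNIV. \<Sum>d\<in>UNIV. \<Sum>b\<in>UNIV. v $ a * ?J $ a $ c * G (F z) $ c $ d * cnj (?J $ b $ d * v $ b))"
        by (intro sum.cong refl sum.swap)
      also have "\<dots> = (\<Sum>c\<in>UNIV. \<Sum>a\<in>UNIV. \<Sum>d\<in>UNIV. \<Sum>b\<in>UNIV. v $ a * ?J $ a $ c * G (F z) $ c $ d * cnj (?J $ b $ d * v $ b))"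
        by (rule sum.swap)
      also have "\<dots> = (\<Sum>c\<in>UNIV. \<Sum>d\<in>UNIV. \<Sum>a\<in>UNIV. \<Sum>b\<in>UNIV. v $ a * ?J $ a $ c * G (F z) $ c $ d * cnj (?J $ b $ d * v $ b))"
        by (intro sum.cong refl sum.swap)
      also have "\<dots> = (\<Sum>c\<in>UNIV. \<Sum>d\<in>UNIV. G (F z) $ c $ d * u $ c * cnj (u $ d))"
        by (simp add: u_def matrix_vector_mult_def transpose_def sum_product sum_distrib_left mult_ac)
      finally show ?thesis using G_pos[OF FV[OF z] \<open>u \<noteq> 0\<close>] by simp
    qed
    fix c a b
    have md: "md (- \<i>) c K z $ a $ b = (\<Sum>e\<in>UNIV. \<Sum>d\<in>UNIV. \<Sum>r\<in>UNIV. ?J $ a $ d * ?J $ c $ r * wd (- \<i>) r (\<lambda>w. G w $ d $ e) (F z) * cnj (?J $ b $ e))" for c a b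
    proof -
      have wc: "wd (- \<i>) c (\<lambda>w. G (F w) $ d $ e) z = (\<Sum>r\<in>UNIV. ?J $ c $ r * wd (- \<i>) r (\<lambda>w. G w $ d $ e) (F z))" for d e
        using hol_compose(2)[where T=F and f="\<lambda>w. G w $ d $ e" and z=z and S="{z}", OF Fhol _ msmooth_diff_at[OF G_smooth FV[OF z]]] J[of z]
        by (simp add: dz_wd jac_def vec_eq_iff)
      have "md (- \<i>) c K z = ?J ** md (- \<i>) c (\<lambda>w. G (F w)) z ** hadj ?J"
        unfolding K_def
        by (simp add: md_mult[OF msmooth_mult[OF V msmooth_const[OF V] GF] msmooth_const[OF V] z] md_mult[OF msmooth_const[OF V] GF z] mm_simps)
      then show ?thesis by (simp add: matrix_mult_nth wc sum_distrib_left sum_distrib_right mult_ac)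
    qed
    have "md (- \<i>) c K z $ a $ b = md (- \<i>) a K z $ c $ b"
    proof -
      have "wd (- \<i>) r (\<lambda>w. G w $ d $ e) (F z) = wd (- \<i>) d (\<lambda>w. G w $ r $ e) (F z)" for r d e
        using G_closed[OF FV[OF z]] by (simp add: dz_wd)
      then have "md (- \<i>) c K z $ a $ b = (\<Sum>e\<in>UNIV. \<Sum>d\<in>UNIV. \<Sum>r\<in>UNIV. ?J $ a $ d * ?J $ c $ r * wd (- \<i>) d (\<lambda>w. G w $ r $ e) (F z) * cnj (?J $ b $ e))"
        unfolding md by (intro sum.cong refl) simp
      also have "\<dots> = (\<Sum>e\<in>UNIV. \<Sum>r\<in>UNIV. \<Sum>d\<in>UNIV. ?J $ a $ d * ?J $ c $ r * wd (- \<i>) d (\<lambda>w. G w $ r $ e) (F z) * cnj (?J $ b $ e))"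
        by (intro sum.cong refl sum.swap)
      finally show ?thesis unfolding md by (simp add: mult_ac)
    qed
    then show "dz c (\<lambda>w. K w $ a $ b) z = dz a (\<lambda>w. K w $ c $ b) z" by (simp add: dz_wd)
  qed
  then interpret K: local_kaehler V K .
  have "kaehler_pullback U G V K F"
    by unfold_locales (auto simp: Fhol FV pullback_metric_jac J K_def)
  moreover have "F 0 = p" by (simp add: F_def linear_0[OF bounded_linear.linear[OF L]])
  ultimately show ?thesis using that[of V K F] p P1 by (simp add: V_def K_def)
qed

end

lemma hermitian_endomorphism_zero:
  fixes G A J :: "complex^'n::finite^'n"
  assumes G: "J ** G ** hadj J = mat 1" and herm: "hadj A = A"
    and tr: "Re (trace ((A ** matrix_inv G) ** (A ** matrix_inv G))) = 0"
  shows "A ** matrix_inv G = 0"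
proof -
  have d: "det J * det G * det (hadj J) = 1" using arg_cong[OF G, of det] by (simp add: det_mul)
  then have J: "det J \<noteq> 0" and Gd: "det G \<noteq> 0" by auto
  let ?A = "J ** A ** hadj J"
  have I1: "matrix_inv (mat 1 :: complex^'n^'n) = mat 1" by (rule matrix_inv_unique) simp
  have hA: "hadj ?A = ?A" by (simp add: hadj_mult herm matrix_mul_assoc)
  have A: "?A = J ** (A ** matrix_inv G) ** matrix_inv J"
    using congruence_endomorphism(1)[OF Gd J, of A] unfolding G I1 by simp
  have "trace (?A ** ?A) = trace ((A ** matrix_inv G) ** (A ** matrix_inv G))"
    unfolding A by (rule trace_conjugate_sq[OF J])
  moreover have "(norm ?A)\<^sup>2 = Re (trace (?A ** ?A))" by (simp only: trace_sq_hermitian[OF hA] Re_complex_of_real)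
  ultimately have "(norm ?A)\<^sup>2 = 0" using tr by simp
  then have "J ** (A ** matrix_inv G) ** matrix_inv J = 0" using A by simp
  then have "matrix_inv J ** (J ** (A ** matrix_inv G) ** matrix_inv J) ** J = 0" by simp
  moreover have "matrix_inv J ** (J ** (A ** matrix_inv G) ** matrix_inv J) ** J = (matrix_inv J ** J) ** (A ** matrix_inv G) ** (matrix_inv J ** J)"
    by (simp only: matrix_mul_assoc)
  ultimately show ?thesis by (simp add: matrix_inv_right_left[OF J])
qed

lemma (in csc_kaehler) end_zero:
  assumes z: "z \<in> U"
  shows "Re (trace (e_end G z ** e_end G z)) = 0 \<Longrightarrow> e_end G z = 0"
    "Re (trace (b_end G z ** b_end G z)) = 0 \<Longrightarrow> b_end G z = 0"
proof -
  obtain P where "unitary_frame (G z) P" using G_frame[OF z] by blast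
  then have P: "transpose P ** G z ** hadj (transpose P) = mat 1" by (simp add: unitary_frame_matrix)
  then have K: "kron (transpose P) (transpose P) ** kron (G z) (G z) ** hadj (kron (transpose P) (transpose P)) = mat 1"
    by (simp add: hadj_kron kron_mult kron_mat1)
  show "Re (trace (e_end G z ** e_end G z)) = 0 \<Longrightarrow> e_end G z = 0"
    unfolding e_end_def by (rule hermitian_endomorphism_zero[OF P e_mat_herm[OF z]])
  show "Re (trace (b_end G z ** b_end G z)) = 0 \<Longrightarrow> b_end G z = 0"
    unfolding b_end_def by (rule hermitian_endomorphism_zero[OF K b_mat_herm[OF z]])
qed

context kaehler_manifold begin

abbreviation coord :: "('a, 'm) chart \<Rightarrow> (complex^'m) set" where "coord c \<equiv> snd c ` fst c"

lemma chart_inj: "c \<in> A \<Longrightarrow> inj_on (snd c) (fst c)"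
proof -
  assume c: "c \<in> A"
  have "fst c \<subseteq> topspace X" using chart_domain[OF c] openin_subset by blast
  then show ?thesis
    using homeomorphic_imp_injective_map[OF chart_homeomorphic[OF c]] by (simp add: Int_absorb1)
qed

lemma chart_inv_coord: "c \<in> A \<Longrightarrow> p \<in> fst c \<Longrightarrow> chart_inv c (snd c p) = p"
  by (simp add: chart_inj inv_into_f_f)

lemma chart_open_image: assumes c: "c \<in> A" and V: "openin X V" "V \<subseteq> fst c" shows "open (snd c ` V)"
proof -
  have "openin (subtopology X (fst c)) V" using V by (auto simp: openin_subtopology)
  then have "openin (top_of_set (coord c)) (snd c ` V)"
    using homeomorphic_imp_open_map[OF chart_homeomorphic[OF c]] by (simp add: open_map_def)
  then show ?thesis using openin_open_trans[OF _ chart_range[OF c]] by blast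
qed

lemma chart_open_preimage: assumes c: "c \<in> A" and V: "open V" shows "openin X {p \<in> fst c. snd c p \<in> V}"
proof -
  have "fst c \<subseteq> topspace X" using chart_domain[OF c] openin_subset by blast
  moreover have "continuous_map (subtopology X (fst c)) (top_of_set (coord c)) (snd c)"
    using homeomorphic_imp_continuous_map[OF chart_homeomorphic[OF c]] .
  then have "openin (subtopology X (fst c)) {p \<in> topspace (subtopology X (fst c)). snd c p \<in> coord c \<inter> V}"
    by (rule openin_continuous_map_preimage) (simp add: V openin_open_Int)
  moreover have "{p \<in> topspace X \<inter> fst c. snd c p \<in> coord c \<inter> V} = {p \<in> fst c. snd c p \<in> V}"
    using calculation(1) by auto
  ultimately have "openin (subtopology X (fst c)) {p \<in> fst c. snd c p \<in> V}" by (simp only: topspace_subtopology)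
  then show ?thesis using openin_trans_full[OF _ chart_domain[OF c]] by blast
qed

lemma chart_local: "c \<in> A \<Longrightarrow> local_kaehler (coord c) (g c)"
proof
  assume c: "c \<in> A"
  show "open (coord c)" by (rule chart_range[OF c])
  show "msmooth (coord c) (g c)"
    unfolding msmooth_def
    by (intro allI smooth_on_nth[OF chart_range[OF c] smooth_on_nth[OF chart_range[OF c] metric_smooth[OF c]]])
  fix z assume z: "z \<in> coord c"
  show "g c z $ b $ a = cnj (g c z $ a $ b)" for a b by (rule metric_hermitian[OF c z])
  show "0 < Re (\<Sum>al\<in>UNIV. \<Sum>be\<in>UNIV. g c z $ al $ be * v $ al * cnj (v $ be))" if "v \<noteq> 0" for v
    by (rule metric_positive[OF c z that])
  show "dz e (\<lambda>w. g c w $ a $ b) z = dz a (\<lambda>w. g c w $ e $ b) z" for e a b by (rule metric_closed[OF c z])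
qed

lemma transition_pullback:
  assumes c: "c \<in> A" and d: "d \<in> A"
  shows "kaehler_pullback (coord d) (g d) (snd c ` (fst c \<inter> fst d)) (g c) (snd d \<circ> chart_inv c)"
proof -
  have o: "open (snd c ` (fst c \<inter> fst d))"
    by (rule chart_open_image[OF c]) (auto intro: chart_domain c d)
  interpret L: local_kaehler "coord d" "g d" by (rule chart_local[OF d])
  interpret L': local_kaehler "snd c ` (fst c \<inter> fst d)" "g c"
    by (rule local_kaehler_subset[OF chart_local[OF c] o]) auto
  show ?thesis
  proof
    show "hol_on (snd c ` (fst c \<inter> fst d)) (\<lambda>w. (snd d \<circ> chart_inv c) w $ mu)" for mu
      using transition_holomorphic[OF c d] complex_differentiable_hol_on by blast
    show "(snd d \<circ> chart_inv c) z \<in> coord d" if "z \<in> snd c ` (fst c \<inter> fst d)" for z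
      using that by (auto simp: chart_inv_coord[OF c])
    show "g c z = pullback_metric (snd d \<circ> chart_inv c) (g d) z" if "z \<in> snd c ` (fst c \<inter> fst d)" for z
      using that metric_tensor[OF c d] by auto
  qed
qed

lemma attains_max:
  fixes v :: "('a, 'm) chart \<Rightarrow> complex^'m \<Rightarrow> real"
  assumes cpt: "compact_space X" and cont: "\<And>c. c \<in> A \<Longrightarrow> continuous_on (coord c) (v c)"
    and compat: "\<And>c d p. c \<in> A \<Longrightarrow> d \<in> A \<Longrightarrow> p \<in> fst c \<inter> fst d \<Longrightarrow> v c (snd c p) = v d (snd d p)"
  obtains c p where "c \<in> A" "p \<in> fst c" "\<And>d q. d \<in> A \<Longrightarrow> q \<in> fst d \<Longrightarrow> v d (snd d q) \<le> v c (snd c p)"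
proof -
  define f where "f p = (let c = (SOME c. c \<in> A \<and> p \<in> fst c) in v c (snd c p))" for p
  have f: "f p = v c (snd c p)" if "c \<in> A" "p \<in> fst c" for c p
  proof -
    have "(SOME c. c \<in> A \<and> p \<in> fst c) \<in> A \<and> p \<in> fst (SOME c. c \<in> A \<and> p \<in> fst c)"
      by (rule someI[of "\<lambda>c. c \<in> A \<and> p \<in> fst c" c]) (use that in blast)
    then show ?thesis unfolding f_def Let_def using compat that by blast
  qed
  have "continuous_map X euclideanreal f"
    unfolding continuous_map_def
  proof (intro conjI allI impI)
    fix S :: "real set" assume "openin euclideanreal S"
    then have S: "open S" by simp
    have "{p \<in> topspace X. f p \<in> S} = (\<Union>c\<in>A. {p \<in> fst c. snd c p \<in> coord c \<inter> v c -` S})"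
      unfolding charts_cover[symmetric] by (auto simp: f)
    moreover have "openin X {p \<in> fst c. snd c p \<in> coord c \<inter> v c -` S}" if "c \<in> A" for c
      using that by (intro chart_open_preimage continuous_on_open_vimage[THEN iffD1, rule_format] chart_range cont S)
        (simp_all add: continuous_open_preimage[OF cont chart_range S])
    ultimately show "openin X {p \<in> topspace X. f p \<in> S}" by auto
  qed auto
  then have "compactin euclideanreal (f ` topspace X)"
    using cpt image_compactin compact_space_def by blast
  then have "compact (f ` topspace X)" by simp
  moreover have "f ` topspace X \<noteq> {}" using nonempty by simp
  ultimately obtain s where "s \<in> f ` topspace X" "\<And>t. t \<in> f ` topspace X \<Longrightarrow> t \<le> s"
    using compact_attains_sup by metis
  then obtain p where p: "p \<in> topspace X" "\<And>q. q \<in> topspace X \<Longrightarrow> f q \<le> f p" by auto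
  then obtain c where c: "c \<in> A" "p \<in> fst c" using charts_cover by blast
  show ?thesis
  proof (rule that[OF c])
    fix d q assume "d \<in> A" "q \<in> fst d"
    moreover then have "q \<in> topspace X" using charts_cover by blast
    ultimately show "v d (snd d q) \<le> v c (snd c p)" using p(2)[of q] f c by simp
  qed
qed

end

lemma (in csc_kaehler) csc_pullback:
  assumes "kaehler_pullback U G V K F"
  shows "csc_kaehler V K R"
proof -
  interpret P: kaehler_pullback U G V K F by fact
  show ?thesis by unfold_locales (simp add: P.tensor_pull P.F_in scal)
qed

lemma (in csc_kaehler) norms_pullback:
  assumes "kaehler_pullback U G V K F" and z: "z \<in> V"
  shows "norm_E K z = norm_E G (F z)" "norm_B K z = norm_B G (F z)"
proof -
  interpret P: kaehler_pullback U G V K F by fact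
  interpret K: csc_kaehler V K R by (rule csc_pullback[OF assms(1)])
  show "norm_E K z = norm_E G (F z)" "norm_B K z = norm_B G (F z)"
    using norm_E_trace[OF P.F_in[OF z]] norm_B_trace[OF P.F_in[OF z]] K.norm_E_trace[OF z] K.norm_B_trace[OF z] P.trace_pull[OF z]
    by simp_all
qed

lemma (in kaehler_manifold) nonpositive_by_maximum:
  fixes v :: "(complex^'m \<Rightarrow> complex^'m^'m) \<Rightarrow> complex^'m \<Rightarrow> real"
  assumes cpt: "compact_space X" and c: "c \<in> A" and z: "z \<in> coord c"
    and cont: "\<And>c. c \<in> A \<Longrightarrow> continuous_on (coord c) (v (g c))"
    and pull: "\<And>U G V K F z. kaehler_pullback U G V K F \<Longrightarrow> z \<in> V \<Longrightarrow> v K z = v G (F z)"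
    and max0: "\<And>d p V K F. d \<in> A \<Longrightarrow> p \<in> fst d \<Longrightarrow> kaehler_pullback (coord d) (g d) V K F \<Longrightarrow> 0 \<in> V \<Longrightarrow> F 0 = snd d p \<Longrightarrow>
      K 0 = mat 1 \<Longrightarrow> (\<And>w. w \<in> V \<Longrightarrow> v K w \<le> v K 0) \<Longrightarrow> v K 0 = 0"
  shows "v (g c) z \<le> 0"
proof -
  obtain d p where d: "d \<in> A" "p \<in> fst d" and max: "\<And>c q. c \<in> A \<Longrightarrow> q \<in> fst c \<Longrightarrow> v (g c) (snd c q) \<le> v (g d) (snd d p)"
  proof (rule attains_max[OF cpt, of "\<lambda>c. v (g c)"])
    fix c d p assume cd: "c \<in> A" "d \<in> A" "p \<in> fst c \<inter> fst d"
    then have "v (g c) (snd c p) = v (g d) ((snd d \<circ> chart_inv c) (snd c p))"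
      by (intro pull[OF transition_pullback[OF cd(1,2)]]) auto
    then show "v (g c) (snd c p) = v (g d) (snd d p)" using cd by (simp add: chart_inv_coord)
  qed (rule cont, assumption, rule that)
  have pd: "snd d p \<in> coord d" using d by blast
  obtain V K F where P: "kaehler_pullback (coord d) (g d) V K F" and F: "0 \<in> V" "F 0 = snd d p" "K 0 = mat 1"
    by (rule local_kaehler.normal_coordinates[OF chart_local[OF d(1)] pd])
  have "v K w \<le> v K 0" if w: "w \<in> V" for w
  proof -
    have "F w \<in> coord d" using kaehler_pullback.F_in[OF P w] .
    then obtain q where "q \<in> fst d" "F w = snd d q" by blast
    then show ?thesis using max[OF d(1), of q] by (simp add: pull[OF P w] pull[OF P F(1)] F(2))
  qed
  from max0[OF d P F this] have "v (g d) (snd d p) = 0" using pull[OF P F(1)] F(2) by simp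
  moreover obtain q where "q \<in> fst c" "z = snd c q" using z by blast
  ultimately show ?thesis using max[OF c, of q] by simp
qed

theorem (in kaehler_manifold) einstein_bochner_flat:
  fixes R :: real
  assumes cpt: "compact_space X" and m2: "CARD('m) \<ge> 2" and R: "R > 0"
    and scal: "\<And>c p. c \<in> A \<Longrightarrow> p \<in> fst c \<Longrightarrow> scalar_curv (g c) (snd c p) = complex_of_real R"
    and pinch: "\<And>c p. c \<in> A \<Longrightarrow> p \<in> fst c \<Longrightarrow> sqrt 2 * norm_E (g c) (snd c p) + norm_B (g c) (snd c p)
             < 2 * sqrt ((real CARD('m))\<^sup>2 - 1) * R / (3 * ((real CARD('m))\<^sup>2 - 2))"
    and c: "c \<in> A"
  shows "csc_kaehler (coord c) (g c) R" "\<And>z. z \<in> coord c \<Longrightarrow> e_end (g c) z = 0" "\<And>z. z \<in> coord c \<Longrightarrow> b_end (g c) z = 0"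
proof -
  have csc: "csc_kaehler (coord c) (g c) R" if "c \<in> A" for c
    using chart_local[OF that] scal[OF that] by (auto simp: csc_kaehler_def csc_kaehler_axioms_def)
  then show "csc_kaehler (coord c) (g c) R" using c .
  have pinchK: "sqrt 2 * norm_E K 0 + norm_B K 0 < 2 * sqrt ((real CARD('m))\<^sup>2 - 1) * R / (3 * ((real CARD('m))\<^sup>2 - 2))"
    if d: "d \<in> A" "p \<in> fst d" and P: "kaehler_pullback (coord d) (g d) V K F" "0 \<in> V" "F 0 = snd d p" for d p V K F
    using pinch[OF d] csc_kaehler.norms_pullback[OF csc[OF d(1)] P(1,2)] by (simp add: P(3))
  have ein: "e_end (g c) z = 0" if c: "c \<in> A" and z: "z \<in> coord c" for c z
  proof -
    have "Re (trace (e_end (g c) z ** e_end (g c) z)) \<le> 0"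
    proof (rule nonpositive_by_maximum[OF cpt c z, of "\<lambda>G z. Re (trace (e_end G z ** e_end G z))"])
      fix c assume c: "c \<in> A"
      interpret C: csc_kaehler "coord c" "g c" R by (rule csc[OF c])
      have "continuous_on (coord c) (\<lambda>z. Re (trace (C.E z ** C.E z)))"
        by (intro continuous_on_Re smooth_on_continuous smooth_on_trace chart_range c msmooth_mult C.E_smooth)
      then show "continuous_on (coord c) (\<lambda>z. Re (trace (e_end (g c) z ** e_end (g c) z)))"
        by (rule continuous_on_cong[THEN iffD1, OF refl, rotated]) (simp only: C.E_e_end)
    next
      fix d p V K F assume d: "d \<in> A" "p \<in> fst d" and P: "kaehler_pullback (coord d) (g d) V K F" "0 \<in> V" "F 0 = snd d p" "K 0 = mat 1"
        and max: "\<And>w. w \<in> V \<Longrightarrow> Re (trace (e_end K w ** e_end K w)) \<le> Re (trace (e_end K 0 ** e_end K 0))"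
      have "e_end K 0 = 0"
        by (rule csc_kaehler.einstein_at_max[OF csc_kaehler.csc_pullback[OF csc[OF d(1)] P(1)] P(2,4) m2 R max pinchK[OF d P(1-3)]])
      then show "Re (trace (e_end K 0 ** e_end K 0)) = 0" by (simp add: trace_def)
    qed (simp add: kaehler_pullback.trace_pull)
    then show ?thesis using csc_kaehler.norm_E_trace(2)[OF csc[OF c] z] by (intro csc_kaehler.end_zero(1)[OF csc[OF c] z]) simp
  qed
  then show "\<And>z. z \<in> coord c \<Longrightarrow> e_end (g c) z = 0" using c by blast
  have "b_end (g c) z = 0" if c: "c \<in> A" and z: "z \<in> coord c" for c z
  proof -
    have "Re (trace (b_end (g c) z ** b_end (g c) z)) \<le> 0"
    proof (rule nonpositive_by_maximum[OF cpt c z, of "\<lambda>G z. Re (trace (b_end G z ** b_end G z))"])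
      fix c assume c: "c \<in> A"
      interpret C: csc_kaehler "coord c" "g c" R by (rule csc[OF c])
      have "continuous_on (coord c) (\<lambda>z. Re (trace (C.BT z ** C.BT z)))"
        by (intro continuous_on_Re smooth_on_continuous smooth_on_trace chart_range c msmooth_mult C.BT_smooth)
      then show "continuous_on (coord c) (\<lambda>z. Re (trace (b_end (g c) z ** b_end (g c) z)))"
        by (rule continuous_on_cong[THEN iffD1, OF refl, rotated]) (simp only: C.einstein_b_mat(2) ein[OF c])
    next
      fix d p V K F assume d: "d \<in> A" "p \<in> fst d" and P: "kaehler_pullback (coord d) (g d) V K F" "0 \<in> V" "F 0 = snd d p" "K 0 = mat 1"
        and max: "\<And>w. w \<in> V \<Longrightarrow> Re (trace (b_end K w ** b_end K w)) \<le> Re (trace (b_end K 0 ** b_end K 0))"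
      have "e_end K w = 0" if "w \<in> V" for w
        using kaehler_pullback.F_in[OF P(1) that] ein[OF d(1)] by (simp add: kaehler_pullback.tensor_pull[OF P(1) that])
      then have "b_end K 0 = 0"
        by (rule csc_kaehler.bochner_flat_at_max[OF csc_kaehler.csc_pullback[OF csc[OF d(1)] P(1)] P(2,4) m2 R _ max pinchK[OF d P(1-3)]])
      then show "Re (trace (b_end K 0 ** b_end K 0)) = 0" by (simp add: trace_def)
    qed (simp add: kaehler_pullback.trace_pull)
    then show ?thesis using csc_kaehler.norm_B_trace(2)[OF csc[OF c] z] by (intro csc_kaehler.end_zero(2)[OF csc[OF c] z]) simp
  qed
  then show "\<And>z. z \<in> coord c \<Longrightarrow> b_end (g c) z = 0" using c by blast
qed

section \<open>Kaehler metrics of constant holomorphic sectional curvature\<close>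

locale chsc_kaehler = local_kaehler U G for U :: "(complex^'m::finite) set" and G :: "complex^'m \<Rightarrow> complex^'m^'m" +
  fixes k :: real
  assumes k_pos: "k > 0"
    and curv_eq: "z \<in> U \<Longrightarrow> base.curv c d z $ a $ b = - (k * (G z $ c $ d * (if a = b then 1 else 0) + G z $ a $ d * (if c = b then 1 else 0)))"

lemma (in csc_kaehler) bochner_flat_chsc:
  assumes R: "R > 0" and "\<And>z. z \<in> U \<Longrightarrow> e_end G z = 0" "\<And>z. z \<in> U \<Longrightarrow> b_end G z = 0"
  shows "chsc_kaehler U G ka"
proof
  show "ka > 0" using R by (simp add: ka_def)
  fix z c d a b assume z: "z \<in> U"
  have "BT z = 0" using einstein_b_mat(2)[OF z assms(2)[OF z]] assms(3)[OF z] by simp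
  then have "Rh z = - (ka *\<^sub>R (mat 1 + swapm))" by (simp add: BT_def eq_neg_iff_add_eq_0)
  then have r: "r_mat G z = - (ka *\<^sub>R (kron (G z) (G z) + swapm ** kron (G z) (G z)))"
    using Rh_r_mat[OF z] by (simp add: mm_simps scaleR_mm)
  have rm: "riemann G z n q a d = - (ka *\<^sub>R (G z $ a $ d * G z $ n $ q + G z $ n $ d * G z $ a $ q))" for n q a d
    using arg_cong[OF r, of "\<lambda>T. T $ (a, n) $ (d, q)"] by (simp add: r_mat_def swapm_mult)
  have "base.curv c d z $ a $ b = (base.curv c d z ** G z ** Gi z) $ a $ b" by (simp add: base.Hi_simps[OF z])
  also have "\<dots> = (\<Sum>q\<in>UNIV. riemann G z a q c d * Gi z $ q $ b)"
    by (simp add: matrix_mult_nth[of "base.curv c d z ** G z"] riemann_curv)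
  also have "\<dots> = - (ka *\<^sub>R (G z $ c $ d * (G z ** Gi z) $ a $ b + G z $ a $ d * (G z ** Gi z) $ c $ b))"
    by (simp add: rm matrix_mult_nth scaleR_conv_of_real[where 'a=complex] sum_negf sum.distrib sum_subtractf left_diff_distrib right_diff_distrib distrib_left distrib_right sum_distrib_left mult_ac)
  also have "\<dots> = - (ka * (G z $ c $ d * (if a = b then 1 else 0) + G z $ a $ d * (if c = b then 1 else 0)))"
    by (simp add: base.Hi_simps[OF z] mat_def scaleR_conv_of_real[where 'a=complex])
  finally show "base.curv c d z $ a $ b = - (ka * (G z $ c $ d * (if a = b then 1 else 0) + G z $ a $ d * (if c = b then 1 else 0)))" .
qed

lemma wd_det:
  fixes A :: "complex^'m::finite \<Rightarrow> complex^'n::finite^'n"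
  assumes S: "msmooth S A" "z \<in> S" and d: "det (A z) \<noteq> 0"
  shows "wd k c (\<lambda>w. det (A w)) z = det (A z) * trace (md k c A z ** matrix_inv (A z))"
proof -
  let ?B = "md k c A z ** matrix_inv (A z)"
  have dA: "(\<lambda>w. A w $ i $ j) differentiable (at z)" for i j by (rule msmooth_diff_at[OF S])
  have prod: "wd k c (\<lambda>w. \<Prod>i\<in>I. f i w) z = (\<Sum>i\<in>I. wd k c (f i) z * (\<Prod>j\<in>I - {i}. f j z)) \<and> (\<lambda>w. \<Prod>i\<in>I. f i w) differentiable (at z)"
    if "finite I" "\<And>i. f i differentiable (at z)" for I :: "'n set" and f :: "'n \<Rightarrow> complex^'m \<Rightarrow> complex"
    using that(1)
  proof (induction I)
    case (insert x I)
    have "(\<Sum>i\<in>I. wd k c (f i) z * (\<Prod>j\<in>insert x I - {i}. f j z)) = f x z * (\<Sum>i\<in>I. wd k c (f i) z * (\<Prod>j\<in>I - {i}. f j z))"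
      unfolding sum_distrib_left
    proof (rule sum.cong[OF refl])
      fix i assume "i \<in> I"
      then have "insert x I - {i} = insert x (I - {i})" "x \<notin> I - {i}" using insert.hyps by auto
      then show "wd k c (f i) z * (\<Prod>j\<in>insert x I - {i}. f j z) = f x z * (wd k c (f i) z * (\<Prod>j\<in>I - {i}. f j z))"
        using insert.hyps by (simp add: mult_ac)
    qed
    moreover have "insert x I - {x} = I" using insert.hyps by auto
    ultimately show ?case using insert that(2) by (simp add: wd_mult)
  qed auto
  have "wd k c (\<lambda>w. det (A w)) z = (\<Sum>p\<in>{p. p permutes UNIV}. of_int (sign p) * (\<Sum>i\<in>UNIV. md k c A z $ i $ p i * (\<Prod>j\<in>UNIV - {i}. A z $ j $ p j)))"
    unfolding det_def using prod[of UNIV "\<lambda>i w. A w $ i $ p i" for p, OF finite_class.finite_UNIV dA]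
    by (simp add: wd_sum wd_mult)
  also have "\<dots> = (\<Sum>i\<in>UNIV. \<Sum>p\<in>{p. p permutes UNIV}. of_int (sign p) * (md k c A z $ i $ p i * (\<Prod>j\<in>UNIV - {i}. A z $ j $ p j)))"
    unfolding sum_distrib_left by (rule sum.swap)
  also have "\<dots> = (\<Sum>i\<in>UNIV. det (\<chi> r. if r = i then md k c A z $ i else A z $ r))"
  proof (rule sum.cong[OF refl])
    fix i :: 'n
    have "md k c A z $ i $ p i * (\<Prod>j\<in>UNIV - {i}. A z $ j $ p j) = (\<Prod>j\<in>UNIV. (\<chi> r. if r = i then md k c A z $ i else A z $ r) $ j $ p j)" for p :: "'n \<Rightarrow> 'n"
      using prod.remove[of UNIV i "\<lambda>j. (\<chi> r. if r = i then md k c A z $ i else A z $ r) $ j $ p j"] by simp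
    then show "(\<Sum>p\<in>{p. p permutes UNIV}. of_int (sign p) * (md k c A z $ i $ p i * (\<Prod>j\<in>UNIV - {i}. A z $ j $ p j))) = det (\<chi> r. if r = i then md k c A z $ i else A z $ r)"
      by (simp add: det_def)
  qed
  also have "\<dots> = (\<Sum>i\<in>UNIV. ?B $ i $ i * det (A z))"
  proof (rule sum.cong[OF refl])
    fix i :: 'n
    have "md k c A z = ?B ** A z" using matrix_inv_right_left[OF d] by (simp add: matrix_mul_assoc[symmetric])
    then have "md k c A z $ i = (?B ** A z) $ i" by simp
    also have "\<dots> = (\<Sum>q\<in>UNIV. ?B $ i $ q *s A z $ q)"
      by (simp add: vec_eq_iff matrix_mult_nth)
    finally have row: "md k c A z $ i = (\<Sum>q\<in>UNIV. ?B $ i $ q *s A z $ q)" .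
    have "det (\<chi> r. if r = i then md k c A z $ i else A z $ r) = (\<Sum>q\<in>UNIV. ?B $ i $ q * det (\<chi> r. if r = i then A z $ q else A z $ r))"
      unfolding row by (subst det_linear_row_sum) (simp_all add: det_row_mul)
    also have "\<dots> = (\<Sum>q\<in>UNIV. if q = i then ?B $ i $ i * det (A z) else 0)"
    proof (rule sum.cong[OF refl])
      fix q
      show "?B $ i $ q * det (\<chi> r. if r = i then A z $ q else A z $ r) = (if q = i then ?B $ i $ i * det (A z) else 0)"
      proof (cases "q = i")
        case True
        then have "(\<chi> r. if r = i then A z $ q else A z $ r) = A z" by (simp add: vec_eq_iff)
        then show ?thesis using True by simp
      next
        case False
        then have "det (\<chi> r. if r = i then A z $ q else A z $ r) = 0"
          by (intro det_identical_rows[of i q]) (auto simp: row_def vec_eq_iff)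
        then show ?thesis using False by simp
      qed
    qed
    finally show "det (\<chi> r. if r = i then md k c A z $ i else A z $ r) = ?B $ i $ i * det (A z)" by simp
  qed
  finally show ?thesis by (simp add: trace_def sum_distrib_left mult.commute)
qed

lemma flat_hermitian_factor_at:
  fixes M :: "'n::finite \<Rightarrow> 'n \<Rightarrow> complex^'m::finite \<Rightarrow> complex"
  assumes U: "open U" "p \<in> U" and w: "\<And>c i j. hol_on U (w c i j)"
    and M: "\<And>i j z. z \<in> U \<Longrightarrow> M i j differentiable (at z)"
    and herm: "\<And>i j z. z \<in> U \<Longrightarrow> M j i z = cnj (M i j z)"
    and flat: "\<And>c i j z. z \<in> U \<Longrightarrow> dz c (M i j) z = (\<Sum>k\<in>UNIV. w c i k z * M k j z)"
    and pos: "\<And>v. v \<noteq> 0 \<Longrightarrow> 0 < Re (\<Sum>i\<in>UNIV. \<Sum>j\<in>UNIV. M i j p * v $ i * cnj (v $ j))"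
  obtains r and S :: "'n \<Rightarrow> 'n \<Rightarrow> complex^'m \<Rightarrow> complex" where "0 < r" "ball p r \<subseteq> U" "\<And>i j. hol_on (ball p r) (S i j)"
    "\<And>i k z. z \<in> ball p r \<Longrightarrow> M i k z = (\<Sum>j\<in>UNIV. S i j z * cnj (S k j z))"
proof -
  obtain r0 where r0: "r0 > 0" "ball p r0 \<subseteq> U" using U openE by blast
  have sh: "p + z \<in> U" if "z \<in> ball 0 r0" for z using that r0 by (auto simp: dist_norm)
  have d: "((\<lambda>z. f (p + z)) has_derivative frechet_derivative f (at (p + z))) (at z)"
    if "f differentiable (at (p + z))" for f :: "complex^'m \<Rightarrow> complex" and z
    by (rule has_derivative_compose[of "\<lambda>z. p + z" "\<lambda>h. h" z UNIV, OF _ has_frechet[OF that]]) (auto intro!: derivative_eq_intros)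
  have wd: "wd k c (\<lambda>z. f (p + z)) z = wd k c f (p + z)" if "f differentiable (at (p + z))" for f :: "complex^'m \<Rightarrow> complex" and z k c
    unfolding wdI[OF d[OF that], of k c] wdI[OF has_frechet[OF that], of k c] ..
  have hol: "hol_on S (\<lambda>z. f (a + z))" if "hol_on T f" "\<And>z. z \<in> S \<Longrightarrow> a + z \<in> T" for S T a and f :: "complex^'m \<Rightarrow> complex"
    by (rule hol_on_compose[OF _ that(1), of S "\<lambda>z. a + z"]) (auto simp: that(2) intro: hol_on_add hol_on_const hol_on_nth)
  have "\<exists>Q. unitary_frame (\<chi> i j. M i j p) Q"
    by (rule unitary_frame_exists, unfold vec_lambda_beta, rule herm[OF U(2)], rule pos)
  then obtain Q where Q: "unitary_frame (\<chi> i j. M i j p) Q" by blast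
  obtain r and S :: "'n \<Rightarrow> 'n \<Rightarrow> complex^'m \<Rightarrow> complex" where r: "0 < r" "r \<le> r0" and S: "\<And>i j. hol_on (ball 0 r) (S i j)"
    and MS: "\<And>i k z. z \<in> ball 0 r \<Longrightarrow> M i k (p + z) = (\<Sum>j\<in>UNIV. S i j z * cnj (S k j z))"
  proof (rule flat_hermitian_factor[of r0 "\<lambda>c i j z. w c i j (p + z)" "\<lambda>i j z. M i j (p + z)" "\<lambda>i a. Q $ i $ a"])
    show "hol_on (ball 0 r0) (\<lambda>z. w c i j (p + z))" for c i j by (rule hol[OF w sh])
    show "(\<lambda>z. M i j (p + z)) differentiable (at z)" if "z \<in> ball 0 r0" for i j z
      using d[OF M[OF sh[OF that]]] differentiable_def by blast
    show "dz c (\<lambda>z. M i j (p + z)) z = (\<Sum>k\<in>UNIV. w c i k (p + z) * M k j (p + z))" if "z \<in> ball 0 r0" for c i j z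
      using flat[OF sh[OF that], of c i j] by (simp add: dz_wd wd[OF M[OF sh[OF that]]])
    show "(\<Sum>i\<in>UNIV. \<Sum>j\<in>UNIV. Q $ i $ a * M i j (p + 0) * cnj (Q $ j $ b)) = (if a = b then 1 else 0)" for a b
      using Q by (simp add: unitary_frame_def mult_ac)
    show "M j i (p + z) = cnj (M i j (p + z))" if "z \<in> ball 0 r0" for i j z by (rule herm[OF sh[OF that]])
  qed (rule r0(1), rule that)
  show thesis
  proof (rule that[of r "\<lambda>i j z. S i j (- p + z)"])
    show "ball p r \<subseteq> U" using r r0 by auto
    show "hol_on (ball p r) (\<lambda>z. S i j (- p + z))" for i j by (rule hol[OF S]) (auto simp: dist_norm norm_minus_commute)
    show "M i k z = (\<Sum>j\<in>UNIV. S i j (- p + z) * cnj (S k j (- p + z)))" if "z \<in> ball p r" for i k z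
      using MS[of "- p + z" i k] that by (simp add: dist_norm norm_minus_commute)
  qed (rule r)
qed

definition hp :: "complex^'n::finite \<Rightarrow> complex^'n \<Rightarrow> complex" where
  "hp u v = (\<Sum>j\<in>UNIV. u $ j * cnj (v $ j))"

text \<open>The Hessian of \<open>ln |x|\<^sup>2\<close> at \<open>x\<close>: the Fubini-Study form on homogeneous coordinates.\<close>
definition fs_form :: "complex^'n::finite \<Rightarrow> complex^'n \<Rightarrow> complex^'n \<Rightarrow> complex" where
  "fs_form x u v = hp u v / hp x x - hp u x * hp x v / (hp x x)\<^sup>2"

definition dv :: "'m \<Rightarrow> (complex^'m::finite \<Rightarrow> complex^'n::finite) \<Rightarrow> complex^'m \<Rightarrow> complex^'n" where
  "dv c s z = (\<chi> j. dz c (\<lambda>w. s w $ j) z)"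

definition vhol :: "(complex^'m::finite) set \<Rightarrow> (complex^'m \<Rightarrow> complex^'n::finite) \<Rightarrow> bool" where
  "vhol S s \<longleftrightarrow> (\<forall>j. hol_on S (\<lambda>w. s w $ j))"

lemma hp_norm: "hp x x = complex_of_real ((norm x)\<^sup>2)"
  by (simp add: hp_def norm_vec_def L2_set_def complex_norm_square sum_nonneg flip: of_real_power)

lemma hp_zero [simp]: "hp x x = 0 \<longleftrightarrow> x = 0"
  by (simp add: hp_norm)

lemma hp_cnj: "cnj (hp u v) = hp v u"
  by (simp add: hp_def mult.commute)

lemma hp_linear:
  "hp (u + v) x = hp u x + hp v x" "hp x (u + v) = hp x u + hp x v"
  "hp (a *s u) x = a * hp u x" "hp x (a *s u) = cnj a * hp x u"
  by (simp_all add: hp_def sum.distrib distrib_left distrib_right sum_distrib_left mult_ac)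

lemma fs_form_scale:
  assumes "h \<noteq> 0" "x \<noteq> 0"
  shows "fs_form (h *s x) (h *s u + a *s x) (h *s v + b *s x) = fs_form x u v"
  using assms by (simp add: fs_form_def hp_linear field_simps power2_eq_square)

lemma vhol_hp:
  assumes s: "vhol S s" and t: "vhol S t" and z: "z \<in> S"
  shows "(\<lambda>w. hp (s w) (t w)) differentiable (at z)"
    "dz c (\<lambda>w. hp (s w) (t w)) z = hp (dv c s z) (t z)" "dzbar c (\<lambda>w. hp (s w) (t w)) z = hp (s z) (dv c t z)"
proof -
  have d: "(\<lambda>w. s w $ j) differentiable (at z)" "(\<lambda>w. t w $ j) differentiable (at z)" "(\<lambda>w. cnj (t w $ j)) differentiable (at z)"
    "wd \<i> c (\<lambda>w. s w $ j) z = 0" "wd \<i> c (\<lambda>w. t w $ j) z = 0" for j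
    using s t z hol_on_dzbar hol_on_differentiable differentiable_cnj unfolding vhol_def dzbar_wd by blast+
  show "(\<lambda>w. hp (s w) (t w)) differentiable (at z)"
    unfolding hp_def using d by auto
  show "dz c (\<lambda>w. hp (s w) (t w)) z = hp (dv c s z) (t z)" "dzbar c (\<lambda>w. hp (s w) (t w)) z = hp (s z) (dv c t z)"
    unfolding hp_def dz_wd dzbar_wd dv_def by (simp_all add: wd_sum wd_mult wd_cnj d dz_wd)
qed

lemma vhol_dv: "open S \<Longrightarrow> vhol S s \<Longrightarrow> vhol S (dv c s)"
  by (auto simp: vhol_def dv_def intro: hol_on_dz)

lemma dzbar_log_derivative:
  assumes s: "vhol S s" and S: "open S" "z \<in> S" and nz: "s z \<noteq> 0"
  shows "(\<lambda>w. hp (dv a s w) (s w) / hp (s w) (s w)) differentiable (at z)"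
    "dzbar b (\<lambda>w. hp (dv a s w) (s w) / hp (s w) (s w)) z = fs_form (s z) (dv a s z) (dv b s z)"
proof -
  note h1 = vhol_hp[OF vhol_dv[OF S(1) s] s S(2)] and h2 = vhol_hp[OF s s S(2)]
  have nz': "hp (s z) (s z) \<noteq> 0" using nz by simp
  show "(\<lambda>w. hp (dv a s w) (s w) / hp (s w) (s w)) differentiable (at z)"
    by (rule differentiable_divide_complex[OF h1(1) h2(1) nz'])
  have "dzbar b (\<lambda>w. hp (dv a s w) (s w) / hp (s w) (s w)) z
    = hp (dv a s z) (dv b s z) * inverse (hp (s z) (s z)) + hp (dv a s z) (s z) * (- (hp (s z) (dv b s z) / (hp (s z) (s z))\<^sup>2))"
    using h1(1,3) h2(1,3) nz' unfolding divide_inverse[of "hp (dv a s _) _"] dzbar_wd by (simp add: wd_mult wd_inverse)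
  then show "dzbar b (\<lambda>w. hp (dv a s w) (s w) / hp (s w) (s w)) z = fs_form (s z) (dv a s z) (dv b s z)"
    by (simp add: fs_form_def divide_inverse)
qed

lemma sum_option: "(\<Sum>i\<in>UNIV. f i) = f None + (\<Sum>a\<in>UNIV. f (Some a))"
  for f :: "'m::finite option \<Rightarrow> 'b::comm_monoid_add"
  by (simp add: UNIV_option_conv sum.reindex)

context chsc_kaehler begin

lemma det_positive:
  assumes z: "z \<in> U"
  shows "\<exists>d>0. det (G z) = complex_of_real d"
proof -
  obtain P where "unitary_frame (G z) P"
    using unitary_frame_exists[of "G z"] G_pos[OF z] G_herm[OF z] by blast
  then have "det (transpose P) * det (G z) * det (hadj (transpose P)) = 1"
    using det_mul[of "transpose P ** G z" "hadj (transpose P)"] det_mul[of "transpose P" "G z"] by (simp add: unitary_frame_matrix)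
  moreover have "det (hadj (transpose P)) = cnj (det (transpose P))"
    by (simp add: det_transpose) (simp add: det_def hadj_def transpose_def)
  ultimately have "det (G z) * complex_of_real ((cmod (det P))\<^sup>2) = 1"
    unfolding complex_norm_square by (simp add: mult_ac)
  moreover from this have "(cmod (det P))\<^sup>2 \<noteq> 0" by auto
  ultimately have "det (G z) = complex_of_real (1 / (cmod (det P))\<^sup>2)" by (simp add: field_simps)
  then show ?thesis using \<open>(cmod (det P))\<^sup>2 \<noteq> 0\<close> by (intro exI[of _ "1 / (cmod (det P))\<^sup>2"]) auto
qed

definition lam :: complex where "lam = - 1 / of_nat (CARD('m) + 1)"
definition pot :: "complex^'m \<Rightarrow> complex" where "pot z = det (G z) powr lam"
definition tht :: "'m \<Rightarrow> complex^'m \<Rightarrow> complex" where "tht c z = lam * trace (base.conn c z)"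

lemma tht_smooth: "smooth_on (tht c) U"
  unfolding tht_def[abs_def] by (intro smooth_on_mult smooth_on_const open_U smooth_on_trace base.conn_smooth)

lemma dzbar_tht:
  assumes z: "z \<in> U"
  shows "wd \<i> d (tht c) z = k * G z $ c $ d"
proof -
  have t: "(\<lambda>w. trace (base.conn c w)) differentiable (at z)"
    by (rule smooth_on_differentiable[OF smooth_on_trace[OF open_U base.conn_smooth] z])
  have "wd \<i> d (tht c) z = lam * trace (base.curv c d z)"
    unfolding tht_def[abs_def] using t by (simp add: wd_mult trace_def base.curv_def wd_sum msmooth_diff_at[OF base.conn_smooth z])
  moreover have "trace (base.curv c d z) = - (of_nat (CARD('m) + 1) * (k * G z $ c $ d))"
  proof -
    have "base.curv c d z $ a $ a = - (k * G z $ c $ d) - (if a = c then k * G z $ c $ d else 0)" for a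
      by (simp add: curv_eq[OF z] distrib_left)
    then show ?thesis by (simp add: trace_def sum_subtractf sum_negf distrib_right)
  qed
  moreover have "(of_nat (CARD('m) + 1) :: complex) \<noteq> 0" by (simp only: of_nat_eq_0_iff)
  ultimately show ?thesis by (simp add: lam_def del: of_nat_add of_nat_Suc)
qed

lemma pot_props:
  assumes z: "z \<in> U"
  shows "\<exists>d>0. pot z = complex_of_real d" "pot differentiable (at z)" "wd (- \<i>) c pot z = tht c z * pot z"
proof -
  obtain d where d: "d > 0" "det (G z) = complex_of_real d" using det_positive[OF z] by blast
  have "lam = complex_of_real (- 1 / of_nat (CARD('m) + 1))" by (simp add: lam_def)
  then have "pot z = complex_of_real (d powr (- 1 / of_nat (CARD('m) + 1)))"
    using d by (simp only: pot_def powr_of_real[OF less_imp_le])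
  then show "\<exists>d>0. pot z = complex_of_real d" using d(1) by (metis powr_gt_zero less_irrefl)
  have der: "((\<lambda>x. x powr lam) has_field_derivative lam * det (G z) powr (lam - 1)) (at (det (G z)))"
    by (rule has_field_derivative_powr) (use d in \<open>auto simp: complex_nonpos_Reals_iff\<close>)
  have dd: "(\<lambda>w. det (G w)) differentiable (at z)"
    by (rule smooth_on_differentiable[OF smooth_on_det[OF open_U] z]) (rule msmoothD[OF G_smooth])
  show "pot differentiable (at z)" unfolding pot_def[abs_def] by (rule differentiable_chain_complex[OF dd der])
  have "wd (- \<i>) c pot z = lam * det (G z) powr (lam - 1) * (det (G z) * trace (base.conn c z))"
    unfolding pot_def[abs_def] wd_chain[OF dd der] wd_det[OF G_smooth z G_det[OF z]] base.conn_def ..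
  then show "wd (- \<i>) c pot z = tht c z * pot z"
    using G_det[OF z] by (simp add: tht_def pot_def powr_diff)
qed

definition N :: "'m option \<Rightarrow> 'm option \<Rightarrow> complex^'m \<Rightarrow> complex" where
  "N i j z = (case i of None \<Rightarrow> 1 | Some a \<Rightarrow> tht a z) * (case j of None \<Rightarrow> 1 | Some b \<Rightarrow> cnj (tht b z))
     + (case i of None \<Rightarrow> 0 | Some a \<Rightarrow> (case j of None \<Rightarrow> 0 | Some b \<Rightarrow> k * G z $ a $ b))"

definition W :: "'m \<Rightarrow> 'm option \<Rightarrow> 'm option \<Rightarrow> complex^'m \<Rightarrow> complex" where
  "W c i j z = (case i of None \<Rightarrow> if j = Some c then 1 else 0
     | Some a \<Rightarrow> (case j of None \<Rightarrow> wd (- \<i>) c (tht a) z - tht c z * tht a z - (\<Sum>n\<in>UNIV. base.conn c z $ a $ n * tht n z)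
         | Some n \<Rightarrow> base.conn c z $ a $ n + (if n = a then 1 else 0) * tht c z + (if n = c then 1 else 0) * tht a z))"

lemma dz_G:
  assumes z: "z \<in> U"
  shows "wd (- \<i>) c (\<lambda>w. G w $ a $ b) z = (\<Sum>n\<in>UNIV. base.conn c z $ a $ n * G z $ n $ b)"
  using base.md_H[OF z, of c] by (simp add: vec_eq_iff matrix_mult_nth)

lemma N_flat:
  assumes z: "z \<in> U"
  shows "(\<lambda>w. pot w * N i j w) differentiable (at z)"
    "wd (- \<i>) c (\<lambda>w. pot w * N i j w) z = (\<Sum>l\<in>UNIV. W c i l z * (pot z * N l j z))"
proof -
  note th = smooth_on_differentiable[OF tht_smooth z] and th' = differentiable_cnj[OF smooth_on_differentiable[OF tht_smooth z]]
  note dG = msmooth_diff_at[OF G_smooth z] and ps = pot_props(2)[OF z]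
  have Nd: "N i j differentiable (at z)"
    unfolding N_def by (cases i; cases j) (simp_all add: th th' dG)
  then show "(\<lambda>w. pot w * N i j w) differentiable (at z)" using ps by simp
  have c: "wd (- \<i>) c (\<lambda>w. cnj (tht b w)) z = k * G z $ c $ b" for b
    by (simp add: wd_cnj th dzbar_tht[OF z] G_herm[OF z, symmetric])
  have "tht c z * N i j z + wd (- \<i>) c (N i j) z = (\<Sum>l\<in>UNIV. W c i l z * N l j z)"
    unfolding sum_option N_def W_def
    by (cases i; cases j) (simp_all add: wd_add wd_mult th th' dG c dz_G[OF z] sum.distrib distrib_left distrib_right
        left_diff_distrib right_diff_distrib sum_distrib_left sum_distrib_right if_mult_zero sum_if_const mult_ac)
  then show "wd (- \<i>) c (\<lambda>w. pot w * N i j w) z = (\<Sum>l\<in>UNIV. W c i l z * (pot z * N l j z))"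
    using pot_props(3)[OF z, of c] by (simp add: wd_mult ps Nd sum_distrib_left[symmetric] mult.left_commute[of _ "pot z"] distrib_left[symmetric] mult_ac)
qed

lemma W_hol: "hol_on U (W c i j)"
  unfolding hol_on_def dzbar_wd
proof (intro ballI allI conjI)
  fix z d assume z: "z \<in> U"
  note th = smooth_on_differentiable[OF tht_smooth z] and th1 = smooth_on_differentiable[OF smooth_on_wd[OF open_U tht_smooth] z]
  note dc = msmooth_diff_at[OF base.conn_smooth z]
  show "W c i j differentiable (at z)"
    unfolding W_def by (cases i; cases j) (simp_all add: th th1 dc)
  have cu: "wd \<i> d (\<lambda>w. base.conn c w $ a $ b) z = - (k * (G z $ c $ d * (if a = b then 1 else 0) + G z $ a $ d * (if c = b then 1 else 0)))" for c a b
    using curv_eq[OF z, of c d a b] by (simp add: base.curv_def)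
  have t2: "wd \<i> d (wd (- \<i>) c (tht a)) z = k * (\<Sum>n\<in>UNIV. base.conn c z $ a $ n * G z $ n $ d)" for a
  proof -
    have "wd \<i> d (wd (- \<i>) c (tht a)) z = wd (- \<i>) c (\<lambda>w. k * G w $ a $ d) z"
      unfolding wd_commute[OF open_U tht_smooth z, of \<i>] by (rule wd_cong[OF open_U z]) (rule dzbar_tht)
    then show ?thesis using msmooth_diff_at[OF G_smooth z] by (simp add: wd_mult dz_G[OF z])
  qed
  show "wd \<i> d (W c i j) z = 0"
  proof (cases i)
    case (Some a)
    show ?thesis
    proof (cases j)
      case None
      have "(\<Sum>n\<in>UNIV. wd \<i> d (\<lambda>w. base.conn c w $ a $ n) z * tht n z) = - (k * (G z $ c $ d * tht a z + G z $ a $ d * tht c z))"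
      proof -
        have "wd \<i> d (\<lambda>w. base.conn c w $ a $ n) z * tht n z = - (if n = a then k * G z $ c $ d * tht a z else 0) - (if n = c then k * G z $ a $ d * tht c z else 0)" for n
          by (auto simp: cu algebra_simps)
        then show ?thesis by (simp only: sum_subtractf sum_negf) (simp add: algebra_simps)
      qed
      then show ?thesis unfolding W_def Some None
        by (simp add: wd_diff wd_mult wd_sum th th1 dc t2 dzbar_tht[OF z] sum.distrib) (simp add: sum_distrib_left algebra_simps)
    next
      case (Some n)
      then show ?thesis unfolding W_def \<open>i = Some a\<close>
        by (cases "n = a"; cases "n = c") (simp_all add: wd_add wd_mult th dc cu dzbar_tht[OF z] algebra_simps)
    qed
  qed (simp add: W_def[abs_def])
qed

theorem fubini_study_lift:
  assumes p: "p \<in> U"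
  obtains r and s :: "complex^'m \<Rightarrow> complex^('m option)" where "0 < r" "ball p r \<subseteq> U" "vhol (ball p r) s"
    "\<And>z. z \<in> ball p r \<Longrightarrow> s z \<noteq> 0" "\<And>z a b. z \<in> ball p r \<Longrightarrow> fs_form (s z) (dv a s z) (dv b s z) = k * G z $ a $ b"
proof -
  obtain r and S :: "'m option \<Rightarrow> 'm option \<Rightarrow> complex^'m \<Rightarrow> complex" where r: "0 < r" "ball p r \<subseteq> U"
    and S: "\<And>i j. hol_on (ball p r) (S i j)"
    and NS: "\<And>i l z. z \<in> ball p r \<Longrightarrow> pot z * N i l z = (\<Sum>j\<in>UNIV. S i j z * cnj (S l j z))"
  proof (rule flat_hermitian_factor_at[OF open_U p W_hol N_flat(1)])
    show "pot z * N j i z = cnj (pot z * N i j z)" if "z \<in> U" for i j z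
      using pot_props(1)[OF that] by (cases i; cases j) (auto simp: N_def mult_ac G_herm[OF that, symmetric])
    show "dz c (\<lambda>w. pot w * N i j w) z = (\<Sum>l\<in>UNIV. W c i l z * (pot z * N l j z))" if "z \<in> U" for c i j z
      using N_flat(2)[OF that] by (simp add: dz_wd)
    fix v :: "complex^('m option)" assume v: "v \<noteq> 0"
    obtain d where d: "d > 0" "pot p = complex_of_real d" using pot_props(1)[OF p] by blast
    define u where "u = (\<chi> a. v $ Some a)"
    define y where "y = v $ None + (\<Sum>a\<in>UNIV. tht a p * v $ Some a)"
    let ?q = "\<Sum>a\<in>UNIV. \<Sum>b\<in>UNIV. G p $ a $ b * u $ a * cnj (u $ b)"
    have "(\<Sum>i\<in>UNIV. \<Sum>j\<in>UNIV. (pot p * N i j p) * v $ i * cnj (v $ j)) = pot p * (y * cnj y + k * ?q)"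
      unfolding sum_option N_def y_def u_def
      by (simp add: sum_distrib_left sum_distrib_right sum.distrib distrib_left distrib_right sum_product mult_ac) (rule sum.swap)
    also have "\<dots> = complex_of_real d * (complex_of_real ((cmod y)\<^sup>2) + k * ?q)" unfolding complex_norm_square by (simp add: d)
    finally have e: "Re (\<Sum>i\<in>UNIV. \<Sum>j\<in>UNIV. (pot p * N i j p) * v $ i * cnj (v $ j)) = d * ((cmod y)\<^sup>2 + k * Re ?q)"
      by simp
    have "(cmod y)\<^sup>2 + k * Re ?q > 0"
    proof (cases "u = 0")
      case True
      then have "v $ Some a = 0" for a by (simp add: u_def vec_eq_iff)
      then have "v $ None \<noteq> 0" "y = v $ None" using v by (auto simp: vec_eq_iff split_option_all y_def)
      then show ?thesis using True by simp
    next
      case False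
      then show ?thesis using G_pos[OF p False] k_pos by (intro add_nonneg_pos mult_pos_pos) auto
    qed
    then show "0 < Re (\<Sum>i\<in>UNIV. \<Sum>j\<in>UNIV. (pot p * N i j p) * v $ i * cnj (v $ j))" using d e by simp
  qed (assumption, rule that)
  define s where "s z = (\<chi> j. S None j z)" for z
  have s: "vhol (ball p r) s" using S by (simp add: vhol_def s_def)
  have ps: "hp (s z) (s z) = pot z" if "z \<in> ball p r" for z
    using NS[OF that, of None None] by (simp add: hp_def s_def N_def)
  have nz: "s z \<noteq> 0" if "z \<in> ball p r" for z
    using pot_props(1)[of z] ps[OF that] r(2) that hp_zero[of "s z"] by auto
  have q: "hp (dv a s z) (s z) / hp (s z) (s z) = tht a z" if z: "z \<in> ball p r" for a z
  proof -
    have "hp (dv a s z) (s z) = wd (- \<i>) a pot z"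
      unfolding vhol_hp(2)[OF s s z, symmetric] dz_wd by (rule wd_cong[OF open_ball z]) (rule ps)
    moreover have "z \<in> U" "pot z \<noteq> 0" using z r(2) nz[OF z] ps[OF z] hp_zero[of "s z"] by auto
    ultimately show ?thesis using pot_props(3)[of z a] ps[OF z] by simp
  qed
  show thesis
  proof (rule that[OF r s nz])
    fix z a b assume z: "z \<in> ball p r"
    have "fs_form (s z) (dv a s z) (dv b s z) = dzbar b (tht a) z"
      unfolding dzbar_log_derivative(2)[OF s open_ball z nz[OF z], symmetric] dzbar_wd
      by (rule wd_cong[OF open_ball z]) (rule q)
    then show "fs_form (s z) (dv a s z) (dv b s z) = k * G z $ a $ b" using dzbar_tht[of z b a] z r(2) by (auto simp: dzbar_wd)
  qed
qed

end

lemma dz_nth: "dz c (\<lambda>w. w $ i) z = (if c = i then 1 else 0)"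
  unfolding dz_wd wdI[OF bounded_linear_imp_has_derivative[OF bounded_linear_vec_nth[of i]], of "- \<i>" c z]
  by (simp add: axis_def)

lemma vhol_id: "vhol S (\<lambda>w. w)" by (simp add: vhol_def hol_on_nth)
lemma vhol_const: "vhol S (\<lambda>w. x)" by (simp add: vhol_def hol_on_const)
lemma vhol_subset: "vhol S s \<Longrightarrow> T \<subseteq> S \<Longrightarrow> vhol T s" unfolding vhol_def by (blast intro: hol_on_subset)

lemma vhol_compose: "vhol S t \<Longrightarrow> vhol T s \<Longrightarrow> (\<And>z. z \<in> S \<Longrightarrow> t z \<in> T) \<Longrightarrow> vhol S (\<lambda>w. s (t w))"
  unfolding vhol_def by (auto intro: hol_on_compose)

lemma vhol_smult: "hol_on S h \<Longrightarrow> vhol S s \<Longrightarrow> vhol S (\<lambda>w. h w *s s w)"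
  unfolding vhol_def by (auto intro: hol_on_mult)

lemma vhol_matrix: "vhol S s \<Longrightarrow> vhol S (\<lambda>w. A *v s w)"
  unfolding vhol_def matrix_vector_mult_def by (auto intro!: hol_on_sum hol_on_mult hol_on_const)

lemma dv_id: "dv a (\<lambda>w. w) z = axis a 1"
  by (simp add: dv_def dz_nth axis_def vec_eq_iff)

lemma hp_axis: "hp (axis a 1) w = cnj (w $ a)" "hp (axis a 1) (axis b 1) = (if a = b then 1 else 0)"
  by (simp_all add: hp_def axis_def if_distrib[of "\<lambda>x. x * _"] cong: if_cong)

lemma vhol_continuous: "vhol S s \<Longrightarrow> continuous_on S s"
  using continuous_on_vec_lambda[of S "\<lambda>j w. s w $ j"] hol_on_continuous by (auto simp: vhol_def)

lemma vhol_has_derivative: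
  assumes "vhol U F" "x \<in> U"
  shows "(F has_derivative (\<lambda>v. transpose (jac F x) *v v)) (at x)"
proof -
  have d: "(\<lambda>w. F w $ i) differentiable (at x)" "dzbar a (\<lambda>w. F w $ i) x = 0" for i a
    using assms by (auto simp: vhol_def hol_on_def)
  show ?thesis
    using differentiable_vec[OF d(1)]
    by (simp add: frechet_dz[OF d(1)] d(2) matrix_vector_mult_def transpose_def jac_def mult.commute cong: sum.cong)
qed

lemma hol_inverse_function:
  fixes F :: "complex^'n::finite \<Rightarrow> complex^'n"
  assumes U: "open U" "x0 \<in> U" and F: "vhol U F" and d: "det (jac F x0) \<noteq> 0"
  obtains U' V g where "open U'" "U' \<subseteq> U" "x0 \<in> U'" "open V" "homeomorphism U' V F g" "vhol V g"
proof -
  have lin: "bounded_linear (\<lambda>v. A *v v)" for A :: "complex^'n^'n"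
    by (intro linear_conv_bounded_linear[THEN iffD1] linearI)
      (auto simp: matrix_vector_right_distrib, auto simp: vec_eq_iff matrix_vector_mult_def scaleR_sum_right)
  define f' where "f' x = Blinfun (\<lambda>v. transpose (jac F x) *v v)" for x
  have f': "blinfun_apply (f' x) = (\<lambda>v. transpose (jac F x) *v v)" for x
    unfolding f'_def by (rule bounded_linear_Blinfun_apply[OF lin])
  define h where "h = Blinfun (\<lambda>v. transpose (matrix_inv (jac F x0)) *v v)"
  have h: "blinfun_apply h = (\<lambda>v. transpose (matrix_inv (jac F x0)) *v v)"
    unfolding h_def by (rule bounded_linear_Blinfun_apply[OF lin])
  have "transpose (matrix_inv (jac F x0)) ** transpose (jac F x0) = mat 1"
    unfolding matrix_transpose_mul[symmetric] matrix_inv_right_left[OF d] by simp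
  then have hf: "h o\<^sub>L f' x0 = id_blinfun"
    by (intro blinfun_eqI) (simp only: h f' blinfun_apply_blinfun_compose matrix_vector_mul_assoc blinfun_apply_id_blinfun matrix_vector_mul_lid)
  have der: "(F has_derivative blinfun_apply (f' x)) (at x)" if "x \<in> U" for x
    using vhol_has_derivative[OF F that] by (simp add: f')
  have cont: "continuous_on U f'"
  proof (rule continuous_on_blinfun_componentwise)
    fix i :: "complex^'n"
    have "continuous_on U (\<lambda>x. jac F x $ a $ b)" for a b
      using F U unfolding vhol_def jac_def by (auto intro: hol_on_continuous hol_on_dz)
    then show "continuous_on U (\<lambda>x. blinfun_apply (f' x) i)"
      unfolding f' matrix_vector_mult_def transpose_def vec_lambda_beta
      by (intro continuous_on_vec_lambda continuous_on_sum continuous_on_mult continuous_on_const)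
  qed
  obtain U' V g g' where *: "open U'" "U' \<subseteq> U" "x0 \<in> U'" "open V" "F x0 \<in> V" "homeomorphism U' V F g"
    "\<And>y. y \<in> V \<Longrightarrow> (g has_derivative (g' y)) (at y)"
    "\<And>y. y \<in> V \<Longrightarrow> g' y = inv (blinfun_apply (f' (g y)))" "\<And>y. y \<in> V \<Longrightarrow> bij (blinfun_apply (f' (g y)))"
    by (rule inverse_function_theorem[OF U(1) der cont U(2) hf]) (assumption, rule that)
  have "g' y (\<i> *s v) = \<i> *s g' y v" if "y \<in> V" for y v
  proof -
    note b = *(9)[OF that]
    have "blinfun_apply (f' (g y)) (\<i> *s g' y v) = \<i> *s blinfun_apply (f' (g y)) (g' y v)"
      by (simp add: f' vec_eq_iff matrix_vector_mult_def sum_distrib_left mult_ac)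
    also have "\<dots> = \<i> *s v" using b by (simp add: *(8)[OF that] bij_is_surj surj_f_inv_f)
    finally show ?thesis using b by (metis *(8)[OF that] bij_inv_eq_iff)
  qed
  then have "vhol V g" unfolding vhol_def
    by (intro allI hol_onI[where D="\<lambda>y v. g' y v $ j" for j])
      (auto intro: bounded_linear.has_derivative[OF bounded_linear_vec_nth *(7)])
  then show thesis using * that by blast
qed

lemma norm_preserving_unitary:
  fixes T :: "complex^'n::finite \<Rightarrow> complex^'n"
  assumes B: "open B" "convex B" "x0 \<in> B" and T: "vhol B T" and n: "\<And>w. w \<in> B \<Longrightarrow> norm (T w) = norm w"
  obtains A where "hadj A ** A = mat 1" "\<And>w. w \<in> B \<Longrightarrow> T w = A *v w"
proof -
  have e1: "hp (dv a T w) (T w) = cnj (w $ a)" if w: "w \<in> B" for a w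
  proof -
    have "dz a (\<lambda>w. hp (T w) (T w)) w = dz a (\<lambda>w. hp w w) w"
      unfolding dz_wd by (rule wd_cong[OF B(1) w]) (simp add: hp_norm n)
    then show ?thesis by (simp add: vhol_hp[OF T T w] vhol_hp[OF vhol_id vhol_id w] dv_id hp_axis)
  qed
  have "hp (dv a T w) (dv b T w) = (if a = b then 1 else 0)" if w: "w \<in> B" for a b w
  proof -
    have "dzbar b (\<lambda>w. hp (dv a T w) (T w)) w = dzbar b (\<lambda>w. hp (axis a 1) w) w"
      unfolding dzbar_wd by (rule wd_cong[OF B(1) w]) (simp add: hp_axis e1)
    then show ?thesis
      unfolding vhol_hp(3)[OF vhol_dv[OF B(1) T] T w] vhol_hp(3)[OF vhol_const vhol_id w] dv_id hp_axis(2) .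
  qed
  then have J: "jac T w ** hadj (jac T w) = mat 1" if "w \<in> B" for w
    using that by (simp add: vec_eq_iff matrix_mult_nth mat_def hp_def dv_def jac_def)
  have Jh: "hol_on B (\<lambda>w. jac T w $ a $ j)" for a j
    using T B(1) by (auto simp: jac_def vhol_def intro: hol_on_dz)
  have Jc: "jac T w $ a $ j = jac T x0 $ a $ j" if w: "w \<in> B" for w a j
  proof (rule has_derivative_zero_constant[OF B(2), of "\<lambda>w. jac T w $ a $ j", THEN exE])
    fix w assume w: "w \<in> B"
    have "hol_on B (\<lambda>w. matrix_inv (jac T w) $ j $ a)"
      by (rule hol_on_matrix_inv[OF Jh _ B(1)]) (rule matrix_inv_unique[OF J])
    then have "hol_on B (\<lambda>w. cnj (jac T w $ a $ j))"
      by (rule hol_on_cong[OF B(1), THEN iffD1, rotated]) (simp add: matrix_inv_unique[OF J])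
    then have "dz c (\<lambda>w. jac T w $ a $ j) w = 0" for c
      using hol_on_dzbar[OF _ w] wd_cnj[OF differentiable_cnj[OF hol_on_differentiable[OF Jh w]], of "- \<i>" c a j]
      by (simp add: dz_wd dzbar_wd)
    then show "((\<lambda>w. jac T w $ a $ j) has_derivative (\<lambda>h. 0)) (at w within B)"
      using has_derivative_at_withinI[OF hol_on_has_derivative[OF Jh[of a j] w], of B] by simp
  next
    fix c assume "\<forall>x\<in>B. jac T x $ a $ j = c"
    then show "jac T w $ a $ j = jac T x0 $ a $ j" using w B(3) by simp
  qed
  let ?J = "jac T x0"
  have J': "hadj ?J ** ?J = mat 1" using J[OF B(3)] matrix_left_right_inverse by blast
  show thesis
  proof (rule that[of "transpose ?J"])
    have "hadj (transpose ?J) ** transpose ?J = transpose (?J ** hadj ?J)"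
      by (simp add: matrix_transpose_mul) (simp add: vec_eq_iff transpose_def hadj_def matrix_mult_nth)
    then show "hadj (transpose ?J) ** transpose ?J = mat 1" by (simp add: J[OF B(3)])
    fix w assume w: "w \<in> B"
    have e2: "w $ a = (\<Sum>j\<in>UNIV. cnj (?J $ a $ j) * T w $ j)" for a
      using arg_cong[OF e1[OF w, of a], of cnj] by (simp add: hp_def dv_def Jc[OF w, unfolded jac_def, simplified] jac_def)
    have "(transpose ?J *v w) $ k = T w $ k" for k
    proof -
      have "(transpose ?J *v w) $ k = (\<Sum>a\<in>UNIV. \<Sum>j\<in>UNIV. ?J $ a $ k * (cnj (?J $ a $ j) * T w $ j))"
        by (simp add: matrix_vector_mult_def transpose_def e2 sum_distrib_left)
      also have "\<dots> = (\<Sum>j\<in>UNIV. (hadj ?J ** ?J) $ j $ k * T w $ j)"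
        by (subst sum.swap) (simp add: matrix_mult_nth sum_distrib_left mult_ac)
      also have "\<dots> = T w $ k" by (simp add: J' mat_def if_distrib[of "\<lambda>x. x * _"] cong: if_cong)
      finally show ?thesis .
    qed
    then show "T w = transpose ?J *v w" by (simp add: vec_eq_iff)
  qed
qed

text \<open>The logarithm of the quotient of the two squared norms is pluriharmonic, hence locally twice the real part of a
  holomorphic function.\<close>
lemma equal_hessians:
  fixes s :: "complex^'m::finite \<Rightarrow> complex^'n::finite" and t :: "complex^'m \<Rightarrow> complex^'l::finite"
  assumes U: "open U" "p \<in> U" and s: "vhol U s" "\<And>z. z \<in> U \<Longrightarrow> s z \<noteq> 0" and t: "vhol U t" "\<And>z. z \<in> U \<Longrightarrow> t z \<noteq> 0"
    and eq: "\<And>z a b. z \<in> U \<Longrightarrow> fs_form (s z) (dv a s z) (dv b s z) = fs_form (t z) (dv a t z) (dv b t z)"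
  obtains r h where "0 < r" "ball p r \<subseteq> U" "hol_on (ball p r) h" "\<And>z. z \<in> ball p r \<Longrightarrow> norm (t z) = cmod (h z) * norm (s z)"
proof -
  define M where "M i j z = hp (t z) (t z) / hp (s z) (s z)" for i j :: unit and z
  define w where "w c i j z = hp (dv c t z) (t z) / hp (t z) (t z) - hp (dv c s z) (s z) / hp (s z) (s z)" for c and i j :: unit and z
  have nz: "hp (s z) (s z) \<noteq> 0" "hp (t z) (t z) \<noteq> 0" if "z \<in> U" for z using s t that by auto
  have Mr: "M i j z = complex_of_real ((norm (t z))\<^sup>2 / (norm (s z))\<^sup>2)" for i j z by (simp add: M_def hp_norm)
  obtain r and S :: "unit \<Rightarrow> unit \<Rightarrow> complex^'m \<Rightarrow> complex" where r: "0 < r" "ball p r \<subseteq> U" "\<And>i j. hol_on (ball p r) (S i j)"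
    "\<And>i k z. z \<in> ball p r \<Longrightarrow> M i k z = (\<Sum>j\<in>UNIV. S i j z * cnj (S k j z))"
  proof (rule flat_hermitian_factor_at[OF U, of w M])
    show "hol_on U (w c i j)" for c i j
      unfolding hol_on_def
    proof (intro ballI conjI allI)
      fix z b assume z: "z \<in> U"
      note d1 = dzbar_log_derivative[OF s(1) U(1) z s(2)[OF z]] and d2 = dzbar_log_derivative[OF t(1) U(1) z t(2)[OF z]]
      show "w c i j differentiable (at z)" unfolding w_def using d1(1) d2(1) by (intro differentiable_diff)
      show "dzbar b (w c i j) z = 0"
        unfolding w_def dzbar_wd wd_diff[OF d2(1) d1(1)] using d1(2) d2(2) eq[OF z] by (simp add: dzbar_wd)
    qed
    fix z c and i j :: unit assume z: "z \<in> U"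
    note h1 = vhol_hp[OF s(1) s(1) z] and h2 = vhol_hp[OF t(1) t(1) z]
    show "M i j differentiable (at z)" unfolding M_def by (rule differentiable_divide_complex[OF h2(1) h1(1) nz(1)[OF z]])
    show "M j i z = cnj (M i j z)" by (simp add: Mr)
    show "dz c (M i j) z = (\<Sum>k\<in>UNIV. w c i k z * M k j z)"
      unfolding M_def w_def using h1(1,2) h2(1,2) nz[OF z]
      by (simp add: divide_inverse dz_wd wd_mult wd_inverse UNIV_unit) (simp add: field_simps power2_eq_square)
  next
    fix v :: "complex^unit" assume v: "v \<noteq> 0"
    have "(\<Sum>i\<in>UNIV. \<Sum>j\<in>UNIV. M i j p * v $ i * cnj (v $ j)) = complex_of_real ((norm (t p))\<^sup>2 / (norm (s p))\<^sup>2 * (cmod (v $ ()))\<^sup>2)"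
      unfolding of_real_mult complex_norm_square by (simp add: Mr UNIV_unit)
    moreover have "v $ () \<noteq> 0" using v by (simp add: vec_eq_iff)
    ultimately show "0 < Re (\<Sum>i\<in>UNIV. \<Sum>j\<in>UNIV. M i j p * v $ i * cnj (v $ j))" using s(2)[OF U(2)] t(2)[OF U(2)] by (simp add: UNIV_unit)
  qed (rule that)
  show thesis
  proof (rule that[OF r(1,2) r(3)[of "()" "()"]])
    fix z assume z: "z \<in> ball p r"
    then have sz: "norm (s z) \<noteq> 0" using r(2) s(2) by auto
    have "complex_of_real ((norm (t z))\<^sup>2 / (norm (s z))\<^sup>2) = complex_of_real ((cmod (S () () z))\<^sup>2)"
      using r(4)[OF z, of "()" "()"] unfolding complex_norm_square Mr by (simp add: UNIV_unit)
    then have "(norm (t z))\<^sup>2 / (norm (s z))\<^sup>2 = (cmod (S () () z))\<^sup>2" by (simp only: of_real_eq_iff)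
    then have "(norm (t z))\<^sup>2 = (cmod (S () () z) * norm (s z))\<^sup>2" using sz by (simp add: field_simps power_mult_distrib)
    then show "norm (t z) = cmod (S () () z) * norm (s z)" by (rule power2_eq_imp_eq) simp_all
  qed
qed

definition par :: "complex^'n::finite \<Rightarrow> complex^'n \<Rightarrow> bool" where
  "par x y \<longleftrightarrow> (\<exists>a. a \<noteq> 0 \<and> x = a *s y)"

lemma par_refl: "par x x" by (auto simp: par_def intro: exI[of _ 1])
lemma par_sym: "par x y \<Longrightarrow> par y x"
  unfolding par_def by (elim exE conjE, rule_tac x="inverse a" in exI) simp
lemma par_trans: "par x y \<Longrightarrow> par y z \<Longrightarrow> par x z"
  unfolding par_def by (elim exE conjE, rule_tac x="a * aa" in exI) simp
lemma par_smult: "a \<noteq> 0 \<Longrightarrow> par (a *s x) x" by (auto simp: par_def)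
lemma par_matrix: "par x y \<Longrightarrow> par (A *v x) (A *v y)"
  by (auto simp: par_def vector_scalar_commute)

definition cone :: "(complex^'m) set \<Rightarrow> (complex^'m \<Rightarrow> complex^'n::finite) \<Rightarrow> (complex^'n) set" where
  "cone Z s = {w. \<exists>z\<in>Z. par w (s z)}"

definition sect :: "(complex^'m) set \<Rightarrow> (complex^'m \<Rightarrow> complex^'n::finite) \<Rightarrow> complex^'n \<Rightarrow> complex^'m" where
  "sect Z s w = (SOME z. z \<in> Z \<and> par w (s z))"

text \<open>The points of the local lift \<open>s\<close> are homogeneous coordinates of the points of \<open>Z\<close>, with \<open>sect\<close> as inverse.\<close>
definition fs_lift :: "(complex^'m \<Rightarrow> complex^'m^'m) \<Rightarrow> real \<Rightarrow> (complex^'m::finite) set \<Rightarrow> (complex^'m \<Rightarrow> complex^'n::finite) \<Rightarrow> bool" where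
  "fs_lift G k Z s \<longleftrightarrow> open Z \<and> vhol Z s \<and> (\<forall>z\<in>Z. s z \<noteq> 0) \<and>
     (\<forall>z\<in>Z. \<forall>a b. fs_form (s z) (dv a s z) (dv b s z) = k * G z $ a $ b) \<and>
     (\<forall>z\<in>Z. \<forall>z'\<in>Z. par (s z) (s z') \<longrightarrow> z = z') \<and> open (cone Z s) \<and> vhol (cone Z s) (sect Z s)"

lemma sect: "w \<in> cone Z s \<Longrightarrow> sect Z s w \<in> Z \<and> par w (s (sect Z s w))"
  unfolding sect_def by (rule someI_ex) (auto simp: cone_def)

lemma sect_unique: "fs_lift G k Z s \<Longrightarrow> z \<in> Z \<Longrightarrow> par w (s z) \<Longrightarrow> w \<in> cone Z s \<and> sect Z s w = z"
  using sect[of w Z s] unfolding fs_lift_def cone_def by (blast intro: par_trans par_sym)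

lemma vhol_cong: "open S \<Longrightarrow> (\<And>z. z \<in> S \<Longrightarrow> f z = g z) \<Longrightarrow> vhol S f \<longleftrightarrow> vhol S g"
  unfolding vhol_def by (intro all_cong1 hol_on_cong) simp_all

lemma hp_sum: "hp (\<Sum>i\<in>I. c i *s u i) x = (\<Sum>i\<in>I. c i * hp (u i) x)" "hp x (\<Sum>i\<in>I. c i *s u i) = (\<Sum>i\<in>I. cnj (c i) * hp x (u i))"
proof -
  have z: "hp 0 x = 0" "hp x 0 = 0" for x :: "complex^'n::finite" by (simp_all add: hp_def)
  show "hp (\<Sum>i\<in>I. c i *s u i) x = (\<Sum>i\<in>I. c i * hp (u i) x)" "hp x (\<Sum>i\<in>I. c i *s u i) = (\<Sum>i\<in>I. cnj (c i) * hp x (u i))"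
    by (induction I rule: infinite_finite_induct) (simp_all add: hp_linear z)
qed

lemma fs_form_sum:
  "fs_form x (\<Sum>i\<in>I. c i *s u i) (\<Sum>j\<in>L. d j *s v j) = (\<Sum>i\<in>I. \<Sum>j\<in>L. c i * cnj (d j) * fs_form x (u i) (v j))"
  by (simp add: fs_form_def hp_sum sum_product sum_distrib_left sum_distrib_right sum_divide_distrib right_diff_distrib sum_subtractf mult_ac)
    (intro arg_cong2[of _ _ _ _ "(-)"] sum.swap)

lemma fs_form_vertical: "x \<noteq> 0 \<Longrightarrow> fs_form x (c *s x) (c *s x) = 0"
  by (simp add: fs_form_def hp_linear power2_eq_square)

lemma hp_unitary:
  assumes "hadj A ** A = mat 1"
  shows "hp (A *v u) (A *v v) = hp u v"
proof -
  have "hp (A *v u) (A *v v) = (\<Sum>i\<in>UNIV. \<Sum>j\<in>UNIV. u $ j * (\<Sum>l\<in>UNIV. cnj (A $ i $ l) * A $ i $ j * cnj (v $ l)))"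
    by (simp add: hp_def matrix_vector_mult_def sum_product sum_distrib_left mult_ac) (intro sum.cong refl sum.swap)
  also have "\<dots> = (\<Sum>j\<in>UNIV. u $ j * (\<Sum>l\<in>UNIV. (\<Sum>i\<in>UNIV. cnj (A $ i $ l) * A $ i $ j) * cnj (v $ l)))"
    by (subst sum.swap, unfold sum_distrib_left[symmetric], subst sum.swap) (simp add: sum_distrib_right)
  also have "\<dots> = (\<Sum>j\<in>UNIV. u $ j * (\<Sum>l\<in>UNIV. (hadj A ** A) $ l $ j * cnj (v $ l)))"
    by (simp add: matrix_mult_nth)
  also have "\<dots> = hp u v"
    by (simp add: assms mat_def hp_def if_distrib[of "\<lambda>x. x * _"] cong: if_cong)
  finally show ?thesis .
qed

lemma unitary_inverse:
  assumes "hadj A ** A = mat (1::complex)"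
  shows "hadj A *v (A *v x) = x" "A *v (hadj A *v x) = x" "hadj (hadj A) ** hadj A = mat 1"
  using assms matrix_left_right_inverse[of "hadj A" A] by (simp_all add: matrix_vector_mul_assoc)

lemma dv_matrix:
  assumes "vhol S s" "z \<in> S"
  shows "dv a (\<lambda>w. A *v s w) z = A *v dv a s z"
proof -
  have d: "(\<lambda>w. s w $ j) differentiable (at z)" for j using assms by (auto simp: vhol_def hol_on_def)
  show ?thesis unfolding dv_def dz_wd matrix_vector_mult_def by (simp add: vec_eq_iff wd_sum wd_mult d)
qed

lemma dv_compose:
  assumes "vhol S F" "vhol T s" "z \<in> S" "F z \<in> T"
  shows "dv a (\<lambda>w. s (F w)) z = (\<Sum>i\<in>UNIV. dz a (\<lambda>w. F w $ i) z *s dv i s (F z))"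
proof -
  have d: "(\<lambda>w. s w $ j) differentiable (at (F z))" "hol_on S (\<lambda>w. F w $ i)" for j i using assms by (auto simp: vhol_def hol_on_def)
  show ?thesis unfolding dv_def by (simp add: vec_eq_iff hol_compose(2)[OF d(2) assms(3) d(1)])
qed

lemma fs_form_pullback:
  assumes "vhol S F" "vhol T s" "z \<in> S" "F z \<in> T" "\<And>a b. fs_form (s (F z)) (dv a s (F z)) (dv b s (F z)) = k * G (F z) $ a $ b"
  shows "fs_form (s (F z)) (dv a (\<lambda>w. s (F w)) z) (dv b (\<lambda>w. s (F w)) z) = k * pullback_metric F G z $ a $ b"
  unfolding dv_compose[OF assms(1-4)] fs_form_sum assms(5) by (simp add: pullback_metric_def sum_distrib_left mult_ac)

lemma fs_lift_unitary:
  fixes A :: "complex^'n::finite^'n"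
  assumes L: "fs_lift G k Z s" and A: "hadj A ** A = mat 1"
  shows "fs_lift G k Z (\<lambda>z. A *v s z)"
proof -
  note L' = L[unfolded fs_lift_def]
  have p: "par w (A *v x) \<longleftrightarrow> par (hadj A *v w) x" for w x
    using par_matrix[of w "A *v x" "hadj A"] par_matrix[of "hadj A *v w" x A] by (auto simp: unitary_inverse[OF A])
  have c: "cone Z (\<lambda>z. A *v s z) = {w. hadj A *v w \<in> cone Z s}" and
    s: "sect Z (\<lambda>z. A *v s z) w = sect Z s (hadj A *v w)" for w
    by (simp_all add: cone_def sect_def p)
  have h: "vhol UNIV (\<lambda>w. hadj A *v w)" by (rule vhol_matrix[OF vhol_id])
  have "open {w. hadj A *v w \<in> cone Z s}"
    using continuous_open_preimage[OF vhol_continuous[OF h] open_UNIV, of "cone Z s"] L' by (simp add: vimage_def)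
  moreover have "vhol {w. hadj A *v w \<in> cone Z s} (\<lambda>w. sect Z s (hadj A *v w))"
    by (rule vhol_compose[OF vhol_subset[OF h]]) (use L' in auto)
  moreover have "A *v x \<noteq> 0" if "x \<noteq> 0" for x
    using that unitary_inverse(1)[OF A, of x] by (metis matrix_vector_mult_0_right)
  ultimately show ?thesis
    using L' vhol_matrix[of Z s A] unfolding fs_lift_def c s[abs_def]
    by (simp add: dv_matrix[of Z s] fs_form_def hp_unitary[OF A] p unitary_inverse[OF A])
qed

lemma fs_lift_subset:
  assumes L: "fs_lift G k Z s" and V: "open V" "V \<subseteq> Z"
  shows "fs_lift G k V s"
proof -
  note L' = L[unfolded fs_lift_def]
  have c: "cone V s = cone Z s \<inter> sect Z s -` V"
    using sect_unique[OF L] sect[of _ Z s] V(2) by (fastforce simp: cone_def)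
  have o: "open (cone V s)" unfolding c
    using L' V by (intro continuous_open_preimage) (auto intro: vhol_continuous)
  have s: "sect V s w = sect Z s w" if w: "w \<in> cone V s" for w
  proof -
    have "sect V s w \<in> Z" "par w (s (sect V s w))" using sect[OF w] V(2) by auto
    from sect_unique[OF L this] show ?thesis by simp
  qed
  have "vhol (cone V s) (sect Z s)" using L' by (auto intro: vhol_subset simp: c)
  then have "vhol (cone V s) (sect V s)"
    using vhol_cong[OF o s] by simp
  then show ?thesis using L' V o unfolding fs_lift_def by (blast intro: vhol_subset)
qed

lemma fs_lift_rigid:
  fixes s t :: "complex^'m::finite \<Rightarrow> complex^'n::finite"
  assumes L: "fs_lift G k Z s" and p: "p \<in> Z" "p \<in> Y" and Y: "open Y" "vhol Y t" "\<And>z. z \<in> Y \<Longrightarrow> t z \<noteq> 0"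
    and eq: "\<And>z a b. z \<in> Y \<Longrightarrow> fs_form (t z) (dv a t z) (dv b t z) = k * G z $ a $ b"
  obtains A V where "hadj A ** A = mat 1" "open V" "p \<in> V" "V \<subseteq> Z \<inter> Y" "\<And>z. z \<in> V \<Longrightarrow> par (t z) (A *v s z)"
proof -
  note L' = L[unfolded fs_lift_def]
  obtain r h where r: "0 < r" "ball p r \<subseteq> Z \<inter> Y" and h: "hol_on (ball p r) h"
    and ht: "\<And>z. z \<in> ball p r \<Longrightarrow> norm (t z) = cmod (h z) * norm (s z)"
  proof (rule equal_hessians[of "Z \<inter> Y" p s t])
    show "vhol (Z \<inter> Y) s" "vhol (Z \<inter> Y) t" using L' Y(2) by (auto intro: vhol_subset)
  qed (use L' p Y eq in auto)
  have hnz: "h z \<noteq> 0" if "z \<in> ball p r" for z using ht[OF that] Y(3)[of z] that r(2) by auto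
  obtain q where q: "s p $ q \<noteq> 0" using L' p(1) by (auto simp: vec_eq_iff)
  let ?S = "sect Z s"
  let ?W = "cone Z s \<inter> ?S -` (ball p r)"
  have W: "open ?W" using L' by (intro continuous_open_preimage) (auto intro: vhol_continuous)
  have sS: "vhol ?W (\<lambda>w. s (?S w))"
    by (rule vhol_compose[of _ _ Z]) (use L' r(2) in \<open>auto intro: vhol_subset\<close>)
  let ?X = "?W \<inter> (\<lambda>w. s (?S w) $ q) -` (- {0})"
  have X: "open ?X" by (rule continuous_open_preimage) (use W sS in \<open>auto simp: vhol_def intro: hol_on_continuous\<close>)
  have Sp: "s z \<in> cone Z s \<and> ?S (s z) = z" if "z \<in> Z" for z by (rule sect_unique[OF L that par_refl])
  have "s p \<in> ?X" using Sp[OF p(1)] r(1) q by simp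
  then obtain e where e: "e > 0" "ball (s p) e \<subseteq> ?X" using X openE by blast
  let ?B = "ball (s p) e"
  define T where "T w = (w $ q / s (?S w) $ q / h (?S w)) *s t (?S w)" for w
  have hS: "vhol ?B ?S" using L' e(2) by (auto intro: vhol_subset)
  have T: "vhol ?B T"
    unfolding T_def
  proof (intro vhol_smult hol_on_divide hol_on_nth)
    show "hol_on ?B (\<lambda>w. s (?S w) $ q)" using vhol_subset[OF sS, of ?B] e(2) by (auto simp: vhol_def)
    show "hol_on ?B (\<lambda>w. h (?S w))" by (rule hol_on_compose[OF _ h]) (use hS e(2) in \<open>auto simp: vhol_def\<close>)
    show "vhol ?B (\<lambda>w. t (?S w))" by (rule vhol_compose[OF hS Y(2)]) (use e(2) r(2) in auto)
  qed (use e(2) hnz in auto)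
  have "norm (T w) = norm w" if w: "w \<in> ?B" for w
  proof -
    have S: "?S w \<in> ball p r" "s (?S w) $ q \<noteq> 0" "w \<in> cone Z s" using w e(2) by auto
    then obtain a where a: "w = a *s s (?S w)" using sect[OF S(3)] by (auto simp: par_def)
    then have "w $ q = a * s (?S w) $ q" by (metis vector_smult_component)
    then have "norm (T w) = cmod a * norm (s (?S w))"
      using S hnz[OF S(1)] by (simp add: T_def norm_vec_smult norm_divide ht[OF S(1)])
    then show ?thesis using a norm_vec_smult by metis
  qed
  then obtain A where A: "hadj A ** A = mat 1" "\<And>w. w \<in> ?B \<Longrightarrow> T w = A *v w"
    using norm_preserving_unitary[OF open_ball convex_ball _ T, of "s p"] e(1) by auto
  let ?V = "ball p r \<inter> s -` ?B"
  show thesis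
  proof (rule that[of A ?V])
    show "open ?V"
      by (rule continuous_open_preimage) (use L' r(2) in \<open>auto intro: continuous_on_subset[OF vhol_continuous]\<close>)
    fix z assume z: "z \<in> ?V"
    then have zZ: "z \<in> Z" "z \<in> ball p r" "s z \<in> ?B" using r(2) by auto
    have "s z $ q \<noteq> 0" using zZ(3) e(2) Sp[OF zZ(1)] by auto
    then have "A *v s z = (1 / h z) *s t z"
      using A(2)[OF zZ(3)] Sp[OF zZ(1)] by (simp add: T_def)
    then show "par (t z) (A *v s z)" using hnz[OF zZ(2)] par_sym[OF par_smult[of "1 / h z" "t z"]] by simp
  qed (use A e(1) r in auto)
qed

theorem (in chsc_kaehler) fs_lift_exists:
  assumes p: "p \<in> U"
  obtains Z and s :: "complex^'m \<Rightarrow> complex^('m option)" where "p \<in> Z" "Z \<subseteq> U" "fs_lift G k Z s"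
proof -
  obtain r and s :: "complex^'m \<Rightarrow> complex^('m option)" where r: "0 < r" "ball p r \<subseteq> U" and s: "vhol (ball p r) s"
    and nz: "\<And>z. z \<in> ball p r \<Longrightarrow> s z \<noteq> 0" and fs: "\<And>z a b. z \<in> ball p r \<Longrightarrow> fs_form (s z) (dv a s z) (dv b s z) = k * G z $ a $ b"
    by (rule fubini_study_lift[OF p]) (rule that)
  have p0: "p \<in> ball p r" using r(1) by simp
  obtain q where q: "s p $ q \<noteq> 0" using nz[OF p0] by (auto simp: vec_eq_iff)
  define pr where "pr x = (\<chi> a. x $ Some a)" for x :: "complex^('m option)"
  define y where "y z = (\<chi> i. case i of None \<Rightarrow> 1 / s z $ q | Some a \<Rightarrow> z $ a)" for z
  define F where "F x = x $ None *s s (pr x)" for x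
  have pr: "vhol S pr" for S by (simp add: vhol_def pr_def hol_on_nth)
  have pry: "pr (y z) = z" for z by (simp add: pr_def y_def vec_eq_iff)
  have Fy: "F (y z) = (1 / s z $ q) *s s z" for z by (simp only: F_def pry) (simp add: y_def)
  define Q where "Q = pr -` ball p r \<inter> {x. x $ None \<noteq> 0}"
  have Q: "open Q"
    using continuous_open_preimage[OF vhol_continuous[OF pr] open_UNIV open_ball]
      continuous_open_preimage[OF hol_on_continuous[OF hol_on_nth] open_UNIV, of "- {0}" None]
    unfolding Q_def by (intro open_Int) (auto simp: vimage_def)
  have FQ: "vhol Q F" unfolding F_def[abs_def]
    by (rule vhol_smult[OF hol_on_nth vhol_compose[OF pr s]]) (auto simp: Q_def)
  have x0: "y p \<in> Q" using q r(1) by (simp add: Q_def pry) (simp add: y_def)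
  have "det (jac F (y p)) \<noteq> 0"
  proof
    let ?c = "y p $ None"
    have c: "?c \<noteq> 0" using x0 by (simp add: Q_def)
    assume "det (jac F (y p)) = 0"
    then have "\<not> invertible (transpose (jac F (y p)))" by (simp add: invertible_det_nz det_transpose)
    then obtain v where v: "v \<noteq> 0" "transpose (jac F (y p)) *v v = 0"
      using matrix_left_invertible_ker[of "transpose (jac F (y p))"] invertible_left_inverse[of "transpose (jac F (y p))"] by blast
    define u where "u = (\<Sum>a\<in>UNIV. v $ Some a *s dv a s p)"
    have "jac F (y p) $ i $ j = (if i = None then s p $ j else 0) + ?c * (\<Sum>a\<in>UNIV. (if i = Some a then dv a s p $ j else 0))" for i j
    proof -
      have sj: "(\<lambda>z. s z $ j) differentiable (at (pr (y p)))" using s p0 by (auto simp: pry vhol_def hol_on_def)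
      have prh: "hol_on UNIV (\<lambda>x. pr x $ a)" for a using pr by (simp add: vhol_def)
      note h = hol_compose[where f="\<lambda>z. s z $ j" and T=pr and S=UNIV and z="y p", OF prh UNIV_I sj]
      have "dz i (\<lambda>x. pr x $ a) (y p) = (if i = Some a then 1 else 0)" for a by (simp add: pr_def dz_nth)
      then have "dz i (\<lambda>x. s (pr x) $ j) (y p) = (\<Sum>a\<in>UNIV. (if i = Some a then dv a s p $ j else 0))"
        unfolding h(2) by (auto intro!: sum.cong simp: dv_def pry)
      then show ?thesis
        using dz_nth[of i None "y p"] wd_mult[OF hol_on_differentiable[OF hol_on_nth[of UNIV None]] h(1), of "- \<i>" i] UNIV_I
        by (simp add: jac_def F_def dz_wd pry)
    qed
    then have "(transpose (jac F (y p)) *v v) $ j = v $ None * s p $ j + ?c * u $ j" for j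
      by (simp add: matrix_vector_mult_def transpose_def sum_option u_def sum_distrib_left mult_ac if_distrib[of "\<lambda>x. _ * x"] cong: if_cong)
    then have e: "v $ None * s p $ j + ?c * u $ j = 0" for j using v(2) by simp
    then have "u $ j = (- v $ None / ?c) * s p $ j" for j
      using c e[of j] by (simp add: field_simps eq_neg_iff_add_eq_0)
    then have u: "u = (- v $ None / ?c) *s s p" by (simp add: vec_eq_iff)
    let ?v = "\<chi> a. v $ Some a"
    have "fs_form (s p) u u = 0" unfolding u by (rule fs_form_vertical[OF nz[OF p0]])
    moreover have "fs_form (s p) u u = k * (\<Sum>a\<in>UNIV. \<Sum>b\<in>UNIV. G p $ a $ b * ?v $ a * cnj (?v $ b))"
      unfolding u_def fs_form_sum fs[OF p0] by (simp add: sum_distrib_left mult_ac)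
    ultimately have "(\<Sum>a\<in>UNIV. \<Sum>b\<in>UNIV. G p $ a $ b * ?v $ a * cnj (?v $ b)) = 0" using k_pos by simp
    then have v0: "?v = 0" using G_pos[OF p, of ?v] by (cases "?v = 0") (simp_all only: zero_complex.sel, auto)
    then have "u = 0" by (simp add: u_def vec_eq_iff)
    then have "v $ None = 0" using e nz[OF p0] by (auto simp: vec_eq_iff)
    then show False using v(1) v0 by (auto simp: vec_eq_iff split_option_all)
  qed
  from hol_inverse_function[OF Q x0 FQ this]
  obtain U' V g where U': "open U'" "U' \<subseteq> Q" "y p \<in> U'" and V: "open V" and hom: "homeomorphism U' V F g" and g: "vhol V g"
    by metis
  have gF: "g (F x) = x" "F x \<in> V" if "x \<in> U'" for x using hom that by (auto simp: homeomorphism_def)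
  have Fg: "F (g x) = x" "g x \<in> U'" if "x \<in> V" for x using hom that by (auto simp: homeomorphism_def)
  let ?Y = "ball p r \<inter> (\<lambda>z. s z $ q) -` (- {0})"
  have sq: "hol_on (ball p r) (\<lambda>z. s z $ q)" using s by (simp add: vhol_def)
  have Y: "open ?Y" by (rule continuous_open_preimage[OF hol_on_continuous[OF sq]]) auto
  have y: "vhol ?Y y" unfolding vhol_def
  proof
    fix j show "hol_on ?Y (\<lambda>w. y w $ j)"
      by (cases j) (auto simp: y_def hol_on_nth intro!: hol_on_divide hol_on_const hol_on_subset[OF sq])
  qed
  define Z where "Z = ?Y \<inter> y -` U'"
  have Z: "open Z" "Z \<subseteq> ball p r" "p \<in> Z"
    unfolding Z_def using continuous_open_preimage[OF vhol_continuous[OF y] Y U'(1)] p0 q U'(3) by auto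
  define n where "n w = (1 / w $ q) *s w" for w :: "complex^('m option)"
  have nq: "vhol {w. w $ q \<noteq> 0} n" unfolding n_def[abs_def]
    by (intro vhol_smult hol_on_divide hol_on_const hol_on_nth vhol_id) auto
  have oq: "open {w :: complex^('m option). w $ q \<noteq> 0}"
    using continuous_open_preimage[OF hol_on_continuous[OF hol_on_nth[of UNIV q]] open_UNIV, of "- {0}"] by (simp add: vimage_def open_Compl)
  let ?W = "{w. w $ q \<noteq> 0} \<inter> n -` V"
  have W: "open ?W" by (rule continuous_open_preimage[OF vhol_continuous[OF nq] oq V])
  have gn: "vhol ?W (\<lambda>w. pr (g (n w)))"
    by (rule vhol_compose[OF vhol_compose[OF vhol_subset[OF nq] g] pr[of UNIV]]) auto
  have np: "n w = F (y z) \<and> w $ q \<noteq> 0" if "z \<in> Z" "par w (s z)" for w z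
    using that by (auto simp: Z_def par_def n_def Fy vec_eq_iff)
  have inZ: "pr (g (n w)) = z \<and> w \<in> ?W" if "z \<in> Z" "par w (s z)" for w z
    using np[OF that] that(1) gF[of "y z"] by (auto simp: Z_def pry)
  have parW: "par w (s (pr (g (n w))))" if w: "w \<in> ?W" for w
  proof -
    let ?x = "g (n w)"
    have x: "F ?x = n w" "?x \<in> U'" using w Fg[of "n w"] by auto
    then have "?x $ None \<noteq> 0" using U'(2) by (auto simp: Q_def)
    moreover have "w = (w $ q * ?x $ None) *s s (pr ?x)" using x(1) w by (simp add: F_def n_def vec_eq_iff field_simps)
    ultimately show ?thesis using w unfolding par_def by (intro exI[of _ "w $ q * ?x $ None"]) auto
  qed
  have cone: "cone Z s = ?W \<inter> (\<lambda>w. pr (g (n w))) -` Z"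
    using inZ parW unfolding cone_def by blast
  have oc: "open (cone Z s)" unfolding cone
    by (rule continuous_open_preimage[OF vhol_continuous[OF gn] W Z(1)])
  have sct: "sect Z s w = pr (g (n w))" if "w \<in> cone Z s" for w
    using sect[OF that] inZ[of "sect Z s w" w] by simp
  have "vhol (cone Z s) (\<lambda>w. pr (g (n w)))" using vhol_subset[OF gn] cone by auto
  then have "vhol (cone Z s) (sect Z s)"
    using vhol_cong[OF oc sct] by simp
  moreover have "z = z'" if "z \<in> Z" "z' \<in> Z" "par (s z) (s z')" for z z'
    using inZ[OF that(1) par_refl] inZ[OF that(2,3)] by simp
  ultimately have "fs_lift G k Z s"
    unfolding fs_lift_def using Z oc fs nz by (auto intro: vhol_subset[OF s])
  then show thesis using that[of Z s] Z r(2) by blast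
qed

section \<open>Developing homogeneous coordinates\<close>

lemma par_open_scalar:
  fixes Q :: "complex^'n::finite^'n"
  assumes V: "open V" "V \<noteq> {}" and p: "\<And>w. w \<in> V \<Longrightarrow> par w (Q *v w)"
  obtains c where "c \<noteq> 0" "\<And>x. Q *v x = c *s x"
proof -
  have ev: "\<exists>c. c \<noteq> 0 \<and> Q *v w = c *s w" if "w \<in> V" for w
    using par_sym[OF p[OF that]] by (auto simp: par_def)
  obtain v where v: "v \<in> V" using V(2) by blast
  obtain d where d: "d > 0" "ball v d \<subseteq> V" using V(1) v openE by blast
  have small: "\<exists>b>0. b * norm x < d" if "d > 0" for d and x :: "complex^'n"
    using that add_nonneg_pos[OF norm_ge_zero[of x] zero_less_one] by (intro exI[of _ "d / (norm x + 1)"]) (auto simp: pos_divide_less_eq)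
  have near: "\<exists>a. a \<noteq> 0 \<and> v + a *s x \<in> V" for x
  proof -
    obtain b where "b > 0" "b * norm x < d" using small[OF d(1)] by blast
    then show ?thesis using d(2) by (intro exI[of _ "complex_of_real b"]) (auto simp: dist_norm norm_vec_smult)
  qed
  obtain e where e: "e \<in> V" "e \<noteq> 0"
  proof (cases "v = 0")
    case True
    then obtain a where "a \<noteq> 0" "v + a *s axis undefined 1 \<in> V" using near[of "axis undefined 1"] by auto
    then show thesis using that[of "v + a *s axis undefined 1"] True by (auto simp: vec_eq_iff axis_def)
  qed (use that v in blast)
  obtain c where c: "c \<noteq> 0" "Q *v e = c *s e" using ev[OF e(1)] by blast
  obtain d where d: "d > 0" "ball e d \<subseteq> V" using V(1) e openE by blast
  have "Q *v x = c *s x" for x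
  proof -
    obtain b where b: "b > 0" "b * norm x < d"
      using small[OF d(1)] by blast
    define a where "a = complex_of_real b"
    have a: "a \<noteq> 0" "cmod a * norm x < d" using b by (auto simp: a_def)
    have "e + a *s x \<in> V" "e + (a / 2) *s x \<in> V"
      using d a(2) by (auto simp: dist_norm norm_vec_smult norm_divide intro!: subsetD[OF d(2)])
    then obtain m n where m: "Q *v (e + a *s x) = m *s (e + a *s x)" and n: "Q *v (e + (a / 2) *s x) = n *s (e + (a / 2) *s x)"
      using ev by metis
    have m': "c *s e + a *s (Q *v x) = m *s (e + a *s x)" and n': "c *s e + (a / 2) *s (Q *v x) = n *s (e + (a / 2) *s x)"
      using m n by (simp_all add: matrix_vector_right_distrib vector_scalar_commute[symmetric] c)
    have i: "(c + m - 2 * n) * e $ i = (n - m) * (a * x $ i)" for i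
    proof -
      have 1: "c * e $ i + a * (Q *v x) $ i = m * (e $ i + a * x $ i)" using arg_cong[OF m', of "\<lambda>y. y $ i"] by (simp add: algebra_simps)
      have 2: "2 * (c * e $ i) + a * (Q *v x) $ i = n * (2 * e $ i + a * x $ i)"
        using arg_cong[OF n', of "\<lambda>y. 2 * y $ i"] by (simp add: algebra_simps)
      show ?thesis using 1 2 by algebra
    qed
    show ?thesis
    proof (cases "m = n")
      case True
      then have "c = m" using i e(2) by (auto simp: vec_eq_iff)
      then show ?thesis using m' a(1) by (simp add: vec_eq_iff algebra_simps)
    next
      case False
      then have "x = ((c + m - 2 * n) / ((n - m) * a)) *s e" using i a(1) by (simp add: vec_eq_iff field_simps)
      then show ?thesis using c(2) by (metis vector_scalar_commute vector_smult_assoc mult.commute)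
    qed
  qed
  then show thesis using that c(1) by blast
qed

lemma unitary_norm: "hadj Q ** Q = mat 1 \<Longrightarrow> norm (Q *v x) = norm x"
  using hp_unitary[of Q x x] by (simp add: hp_norm del: of_real_power)

text \<open>Otherwise the resolvent would be entire and vanish at infinity.\<close>
lemma unitary_eigenvector:
  fixes Q :: "complex^'n::finite^'n"
  assumes Q: "hadj Q ** Q = mat 1"
  obtains e c where "e \<noteq> 0" "c \<noteq> 0" "Q *v e = c *s e"
proof -
  define M where "M c = (\<chi> i j. Q $ i $ j - (if i = j then c else 0))" for c
  have Mv: "M c *v x = Q *v x - c *s x" for c x
    by (simp add: M_def vec_eq_iff matrix_vector_mult_def left_diff_distrib sum_subtractf if_distrib[of "\<lambda>x. x * _"] cong: if_cong)
  have "\<exists>c. det (M c) = 0"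
  proof (rule ccontr)
    assume "\<not> (\<exists>c. det (M c) = 0)"
    then have d: "det (M c) \<noteq> 0" for c by blast
    have "matrix_inv (M c) $ i $ j = 0" for c i j
    proof (rule Liouville_weak_0[where f="\<lambda>c. matrix_inv (M c) $ i $ j" and z=c])
      have hd: "(\<lambda>c. det (B c)) holomorphic_on UNIV" if "\<And>k l. (\<lambda>c. B c $ k $ l) holomorphic_on UNIV" for B :: "complex \<Rightarrow> complex^'n^'n"
        unfolding det_def by (intro holomorphic_on_sum holomorphic_on_mult holomorphic_on_prod holomorphic_on_const that)
      have Mh: "(\<lambda>c. M c $ k $ l) holomorphic_on UNIV" for k l
        unfolding M_def by (cases "k = l") (auto intro!: holomorphic_intros)
      then have "(\<lambda>c. (\<chi> k l. if l = i then (if k = j then 1 else 0) else M c $ k $ l) $ k $ l) holomorphic_on UNIV" for k l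
        by (cases "l = i"; cases "k = j") (auto intro!: holomorphic_intros)
      then show "(\<lambda>c. matrix_inv (M c) $ i $ j) holomorphic_on UNIV"
        unfolding matrix_inv_cramer[OF d] by (intro holomorphic_on_divide d hd Mh)
      have b: "cmod (matrix_inv (M c) $ i $ j) * (cmod c - 1) \<le> 1" if "cmod c \<ge> 1" for c
      proof -
        define y where "y = matrix_inv (M c) *v axis j 1"
        have "M c *v y = axis j 1" by (simp add: y_def matrix_vector_mul_assoc matrix_inv_right_left[OF d])
        then have "c *s y = Q *v y - axis j 1" by (simp add: Mv algebra_simps)
        then have "cmod c * norm y \<le> norm y + 1"
          using norm_triangle_ineq4[of "Q *v y" "axis j 1"] by (metis norm_vec_smult unitary_norm[OF Q] norm_axis_one)
        moreover have "cmod (matrix_inv (M c) $ i $ j) \<le> norm y"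
          using Finite_Cartesian_Product.norm_nth_le[of y i] by (simp add: y_def matrix_vector_mult_def axis_def if_distrib[of "\<lambda>x. _ * x"] cong: if_cong)
        then have "cmod (matrix_inv (M c) $ i $ j) * (cmod c - 1) \<le> norm y * (cmod c - 1)" using that by (intro mult_right_mono) auto
        ultimately show ?thesis by (simp add: algebra_simps)
      qed
      show "((\<lambda>c. matrix_inv (M c) $ i $ j) \<longlongrightarrow> 0) at_infinity"
        unfolding Lim_at_infinity
      proof (intro allI impI)
        fix e :: real assume e: "e > 0"
        show "\<exists>b. \<forall>c. b \<le> cmod c \<longrightarrow> dist (matrix_inv (M c) $ i $ j) 0 < e"
        proof (intro exI[of _ "1 + 2 / e"] allI impI)
          fix c assume c: "1 + 2 / e \<le> cmod c"
          have "2 / e > 0" using e by simp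
          then have "1 \<le> cmod c" using c by linarith
          then have "cmod (matrix_inv (M c) $ i $ j) * (2 / e) \<le> 1"
            using b[of c] c mult_left_mono[of "2 / e" "cmod c - 1" "cmod (matrix_inv (M c) $ i $ j)"]
            by (intro order_trans[OF _ b[of c]]) auto
          then show "dist (matrix_inv (M c) $ i $ j) 0 < e" using e by (simp add: field_simps)
        qed
      qed
    qed
    then have "matrix_inv (M 0) = 0" by (simp add: vec_eq_iff)
    then have "(mat 1 :: complex^'n^'n) = 0" using matrix_inv_right_left(1)[OF d[of 0]] by simp
    then have "(mat 1 :: complex^'n^'n) $ undefined $ undefined = 0" by simp
    then show False by (simp add: mat_def)
  qed
  then obtain c where "det (M c) = 0" by blast
  then have "\<not> invertible (M c)" by (simp add: invertible_det_nz)
  then obtain e where e: "e \<noteq> 0" "M c *v e = 0"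
    using matrix_left_invertible_ker[of "M c"] invertible_left_inverse[of "M c"] by blast
  then have Qe: "Q *v e = c *s e" by (simp add: Mv)
  have "c \<noteq> 0"
  proof
    assume "c = 0"
    then have "norm (Q *v e) = 0" using Qe by (simp add: norm_vec_smult)
    then show False using e(1) unfolding unitary_norm[OF Q] by simp
  qed
  then show thesis using that e(1) Qe by blast
qed

locale hom_atlas =
  fixes X :: "'a topology" and lifting :: "'a set \<Rightarrow> ('a \<Rightarrow> complex^'n::finite) \<Rightarrow> bool"
  assumes Hausdorff: "Hausdorff_space X" and connected: "connected_space X" and nonempty: "topspace X \<noteq> {}"
    and lifting_exists: "p \<in> topspace X \<Longrightarrow> \<exists>N t. lifting N t \<and> p \<in> N"
    and lifting_open: "lifting N t \<Longrightarrow> openin X N"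
    and lifting_nonzero: "lifting N t \<Longrightarrow> p \<in> N \<Longrightarrow> t p \<noteq> 0"
    and lifting_continuous: "lifting N t \<Longrightarrow> open V \<Longrightarrow> openin X {p \<in> N. t p \<in> V}"
    and lifting_inj: "lifting N t \<Longrightarrow> p \<in> N \<Longrightarrow> q \<in> N \<Longrightarrow> par (t p) (t q) \<Longrightarrow> p = q"
    and lifting_image: "lifting N t \<Longrightarrow> openin X S \<Longrightarrow> open {w. \<exists>p\<in>N \<inter> S. par w (t p)}"
    and lifting_unitary: "lifting N t \<Longrightarrow> hadj Q ** Q = mat 1 \<Longrightarrow> lifting N (\<lambda>p. Q *v t p)"
    and lifting_rigid: "lifting N t \<Longrightarrow> lifting N' t' \<Longrightarrow> p \<in> N \<inter> N' \<Longrightarrow>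
       \<exists>Q V. hadj Q ** Q = mat 1 \<and> openin X V \<and> p \<in> V \<and> V \<subseteq> N \<inter> N' \<and> (\<forall>q\<in>V. par (t' q) (Q *v t q))"
begin

definition dev :: "(complex^'n) set \<Rightarrow> (complex^'n \<Rightarrow> 'a) \<Rightarrow> bool" where
  "dev D f \<longleftrightarrow> (\<forall>v\<in>D. \<exists>N t V. lifting N t \<and> open V \<and> v \<in> V \<and> V \<subseteq> D \<and> (\<forall>w\<in>V. f w \<in> N \<and> par (t (f w)) w))"

lemma devE:
  assumes "dev D f" "v \<in> D"
  obtains N t V where "lifting N t" "open V" "v \<in> V" "V \<subseteq> D" "\<And>w. w \<in> V \<Longrightarrow> f w \<in> N \<and> par (t (f w)) w"
  using assms unfolding dev_def by meson

lemma dev_open: "dev D f \<Longrightarrow> open D"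
  unfolding dev_def by (subst open_subopen) metis

lemma dev_nonzero: "dev D f \<Longrightarrow> 0 \<notin> D"
proof
  assume "dev D f" "0 \<in> D"
  then obtain N t V where N: "lifting N t" "f 0 \<in> N" "par (t (f 0)) 0" by (rule devE) blast
  then show False using lifting_nonzero[OF N(1,2)] by (simp add: par_def)
qed

lemma dev_topspace: "dev D f \<Longrightarrow> v \<in> D \<Longrightarrow> f v \<in> topspace X"
  using devE lifting_open openin_subset by (metis subsetD)

lemma dev_local:
  assumes "\<And>v. v \<in> D \<Longrightarrow> \<exists>V h. open V \<and> v \<in> V \<and> V \<subseteq> D \<and> dev V h \<and> (\<forall>w\<in>V. f w = h w)"
  shows "dev D f"
  unfolding dev_def
proof
  fix v assume "v \<in> D"
  then obtain V h where V: "open V" "v \<in> V" "V \<subseteq> D" "dev V h" "\<And>w. w \<in> V \<Longrightarrow> f w = h w" using assms by metis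
  obtain N t W where "lifting N t" "open W" "v \<in> W" "W \<subseteq> V" "\<And>w. w \<in> W \<Longrightarrow> h w \<in> N \<and> par (t (h w)) w"
    using devE[OF V(4,2)] by metis
  then show "\<exists>N t V. lifting N t \<and> open V \<and> v \<in> V \<and> V \<subseteq> D \<and> (\<forall>w\<in>V. f w \<in> N \<and> par (t (f w)) w)"
    using V by (intro exI[of _ N] exI[of _ t] exI[of _ W]) auto
qed

lemma dev_subset:
  assumes f: "dev D f" and V: "open V" "V \<subseteq> D"
  shows "dev V f"
  unfolding dev_def
proof
  fix v assume v: "v \<in> V"
  obtain N t W where "lifting N t" "open W" "v \<in> W" "\<And>w. w \<in> W \<Longrightarrow> f w \<in> N \<and> par (t (f w)) w"
    using devE[OF f] v V(2) by (metis subsetD)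
  then show "\<exists>N t W. lifting N t \<and> open W \<and> v \<in> W \<and> W \<subseteq> V \<and> (\<forall>w\<in>W. f w \<in> N \<and> par (t (f w)) w)"
    using V v by (intro exI[of _ N] exI[of _ t] exI[of _ "W \<inter> V"]) auto
qed

lemma dev_preimage:
  assumes f: "dev D f" and S: "openin X S"
  shows "open {w \<in> D. f w \<in> S}"
proof (subst open_subopen, rule ballI)
  fix v assume v: "v \<in> {w \<in> D. f w \<in> S}"
  then obtain N t V where N: "lifting N t" "open V" "v \<in> V" "V \<subseteq> D" "\<And>w. w \<in> V \<Longrightarrow> f w \<in> N \<and> par (t (f w)) w"
    using devE[OF f, of v] by (metis (no_types, lifting) mem_Collect_eq)
  let ?T = "V \<inter> {w. \<exists>p\<in>N \<inter> S. par w (t p)}"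
  have "open ?T" using N(2) lifting_image[OF N(1) S] by blast
  moreover have "v \<in> ?T" using N(3,5) v par_sym by blast
  moreover have "?T \<subseteq> {w \<in> D. f w \<in> S}"
    using N(4,5) lifting_inj[OF N(1)] par_trans by blast
  ultimately show "\<exists>T. open T \<and> v \<in> T \<and> T \<subseteq> {w \<in> D. f w \<in> S}" by blast
qed

lemma dev_continuous: "dev D f \<Longrightarrow> continuous_map (top_of_set D) X f"
  using dev_topspace dev_preimage by (fastforce simp: continuous_map_def openin_open)

definition psi :: "'a set \<Rightarrow> ('a \<Rightarrow> complex^'n) \<Rightarrow> complex^'n \<Rightarrow> 'a" where
  "psi N t w = (SOME p. p \<in> N \<and> par w (t p))"

lemma dev_psi:
  assumes "lifting N t"
  shows "dev {w. \<exists>p\<in>N. par w (t p)} (psi N t)" "\<And>w p. p \<in> N \<Longrightarrow> par w (t p) \<Longrightarrow> psi N t w = p"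
proof -
  have s: "psi N t w \<in> N \<and> par w (t (psi N t w))" if "p \<in> N" "par w (t p)" for w p
    unfolding psi_def by (rule someI[of "\<lambda>p. p \<in> N \<and> par w (t p)" p]) (use that in blast)
  have "open {w. \<exists>p\<in>N. par w (t p)}"
    using lifting_image[OF assms lifting_open[OF assms]] by simp
  then show "dev {w. \<exists>p\<in>N. par w (t p)} (psi N t)"
    unfolding dev_def using assms s par_sym by blast
  show "\<And>w p. p \<in> N \<Longrightarrow> par w (t p) \<Longrightarrow> psi N t w = p"
    using s lifting_inj[OF assms] par_trans par_sym by blast
qed

lemma dev_compose:
  assumes f: "dev D f" and c: "c \<noteq> 0" and Q: "hadj Q ** Q = mat 1"
  shows "dev {w. c *s (Q *v w) \<in> D} (\<lambda>w. f (c *s (Q *v w)))"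
  unfolding dev_def
proof
  have "vhol UNIV (\<lambda>w. c *s (Q *v w))" by (intro vhol_smult hol_on_const vhol_matrix vhol_id)
  from continuous_open_preimage[OF vhol_continuous[OF this] open_UNIV]
  have o: "open V \<Longrightarrow> open {w. c *s (Q *v w) \<in> V}" for V by (simp add: vimage_def)
  fix v assume v: "v \<in> {w. c *s (Q *v w) \<in> D}"
  then obtain N t V where N: "lifting N t" "open V" "c *s (Q *v v) \<in> V" "V \<subseteq> D" "\<And>w. w \<in> V \<Longrightarrow> f w \<in> N \<and> par (t (f w)) w"
    using devE[OF f] by (metis mem_Collect_eq)
  have "par (hadj Q *v t (f (c *s (Q *v w)))) w" if "c *s (Q *v w) \<in> V" for w
  proof -
    have "par (t (f (c *s (Q *v w)))) (Q *v w)" using N(5)[OF that] par_smult[OF c] par_trans by blast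
    then show ?thesis using par_matrix[of _ "Q *v w" "hadj Q"] by (simp add: unitary_inverse[OF Q])
  qed
  then show "\<exists>N t V. lifting N t \<and> open V \<and> v \<in> V \<and> V \<subseteq> {w. c *s (Q *v w) \<in> D} \<and>
      (\<forall>w\<in>V. f (c *s (Q *v w)) \<in> N \<and> par (t (f (c *s (Q *v w)))) w)"
    using N o[OF N(2)] lifting_unitary[OF N(1) unitary_inverse(3)[OF Q]]
    by (intro exI[of _ N] exI[of _ "\<lambda>p. hadj Q *v t p"] exI[of _ "{w. c *s (Q *v w) \<in> V}"]) auto
qed

lemma dev_lifting:
  assumes f: "dev D f" "v \<in> D" and N: "lifting N t" "f v \<in> N"
  obtains Q V where "hadj Q ** Q = mat 1" "open V" "v \<in> V" "V \<subseteq> D" "\<And>w. w \<in> V \<Longrightarrow> f w \<in> N \<and> par (t (f w)) (Q *v w)"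
proof -
  obtain N' t' V where N': "lifting N' t'" "open V" "v \<in> V" "V \<subseteq> D" "\<And>w. w \<in> V \<Longrightarrow> f w \<in> N' \<and> par (t' (f w)) w"
    using devE[OF f] by metis
  obtain Q S where Q: "hadj Q ** Q = mat 1" "openin X S" "f v \<in> S" "S \<subseteq> N' \<inter> N" "\<And>q. q \<in> S \<Longrightarrow> par (t q) (Q *v t' q)"
    using lifting_rigid[OF N'(1) N(1), of "f v"] N(2) N'(3,5) by blast
  show thesis
  proof (rule that[OF Q(1), of "V \<inter> {w \<in> D. f w \<in> S}"])
    show "open (V \<inter> {w \<in> D. f w \<in> S})" using N'(2) dev_preimage[OF f(1) Q(2)] by blast
    fix w assume w: "w \<in> V \<inter> {w \<in> D. f w \<in> S}"
    then have "par (t (f w)) (Q *v t' (f w))" "par (Q *v t' (f w)) (Q *v w)"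
      using Q(5) N'(5) par_matrix by blast+
    then show "f w \<in> N \<and> par (t (f w)) (Q *v w)" using w Q(4) par_trans by blast
  qed (use f N' Q in auto)
qed

lemma dev_identity:
  assumes D: "connected D" and f: "dev D f" and h: "dev D h"
    and W: "open W" "W \<noteq> {}" "W \<subseteq> D" "\<And>w. w \<in> W \<Longrightarrow> f w = h w" and v: "v \<in> D"
  shows "f v = h v"
proof -
  define T where "T = \<Union>{V. open V \<and> V \<subseteq> D \<and> (\<forall>w\<in>V. f w = h w)}"
  have T: "open T" "T \<subseteq> D" "\<And>w. w \<in> T \<Longrightarrow> f w = h w" unfolding T_def by auto
  have mem: "w \<in> T" if "open V" "V \<subseteq> D" "\<And>w. w \<in> V \<Longrightarrow> f w = h w" "w \<in> V" for V w using that unfolding T_def by blast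
  have "\<exists>V. open V \<and> u \<in> V \<and> V \<subseteq> D - T" if u: "u \<in> D - T" for u
  proof (rule ccontr)
    assume "\<not> ?thesis"
    then have meets: "V \<inter> T \<noteq> {}" if "open V" "u \<in> V" "V \<subseteq> D" for V using that by blast
    have "f u = h u"
    proof (rule ccontr)
      assume "f u \<noteq> h u"
      then obtain N1 N2 where N: "openin X N1" "openin X N2" "f u \<in> N1" "h u \<in> N2" "N1 \<inter> N2 = {}"
        using Hausdorff dev_topspace f h u unfolding Hausdorff_space_def disjnt_def by (metis DiffD1)
      have "{w \<in> D. f w \<in> N1} \<inter> {w \<in> D. h w \<in> N2} \<inter> T \<noteq> {}"
        using u N by (intro meets open_Int dev_preimage[OF f] dev_preimage[OF h]) auto
      then show False using T(3) N(5) by auto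
    qed
    obtain N t V where N: "lifting N t" "open V" "u \<in> V" "V \<subseteq> D" "\<And>w. w \<in> V \<Longrightarrow> f w \<in> N \<and> par (t (f w)) w"
      using devE[OF f, of u] u by (metis DiffD1)
    have "h u \<in> N" using N(3,5) \<open>f u = h u\<close> by metis
    then obtain Q V' where Q: "hadj Q ** Q = mat 1" "open V'" "u \<in> V'" "V' \<subseteq> D" "\<And>w. w \<in> V' \<Longrightarrow> h w \<in> N \<and> par (t (h w)) (Q *v w)"
      using dev_lifting[OF h _ N(1), of u] u by (metis DiffD1)
    have op: "open (V \<inter> V' \<inter> T)" "V \<inter> V' \<inter> T \<noteq> {}" using N Q T(1) meets[of "V \<inter> V'"] by auto
    have "par w (Q *v w)" if "w \<in> V \<inter> V' \<inter> T" for w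
      using that N(5)[of w] Q(5)[of w] T(3)[of w] par_trans par_sym by (metis IntD1 IntD2)
    then obtain c where c: "c \<noteq> 0" "\<And>x. Q *v x = c *s x" using par_open_scalar[OF op] by metis
    have "f w = h w" if w: "w \<in> V \<inter> V'" for w
    proof (rule lifting_inj[OF N(1)])
      have "par (t (h w)) w" using Q(5)[of w] w c par_smult[OF c(1), of w] par_trans by (metis IntD2)
      then show "par (t (f w)) (t (h w))" using N(5)[of w] w par_trans par_sym by blast
    qed (use N(5) Q(5) w in auto)
    then have "u \<in> T" using mem[of "V \<inter> V'"] N Q by blast
    then show False using u by blast
  qed
  then have "open (D - T)" by (subst open_subopen) blast
  then have "T \<inter> D = {} \<or> (D - T) \<inter> D = {}"
    using T(1) by (intro connectedD[OF D]) auto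
  moreover have "W \<subseteq> T" using W mem by blast
  ultimately show ?thesis using W(2,3) T(3) v by blast
qed

lemma uniform_extension:
  assumes "compact_space X"
  obtains d where "d > 0" "\<And>D f v. dev D f \<Longrightarrow> v \<in> D \<Longrightarrow>
    \<exists>h V. dev (ball v (d * norm v)) h \<and> open V \<and> v \<in> V \<and> V \<subseteq> D \<inter> ball v (d * norm v) \<and> (\<forall>w\<in>V. h w = f w)"
proof -
  define ext where "ext S d \<longleftrightarrow> (\<forall>D f v. dev D f \<longrightarrow> v \<in> D \<longrightarrow> f v \<in> S \<longrightarrow>
    (\<exists>h V. dev (ball v (d * norm v)) h \<and> open V \<and> v \<in> V \<and> V \<subseteq> D \<inter> ball v (d * norm v) \<and> (\<forall>w\<in>V. h w = f w)))" for S and d :: real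
  have "\<exists>S d. openin X S \<and> p \<in> S \<and> d > 0 \<and> ext S d" if p: "p \<in> topspace X" for p
  proof -
    obtain N t where N: "lifting N t" "p \<in> N" using lifting_exists[OF p] by blast
    let ?C = "{w. \<exists>p\<in>N. par w (t p)}"
    note psi = dev_psi[OF N(1)]
    have "t p \<in> ?C" using N(2) par_refl by blast
    then obtain r2 where r2: "r2 > 0" "ball (t p) r2 \<subseteq> ?C" using dev_open[OF psi(1)] openE by blast
    define r where "r = r2 / 2"
    define d where "d = r / (norm (t p) + r)"
    have r: "r > 0" "ball (t p) (2 * r) \<subseteq> ?C" using r2 by (auto simp: r_def)
    have nr: "norm (t p) + r > 0" using r(1) by (simp add: add_nonneg_pos)
    have d: "d > 0" using r(1) nr by (simp add: d_def)
    let ?S = "{q \<in> N. t q \<in> ball (t p) r}"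
    have "ext ?S d" unfolding ext_def
    proof (intro allI impI)
      fix D f v assume f: "dev D f" and v: "v \<in> D" and fv: "f v \<in> ?S"
      obtain Q V where Q: "hadj Q ** Q = mat 1" "open V" "v \<in> V" "V \<subseteq> D" "\<And>w. w \<in> V \<Longrightarrow> f w \<in> N \<and> par (t (f w)) (Q *v w)"
        using dev_lifting[OF f v N(1)] fv by (metis (no_types, lifting) mem_Collect_eq)
      obtain a where a: "a \<noteq> 0" "t (f v) = a *s (Q *v v)" using Q(5)[OF Q(3)] by (auto simp: par_def)
      have v0: "norm v > 0" using dev_nonzero[OF f] v by auto
      have "cmod a * norm v = norm (t (f v))" using a(2) by (simp add: norm_vec_smult unitary_norm[OF Q(1)])
      also have "\<dots> \<le> norm (t p) + r"
        using fv norm_triangle_sub[of "t (f v)" "t p"] by (auto simp: dist_norm norm_minus_commute)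
      finally have an: "cmod a * (d * norm v) \<le> r"
        using d nr mult_left_mono[of "cmod a * norm v" "norm (t p) + r" d] by (simp add: d_def mult_ac)
      let ?h = "\<lambda>w. psi N t (a *s (Q *v w))"
      have dh: "dev {w. a *s (Q *v w) \<in> ?C} ?h" by (rule dev_compose[OF psi(1) a(1) Q(1)])
      have sub: "ball v (d * norm v) \<subseteq> {w. a *s (Q *v w) \<in> ?C}"
      proof
        fix w assume w: "w \<in> ball v (d * norm v)"
        have "a *s (Q *v w) - t (f v) = a *s (Q *v (w - v))" by (simp add: a(2) matrix_vector_mult_diff_distrib vec_eq_iff algebra_simps)
        then have "norm (a *s (Q *v w) - t (f v)) = cmod a * norm (w - v)" by (simp add: norm_vec_smult unitary_norm[OF Q(1)])
        also have "\<dots> < cmod a * (d * norm v)" using w a(1) by (simp add: dist_norm norm_minus_commute)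
        finally have "norm (a *s (Q *v w) - t (f v)) < r" using an by simp
        moreover have "norm (t (f v) - t p) < r" using fv by (simp add: dist_norm norm_minus_commute)
        ultimately have "norm (a *s (Q *v w) - t p) < 2 * r"
          using norm_triangle_ineq[of "a *s (Q *v w) - t (f v)" "t (f v) - t p"] by simp
        then have "a *s (Q *v w) \<in> ball (t p) (2 * r)" by (simp add: dist_norm norm_minus_commute)
        then show "w \<in> {w. a *s (Q *v w) \<in> ?C}" using r(2) by blast
      qed
      have "psi N t (a *s (Q *v w)) = f w" if "w \<in> V" for w
        using psi(2)[of "f w" "a *s (Q *v w)"] Q(5)[OF that] par_smult[OF a(1), of "Q *v w"] par_trans par_sym by blast
      then show "\<exists>h V. dev (ball v (d * norm v)) h \<and> open V \<and> v \<in> V \<and> V \<subseteq> D \<inter> ball v (d * norm v) \<and> (\<forall>w\<in>V. h w = f w)"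
        using dev_subset[OF dh open_ball sub] Q v0 d
        by (intro exI[of _ ?h] exI[of _ "V \<inter> ball v (d * norm v)"]) auto
    qed
    moreover have "openin X ?S" by (rule lifting_continuous[OF N(1)]) simp
    ultimately show ?thesis using N(2) r(1) d by (intro exI[of _ ?S] exI[of _ d]) auto
  qed
  then obtain S d where S: "\<And>p. p \<in> topspace X \<Longrightarrow> openin X (S p) \<and> p \<in> S p \<and> d p > 0 \<and> ext (S p) (d p)" by metis
  obtain F where F: "finite F" "F \<subseteq> topspace X" "topspace X \<subseteq> \<Union>(S ` F)"
  proof -
    have "topspace X \<subseteq> \<Union>(S ` topspace X)" "\<forall>V\<in>S ` topspace X. openin X V" using S by auto
    then obtain \<F> where "finite \<F>" "\<F> \<subseteq> S ` topspace X" "topspace X \<subseteq> \<Union>\<F>"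
      using assms unfolding compact_space_def compactin_def by meson
    then show thesis using that finite_subset_image[of \<F> S "topspace X"] by blast
  qed
  have F0: "F \<noteq> {}" using F(3) nonempty by auto
  define e where "e = Min (d ` F)"
  have e: "e > 0" "\<And>p. p \<in> F \<Longrightarrow> e \<le> d p" using F F0 S unfolding e_def by (auto simp: Min_gr_iff)
  show thesis
  proof (rule that[OF e(1)])
    fix D f v assume f: "dev D f" and v: "v \<in> D"
    obtain p where p: "p \<in> F" "f v \<in> S p" using F(3) dev_topspace[OF f v] by blast
    have "ext (S p) (d p)" using S p(1) F(2) by blast
    then obtain h V where h: "dev (ball v (d p * norm v)) h" "open V" "v \<in> V" "V \<subseteq> D \<inter> ball v (d p * norm v)" "\<And>w. w \<in> V \<Longrightarrow> h w = f w"
      unfolding ext_def using f v p(2) by metis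
    have "ball v (e * norm v) \<subseteq> ball v (d p * norm v)" using e(2)[OF p(1)] by (intro subset_ball mult_right_mono) auto
    moreover have "norm v > 0" using dev_nonzero[OF f] v by auto
    ultimately show "\<exists>h V. dev (ball v (e * norm v)) h \<and> open V \<and> v \<in> V \<and> V \<subseteq> D \<inter> ball v (e * norm v) \<and> (\<forall>w\<in>V. h w = f w)"
      using h dev_subset[OF h(1) open_ball] e(1) by (intro exI[of _ h] exI[of _ "V \<inter> ball v (e * norm v)"]) auto
  qed
qed

end

lemma open_perturb:
  fixes V :: "(complex^'n::finite) set"
  assumes "open V" "v \<in> V"
  obtains w where "w \<in> V" "w $ o1 \<noteq> 0"
proof (cases "v $ o1 = 0")
  case True
  obtain d where d: "d > 0" "ball v d \<subseteq> V" using assms openE by blast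
  have "v + complex_of_real (d / 2) *s axis o1 1 \<in> V"
    using d by (intro subsetD[OF d(2)]) (simp add: dist_norm norm_vec_smult norm_axis_one norm_divide)
  then show thesis using that True d(1) by fastforce
qed (use assms that in blast)

lemma open_coordinate: "open {v :: complex^'n::finite. v $ o1 \<in> S}" if "open S"
  using continuous_open_preimage[OF hol_on_continuous[OF hol_on_nth[of UNIV o1]] open_UNIV that] by (simp add: vimage_def)

lemma convex_coordinate: "convex {v :: complex^'n::finite. v $ i \<in> S}" if "convex S"
  using convex_linear_vimage[OF bounded_linear.linear[OF bounded_linear_vec_nth[of i]] that] by (simp add: vimage_def)

text \<open>The complement is the image of a convex set under the exponential function in the coordinate \<open>o1\<close>.\<close>
lemma connected_polydisc_minus_hyperplane:
  fixes v :: "complex^'n::finite"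
  assumes v: "v $ o1 = 0" and r: "r > 0"
  shows "connected {x. (\<forall>i. cmod (x $ i - v $ i) < r) \<and> x $ o1 \<noteq> 0}"
proof -
  define E where "E x = (\<chi> i. if i = o1 then exp (x $ o1) else x $ i)" for x :: "complex^'n"
  define W where "W = {x. x $ o1 \<in> {z. Re z < ln r}} \<inter> (\<Inter>i\<in>-{o1}. {x :: complex^'n. x $ i \<in> ball (v $ i) r})"
  have "convex W" unfolding W_def by (intro convex_Int convex_INT convex_coordinate convex_halfspace_Re_lt convex_ball)
  moreover have "continuous_on W E" unfolding E_def
  proof (rule continuous_on_vec_lambda)
    show "continuous_on W (\<lambda>x. if i = o1 then exp (x $ o1) else x $ i)" for i
      by (cases "i = o1") (simp_all add: continuous_on_exp[OF hol_on_continuous[OF hol_on_nth]] hol_on_continuous[OF hol_on_nth])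
  qed
  ultimately have "connected (E ` W)" using convex_connected connected_continuous_image by blast
  moreover have "E ` W = {x. (\<forall>i. cmod (x $ i - v $ i) < r) \<and> x $ o1 \<noteq> 0}"
  proof (intro equalityI subsetI)
    fix y assume "y \<in> E ` W"
    then obtain x where x: "x \<in> W" "y = E x" by blast
    have "exp (Re (x $ o1)) < exp (ln r)" using x(1) by (simp add: W_def)
    then have "cmod (exp (x $ o1)) < r" using r by simp
    then show "y \<in> {x. (\<forall>i. cmod (x $ i - v $ i) < r) \<and> x $ o1 \<noteq> 0}"
      using x v by (auto simp: E_def W_def dist_norm norm_minus_commute)
  next
    fix y assume y: "y \<in> {x. (\<forall>i. cmod (x $ i - v $ i) < r) \<and> x $ o1 \<noteq> 0}"
    define x where "x = (\<chi> i. if i = o1 then Ln (y $ o1) else y $ i)"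
    have "cmod (y $ o1 - v $ o1) < r" using y by blast
    then have "cmod (y $ o1) < r" using v by simp
    then have "x \<in> W" using y r by (auto simp: x_def W_def dist_norm norm_minus_commute)
    moreover have "y = E x" using y by (simp add: E_def x_def vec_eq_iff)
    ultimately show "y \<in> E ` W" by blast
  qed
  ultimately show ?thesis by simp
qed

context hom_atlas begin

lemma convex_extension:
  assumes C: "open C" "convex C" "p \<in> C" and d: "d > 0" and r0: "r0 > 0" and f0: "dev (ball p r0) f0"
    and ext: "\<And>D f v. dev D f \<Longrightarrow> v \<in> D \<Longrightarrow> v \<in> C \<Longrightarrow> \<exists>h V. dev (ball v d) h \<and> open V \<and> v \<in> V \<and> V \<subseteq> D \<and> (\<forall>w\<in>V. h w = f w)"
  shows "\<exists>F. dev C F"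
proof -
  define r where "r n = r0 + real n * (d / 2)" for n
  define K where "K n = C \<inter> ball p (r n)" for n
  have rp: "r n > 0" for n using r0 d by (simp add: r_def add_pos_nonneg)
  have rS: "r (Suc n) = r n + d / 2" for n by (simp add: r_def algebra_simps)
  have K: "open (K n)" "convex (K n)" "p \<in> K n" for n using C rp by (auto simp: K_def intro: convex_Int)
  have KS: "K n \<subseteq> K (Suc n)" for n using rS[of n] d by (auto simp: K_def)
  have step: "\<exists>f'. dev (K (Suc n)) f' \<and> (\<forall>w\<in>K n. f' w = f w)" if f: "dev (K n) f" for n f
  proof -
    obtain h V where h: "\<And>v. v \<in> K n \<Longrightarrow> dev (ball v d) (h v) \<and> open (V v) \<and> v \<in> V v \<and> V v \<subseteq> K n \<and> (\<forall>w\<in>V v. h v w = f w)"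
      using ext[OF f] unfolding K_def by (metis IntD1)
    have hf: "h v w = f w" if v: "v \<in> K n" and w: "w \<in> ball v d \<inter> K n" for v w
    proof (rule dev_identity[of "ball v d \<inter> K n" "h v" f "ball v d \<inter> V v" w])
      show "dev (ball v d \<inter> K n) (h v)" "dev (ball v d \<inter> K n) f"
        using h[OF v] f K by (auto intro: dev_subset)
      show "ball v d \<inter> V v \<noteq> {}" using h[OF v] d centre_in_ball[of v d] by blast
    qed (use h[OF v] w K in \<open>auto intro!: convex_connected convex_Int\<close>)
    define t where "t = r n / r (Suc n)"
    have t: "0 < t" "t < 1" using rp[of n] rp[of "Suc n"] d by (auto simp: t_def rS)
    define q where "q z = (1 - t) *\<^sub>R p + t *\<^sub>R z" for z
    have qp: "q z - p = t *\<^sub>R (z - p)" "z - q z = (1 - t) *\<^sub>R (z - p)" for z by (simp_all add: q_def algebra_simps)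
    have q: "q z \<in> K n" "dist (q z) z < d" if z: "z \<in> K (Suc n)" for z
    proof -
      have zp: "norm (z - p) < r (Suc n)" using z by (simp add: K_def dist_norm norm_minus_commute)
      have "norm (q z - p) = t * norm (z - p)" using t by (simp add: qp)
      also have "\<dots> < t * r (Suc n)" using zp t by simp
      finally have "norm (q z - p) < r n" using rp[of "Suc n"] by (simp add: t_def)
      moreover have "q z \<in> C" unfolding q_def by (rule convexD_alt[OF C(2,3)]) (use z t in \<open>auto simp: K_def\<close>)
      ultimately show "q z \<in> K n" by (simp add: K_def dist_norm norm_minus_commute)
      have "norm (z - q z) = (1 - t) * norm (z - p)" using t by (simp add: qp)
      also have "\<dots> < (1 - t) * r (Suc n)" using zp t by simp
      also have "\<dots> = d / 2" using rp[of "Suc n"] rS[of n] by (simp add: t_def left_diff_distrib)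
      finally show "dist (q z) z < d" using d by (simp add: dist_norm norm_minus_commute)
    qed
    have agree: "h (q z) z = h w z" if z: "z \<in> K (Suc n)" and w: "w \<in> K n" "dist w z < d" "dist w (q z) < d" for z w
    proof (rule dev_identity[of "ball (q z) d \<inter> ball w d" "h (q z)" "h w" "V (q z) \<inter> ball (q z) d \<inter> ball w d" z])
      note hq = h[OF q(1)[OF z]] and hw = h[OF w(1)]
      show "dev (ball (q z) d \<inter> ball w d) (h (q z))" "dev (ball (q z) d \<inter> ball w d) (h w)"
        using hq hw by (auto intro: dev_subset)
      show "V (q z) \<inter> ball (q z) d \<inter> ball w d \<noteq> {}" using hq d w(3) by (auto simp: dist_commute)
      show "h (q z) u = h w u" if "u \<in> V (q z) \<inter> ball (q z) d \<inter> ball w d" for u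
        using that hq hf[OF w(1), of u] by auto
    qed (use h[OF q(1)[OF z]] q(2)[OF z] w(2) in \<open>auto intro!: convex_connected convex_Int\<close>)
    define f' where "f' z = h (q z) z" for z
    have qc: "continuous_on S q" for S unfolding q_def by (intro continuous_intros)
    have dev': "dev (K (Suc n)) f'"
    proof (rule dev_local)
      fix z assume z: "z \<in> K (Suc n)"
      let ?V = "K (Suc n) \<inter> q -` ball (q z) d \<inter> ball (q z) d"
      have "open ?V" using continuous_open_preimage[OF qc K(1) open_ball] by auto
      moreover have "z \<in> ?V" using z q(2)[OF z] d by simp
      moreover have "dev ?V (h (q z))" by (rule dev_subset[of "ball (q z) d"]) (use h[OF q(1)[OF z]] calculation(1) in auto)
      moreover have "f' u = h (q z) u" if "u \<in> ?V" for u
        unfolding f'_def by (rule agree) (use that q(1)[OF z] in auto)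
      ultimately show "\<exists>V h. open V \<and> z \<in> V \<and> V \<subseteq> K (Suc n) \<and> dev V h \<and> (\<forall>w\<in>V. f' w = h w)" by blast
    qed
    have "f' w = f w" if w: "w \<in> K n" for w
    proof (rule dev_identity[of "K n" f' f "K n \<inter> q -` ball p d \<inter> ball p d" w])
      have qp': "q p = p" by (simp add: q_def flip: scaleR_add_left)
      show "dev (K n) f'" by (rule dev_subset[OF dev' K(1) KS])
      show "open (K n \<inter> q -` ball p d \<inter> ball p d)" using continuous_open_preimage[OF qc K(1) open_ball] by auto
      show "K n \<inter> q -` ball p d \<inter> ball p d \<noteq> {}" using K(3)[of n] d qp' centre_in_ball[of p d] by (metis IntI empty_iff vimage_eq)
      show "f' u = f u" if u: "u \<in> K n \<inter> q -` ball p d \<inter> ball p d" for u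
      proof -
        have "f' u = h p u" unfolding f'_def by (rule agree) (use u K(3) KS in auto)
        then show ?thesis using hf[OF K(3)] u by auto
      qed
    qed (use f K w in \<open>auto intro: convex_connected\<close>)
    then show ?thesis using dev' by blast
  qed
  have "dev (K 0) f0" by (rule dev_subset[OF f0 K(1)]) (auto simp: K_def r_def)
  then obtain F where F: "\<And>n. dev (K n) (F n)" "\<And>n w. w \<in> K n \<Longrightarrow> F (Suc n) w = F n w"
    using dependent_nat_choice[of "\<lambda>n f. dev (K n) f" "\<lambda>n f f'. \<forall>w\<in>K n. f' w = f w"] step by metis
  have mono: "K m \<subseteq> K n" if "m \<le> n" for m n using lift_Suc_mono_le[of K, OF KS that] .
  have Fm: "F n w = F m w" if "m \<le> n" "w \<in> K m" for m n w
    using that(1)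
  proof (induction n rule: dec_induct)
    case (step k)
    then have "w \<in> K k" using mono that(2) by blast
    then show ?case using F(2) step.IH by simp
  qed simp
  have "dev C (\<lambda>w. F (LEAST n. w \<in> K n) w)"
  proof (rule dev_local)
    fix v assume v: "v \<in> C"
    obtain n where "norm (v - p) / (d / 2) < real n" using reals_Archimedean2 by blast
    then have "norm (v - p) < r n" using d r0 by (simp add: r_def field_simps)
    then have "v \<in> K n" using v by (simp add: K_def dist_norm norm_minus_commute)
    moreover have "F (LEAST n. w \<in> K n) w = F n w" if "w \<in> K n" for w
      using Fm[of "LEAST n. w \<in> K n" n w] LeastI[of "\<lambda>n. w \<in> K n", OF that] Least_le[of "\<lambda>n. w \<in> K n", OF that] by simp
    ultimately show "\<exists>V h. open V \<and> v \<in> V \<and> V \<subseteq> C \<and> dev V h \<and> (\<forall>w\<in>V. F (LEAST n. w \<in> K n) w = h w)"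
      using K(1) F(1) by (intro exI[of _ "K n"] exI[of _ "F n"]) (auto simp: K_def)
  qed
  then show ?thesis by blast
qed

lemma half_space_extension:
  assumes "compact_space X"
  shows "\<exists>F. dev {v. v $ o1 \<in> {z. 1 / 2 < Re z}} F"
proof -
  obtain d where d: "d > 0" "\<And>D f v. dev D f \<Longrightarrow> v \<in> D \<Longrightarrow>
    \<exists>h V. dev (ball v (d * norm v)) h \<and> open V \<and> v \<in> V \<and> V \<subseteq> D \<inter> ball v (d * norm v) \<and> (\<forall>w\<in>V. h w = f w)"
    using uniform_extension[OF assms] by metis
  obtain p N t where N: "lifting N t" "p \<in> N" using nonempty lifting_exists by blast
  let ?D = "{w. \<exists>p\<in>N. par w (t p)}"
  note D = dev_psi(1)[OF N(1)]
  obtain w where w: "w \<in> ?D" "w $ o1 \<noteq> 0"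
    by (rule open_perturb[OF dev_open[OF D], of "t p"]) (use N(2) par_refl in blast)+
  let ?v = "(1 / w $ o1) *s w"
  have "?v \<in> ?D" using w par_smult[of "1 / w $ o1" w] par_trans by fastforce
  then obtain r where r: "r > 0" "ball ?v r \<subseteq> ?D" using dev_open[OF D] openE by blast
  show ?thesis
  proof (rule convex_extension[of _ ?v "d / 2" r "psi N t"])
    show "dev (ball ?v r) (psi N t)" by (rule dev_subset[OF D open_ball r(2)])
    show "open {v :: complex^'n. v $ o1 \<in> {z. 1 / 2 < Re z}}" by (intro open_coordinate open_halfspace_Re_gt)
    show "convex {v :: complex^'n. v $ o1 \<in> {z. 1 / 2 < Re z}}" by (intro convex_coordinate convex_halfspace_Re_gt)
    fix D f v assume f: "dev D f" and v: "v \<in> D" "v \<in> {v :: complex^'n. v $ o1 \<in> {z. 1 / 2 < Re z}}"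
    have "1 / 2 \<le> norm v" using v(2) complex_Re_le_cmod[of "v $ o1"] Finite_Cartesian_Product.norm_nth_le[of v o1] by simp
    then have "d * (1 / 2) \<le> d * norm v" using d(1) by (intro mult_left_mono) auto
    then have "ball v (d / 2) \<subseteq> ball v (d * norm v)" by auto
    then show "\<exists>h V. dev (ball v (d / 2)) h \<and> open V \<and> v \<in> V \<and> V \<subseteq> D \<and> (\<forall>w\<in>V. h w = f w)"
      using d(2)[OF f v(1)] dev_subset open_ball by (metis Int_subset_iff)
  qed (use d r w in auto)
qed

lemma affine_extension:
  assumes "compact_space X"
  shows "\<exists>F. dev {v. v $ o1 \<noteq> 0} F \<and> (\<forall>v c. c \<noteq> 0 \<longrightarrow> F (c *s v) = F v)"
proof -
  obtain f where f: "dev {v. v $ o1 \<in> {z. 1 / 2 < Re z}} f" using half_space_extension[OF assms] by blast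
  define n where "n v = (1 / v $ o1) *s v" for v :: "complex^'n"
  let ?D = "{v :: complex^'n. v $ o1 \<noteq> 0}"
  have D: "open ?D" using open_coordinate[of "- {0}" o1] by (simp add: open_Compl)
  have n: "vhol ?D n" unfolding n_def[abs_def] by (intro vhol_smult hol_on_divide hol_on_const hol_on_nth vhol_id) auto
  have "dev ?D (\<lambda>v. f (n v))"
    unfolding dev_def
  proof
    fix v assume v: "v \<in> ?D"
    then have "n v \<in> {v. v $ o1 \<in> {z. 1 / 2 < Re z}}" by (simp add: n_def)
    then obtain N t V where N: "lifting N t" "open V" "n v \<in> V" "\<And>w. w \<in> V \<Longrightarrow> f w \<in> N \<and> par (t (f w)) w"
      using devE[OF f] by metis
    have "open (?D \<inter> n -` V)" by (rule continuous_open_preimage[OF vhol_continuous[OF n] D N(2)])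
    moreover have "par (n w) w" if "w \<in> ?D" for w unfolding n_def by (rule par_smult) (use that in simp)
    ultimately show "\<exists>N t V. lifting N t \<and> open V \<and> v \<in> V \<and> V \<subseteq> ?D \<and> (\<forall>w\<in>V. f (n w) \<in> N \<and> par (t (f (n w))) w)"
      using N v by (intro exI[of _ N] exI[of _ t] exI[of _ "?D \<inter> n -` V"]) (auto intro: par_trans)
  qed
  moreover have "n (c *s v) = n v" if "c \<noteq> 0" for c v using that by (simp add: n_def)
  ultimately show ?thesis by (intro exI[of _ "\<lambda>v. f (n v)"]) simp
qed

lemma punctured_extension:
  assumes cpt: "compact_space X"
  shows "\<exists>F. dev (- {0}) F \<and> (\<forall>v c. c \<noteq> 0 \<longrightarrow> v \<noteq> 0 \<longrightarrow> F (c *s v) = F v)"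
proof -
  define o1 :: 'n where "o1 = undefined"
  obtain f where f: "dev {v. v $ o1 \<noteq> 0} f" "\<And>v c. c \<noteq> 0 \<Longrightarrow> f (c *s v) = f v" using affine_extension[OF cpt] by metis
  define ok where "ok v h V \<longleftrightarrow> open V \<and> v \<in> V \<and> dev V h \<and> (\<forall>w\<in>V. w $ o1 \<noteq> 0 \<longrightarrow> h w = f w)" for v h V
  have oD: "open {v :: complex^'n. v $ o1 \<noteq> 0}" using open_coordinate[of "- {0}" o1] by (simp add: open_Compl)
  have ex: "\<exists>h V. ok v h V" if v: "v \<noteq> 0" for v
  proof (cases "v $ o1 = 0")
    case False
    then show ?thesis using f(1) oD unfolding ok_def by (intro exI[of _ f] exI[of _ "{v. v $ o1 \<noteq> 0}"]) auto
  next
    case True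
    obtain d where d: "d > 0" "\<And>D f v. dev D f \<Longrightarrow> v \<in> D \<Longrightarrow>
      \<exists>h V. dev (ball v (d * norm v)) h \<and> open V \<and> v \<in> V \<and> V \<subseteq> D \<inter> ball v (d * norm v) \<and> (\<forall>w\<in>V. h w = f w)"
      using uniform_extension[OF cpt] by metis
    define e where "e = d * norm v / (4 * real CARD('n))"
    have e: "e > 0" using d(1) v by (simp add: e_def)
    let ?B = "{x. \<forall>i. cmod (x $ i - v $ i) < e}"
    have nB: "norm (x - v) < d * norm v / 4" if "x \<in> ?B" for x
    proof -
      have "norm (x - v) \<le> (\<Sum>i\<in>UNIV. cmod (x $ i - v $ i))" unfolding norm_vec_def using L2_set_le_sum[of UNIV "\<lambda>i. cmod ((x - v) $ i)"] by simp
      also have "\<dots> < (\<Sum>i\<in>(UNIV :: 'n set). e)" by (rule sum_strict_mono) (use that in auto)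
      finally show ?thesis by (simp add: e_def)
    qed
    define u where "u = v + complex_of_real (e / 2) *s axis o1 1"
    have u: "u \<in> ?B" "u $ o1 \<noteq> 0" using e True by (auto simp: u_def axis_def)
    have "norm v \<le> norm u" unfolding norm_vec_def by (rule L2_set_mono) (auto simp: u_def axis_def True)
    then have du: "d * norm v \<le> d * norm u" using d(1) by simp
    have sub: "?B \<subseteq> ball u (d * norm u)"
    proof
      fix x assume "x \<in> ?B"
      then have "norm (x - v) + norm (u - v) < d * norm v" using nB[of x] nB[OF u(1)] norm_ge_zero[of "x - v"] norm_ge_zero[of "u - v"] by linarith
      then have "norm (u - x) < d * norm v" using norm_triangle_ineq4[of "u - v" "x - v"] by simp
      then show "x \<in> ball u (d * norm u)" using du by (simp add: dist_norm)
    qed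
    have "?B = (\<Inter>i. {x. x $ i \<in> ball (v $ i) e})" by (auto simp: dist_norm norm_minus_commute)
    then have oB: "open ?B" by (simp only:) (intro open_INT finite_class.finite_UNIV ballI open_coordinate open_ball)
    obtain h V where h: "dev (ball u (d * norm u)) h" "open V" "u \<in> V" "V \<subseteq> {v. v $ o1 \<noteq> 0}" "\<And>w. w \<in> V \<Longrightarrow> h w = f w"
      using d(2)[OF f(1), of u] u(2) by blast
    have hB: "dev ?B h" by (rule dev_subset[OF h(1) oB sub])
    let ?P = "{x. (\<forall>i. cmod (x $ i - v $ i) < e) \<and> x $ o1 \<noteq> 0}"
    have oP: "open ?P" using open_Int[OF oB oD] by (simp add: Collect_conj_eq)
    have "h w = f w" if "w \<in> ?B" "w $ o1 \<noteq> 0" for w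
    proof (rule dev_identity[of ?P h f "?P \<inter> V" w])
      show "connected ?P" by (rule connected_polydisc_minus_hyperplane[OF True e])
      show "dev ?P h" "dev ?P f" using dev_subset[OF hB oP] dev_subset[OF f(1) oP] by auto
    qed (use oP h u that in auto)
    then show ?thesis using oB hB e unfolding ok_def by (intro exI[of _ h] exI[of _ ?B]) auto
  qed
  have uniq: "h v = h' v" if a: "ok v h V" "ok v h' V'" for v h h' V V'
  proof -
    have "open (V \<inter> V')" "v \<in> V \<inter> V'" using a by (auto simp: ok_def)
    then obtain e where e: "e > 0" "ball v e \<subseteq> V \<inter> V'" by (rule openE)
    obtain w where w: "w \<in> ball v e" "w $ o1 \<noteq> 0" by (rule open_perturb[OF open_ball, of v v e]) (use e(1) in auto)
    show ?thesis
    proof (rule dev_identity[of "ball v e" h h' "ball v e \<inter> {v. v $ o1 \<noteq> 0}" v])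
      show "dev (ball v e) h" "dev (ball v e) h'" using a e(2) by (auto simp: ok_def intro: dev_subset)
      show "h u = h' u" if "u \<in> ball v e \<inter> {v. v $ o1 \<noteq> 0}" for u
      proof -
        have "u \<in> V" "u \<in> V'" "u $ o1 \<noteq> 0" using that e(2) by auto
        then show ?thesis using a by (simp add: ok_def)
      qed
    qed (use e w oD in auto)
  qed
  define F where "F v = (SOME p. \<exists>h V. ok v h V \<and> p = h v)" for v
  have F: "F v = h v" if "ok v h V" for v h V
  proof -
    have "\<exists>h V. ok v h V \<and> F v = h v" unfolding F_def by (rule someI_ex) (use that in blast)
    then show ?thesis using uniq that by metis
  qed
  have devF: "dev (- {0}) F"
  proof (rule dev_local)
    fix v :: "complex^'n" assume "v \<in> - {0}"
    then obtain h V where h: "ok v h V" using ex by blast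
    have "ok w h V" if "w \<in> V" for w using h that by (auto simp: ok_def)
    moreover have "V \<subseteq> - {0}" using h dev_nonzero by (auto simp: ok_def)
    ultimately show "\<exists>V h. open V \<and> v \<in> V \<and> V \<subseteq> - {0} \<and> dev V h \<and> (\<forall>w\<in>V. F w = h w)"
      using h F[of _ h V] unfolding ok_def[of v] by blast
  qed
  have Ff: "F v = f v" if "v $ o1 \<noteq> 0" for v
    by (rule F[of v f "{v. v $ o1 \<noteq> 0}"]) (use that f(1) oD in \<open>auto simp: ok_def\<close>)
  have "F (c *s v) = F v" if c: "c \<noteq> 0" and v: "v \<noteq> 0" for c v
  proof -
    have eq: "{w :: complex^'n. c *s (mat 1 *v w) \<in> - {0}} = - {0}" using c by (auto simp: vec_eq_iff)
    have "dev (- {0}) (\<lambda>w. F (c *s w))" using dev_compose[OF devF c, of "mat 1"] unfolding eq by simp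
    moreover have "connected (- {0 :: complex^'n})" by (rule connected_punctured_universe) simp
    moreover have "axis o1 1 \<in> {v :: complex^'n. v $ o1 \<noteq> 0}" by simp
    moreover have "F (c *s w) = F w" if "w \<in> {v. v $ o1 \<noteq> 0}" for w using that c Ff f(2) by simp
    ultimately show ?thesis using dev_identity[of "- {0}" "\<lambda>w. F (c *s w)" F, OF _ _ devF oD _ _ _, of v] v by fastforce
  qed
  then show ?thesis using devF by blast
qed

theorem developing_map:
  assumes cpt: "compact_space X"
  obtains F where "dev (- {0}) F" "F ` (- {0}) = topspace X" "\<And>v w. v \<noteq> 0 \<Longrightarrow> w \<noteq> 0 \<Longrightarrow> F v = F w \<longleftrightarrow> par v w"
    "\<And>V. open V \<Longrightarrow> 0 \<notin> V \<Longrightarrow> openin X (F ` V)"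
proof -
  obtain F where F: "dev (- {0}) F" and sc: "\<And>v c. c \<noteq> 0 \<Longrightarrow> v \<noteq> 0 \<Longrightarrow> F (c *s v) = F v" using punctured_extension[OF cpt] by metis
  have opn: "openin X (F ` V)" if V: "open V" "0 \<notin> V" for V
  proof (subst openin_subopen, rule ballI)
    fix p assume "p \<in> F ` V"
    then obtain v where v: "v \<in> V" "p = F v" by blast
    obtain N t W where N: "lifting N t" "open W" "v \<in> W" "W \<subseteq> V" "\<And>w. w \<in> W \<Longrightarrow> F w \<in> N \<and> par (t (F w)) w"
      using devE[OF dev_subset[OF F V(1)], of v] V(2) v(1) by auto
    let ?C = "\<Union>a\<in>- {0}. {x. a *s x \<in> W}"
    have "open {x. a *s x \<in> W}" for a
      using continuous_open_preimage[OF vhol_continuous[OF vhol_smult[OF hol_on_const vhol_id]] open_UNIV N(2), of a] by (simp add: vimage_def)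
    then have "open ?C" by blast
    then have o: "openin X {q \<in> N. t q \<in> ?C}" by (rule lifting_continuous[OF N(1)])
    have "{q \<in> N. t q \<in> ?C} \<subseteq> F ` V"
    proof
      fix q assume "q \<in> {q \<in> N. t q \<in> ?C}"
      then obtain a where a: "q \<in> N" "a \<noteq> 0" "a *s t q \<in> W" by blast
      have "F (a *s t q) = q" by (rule lifting_inj[OF N(1)]) (use N(5)[OF a(3)] a(1) par_smult[OF a(2)] par_trans in blast)+
      then show "q \<in> F ` V" using a(3) N(4) by force
    qed
    moreover have "p \<in> {q \<in> N. t q \<in> ?C}"
    proof -
      obtain a where a: "a \<noteq> 0" "v = a *s t p" using par_sym[of "t p" v] N(5)[OF N(3)] v(2) unfolding par_def by blast
      then have "a *s t p \<in> W" using N(3) by simp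
      then show ?thesis using a(1) N(5)[OF N(3)] v(2) by blast
    qed
    ultimately show "\<exists>T. openin X T \<and> p \<in> T \<and> T \<subseteq> F ` V" using o by blast
  qed
  have img: "F ` (- {0}) = topspace X"
  proof -
    have "F v \<in> F ` sphere 0 1" if "v \<noteq> 0" for v
    proof -
      have "F v = F (complex_of_real (1 / norm v) *s v)" using sc[of "complex_of_real (1 / norm v)" v] that by simp
      moreover have "complex_of_real (1 / norm v) *s v \<in> sphere 0 1" using that by (simp add: norm_vec_smult norm_divide)
      ultimately show ?thesis by blast
    qed
    moreover have s0: "sphere 0 1 \<subseteq> - {0 :: complex^'n}" by auto
    ultimately have e: "F ` (- {0}) = F ` sphere 0 1" by auto
    have "compactin (top_of_set (- {0 :: complex^'n})) (sphere 0 1)" using s0 by (simp add: compactin_subtopology)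
    then have "compactin X (F ` (- {0}))" unfolding e by (rule image_compactin[OF _ dev_continuous[OF F]])
    then have "closedin X (F ` (- {0}))" by (rule compactin_imp_closedin[OF Hausdorff])
    moreover have "openin X (F ` (- {0}))" by (rule opn) auto
    moreover have "F (axis undefined 1) \<in> F ` (- {0})" by (simp add: axis_eq_0_iff)
    ultimately show ?thesis using connected unfolding connected_space_clopen_in by blast
  qed
  have inj: "par v1 v2" if v: "v1 \<noteq> 0" "v2 \<noteq> 0" and eq: "F v1 = F v2" for v1 v2
  proof -
    obtain N t V where N: "lifting N t" "open V" "v1 \<in> V" "V \<subseteq> - {0}" "\<And>w. w \<in> V \<Longrightarrow> F w \<in> N \<and> par (t (F w)) w"
      using devE[OF F, of v1] v by auto
    obtain Q V' where Q: "hadj Q ** Q = mat 1" "open V'" "v2 \<in> V'" "V' \<subseteq> - {0}" "\<And>w. w \<in> V' \<Longrightarrow> F w \<in> N \<and> par (t (F w)) (Q *v w)"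
      using dev_lifting[OF F _ N(1), of v2] v N(3,5) eq by (metis ComplI singletonD)
    have "par v1 (Q *v v2)" using N(5)[OF N(3)] Q(5)[OF Q(3)] eq par_trans par_sym by metis
    then obtain c where c: "c \<noteq> 0" "v1 = c *s (Q *v v2)" by (auto simp: par_def)
    have Q0: "Q *v w \<noteq> 0" if "w \<noteq> 0" for w using that unitary_norm[OF Q(1), of w] by (metis norm_eq_zero)
    have oQ: "open {w. c *s (Q *v w) \<in> S}" if "open S" for c S
      using continuous_open_preimage[OF vhol_continuous[OF vhol_smult[OF hol_on_const vhol_matrix[OF vhol_id]]] open_UNIV that, of c Q] by (simp add: vimage_def)
    have FQ: "F (Q *v w) = F w" if w: "w \<noteq> 0" for w
    proof -
      have eqs: "{w. c *s (Q *v w) \<in> - {0}} = - {0}" using Q0 c(1) by (auto simp: vec_eq_iff)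
      have dQ: "dev (- {0}) (\<lambda>w. F (c *s (Q *v w)))" using dev_compose[OF F c(1) Q(1)] unfolding eqs .
      have "F (c *s (Q *v w)) = F w"
      proof (rule dev_identity[OF _ dQ F, of "V' \<inter> {w. c *s (Q *v w) \<in> V}" w])
        show "connected (- {0 :: complex^'n})" by (rule connected_punctured_universe) simp
        show "F (c *s (Q *v u)) = F u" if u: "u \<in> V' \<inter> {w. c *s (Q *v w) \<in> V}" for u
        proof (rule lifting_inj[OF N(1)])
          have "par (t (F (c *s (Q *v u)))) (c *s (Q *v u))" "par (t (F u)) (Q *v u)" using N(5) Q(5) u by blast+
          then show "par (t (F (c *s (Q *v u)))) (t (F u))" using par_smult[OF c(1)] par_trans par_sym by blast
        qed (use N(5) Q(5) u in blast)+
      qed (use Q N c w oQ in auto)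
      then show ?thesis using sc[OF c(1) Q0[OF w]] by simp
    qed
    obtain e a where e: "e \<noteq> 0" "a \<noteq> 0" "Q *v e = a *s e" using unitary_eigenvector[OF Q(1)] by metis
    obtain N t V where N: "lifting N t" "open V" "e \<in> V" "V \<subseteq> - {0}" "\<And>w. w \<in> V \<Longrightarrow> F w \<in> N \<and> par (t (F w)) w"
      using devE[OF F, of e] e(1) by auto
    let ?W = "V \<inter> {w. (1 / a) *s (Q *v w) \<in> V}"
    have "e \<in> ?W" using N(3) e by simp
    moreover have "par w (Q *v w)" if w: "w \<in> ?W" for w
    proof -
      have w0: "w \<noteq> 0" using w N(4) by auto
      have "F ((1 / a) *s (Q *v w)) = F w" using sc[of "1 / a" "Q *v w"] e(2) Q0[OF w0] FQ[OF w0] by simp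
      then have "par w ((1 / a) *s (Q *v w))" using N(5)[of w] N(5)[of "(1 / a) *s (Q *v w)"] w par_trans par_sym by (metis IntD1 IntD2 mem_Collect_eq)
      then show ?thesis using par_smult[of "1 / a" "Q *v w"] e(2) par_trans by auto
    qed
    ultimately obtain b where b: "b \<noteq> 0" "\<And>x. Q *v x = b *s x"
      using par_open_scalar[of ?W Q] oQ[OF N(2)] N(2) by (metis empty_iff open_Int)
    then show ?thesis using c by (auto simp: par_def intro!: exI[of _ "c * b"])
  qed
  show thesis
  proof (rule that[OF F img _ opn])
    show "F v = F w \<longleftrightarrow> par v w" if "v \<noteq> 0" "w \<noteq> 0" for v w
      using inj[OF that] sc[OF _ that(2)] by (auto simp: par_def)
  qed
qed

end

section \<open>The biholomorphism with complex projective space\<close>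

lemma vhol_iff: "vhol S F \<longleftrightarrow> (\<forall>z\<in>S. complex_differentiable_at F z)"
  by (simp add: vhol_def complex_differentiable_hol_on)

lemma cline_eq: "v \<noteq> 0 \<Longrightarrow> w \<noteq> 0 \<Longrightarrow> cline v = cline w \<longleftrightarrow> par v w"
proof
  assume "cline v = cline w" and v: "v \<noteq> 0"
  moreover have "v \<in> cline v" unfolding cline_def by (rule range_eqI[of _ _ 1]) simp
  ultimately obtain a where "v = a *s w" by (auto simp: cline_def)
  then show "par v w" using v unfolding par_def by (metis vector_smult_lzero)
next
  assume "par v w"
  then obtain a where a: "a \<noteq> 0" "v = a *s w" by (auto simp: par_def)
  have "b *s w \<in> cline v" for b using a unfolding cline_def by (intro range_eqI[of _ _ "b / a"]) simp
  then show "cline v = cline w" using a(2) by (auto simp: cline_def)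
qed

lemma cp_chart:
  assumes v: "v \<noteq> 0"
  shows "cline v \<in> fst (cp_chart o1) \<longleftrightarrow> v $ o1 None \<noteq> 0"
    "v $ o1 None \<noteq> 0 \<Longrightarrow> snd (cp_chart o1) (cline v) = (\<chi> j. v $ o1 (Some j) / v $ o1 None)"
proof -
  show "cline v \<in> fst (cp_chart o1) \<longleftrightarrow> v $ o1 None \<noteq> 0"
  proof
    assume "cline v \<in> fst (cp_chart o1)"
    then obtain w where w: "w $ o1 None \<noteq> 0" "cline v = cline w" by (auto simp: cp_chart_def)
    then have "w \<noteq> 0" by auto
    then obtain a where "a \<noteq> 0" "v = a *s w" using w(2) cline_eq[OF v, of w] by (auto simp: par_def)
    then show "v $ o1 None \<noteq> 0" using w(1) by simp
  qed (auto simp: cp_chart_def)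
  assume n: "v $ o1 None \<noteq> 0"
  define z where "z = (SOME z. z \<in> cline v \<and> z \<noteq> 0)"
  have "v \<in> cline v" unfolding cline_def by (rule range_eqI[of _ _ 1]) simp
  then have "z \<in> cline v \<and> z \<noteq> 0" unfolding z_def using someI[of "\<lambda>z. z \<in> cline v \<and> z \<noteq> 0" v] v by simp
  then obtain a where "z = a *s v" "a \<noteq> 0" by (auto simp: cline_def)
  then have "z $ o1 (Some j) / z $ o1 None = v $ o1 (Some j) / v $ o1 None" for j by simp
  then show "snd (cp_chart o1) (cline v) = (\<chi> j. v $ o1 (Some j) / v $ o1 None)"
    by (simp add: cp_chart_def z_def[symmetric])
qed

definition affine_lift :: "('m option \<Rightarrow> 'm option) \<Rightarrow> complex^'m \<Rightarrow> complex^('m::finite option)" where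
  "affine_lift o1 v = (\<chi> i. case inv o1 i of None \<Rightarrow> 1 | Some j \<Rightarrow> v $ j)"

lemma affine_lift_nth: "bij o1 \<Longrightarrow> affine_lift o1 v $ o1 i = (case i of None \<Rightarrow> 1 | Some j \<Rightarrow> v $ j)"
  by (simp add: affine_lift_def bij_is_inj)

lemma affine_lift_nonzero: "bij o1 \<Longrightarrow> affine_lift o1 v \<noteq> 0"
  using affine_lift_nth[of o1 v None] by auto

lemma affine_lift_vhol: "vhol S (affine_lift o1)"
  unfolding vhol_def
proof
  fix i show "hol_on S (\<lambda>v. affine_lift o1 v $ i)"
    unfolding affine_lift_def by (cases "inv o1 i") (simp_all add: hol_on_const hol_on_nth)
qed

lemma affine_lift_quotient:
  assumes o1: "bij o1" and w: "w $ o1 None \<noteq> 0"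
  shows "affine_lift o1 (\<chi> j. w $ o1 (Some j) / w $ o1 None) = (1 / w $ o1 None) *s w"
proof -
  have "affine_lift o1 (\<chi> j. w $ o1 (Some j) / w $ o1 None) $ o1 i = ((1 / w $ o1 None) *s w) $ o1 i" for i
    using w by (cases i) (simp_all add: affine_lift_nth[OF o1])
  then have "affine_lift o1 (\<chi> j. w $ o1 (Some j) / w $ o1 None) $ i = ((1 / w $ o1 None) *s w) $ i" for i
    using bij_is_surj[OF o1, THEN surjD, of i] by blast
  then show ?thesis unfolding vec_eq_iff by (rule allI)
qed

lemma chart_inv_cp_chart:
  assumes o1: "bij o1"
  shows "chart_inv (cp_chart o1) v = cline (affine_lift o1 v)"
proof -
  have inj: "inj_on (snd (cp_chart o1)) (fst (cp_chart o1))"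
  proof (rule inj_onI)
    fix L L' assume L: "L \<in> fst (cp_chart o1)" "L' \<in> fst (cp_chart o1)" "snd (cp_chart o1) L = snd (cp_chart o1) L'"
    then obtain v w where v: "v $ o1 None \<noteq> 0" "L = cline v" and w: "w $ o1 None \<noteq> 0" "L' = cline w" by (auto simp: cp_chart_def)
    then have nz: "v \<noteq> 0" "w \<noteq> 0" by auto
    then have "(1 / v $ o1 None) *s v = (1 / w $ o1 None) *s w"
      using L(3) v w cp_chart(2) affine_lift_quotient[OF o1] by metis
    then have "par v ((1 / w $ o1 None) *s w)" using par_sym[OF par_smult[of "1 / v $ o1 None" v]] v(1) by simp
    then have "par v w" using par_trans par_smult[of "1 / w $ o1 None" w] w(1) by simp
    then show "L = L'" using v w cline_eq[OF nz] by simp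
  qed
  have nz: "affine_lift o1 v $ o1 None \<noteq> 0" by (simp add: affine_lift_nth[OF o1])
  note c = cp_chart[OF affine_lift_nonzero[OF o1], of v o1]
  have "snd (cp_chart o1) (cline (affine_lift o1 v)) = v"
    using c(2)[OF nz] by (simp add: affine_lift_nth[OF o1] vec_eq_iff)
  then show ?thesis using inv_into_f_eq[OF inj] c(1) nz by blast
qed

lemma fs_form_cnj: "cnj (fs_form x u v) = fs_form x v u"
  by (simp add: fs_form_def hp_cnj mult.commute)

lemma fubini_study_affine_lift:
  assumes o1: "bij o1"
  shows "fubini_study c w $ a $ b = fs_form (affine_lift o1 w) (dv a (affine_lift o1) w) (dv b (affine_lift o1) w)"
proof -
  let ?e = "affine_lift o1"
  note e = affine_lift_vhol[of UNIV o1]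
  have n: "hp (?e v) (?e v) = complex_of_real (1 + (norm v)\<^sup>2)" for v
  proof -
    have "hp (?e v) (?e v) = (\<Sum>i\<in>UNIV. ?e v $ o1 i * cnj (?e v $ o1 i))"
      unfolding hp_def by (rule sum.reindex_bij_betw[OF o1, symmetric])
    also have "\<dots> = 1 + hp v v" by (simp add: sum_option affine_lift_nth[OF o1] hp_def)
    finally show ?thesis by (simp add: hp_norm)
  qed
  have l: "dzbar b (\<lambda>v. complex_of_real (ln (1 + (norm v)\<^sup>2))) v = cnj (hp (dv b ?e v) (?e v) / hp (?e v) (?e v))" for v
  proof -
    have p: "1 + (norm u)\<^sup>2 > 0" for u :: "complex^'b" by (simp add: add_pos_nonneg)
    have "complex_of_real (ln (1 + (norm u)\<^sup>2)) = Ln (hp (?e u) (?e u))" for u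
      unfolding n using Ln_of_real[OF p[of u]] by simp
    moreover have "(Ln has_field_derivative inverse (hp (?e v) (?e v))) (at (hp (?e v) (?e v)))"
      unfolding n by (rule has_field_derivative_Ln) (use p[of v] in \<open>simp add: complex_nonpos_Reals_iff del: of_real_add\<close>)
    ultimately have "dzbar b (\<lambda>v. complex_of_real (ln (1 + (norm v)\<^sup>2))) v = inverse (hp (?e v) (?e v)) * hp (?e v) (dv b ?e v)"
      using wd_chain[OF vhol_hp(1)[OF e e UNIV_I]] vhol_hp(3)[OF e e UNIV_I] by (simp add: dzbar_wd)
    then show ?thesis by (simp add: hp_cnj divide_inverse mult.commute)
  qed
  have "?e w \<noteq> 0" by (rule affine_lift_nonzero[OF o1])
  note d = dzbar_log_derivative[OF e open_UNIV UNIV_I this]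
  have "fubini_study c w $ a $ b = dz a (\<lambda>v. cnj (hp (dv b ?e v) (?e v) / hp (?e v) (?e v))) w"
    unfolding fubini_study_def vec_lambda_beta l ..
  also have "\<dots> = cnj (fs_form (?e w) (dv b ?e w) (dv a ?e w))"
    unfolding dz_wd wd_cnj[OF d(1)] using d(2) by (simp add: dzbar_wd)
  finally show ?thesis by (simp only: fs_form_cnj)
qed

lemma dv_smult:
  assumes "hol_on S h" "vhol S s" "z \<in> S"
  shows "dv a (\<lambda>w. h w *s s w) z = h z *s dv a s z + dz a h z *s s z"
proof -
  have d: "h differentiable (at z)" "(\<lambda>w. s w $ j) differentiable (at z)" for j using assms by (auto simp: vhol_def hol_on_def)
  show ?thesis by (simp add: dv_def vec_eq_iff dz_wd wd_mult d)
qed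

lemma pullback_fubini_study:
  fixes s :: "complex^'m::finite \<Rightarrow> complex^('m option)" and o1 :: "'m option \<Rightarrow> 'm option"
  assumes o1: "bij o1" and s: "vhol S s" and S: "open S" "z \<in> S" and nz: "\<And>z. z \<in> S \<Longrightarrow> s z $ o1 None \<noteq> 0"
  shows "pullback_metric (\<lambda>z. \<chi> j. s z $ o1 (Some j) / s z $ o1 None) (fubini_study c) z $ a $ b = fs_form (s z) (dv a s z) (dv b s z)"
    "vhol S (\<lambda>z. \<chi> j. s z $ o1 (Some j) / s z $ o1 None)"
proof -
  let ?H = "\<lambda>z. \<chi> j. s z $ o1 (Some j) / s z $ o1 None"
  show H: "vhol S ?H" unfolding vhol_def using s nz by (auto simp: vhol_def intro: hol_on_divide)
  let ?h = "\<lambda>z. 1 / s z $ o1 None"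
  have h: "hol_on S ?h" using s nz by (auto simp: vhol_def intro: hol_on_divide hol_on_const)
  have q: "affine_lift o1 (?H w) = ?h w *s s w" if "w \<in> S" for w by (rule affine_lift_quotient[OF o1 nz[OF that]])
  have dq: "dv a (\<lambda>w. affine_lift o1 (?H w)) z = ?h z *s dv a s z + dz a ?h z *s s z" for a
    unfolding dv_smult[OF h s S(2), symmetric] unfolding dv_def dz_wd by (simp only: vec_eq_iff vec_lambda_beta) (intro allI wd_cong[OF S], simp only: q)
  have "fs_form (affine_lift o1 (?H z)) (dv a (\<lambda>w. affine_lift o1 (?H w)) z) (dv b (\<lambda>w. affine_lift o1 (?H w)) z)
    = complex_of_real 1 * pullback_metric ?H (fubini_study c) z $ a $ b"
    by (rule fs_form_pullback[OF H affine_lift_vhol[of UNIV] S(2) UNIV_I]) (simp add: fubini_study_affine_lift[OF o1])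
  moreover have "s z \<noteq> 0" using nz[OF S(2)] by auto
  ultimately show "pullback_metric ?H (fubini_study c) z $ a $ b = fs_form (s z) (dv a s z) (dv b s z)"
    unfolding dq q[OF S(2)] using nz[OF S(2)] by (simp add: fs_form_scale)
qed

context kaehler_manifold begin

definition klift :: "real \<Rightarrow> 'a set \<Rightarrow> ('a \<Rightarrow> complex^('m option)) \<Rightarrow> bool" where
  "klift k N t \<longleftrightarrow> (\<exists>c\<in>A. \<exists>Z s. Z \<subseteq> coord c \<and> fs_lift (g c) k Z s \<and> N = {p \<in> fst c. snd c p \<in> Z} \<and> t = (\<lambda>p. s (snd c p)))"

lemma kliftE:
  assumes "klift k N t"
  obtains c Z s where "c \<in> A" "Z \<subseteq> coord c" "fs_lift (g c) k Z s" "N = {p \<in> fst c. snd c p \<in> Z}" "t = (\<lambda>p. s (snd c p))"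
  using assms unfolding klift_def by blast

lemma klift_exists:
  assumes chsc: "chsc_kaehler (coord c) (g c) k" and c: "c \<in> A" "p \<in> fst c"
  obtains Z s where "Z \<subseteq> coord c" "fs_lift (g c) k Z (s :: complex^'m \<Rightarrow> complex^('m option))" "snd c p \<in> Z"
    "klift k {p \<in> fst c. snd c p \<in> Z} (\<lambda>p. s (snd c p))"
proof -
  have "snd c p \<in> coord c" using c(2) by blast
  from chsc_kaehler.fs_lift_exists[OF chsc this] obtain Z and s :: "complex^'m \<Rightarrow> complex^('m option)"
    where "snd c p \<in> Z" "Z \<subseteq> coord c" "fs_lift (g c) k Z s" by metis
  then show thesis using that[of Z s] c(1) unfolding klift_def by blast
qed

lemma klift_rigid:
  assumes N: "klift k N t" and N': "klift k N' t'" and p: "p \<in> N \<inter> N'"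
  shows "\<exists>Q V. hadj Q ** Q = mat 1 \<and> openin X V \<and> p \<in> V \<and> V \<subseteq> N \<inter> N' \<and> (\<forall>q\<in>V. par (t' q) (Q *v t q))"
proof -
  obtain c Z s where c: "c \<in> A" "Z \<subseteq> coord c" "fs_lift (g c) k Z s" "N = {p \<in> fst c. snd c p \<in> Z}" "t = (\<lambda>p. s (snd c p))"
    by (rule kliftE[OF N])
  obtain d Z' s' where d: "d \<in> A" "Z' \<subseteq> coord d" "fs_lift (g d) k Z' s'" "N' = {p \<in> fst d. snd d p \<in> Z'}" "t' = (\<lambda>p. s' (snd d p))"
    by (rule kliftE[OF N'])
  note L = c(3)[unfolded fs_lift_def] and L' = d(3)[unfolded fs_lift_def]
  have oN': "openin X N'" unfolding d(4) using L' by (intro chart_open_preimage d(1)) blast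
  let ?F = "snd d \<circ> chart_inv c" and ?Y = "snd c ` (fst c \<inter> N')"
  have Y: "open ?Y" by (rule chart_open_image[OF c(1)]) (use oN' chart_domain[OF c(1)] in auto)
  interpret P: kaehler_pullback "coord d" "g d" "snd c ` (fst c \<inter> fst d)" "g c" ?F
    by (rule transition_pullback[OF c(1) d(1)])
  have sub: "?Y \<subseteq> snd c ` (fst c \<inter> fst d)" using d(4) by auto
  have F: "vhol ?Y ?F" using P.F_hol sub unfolding vhol_def by (blast intro: hol_on_subset)
  have FZ: "?F z \<in> Z'" if "z \<in> ?Y" for z using that by (auto simp: chart_inv_coord[OF c(1)] d(4))
  have t: "vhol ?Y (\<lambda>z. s' (?F z))" by (rule vhol_compose[OF F _ FZ]) (use L' in blast)
  obtain Q V where Q: "hadj Q ** Q = mat 1" "open V" "snd c p \<in> V" "V \<subseteq> Z \<inter> ?Y" "\<And>z. z \<in> V \<Longrightarrow> par (s' (?F z)) (Q *v s z)"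
  proof (rule fs_lift_rigid[OF c(3) _ _ Y t])
    show "snd c p \<in> Z" "snd c p \<in> ?Y" using p c(4) by auto
    fix z assume z: "z \<in> ?Y"
    show "s' (?F z) \<noteq> 0" using L' FZ[OF z] by blast
    have s': "vhol Z' s'" using L' by blast
    have "z \<in> snd c ` (fst c \<inter> fst d)" using z sub by blast
    then have pm: "pullback_metric ?F (g d) z = g c z" by (simp only: P.F_pull)
    have fs: "fs_form (s' (?F z)) (dv a s' (?F z)) (dv b s' (?F z)) = k * g d (?F z) $ a $ b" for a b
      using L' FZ[OF z] by blast
    show "fs_form (s' (?F z)) (dv a (\<lambda>z. s' (?F z)) z) (dv b (\<lambda>z. s' (?F z)) z) = k * g c z $ a $ b" for a b
      unfolding pm[symmetric] by (rule fs_form_pullback[where F="?F" and s=s' and G="g d", OF F s' z FZ[OF z] fs])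
  qed (rule that)
  let ?V = "{q \<in> fst c. snd c q \<in> V}"
  have "q \<in> N' \<and> par (t' q) (Q *v t q)" if q: "q \<in> ?V" for q
  proof -
    obtain q' where "q' \<in> fst c \<inter> N'" "snd c q' = snd c q" using q Q(4) by auto
    then have "q \<in> N'" using q chart_inv_coord[OF c(1)] by (metis (no_types, lifting) IntD1 IntD2 mem_Collect_eq)
    then show ?thesis using Q(5)[of "snd c q"] q by (simp add: c(5) d(5) chart_inv_coord[OF c(1)])
  qed
  then have "?V \<subseteq> N \<inter> N'" "\<forall>q\<in>?V. par (t' q) (Q *v t q)" using Q(4) by (auto simp: c(4))
  moreover have "p \<in> ?V" using p c(4) Q(3) by auto
  ultimately show ?thesis using Q(1) chart_open_preimage[OF c(1) Q(2)] by blast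
qed

lemma klift_hom_atlas:
  assumes chsc: "\<And>c. c \<in> A \<Longrightarrow> chsc_kaehler (coord c) (g c) k"
  shows "hom_atlas X (klift k)"
proof
  show "Hausdorff_space X" "connected_space X" "topspace X \<noteq> {}" by (rule Hausdorff connected nonempty)+
  show "\<exists>N t. klift k N t \<and> p \<in> N" if "p \<in> topspace X" for p
  proof -
    have "p \<in> (\<Union>c\<in>A. fst c)" unfolding charts_cover by (rule that)
    then obtain c where c: "c \<in> A" "p \<in> fst c" by (rule UN_E)
    obtain Z and s :: "complex^'m \<Rightarrow> complex^('m option)" where "snd c p \<in> Z" "klift k {p \<in> fst c. snd c p \<in> Z} (\<lambda>p. s (snd c p))"
      by (rule klift_exists[OF chsc[OF c(1)] c])
    then show ?thesis using c(2) by blast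
  qed
  fix N :: "'a set" and t :: "'a \<Rightarrow> complex^('m option)" assume N: "klift k N t"
  obtain c Z s where c: "c \<in> A" "Z \<subseteq> coord c" "fs_lift (g c) k Z s" "N = {p \<in> fst c. snd c p \<in> Z}" "t = (\<lambda>p. s (snd c p))"
    by (rule kliftE[OF N])
  note L = c(3)[unfolded fs_lift_def]
  show "openin X N" unfolding c(4) using L by (intro chart_open_preimage c(1)) blast
  show "t p \<noteq> 0" if "p \<in> N" for p using that L by (simp add: c(4,5))
  show "openin X {p \<in> N. t p \<in> V}" if "open V" for V
  proof -
    have "open (Z \<inter> s -` V)" using L that by (intro continuous_open_preimage vhol_continuous) auto
    from chart_open_preimage[OF c(1) this] show ?thesis by (simp add: c(4,5) conj_assoc)
  qed
  show "p = q" if "p \<in> N" "q \<in> N" "par (t p) (t q)" for p q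
    using that L inj_onD[OF chart_inj[OF c(1)], of p q] by (auto simp: c(4,5))
  show "open {w. \<exists>p\<in>N \<inter> S. par w (t p)}" if S: "openin X S" for S
  proof -
    have "open (Z \<inter> snd c ` (fst c \<inter> S))"
      using L S chart_domain[OF c(1)] by (intro open_Int chart_open_image[OF c(1)]) auto
    from fs_lift_subset[OF c(3) this] have "open (cone (Z \<inter> snd c ` (fst c \<inter> S)) s)" by (auto simp: fs_lift_def)
    moreover have "cone (Z \<inter> snd c ` (fst c \<inter> S)) s = {w. \<exists>p\<in>N \<inter> S. par w (t p)}"
      by (auto simp: cone_def c(4,5))
    ultimately show ?thesis by simp
  qed
  show "klift k N (\<lambda>p. Q *v t p)" if "hadj Q ** Q = mat 1" for Q
    unfolding klift_def c(5) using c(1,2,4) fs_lift_unitary[OF c(3) that] by (intro bexI[of _ c] exI[of _ Z] exI[of _ "\<lambda>z. Q *v s z"]) auto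
qed (rule klift_rigid)

theorem chsc_homothetic_cp:
  assumes cpt: "compact_space X" and chsc: "\<And>c. c \<in> A \<Longrightarrow> chsc_kaehler (coord c) (g c) k" and k: "k > 0"
  shows "biholomorphically_homothetic X A g (cp_topology :: (complex^('m option)) set topology) cp_atlas fubini_study"
proof -
  interpret H: hom_atlas X "klift k" by (rule klift_hom_atlas[OF chsc])
  obtain F where F: "H.dev (- {0}) F" "F ` (- {0}) = topspace X" and Feq: "\<And>v w. v \<noteq> 0 \<Longrightarrow> w \<noteq> 0 \<Longrightarrow> F v = F w \<longleftrightarrow> par v w"
    and Fopen: "\<And>V. open V \<Longrightarrow> 0 \<notin> V \<Longrightarrow> openin X (F ` V)"
    by (rule H.developing_map[OF cpt]) (rule that)
  have local: "\<exists>Z s V. Z \<subseteq> coord c \<and> fs_lift (g c) k Z s \<and> open V \<and> v \<in> V \<and> 0 \<notin> V \<and>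
      (\<forall>w\<in>V. F w \<in> fst c \<and> snd c (F w) \<in> Z \<and> par (s (snd c (F w))) w)" if c: "c \<in> A" "F v \<in> fst c" and v: "v \<noteq> 0" for c v
  proof -
    obtain Z and s :: "complex^'m \<Rightarrow> complex^('m option)" where Z: "Z \<subseteq> coord c" "fs_lift (g c) k Z s" "snd c (F v) \<in> Z"
      "klift k {p \<in> fst c. snd c p \<in> Z} (\<lambda>p. s (snd c p))"
      by (rule klift_exists[OF chsc[OF c(1)] c]) (rule that)
    obtain Q V where Q: "hadj Q ** Q = mat 1" "open V" "v \<in> V" "V \<subseteq> - {0}"
      "\<And>w. w \<in> V \<Longrightarrow> F w \<in> {p \<in> fst c. snd c p \<in> Z} \<and> par (s (snd c (F w))) (Q *v w)"
      by (rule H.dev_lifting[OF F(1) _ Z(4), of v]) (use v c Z in auto)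
    have "par (hadj Q *v s (snd c (F w))) w" if "w \<in> V" for w
      using par_matrix[of _ _ "hadj Q"] Q(5)[OF that] unitary_inverse(1)[OF Q(1)] by metis
    then show ?thesis
      using Z(1) fs_lift_unitary[OF Z(2) unitary_inverse(3)[OF Q(1)]] Q
      by (intro exI[of _ Z] exI[of _ "\<lambda>z. hadj Q *v s z"] exI[of _ V]) auto
  qed
  define f where "f p = cline (SOME v. v \<noteq> 0 \<and> F v = p)" for p
  have fF: "f (F v) = cline v" if "v \<noteq> 0" for v
  proof -
    have "(SOME w. w \<noteq> 0 \<and> F w = F v) \<noteq> 0 \<and> F (SOME w. w \<noteq> 0 \<and> F w = F v) = F v"
      using someI[of "\<lambda>w. w \<noteq> 0 \<and> F w = F v" v] that by simp
    then show ?thesis unfolding f_def using Feq cline_eq that by metis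
  qed
  have top: "\<exists>v. v \<noteq> 0 \<and> p = F v" if "p \<in> topspace X" for p using that F(2) by blast
  have bij: "bij_betw f (topspace X) (topspace cp_topology)"
    unfolding bij_betw_def
  proof
    show "inj_on f (topspace X)" by (rule inj_onI) (metis top fF Feq cline_eq)
    show "f ` topspace X = topspace cp_topology"
      unfolding topspace_cp_topology F(2)[symmetric] by (auto simp: image_image fF)
  qed
  have finv: "inv_into (topspace X) f (cline v) = F v" if "v \<noteq> 0" for v
    using bij that fF[OF that] F(2) unfolding bij_betw_def by (metis ComplI imageI inv_into_f_eq singletonD)
  have cont: "continuous_map X cp_topology f"
    unfolding continuous_map_def
  proof (intro conjI allI impI)
    show "f \<in> topspace X \<rightarrow> topspace cp_topology" using bij by (auto simp: bij_betw_def)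
    fix S :: "(complex^('m option)) set set" assume S: "openin cp_topology S"
    have "{p \<in> topspace X. f p \<in> S} = F ` {v. v \<noteq> 0 \<and> cline v \<in> S}" unfolding F(2)[symmetric] using fF by auto
    then show "openin X {p \<in> topspace X. f p \<in> S}" using Fopen S by (simp add: openin_cp_topology)
  qed
  have cont': "continuous_map cp_topology X (inv_into (topspace X) f)"
  proof (rule continuous_compose_quotient_map[OF quotient_map_cline])
    show "continuous_map (top_of_set (- {0})) X (inv_into (topspace X) f \<circ> cline)"
      by (rule continuous_map_eq[OF H.dev_continuous[OF F(1)]]) (simp add: finv)
  qed
  have hol: "complex_differentiable_at (snd d \<circ> f \<circ> chart_inv c) (snd c p) \<and>
      pullback_metric (snd d \<circ> f \<circ> chart_inv c) (fubini_study d) (snd c p) = k *\<^sub>R g c (snd c p)"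
    if c: "c \<in> A" "p \<in> fst c" and d: "d \<in> cp_atlas" "f p \<in> fst d" for c d p
  proof -
    obtain o1 where o1: "bij o1" "d = cp_chart o1" using d(1) by (auto simp: cp_atlas_def)
    obtain v where v: "v \<noteq> 0" "p = F v" using top c chart_domain[OF c(1)] openin_subset by blast
    obtain Z s V where Z: "Z \<subseteq> coord c" "fs_lift (g c) k Z s" "open V" "v \<in> V" "0 \<notin> V"
      "\<And>w. w \<in> V \<Longrightarrow> F w \<in> fst c \<and> snd c (F w) \<in> Z \<and> par (s (snd c (F w))) w"
      using local[OF c(1), of v] c(2) v by metis
    note L = Z(2)[unfolded fs_lift_def]
    let ?W = "snd c ` F ` V"
    have FV: "F ` V \<subseteq> fst c" using Z(6) by blast
    have W: "open ?W" by (rule chart_open_image[OF c(1) Fopen[OF Z(3,5)] FV])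
    have WZ: "?W \<subseteq> Z" using Z(6) by blast
    have fW: "f (chart_inv c z) = cline (s z)" "s z \<noteq> 0" if "z \<in> ?W" for z
    proof -
      obtain w where w: "w \<in> V" "z = snd c (F w)" using \<open>z \<in> ?W\<close> by blast
      have w0: "w \<noteq> 0" using w(1) Z(5) by blast
      show s0: "s z \<noteq> 0" using L WZ that by blast
      have "cline (s z) = cline w" using cline_eq[OF s0 w0] Z(6)[OF w(1)] w(2) by simp
      then show "f (chart_inv c z) = cline (s z)"
        using w Z(6)[OF w(1)] fF[OF w0] chart_inv_coord[OF c(1)] by simp
    qed
    let ?S = "?W \<inter> (\<lambda>z. s z $ o1 None) -` (- {0})"
    have sW: "vhol ?W s" using L WZ by (auto intro: vhol_subset)
    have S: "open ?S" by (rule continuous_open_preimage[OF _ W]) (use sW in \<open>auto simp: vhol_def intro: hol_on_continuous\<close>)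
    have pW: "snd c p \<in> ?W" using v(2) Z(4) by blast
    have pS: "snd c p \<in> ?S"
      using fW[OF pW] d(2) pW cp_chart(1)[of "s (snd c p)" o1] by (simp add: o1(2) chart_inv_coord[OF c])
    let ?H = "\<lambda>z. \<chi> j. s z $ o1 (Some j) / s z $ o1 None"
    have eq: "(snd d \<circ> f \<circ> chart_inv c) z = ?H z" if "z \<in> ?S" for z
      using that fW[of z] cp_chart(2)[of "s z" o1] by (simp add: o1(2))
    have sS: "vhol ?S s" using sW by (rule vhol_subset) auto
    have nzS: "s z $ o1 None \<noteq> 0" if "z \<in> ?S" for z using that by auto
    note P = pullback_fubini_study[OF o1(1) sS S pS nzS]
    have "vhol ?S (snd d \<circ> f \<circ> chart_inv c)" by (rule vhol_cong[OF S eq, THEN iffD2]) (assumption, rule P(2))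
    then have 1: "complex_differentiable_at (snd d \<circ> f \<circ> chart_inv c) (snd c p)" using pS unfolding vhol_iff by blast
    have "dz a (\<lambda>w. (snd d \<circ> f \<circ> chart_inv c) w $ j) (snd c p) = dz a (\<lambda>w. ?H w $ j) (snd c p)" for a j
      unfolding dz_wd by (rule wd_cong[OF S pS]) (simp only: eq)
    then have "pullback_metric (snd d \<circ> f \<circ> chart_inv c) (fubini_study d) (snd c p) = pullback_metric ?H (fubini_study d) (snd c p)"
      unfolding pullback_metric_def eq[OF pS] by (simp only:)
    moreover have "pullback_metric ?H (fubini_study d) (snd c p) = k *\<^sub>R g c (snd c p)"
    proof -
      have "fs_form (s (snd c p)) (dv a s (snd c p)) (dv b s (snd c p)) = k * g c (snd c p) $ a $ b" for a b
        using L pW WZ by blast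
      then show ?thesis by (simp only: vec_eq_iff P(1)) (simp add: scaleR_conv_of_real[where 'a=complex])
    qed
    ultimately show ?thesis using 1 by simp
  qed
  have hol': "complex_differentiable_at (snd c \<circ> inv_into (topspace X) f \<circ> chart_inv d) (snd d L)"
    if d: "d \<in> cp_atlas" "L \<in> fst d" and c: "c \<in> A" "inv_into (topspace X) f L \<in> fst c" for c d L
  proof -
    obtain o1 where o1: "bij o1" "d = cp_chart o1" using d(1) by (auto simp: cp_atlas_def)
    let ?e = "affine_lift o1"
    obtain v where v: "v $ o1 None \<noteq> 0" "L = cline v" using d(2) by (auto simp: o1(2) cp_chart_def)
    have v0: "v \<noteq> 0" using v(1) by auto
    have ev: "?e (snd d L) = (1 / v $ o1 None) *s v"
      unfolding o1(2) v(2) cp_chart(2)[where ?o1.0=o1, OF v0 v(1)] by (rule affine_lift_quotient[OF o1(1) v(1)])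
    have "par (?e (snd d L)) v" unfolding ev by (rule par_smult) (use v(1) in simp)
    then have "F (?e (snd d L)) = F v" using Feq[OF affine_lift_nonzero[OF o1(1)] v0] by simp
    then have "F (?e (snd d L)) \<in> fst c" using c(2) v(2) finv[OF v0] by simp
    then obtain Z s V where Z: "Z \<subseteq> coord c" "fs_lift (g c) k Z s" "open V" "?e (snd d L) \<in> V" "0 \<notin> V"
      "\<And>w. w \<in> V \<Longrightarrow> F w \<in> fst c \<and> snd c (F w) \<in> Z \<and> par (s (snd c (F w))) w"
      using local[OF c(1) _ affine_lift_nonzero[OF o1(1)]] by metis
    have sc: "u \<in> cone Z s \<and> sect Z s u = snd c (F u)" if "u \<in> V" for u
      by (rule sect_unique[OF Z(2)]) (use Z(6)[OF that] par_sym in auto)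
    let ?S = "?e -` V"
    have S: "open ?S" using continuous_open_preimage[OF vhol_continuous[OF affine_lift_vhol] open_UNIV Z(3)] by simp
    have "vhol ?S (\<lambda>w. sect Z s (?e w))"
      by (rule vhol_compose[OF affine_lift_vhol, of "cone Z s"]) (use sc Z(2) in \<open>auto simp: fs_lift_def\<close>)
    moreover have eq: "(snd c \<circ> inv_into (topspace X) f \<circ> chart_inv d) w = sect Z s (?e w)" if "w \<in> ?S" for w
      using sc[of "?e w"] that by (simp add: o1(2) chart_inv_cp_chart[OF o1(1)] finv[OF affine_lift_nonzero[OF o1(1)]])
    ultimately have "vhol ?S (snd c \<circ> inv_into (topspace X) f \<circ> chart_inv d)" by (intro vhol_cong[OF S eq, THEN iffD2])
    then show ?thesis using Z(4) unfolding vhol_iff by blast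
  qed
  have "biholomorphism X A cp_topology cp_atlas f"
    unfolding biholomorphism_def holomorphic_map_def using bij cont cont' hol hol' by blast
  then show ?thesis unfolding biholomorphically_homothetic_def using k hol by blast
qed

end

theorem theorem4p8:
  fixes X :: "'a topology" and A :: "('a, 'm::finite) chart set"
    and g :: "('a, 'm) chart_metric" and R :: real
  assumes "kaehler_manifold X A g"
    and "compact_space X"
    and "CARD('m) \<ge> 2"
    and "R > 0"
    and "\<And>c p. c \<in> A \<Longrightarrow> p \<in> fst c \<Longrightarrow> scalar_curv (g c) (snd c p) = complex_of_real R"
    and "\<And>c p. c \<in> A \<Longrightarrow> p \<in> fst c \<Longrightarrow>
           sqrt 2 * norm_E (g c) (snd c p) + norm_B (g c) (snd c p)
             < 2 * sqrt ((real CARD('m))\<^sup>2 - 1) * R / (3 * ((real CARD('m))\<^sup>2 - 2))"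
  shows "biholomorphically_homothetic X A g
           (cp_topology :: (complex^('m option)) set topology) cp_atlas fubini_study"
proof -
  interpret kaehler_manifold X A g by fact
  have m0: "real CARD('m) * (real CARD('m) + 1) > 0" by simp
  define k where "k = R / (real CARD('m) * (real CARD('m) + 1))"
  have "chsc_kaehler (coord c) (g c) k" if c: "c \<in> A" for c
  proof -
    note flat = einstein_bochner_flat[OF assms(2-6) c]
    show ?thesis using csc_kaehler.bochner_flat_chsc[OF flat(1) assms(4) flat(2,3)]
      by (simp add: csc_kaehler.ka_def[OF flat(1)] k_def)
  qed
  moreover have "k > 0" using assms(4) m0 by (simp add: k_def)
  ultimately show ?thesis using chsc_homothetic_cp[OF assms(2)] by blast
qed

end
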